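(* Let $\mathrm{R}$ be a real closed field, let $d \geq 2$, and let $\mathcal{P} \subset \mathrm{R}[X_1,\ldots,X_n]_{\leq d}$ and $\mathcal{Q} \subset \mathrm{R}[X_1,\ldots,X_n,Y]_{\leq d}$ be finite sets of polynomials. Let $A \subset \mathrm{R}^n$ be a closed and bounded $\mathcal{P}$-semi-algebraic set, and let $f,g: A \rightarrow \mathrm{R}$ be continuous $\mathcal{Q}$-semi-algebraic functions satisfying $f^{-1}(0) \subset g^{-1}(0)$. Then there exist $c \in \mathrm{R}$ (depending on $A,f,g$) and $N \leq (8 d)^{2(n+7)}$ such that for all $x \in A$, \[ |g(x)|^{N} \leq c \cdot |f(x)|. \] Moreover, in the special case where $\mathrm{R} = \mathbb{R}$, $\mathcal{P} \subset \mathbb{Z}[X_1,\ldots,X_n]_{\leq d}$, $\mathcal{Q} \subset \mathbb{Z}[X_1,\ldots,X_n,Y]_{\leq d}$, and the bit-sizes of the coefficients of the polynomials in $\mathcal{P}\cup\mathcal{Q}$ are bounded by $\tau$, there exists \[ c \leq \min\{2^{\tau d^{O(n^2)}},\,2^{\tau d^{O(n\log d)}}\} \] such that $|g(x)|^N \le c\cdot |f(x)|$ holds for all $x\in A$ with $N =(8 d)^{2(n+7)}$.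
   Context: $\mathrm{R}[X_1,\ldots,X_n]_{\leq d}$ denotes the set of polynomials of degree at most $d$. For a finite set of polynomials $\mathcal{P}$, a $\mathcal{P}$-formula is a quantifier-free first-order formula whose atoms are of the form $P=0$, $P>0$, $P<0$ with $P \in \mathcal{P}$; a $\mathcal{P}$-semi-algebraic set is the set of points satisfying some $\mathcal{P}$-formula. A $\mathcal{Q}$-semi-algebraic function $f:A\to\mathrm{R}$ (with $A\subset \mathrm{R}^n$) is one whose graph $\{(x,f(x))\}\subset\mathrm{R}^{n+1}$ is a $\mathcal{Q}$-semi-algebraic set. The notation $O(\cdot)$ in the exponents means bounded by an absolute constant times the indicated expression.
   Formalization: In the integer-coefficient part n ≥ 1 is assumed: for n = 0 the stated bound reads c ≤ 2^τ, which fails (f = 1, g = 2 on a point, τ = 2, d = 2). *)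

theory Defs
  imports Complex_Main "HOL-Library.Poly_Mapping"
begin

class real_closed_field = linordered_field +
  assumes rcf_sqrt: "0 \<le> x \<Longrightarrow> \<exists>y. y * y = x"
  assumes rcf_odd_root:
    "odd n \<Longrightarrow> c n \<noteq> 0 \<Longrightarrow> \<exists>x. (\<Sum>i\<le>n. c i * x ^ i) = 0"

text \<open>A monomial is a finitely supported exponent vector (variable index i is X_(i+1),
i.e. variables are indexed from 0); a polynomial is a finitely supported map from
monomials to coefficients.\<close>

type_synonym 'a mpoly = "(nat \<Rightarrow>\<^sub>0 nat) \<Rightarrow>\<^sub>0 'a"

definition mpoly_eval :: "'a::comm_ring_1 mpoly \<Rightarrow> 'a list \<Rightarrow> 'a" where
  "mpoly_eval p x =
     (\<Sum>m\<in>Poly_Mapping.keys p. Poly_Mapping.lookup p m * (\<Prod>i\<in>Poly_Mapping.keys m. (x ! i) ^ Poly_Mapping.lookup m i))"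

definition mon_degree :: "(nat \<Rightarrow>\<^sub>0 nat) \<Rightarrow> nat" where
  "mon_degree m = (\<Sum>i\<in>Poly_Mapping.keys m. Poly_Mapping.lookup m i)"

definition poly_in_vars_deg :: "nat \<Rightarrow> nat \<Rightarrow> 'a::zero mpoly \<Rightarrow> bool" where
  "poly_in_vars_deg n d p \<longleftrightarrow>
     (\<forall>m\<in>Poly_Mapping.keys p. Poly_Mapping.keys m \<subseteq> {..<n} \<and> mon_degree m \<le> d)"

datatype 'p qf_formula =
    QTrue | QFalse
  | AtomEq 'p | AtomGt 'p | AtomLt 'p
  | QNot "'p qf_formula" | QAnd "'p qf_formula" "'p qf_formula"
  | QOr "'p qf_formula" "'p qf_formula"

primrec qf_atoms :: "'p qf_formula \<Rightarrow> 'p set" where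
  "qf_atoms QTrue = {}"
| "qf_atoms QFalse = {}"
| "qf_atoms (AtomEq p) = {p}"
| "qf_atoms (AtomGt p) = {p}"
| "qf_atoms (AtomLt p) = {p}"
| "qf_atoms (QNot \<phi>) = qf_atoms \<phi>"
| "qf_atoms (QAnd \<phi> \<psi>) = qf_atoms \<phi> \<union> qf_atoms \<psi>"
| "qf_atoms (QOr \<phi> \<psi>) = qf_atoms \<phi> \<union> qf_atoms \<psi>"

primrec qf_sat :: "'a::linordered_idom mpoly qf_formula \<Rightarrow> 'a list \<Rightarrow> bool" where
  "qf_sat QTrue x = True"
| "qf_sat QFalse x = False"
| "qf_sat (AtomEq p) x = (mpoly_eval p x = 0)"
| "qf_sat (AtomGt p) x = (mpoly_eval p x > 0)"
| "qf_sat (AtomLt p) x = (mpoly_eval p x < 0)"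
| "qf_sat (QNot \<phi>) x = (\<not> qf_sat \<phi> x)"
| "qf_sat (QAnd \<phi> \<psi>) x = (qf_sat \<phi> x \<and> qf_sat \<psi> x)"
| "qf_sat (QOr \<phi> \<psi>) x = (qf_sat \<phi> x \<or> qf_sat \<psi> x)"

definition semialg :: "nat \<Rightarrow> 'a::linordered_idom mpoly set \<Rightarrow> 'a list set \<Rightarrow> bool" where
  "semialg n P S \<longleftrightarrow>
     (\<exists>\<phi>. qf_atoms \<phi> \<subseteq> P \<and> S = {x. length x = n \<and> qf_sat \<phi> x})"

text \<open>f : A \<rightarrow> R (A in R^n) is Q-semi-algebraic: its graph in R^(n+1) is Q-semi-algebraic
(the last coordinate, of index n, is the variable Y).\<close>

definition semialg_fun ::
  "nat \<Rightarrow> 'a::linordered_idom mpoly set \<Rightarrow> 'a list set \<Rightarrow> ('a list \<Rightarrow> 'a) \<Rightarrow> bool" where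
  "semialg_fun n Q A f \<longleftrightarrow> semialg (Suc n) Q ((\<lambda>x. x @ [f x]) ` A)"

section \<open>Euclidean topology on R^n (via the max-norm, which induces the same topology)\<close>

definition sa_bounded :: "nat \<Rightarrow> 'a::linordered_idom list set \<Rightarrow> bool" where
  "sa_bounded n A \<longleftrightarrow> (\<exists>r. \<forall>x\<in>A. \<forall>i<n. \<bar>x ! i\<bar> \<le> r)"

definition sa_closed :: "nat \<Rightarrow> 'a::linordered_idom list set \<Rightarrow> bool" where
  "sa_closed n A \<longleftrightarrow>
     (\<forall>y. length y = n \<and> y \<notin> A \<longrightarrow>
        (\<exists>e>0. \<forall>x. length x = n \<and> (\<forall>i<n. \<bar>x ! i - y ! i\<bar> < e) \<longrightarrow> x \<notin> A))"

definition sa_continuous_on :: "nat \<Rightarrow> 'a::linordered_idom list set \<Rightarrow> ('a list \<Rightarrow> 'a) \<Rightarrow> bool" where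
  "sa_continuous_on n A f \<longleftrightarrow>
     (\<forall>x\<in>A. \<forall>e>0. \<exists>\<delta>>0. \<forall>y\<in>A.
        (\<forall>i<n. \<bar>y ! i - x ! i\<bar> < \<delta>) \<longrightarrow> \<bar>f y - f x\<bar> < e)"

definition bitsize :: "int \<Rightarrow> nat" where
  "bitsize a = (LEAST k. \<bar>a\<bar> < 2 ^ k)"

definition int_coeffs_bitsize :: "nat \<Rightarrow> real mpoly \<Rightarrow> bool" where
  "int_coeffs_bitsize \<tau> p \<longleftrightarrow>
     (\<forall>m. \<exists>a::int. Poly_Mapping.lookup p m = of_int a \<and> bitsize a \<le> \<tau>)"

end

theory Submission
  imports Defs "HOL-Algebra.Algebraic_Closure_Type" "HOL-Computational_Algebra.Computational_Algebra"
    "Jordan_Normal_Form.Char_Poly" "HOL-Library.Nat_Bijection"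
begin

text \<open>Over the reals, the extreme values of \<open>|g|\<close> on the slices \<open>|f| = t\<close> are approximated by critical
values on smooth bounded hypersurfaces \<open>\<Sum> q\<^sup>2 + \<dots> = \<zeta>\<close> built from the sign conditions. Since the
critical system is monic in every variable, linear algebra in the quotient ring eliminates all
variables: one obtains a nonzero bivariate polynomial of controlled degree and height that
annihilates \<open>(t, max |g|)\<close>, after letting the deformation parameter \<open>\<zeta>\<close> tend to 0. Reading off its
least nonzero coefficient in \<open>t\<close> gives the exponent, and for integer coefficients also the constant.
An arbitrary real closed field is reached by quantifier elimination in the form of a transfer
principle: the sign diagram of a finite family of polynomials is determined by finitely many signs
of polynomials in the parameters.\<close>

text \<open>The class of real closed fields supplies only square roots and roots of polynomials of
  odd degree, so the intermediate value theorem itself has to be proved before signs can be compared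
  between fields. Transfer is possible because the exponent depends only on \<open>n\<close> and
  \<open>d\<close>: for formulas with given supports the claim is a first-order sentence in which
  the coefficients are quantified. Compactness and limits are then used over the reals only.

  A sum of squares forgets the strict inequalities of a sign condition, so its zero set may leave
  the semi-algebraic set. This is avoided by working near maximizers at which as many polynomials as
  possible vanish, where all others keep their sign. The perturbation has degree
  \<open>2 * d + 2\<close>, even and above the degree of the squares; elimination in
  \<open>n + 1\<close> variables gives degree \<open>(2 * d + 2) ^ (n + 1)\<close>, which is below
  \<open>(8 * d) ^ (2 * (n + 7))\<close>. The number of polynomials does not enter this degree, and
  in the constant it is bounded by the number of all integer polynomials of the given degree and
  coefficient size.\<close>

section \<open>Power sums and coefficients of polynomials over a subfield\<close>

definition subfield_set :: "'a::field set \<Rightarrow> bool" where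
  "subfield_set S \<longleftrightarrow> 1 \<in> S \<and> (\<forall>x\<in>S. \<forall>y\<in>S. x - y \<in> S \<and> x * y \<in> S \<and> x / y \<in> S)"

lemma subfield_set_closed:
  assumes "subfield_set S"
  shows "0 \<in> S" "1 \<in> S" "x \<in> S \<Longrightarrow> y \<in> S \<Longrightarrow> x + y \<in> S" "x \<in> S \<Longrightarrow> - x \<in> S"
    "x \<in> S \<Longrightarrow> y \<in> S \<Longrightarrow> x - y \<in> S" "x \<in> S \<Longrightarrow> y \<in> S \<Longrightarrow> x * y \<in> S"
    "x \<in> S \<Longrightarrow> y \<in> S \<Longrightarrow> x / y \<in> S" "of_nat n \<in> S"
proof -
  have *: "1 \<in> S" "\<And>x y. x \<in> S \<Longrightarrow> y \<in> S \<Longrightarrow> x - y \<in> S" "\<And>x y. x \<in> S \<Longrightarrow> y \<in> S \<Longrightarrow> x * y \<in> S"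
    "\<And>x y. x \<in> S \<Longrightarrow> y \<in> S \<Longrightarrow> x / y \<in> S"
    using assms unfolding subfield_set_def by auto
  have 0: "0 \<in> S" using *(2)[OF *(1) *(1)] by simp
  have neg: "- x \<in> S" if "x \<in> S" for x using *(2)[OF 0 that] by simp
  have add: "x + y \<in> S" if "x \<in> S" "y \<in> S" for x y
    using *(2)[OF that(1) neg[OF that(2)]] by simp
  have "of_nat n \<in> S" by (induction n) (auto simp: 0 *(1) intro: add)
  then show "0 \<in> S" "1 \<in> S" "x \<in> S \<Longrightarrow> y \<in> S \<Longrightarrow> x + y \<in> S" "x \<in> S \<Longrightarrow> - x \<in> S"
    "x \<in> S \<Longrightarrow> y \<in> S \<Longrightarrow> x - y \<in> S" "x \<in> S \<Longrightarrow> y \<in> S \<Longrightarrow> x * y \<in> S"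
    "x \<in> S \<Longrightarrow> y \<in> S \<Longrightarrow> x / y \<in> S" "of_nat n \<in> S"
    using * 0 neg add by auto
qed

lemma subfield_set_sum:
  assumes "subfield_set S" "\<And>i. i \<in> I \<Longrightarrow> f i \<in> S"
  shows "sum f I \<in> S"
  using assms(2) by (induction I rule: infinite_finite_induct) (auto simp: subfield_set_closed[OF assms(1)])

text \<open>Newton's identities in generating form: the logarithmic derivative of the product of the
  \<open>1 - z i X\<close> is minus the sum of the \<open>z i / (1 - z i X)\<close>, whose
  coefficients are the power sums. Here it is multiplied by the product.\<close>

lemma newton_identities_deriv:
  fixes z :: "'i \<Rightarrow> 'a::field_char_0"
  assumes "finite I"
  shows "fps_deriv (\<Prod>i\<in>I. 1 - fps_const (z i) * fps_X)
    = - (\<Prod>i\<in>I. 1 - fps_const (z i) * fps_X) * Abs_fps (\<lambda>m. \<Sum>i\<in>I. z i ^ Suc m)"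
  using assms
proof (induction I rule: finite_induct)
  case empty
  have "Abs_fps (\<lambda>m. 0) = (0::'a fps)" by (simp add: fps_eq_iff)
  then show ?case by simp
next
  case (insert j I)
  let ?F = "\<Prod>i\<in>I. 1 - fps_const (z i) * fps_X"
  let ?P = "Abs_fps (\<lambda>m. \<Sum>i\<in>I. z i ^ Suc m)"
  let ?Z = "Abs_fps (\<lambda>m. z j ^ Suc m)"
  have Z: "(1 - fps_const (z j) * fps_X) * ?Z = fps_const (z j)"
    unfolding fps_eq_iff
  proof
    fix n show "((1 - fps_const (z j) * fps_X) * ?Z) $ n = fps_const (z j) $ n"
      by (cases n) (simp_all add: left_diff_distrib mult.assoc)
  qed
  have sum: "Abs_fps (\<lambda>m. \<Sum>i\<in>insert j I. z i ^ Suc m) = ?Z + ?P"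
    using insert by (simp add: fps_eq_iff)
  have prod: "(\<Prod>i\<in>insert j I. 1 - fps_const (z i) * fps_X) = (1 - fps_const (z j) * fps_X) * ?F"
    using insert by simp
  have "fps_deriv ((1 - fps_const (z j) * fps_X) * ?F)
      = - fps_const (z j) * ?F - (1 - fps_const (z j) * fps_X) * (?F * ?P)"
    using insert.IH by (simp add: algebra_simps flip: fps_const_neg)
  also have "\<dots> = - ((1 - fps_const (z j) * fps_X) * ?Z) * ?F - (1 - fps_const (z j) * fps_X) * (?F * ?P)"
    unfolding Z by simp
  also have "\<dots> = - ((1 - fps_const (z j) * fps_X) * ?F) * (?Z + ?P)"
    by (simp add: algebra_simps)
  finally show ?case unfolding sum prod .
qed

lemma prod_roots_fps:
  fixes z :: "'i \<Rightarrow> 'a::field_char_0"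
  assumes "finite I"
  shows "fps_of_poly (reflect_poly (\<Prod>i\<in>I. [:- z i, 1:])) = (\<Prod>i\<in>I. 1 - fps_const (z i) * fps_X)"
  using assms
proof (induction I rule: finite_induct)
  case (insert j I)
  have r: "reflect_poly [:- z j, 1:] = [:1, - z j:]"
    by (simp add: reflect_poly_def)
  have f: "fps_of_poly [:1, - z j:] = 1 - fps_const (z j) * fps_X"
    by (simp add: fps_of_poly_pCons algebra_simps)
  show ?case
    by (simp only: prod.insert[OF insert.hyps] reflect_poly_mult fps_of_poly_mult r f insert.IH)
qed simp

text \<open>Stands in for the theorem on symmetric polynomials: membership in a subfield passes from
  the coefficients to the power sums of the roots and back. The Newton recurrence \<open>rec\<close>
  can be solved for either sequence, since \<open>F $ 0 = 1\<close> and division by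
  \<open>Suc m\<close> is possible in characteristic 0.\<close>

lemma coeffs_in_subfield_iff_power_sums:
  fixes z :: "'i \<Rightarrow> 'a::field_char_0"
  assumes "finite I" and S: "subfield_set S"
  shows "(\<forall>i. coeff (\<Prod>i\<in>I. [:- z i, 1:]) i \<in> S) \<longleftrightarrow> (\<forall>m. (\<Sum>i\<in>I. z i ^ m) \<in> S)"
proof -
  define P where "P = (\<Prod>i\<in>I. [:- z i, 1:])"
  define F where "F = (\<Prod>i\<in>I. 1 - fps_const (z i) * fps_X)"
  define p where "p = (\<lambda>m. \<Sum>i\<in>I. z i ^ m)"
  note cl = subfield_set_closed[OF S]
  have F: "F $ i = coeff (reflect_poly P) i" for i
    using prod_roots_fps[OF assms(1), of z] unfolding F_def P_def by (metis fps_of_poly_nth)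
  have FP: "(\<forall>i. F $ i \<in> S) \<longleftrightarrow> (\<forall>i. coeff P i \<in> S)"
  proof
    assume *: "\<forall>i. F $ i \<in> S"
    show "\<forall>i. coeff P i \<in> S"
    proof
      fix i show "coeff P i \<in> S"
        using *[rule_format, of "degree P - i"] cl(1)
        by (cases "i \<le> degree P") (auto simp: F coeff_reflect_poly coeff_eq_0 split: if_splits)
    qed
  next
    assume "\<forall>i. coeff P i \<in> S" then show "\<forall>i. F $ i \<in> S"
      by (auto simp: F coeff_reflect_poly cl)
  qed
  have F0: "F $ 0 = 1"
  proof -
    have "coeff P (degree P) = 1" unfolding P_def by (subst lead_coeff_prod) simp
    then show ?thesis unfolding F by (simp add: coeff_reflect_poly)
  qed
  have rec: "of_nat (Suc m) * F $ Suc m = - (\<Sum>j\<le>m. F $ j * p (Suc m - j))" for m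
  proof -
    have "fps_deriv F = - F * Abs_fps (\<lambda>m. p (Suc m))"
      unfolding F_def p_def by (rule newton_identities_deriv[OF assms(1)])
    then have "fps_deriv F $ m = (- F * Abs_fps (\<lambda>m. p (Suc m))) $ m" by simp
    also have "\<dots> = - (\<Sum>j=0..m. F $ j * p (Suc (m - j)))"
      by (simp add: fps_mult_nth sum_negf)
    also have "(\<Sum>j=0..m. F $ j * p (Suc (m - j))) = (\<Sum>j\<le>m. F $ j * p (Suc m - j))"
      by (rule sum.cong) (auto simp: Suc_diff_le)
    finally show ?thesis by simp
  qed
  have "(\<forall>i. F $ i \<in> S) \<longleftrightarrow> (\<forall>m. p m \<in> S)"
  proof
    assume FS: "\<forall>i. F $ i \<in> S"
    show "\<forall>m. p m \<in> S"
    proof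
      fix m show "p m \<in> S"
      proof (induction m rule: less_induct)
        case (less m)
        show ?case
        proof (cases m)
          case 0 then show ?thesis using cl(8) by (simp add: p_def)
        next
          case (Suc k)
          have "(\<Sum>j\<le>k. F $ j * p (Suc k - j)) = p (Suc k) + (\<Sum>j\<in>{1..k}. F $ j * p (Suc k - j))"
            by (simp add: atMost_atLeast0 sum.atLeast_Suc_atMost F0)
          then have eq: "p (Suc k) = - (of_nat (Suc k) * F $ Suc k) - (\<Sum>j\<in>{1..k}. F $ j * p (Suc k - j))"
            unfolding rec[of k] by simp
          have "(\<Sum>j\<in>{1..k}. F $ j * p (Suc k - j)) \<in> S"
            by (rule subfield_set_sum[OF S]) (use FS less Suc in \<open>auto intro!: cl\<close>)
          moreover have "of_nat (Suc k) * F $ Suc k \<in> S" using FS by (intro cl) auto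
          ultimately show ?thesis unfolding Suc eq by (metis cl(4) cl(5))
        qed
      qed
    qed
  next
    assume pS: "\<forall>m. p m \<in> S"
    show "\<forall>i. F $ i \<in> S"
    proof
      fix i show "F $ i \<in> S"
      proof (induction i rule: less_induct)
        case (less i)
        show ?case
        proof (cases i)
          case 0 then show ?thesis using cl(2) F0 by simp
        next
          case (Suc k)
          have "(\<Sum>j\<le>k. F $ j * p (Suc k - j)) \<in> S"
            by (rule subfield_set_sum[OF S]) (use pS less Suc in \<open>auto intro!: cl\<close>)
          then have "- (\<Sum>j\<le>k. F $ j * p (Suc k - j)) / of_nat (Suc k) \<in> S"
            using cl(8)[of "Suc k"] by (intro cl)
          moreover have "- (\<Sum>j\<le>k. F $ j * p (Suc k - j)) / of_nat (Suc k) = F $ Suc k"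
            using rec[of k, symmetric] by (simp add: field_simps del: of_nat_Suc)
          ultimately show ?thesis using Suc by simp
        qed
      qed
    qed
  qed
  then show ?thesis using FP unfolding P_def p_def by simp
qed

lemma sum_square_symmetric:
  fixes f :: "nat \<Rightarrow> nat \<Rightarrow> 'a::comm_semiring_1"
  assumes "\<And>i j. f i j = f j i"
  shows "(\<Sum>i<n. \<Sum>j<n. f i j) = 2 * (\<Sum>(j, i)\<in>Sigma {..<n} (\<lambda>j. {..<j}). f i j) + (\<Sum>i<n. f i i)"
proof -
  have "(\<Sum>i<n. \<Sum>j<n. f i j) = 2 * (\<Sum>j<n. \<Sum>i<j. f i j) + (\<Sum>i<n. f i i)"
  proof (induction n)
    case (Suc n)
    have "(\<Sum>j<n. f n j) = (\<Sum>j<n. f j n)" using assms by simp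
    then show ?case using Suc by (simp add: sum.distrib algebra_simps mult_2)
  qed simp
  then show ?thesis by (simp add: sum.Sigma)
qed

text \<open>The sum over pairs below the diagonal is half of the full double sum minus the diagonal.
  Both parts follow by induction on \<open>m\<close> with extra factors
  \<open>z i ^ a * z j ^ b\<close> carried along: expanding one factor \<open>?w i j\<close> only
  shifts \<open>a\<close> and \<open>b\<close>, and at \<open>m = 0\<close> power sums or their
  products remain.\<close>

lemma pair_power_sums_in_subfield:
  fixes z :: "nat \<Rightarrow> 'a::field_char_0"
  assumes S: "subfield_set S" and p: "\<And>m. (\<Sum>i<n. z i ^ m) \<in> S" and t: "t \<in> S"
  shows "(\<Sum>(j, i)\<in>Sigma {..<n} (\<lambda>j. {..<j}). (z i + z j + t * (z i * z j)) ^ m) \<in> S"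
proof -
  note cl = subfield_set_closed[OF S]
  let ?w = "\<lambda>i j. z i + z j + t * (z i * z j)"
  have double: "(\<Sum>i<n. \<Sum>j<n. z i ^ a * z j ^ b * ?w i j ^ m) \<in> S" for a b m
  proof (induction m arbitrary: a b)
    case 0
    have "(\<Sum>i<n. \<Sum>j<n. z i ^ a * z j ^ b) = (\<Sum>i<n. z i ^ a) * (\<Sum>i<n. z i ^ b)"
      by (simp add: sum_product)
    then show ?case using cl(6)[OF p p] by simp
  next
    case (Suc m)
    have "(\<Sum>i<n. \<Sum>j<n. z i ^ a * z j ^ b * ?w i j ^ Suc m) =
        (\<Sum>i<n. \<Sum>j<n. z i ^ Suc a * z j ^ b * ?w i j ^ m)
      + (\<Sum>i<n. \<Sum>j<n. z i ^ a * z j ^ Suc b * ?w i j ^ m)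
      + t * (\<Sum>i<n. \<Sum>j<n. z i ^ Suc a * z j ^ Suc b * ?w i j ^ m)"
      unfolding sum_distrib_left sum.distrib[symmetric] by (intro sum.cong) (auto simp: algebra_simps)
    then show ?case by (simp only:) (intro cl(3,6) t Suc)
  qed
  have diag: "(\<Sum>i<n. z i ^ a * ?w i i ^ m) \<in> S" for a m
  proof (induction m arbitrary: a)
    case 0 then show ?case using p by simp
  next
    case (Suc m)
    have "(\<Sum>i<n. z i ^ a * ?w i i ^ Suc m) =
        (\<Sum>i<n. z i ^ Suc a * ?w i i ^ m) + (\<Sum>i<n. z i ^ Suc a * ?w i i ^ m)
        + t * (\<Sum>i<n. z i ^ Suc (Suc a) * ?w i i ^ m)"
      unfolding sum_distrib_left sum.distrib[symmetric] by (intro sum.cong) (auto simp: algebra_simps)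
    then show ?case by (simp only:) (intro cl(3,6) t Suc)
  qed
  let ?T = "\<Sum>(j, i)\<in>Sigma {..<n} (\<lambda>j. {..<j}). ?w i j ^ m"
  have "(\<Sum>i<n. \<Sum>j<n. ?w i j ^ m) = 2 * ?T + (\<Sum>i<n. ?w i i ^ m)"
    by (rule sum_square_symmetric) (simp add: algebra_simps)
  then have "?T = ((\<Sum>i<n. \<Sum>j<n. ?w i j ^ m) - (\<Sum>i<n. ?w i i ^ m)) / of_nat 2"
    by simp
  also have "\<dots> \<in> S"
    using double[of 0 0 m] diag[of 0 m] by (intro cl) auto
  finally show ?thesis .
qed

lemma card_below_diagonal: "2 * card (Sigma {..<n} (\<lambda>j::nat. {..<j})) = n * (n - 1)"
proof -
  have "n * n = 2 * card (Sigma {..<n} (\<lambda>j::nat. {..<j})) + n"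
    using sum_square_symmetric[of "\<lambda>_ _. 1::nat" n] by (simp add: case_prod_beta)
  then show ?thesis by (simp add: algebra_simps)
qed

section \<open>Adjoining a root of -1, and the intermediate value theorem\<close>

lemma rcf_sqrt_nonneg:
  assumes "0 \<le> (x::'a::real_closed_field)" shows "\<exists>y\<ge>0. y * y = x"
  using rcf_sqrt[OF assms] by (metis abs_ge_zero abs_mult_self_eq)

text \<open>Adjoining a square root of \<open>-1\<close>: the set \<open>R(i)\<close> inside the algebraic closure.\<close>

definition gauss_set :: "'a::real_closed_field alg_closure \<Rightarrow> 'a alg_closure set" where
  "gauss_set \<iota> = {to_ac a + \<iota> * to_ac b | a b. True}"

context
  fixes \<iota> :: "'a::real_closed_field alg_closure"
  assumes ii: "\<iota> * \<iota> = -1"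
begin

lemma gauss_setI: "to_ac a + \<iota> * to_ac b \<in> gauss_set \<iota>"
  unfolding gauss_set_def by auto

lemma gauss_set_diff: "x \<in> gauss_set \<iota> \<Longrightarrow> y \<in> gauss_set \<iota> \<Longrightarrow> x - y \<in> gauss_set \<iota>"
proof -
  assume "x \<in> gauss_set \<iota>" "y \<in> gauss_set \<iota>"
  then obtain a b c d where *: "x = to_ac a + \<iota> * to_ac b" "y = to_ac c + \<iota> * to_ac d"
    unfolding gauss_set_def by auto
  have "x - y = to_ac (a - c) + \<iota> * to_ac (b - d)" unfolding * by (simp add: algebra_simps)
  then show ?thesis using gauss_setI by metis
qed

lemma gauss_set_mult: "x \<in> gauss_set \<iota> \<Longrightarrow> y \<in> gauss_set \<iota> \<Longrightarrow> x * y \<in> gauss_set \<iota>"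
proof -
  assume "x \<in> gauss_set \<iota>" "y \<in> gauss_set \<iota>"
  then obtain a b c d where *: "x = to_ac a + \<iota> * to_ac b" "y = to_ac c + \<iota> * to_ac d"
    unfolding gauss_set_def by auto
  have "x * y = to_ac a * to_ac c + (\<iota> * \<iota>) * (to_ac b * to_ac d) + \<iota> * (to_ac a * to_ac d + to_ac b * to_ac c)"
    unfolding * by (simp add: algebra_simps)
  also have "\<dots> = to_ac (a * c - b * d) + \<iota> * to_ac (a * d + b * c)"
    unfolding ii by (simp add: algebra_simps)
  finally show ?thesis using gauss_setI by metis
qed

lemma gauss_set_divide: "x \<in> gauss_set \<iota> \<Longrightarrow> y \<in> gauss_set \<iota> \<Longrightarrow> x / y \<in> gauss_set \<iota>"
proof -
  assume x: "x \<in> gauss_set \<iota>" and "y \<in> gauss_set \<iota>"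
  then obtain a b where y: "y = to_ac a + \<iota> * to_ac b"
    unfolding gauss_set_def by auto
  show ?thesis
  proof (cases "a = 0 \<and> b = 0")
    case True
    then have "y = 0" using y by simp
    then show ?thesis using gauss_setI[of 0 0] by simp
  next
    case False
    define r where "r = a * a + b * b"
    have r: "r \<noteq> 0" using False unfolding r_def by (metis sum_squares_eq_zero_iff)
    have "y * (to_ac a - \<iota> * to_ac b) = to_ac a * to_ac a - (\<iota> * \<iota>) * (to_ac b * to_ac b)"
      unfolding y by (simp add: algebra_simps)
    also have "\<dots> = to_ac r" unfolding ii r_def by simp
    finally have yr: "y * (to_ac a - \<iota> * to_ac b) = to_ac r" .
    then have y0: "y \<noteq> 0" using r by auto
    have "x / y = x * (to_ac (a / r) + \<iota> * to_ac (- b / r))"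
    proof -
      have "to_ac r \<noteq> (0::'a alg_closure)" using r by simp
      then have "x * (to_ac (a / r) + \<iota> * to_ac (- b / r)) = x * (to_ac a - \<iota> * to_ac b) / to_ac r"
        by (simp add: field_simps)
      also have "\<dots> = x * (to_ac a - \<iota> * to_ac b) / (y * (to_ac a - \<iota> * to_ac b))" unfolding yr ..
      also have "\<dots> = x / y"
      proof -
        have "to_ac a - \<iota> * to_ac b \<noteq> 0" using yr r by auto
        then show ?thesis by simp
      qed
      finally show ?thesis by simp
    qed
    then show ?thesis using gauss_set_mult[OF x gauss_setI] by metis
  qed
qed

lemma subfield_gauss_set: "subfield_set (gauss_set \<iota>)"
  unfolding subfield_set_def
  using gauss_set_diff gauss_set_mult gauss_set_divide gauss_setI[of 1 0] by simp

text \<open>With \<open>r\<close> the modulus of \<open>x\<close>, the parts of the square root have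
  squares \<open>(r + a) / 2\<close> and \<open>(r - a) / 2\<close>, both nonnegative because
  \<open>|a| \<le> r\<close>. Their product is \<open>b / 2\<close> up to a sign, which
  \<open>s\<close> corrects.\<close>

lemma gauss_set_sqrt:
  assumes "x \<in> gauss_set \<iota>" shows "\<exists>w\<in>gauss_set \<iota>. w * w = x"
proof -
  obtain a b where x: "x = to_ac a + \<iota> * to_ac b"
    using assms unfolding gauss_set_def by auto
  obtain r where r: "r \<ge> 0" "r * r = a * a + b * b"
    using rcf_sqrt_nonneg[of "a * a + b * b"] by auto
  have "a * a \<le> r * r" using r by simp
  then have ar: "\<bar>a\<bar> \<le> r" using r(1)
    by (metis abs_le_square_iff abs_of_nonneg power2_eq_square)
  obtain c where c: "c \<ge> 0" "c * c = (r + a) / 2" using rcf_sqrt_nonneg[of "(r + a) / 2"] ar by force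
  obtain d where d: "d \<ge> 0" "d * d = (r - a) / 2" using rcf_sqrt_nonneg[of "(r - a) / 2"] ar by force
  have "(2 * (c * d)) * (2 * (c * d)) = 4 * ((c * c) * (d * d))" by (simp add: algebra_simps)
  also have "\<dots> = r * r - a * a" unfolding c d by (simp add: field_simps)
  also have "\<dots> = b * b" using r by simp
  finally have "2 * (c * d) = b \<or> 2 * (c * d) = - b" by (metis square_eq_iff)
  then obtain s where s: "s = 1 \<or> s = -1" "2 * (c * (s * d)) = b"
  proof
    assume "2 * (c * d) = b" then show ?thesis using that[of 1] by simp
  next
    assume "2 * (c * d) = - b" then show ?thesis using that[of "-1"] by simp
  qed
  have "(to_ac c + \<iota> * to_ac (s * d)) * (to_ac c + \<iota> * to_ac (s * d))
      = to_ac c * to_ac c + (\<iota> * \<iota>) * (to_ac (s * d) * to_ac (s * d)) + \<iota> * (2 * (to_ac c * to_ac (s * d)))"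
    by (simp add: algebra_simps)
  also have "\<dots> = to_ac (c * c - (s * d) * (s * d)) + \<iota> * to_ac (2 * (c * (s * d)))"
    unfolding ii by simp
  also have "c * c - (s * d) * (s * d) = a"
    using s(1) c d by (auto simp: field_simps)
  finally show ?thesis using gauss_setI x s by metis
qed

lemma to_ac_range_subfield: "subfield_set (range (to_ac :: 'a \<Rightarrow> 'a alg_closure))"
  unfolding subfield_set_def
proof (safe)
  show "1 \<in> range (to_ac :: 'a \<Rightarrow> 'a alg_closure)" by (metis rangeI to_ac_1)
  fix x y :: 'a
  show "to_ac x - to_ac y \<in> range to_ac" by (metis rangeI to_ac_diff)
  show "to_ac x * to_ac y \<in> range to_ac" by (metis rangeI to_ac_mult)
  show "to_ac x / to_ac y \<in> range to_ac" by (metis rangeI to_ac_divide)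
qed

text \<open>Laplace's proof of the fundamental theorem of algebra, by induction on the power of 2 in
  the degree. The values \<open>z i + z j + t * (z i * z j)\<close> over the pairs
  \<open>i < j\<close> are the roots of a polynomial over the base field of degree
  \<open>n * (n - 1) / 2\<close>, in which 2 occurs once less.\<close>

lemma monic_root_in_gauss_set:
  fixes z :: "nat \<Rightarrow> 'a alg_closure"
  assumes "\<And>i. coeff (\<Prod>i<n. [:- z i, 1:]) i \<in> range to_ac" "n = 2 ^ k * m" "odd m"
  shows "\<exists>i<n. z i \<in> gauss_set \<iota>"
  using assms
proof (induction k arbitrary: n m z)
  case 0
  define P where "P = (\<Prod>i<n. [:- z i, 1:])"
  have deg: "degree P = n" unfolding P_def by (subst degree_prod_eq_sum_degree) auto
  have "coeff P (degree P) = 1" unfolding P_def by (subst lead_coeff_prod) simp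
  have "\<exists>c. \<forall>i. coeff P i = to_ac (c i)" using 0(1) unfolding P_def[symmetric] by (intro choice allI) blast
  then obtain c where c: "\<And>i. coeff P i = to_ac (c i)" by auto
  have "c n \<noteq> 0" using \<open>coeff P (degree P) = 1\<close> deg c[of n] by auto
  then obtain x where x: "(\<Sum>i\<le>n. c i * x ^ i) = 0" using rcf_odd_root[of n c] 0 by auto
  have "poly P (to_ac x) = to_ac (\<Sum>i\<le>n. c i * x ^ i)"
    unfolding poly_altdef deg c to_ac_sum by simp
  then have "poly P (to_ac x) = 0" using x by simp
  then have "(\<Prod>i<n. to_ac x - z i) = 0" unfolding P_def poly_prod by simp
  then obtain i where "i < n" "z i = to_ac x" by auto
  then show ?case using gauss_setI[of x 0] by auto
next
  case (Suc k)
  let ?I = "Sigma {..<n} (\<lambda>j. {..<j})"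
  define w where "w = (\<lambda>t (j, i). z i + z j + of_nat t * (z i * z j))"
  define N where "N = card ?I"
  have fin: "finite ?I" by auto
  have N2: "2 * N = n * (n - 1)" unfolding N_def by (rule card_below_diagonal)
  have n0: "n > 0" "even n" using Suc.prems by (auto intro: Nat.gr0I)
  have NN: "N = 2 ^ k * (m * (n - 1))" using N2 Suc.prems by simp
  have oddN: "odd (m * (n - 1))" using Suc.prems n0 by auto
  obtain \<beta> where \<beta>: "bij_betw \<beta> {..<N} ?I"
    using ex_bij_betw_nat_finite[OF fin] unfolding N_def lessThan_atLeast0 by blast
  note S = to_ac_range_subfield
  have ex: "\<exists>p\<in>?I. w t p \<in> gauss_set \<iota>" for t
  proof -
    have ps: "(\<Sum>i<n. z i ^ m) \<in> range to_ac" for m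
      using coeffs_in_subfield_iff_power_sums[OF _ S, of "{..<n}" z] Suc.prems(1) by auto
    have "(\<Sum>p\<in>?I. w t p ^ m) \<in> range to_ac" for m
      using pair_power_sums_in_subfield[OF S ps subfield_set_closed(8)[OF S, of t], of m]
      unfolding w_def by (simp add: case_prod_beta)
    moreover have "(\<Sum>i<N. w t (\<beta> i) ^ m) = (\<Sum>p\<in>?I. w t p ^ m)" for m
      by (rule sum.reindex_bij_betw[OF \<beta>])
    ultimately have "(\<Sum>i<N. w t (\<beta> i) ^ m) \<in> range to_ac" for m by simp
    then have "coeff (\<Prod>i<N. [:- w t (\<beta> i), 1:]) i \<in> range to_ac" for i
      using coeffs_in_subfield_iff_power_sums[OF _ S, of "{..<N}" "\<lambda>i. w t (\<beta> i)"] by auto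
    from Suc.IH[OF this NN oddN] obtain i where "i < N" "w t (\<beta> i) \<in> gauss_set \<iota>" by auto
    then show ?thesis using bij_betwE[OF \<beta>] by blast
  qed
  then obtain \<phi> where \<phi>: "\<And>t. \<phi> t \<in> ?I" "\<And>t. w t (\<phi> t) \<in> gauss_set \<iota>" by metis
  \<comment> \<open>There are infinitely many \<open>t\<close> but only finitely many pairs, so two
    parameters select the same pair. The two elements obtained determine product and sum of
    \<open>z i\<close> and \<open>z j\<close> linearly, and a square root of the discriminant then
    separates the two roots.\<close>
  have "\<not> inj \<phi>"
  proof
    assume "inj \<phi>"
    then have "infinite (range \<phi>)" using finite_imageD by blast
    moreover have "range \<phi> \<subseteq> ?I" using \<phi>(1) by blast
    ultimately show False using fin finite_subset by blast
  qed
  then obtain s t where st: "s \<noteq> t" "\<phi> s = \<phi> t" unfolding inj_def by auto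
  obtain i j where ij: "\<phi> s = (j, i)" "i < j" "j < n" using \<phi>(1)[of s] by auto
  note C = subfield_set_closed[OF subfield_gauss_set]
  have 1: "z i + z j + of_nat s * (z i * z j) \<in> gauss_set \<iota>" using \<phi>(2)[of s] ij unfolding w_def by auto
  have 2: "z i + z j + of_nat t * (z i * z j) \<in> gauss_set \<iota>" using \<phi>(2)[of t] ij st unfolding w_def by auto
  have ne: "of_nat s - of_nat t \<noteq> (0::'a alg_closure)" using st by simp
  have "(z i + z j + of_nat s * (z i * z j)) - (z i + z j + of_nat t * (z i * z j)) = (of_nat s - of_nat t) * (z i * z j)"
    by (simp add: algebra_simps)
  then have "z i * z j = ((z i + z j + of_nat s * (z i * z j)) - (z i + z j + of_nat t * (z i * z j))) / (of_nat s - of_nat t)"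
    using ne by simp
  also have "\<dots> \<in> gauss_set \<iota>" by (rule C(7)[OF C(5)[OF 1 2] C(5)[OF C(8) C(8)]])
  finally have prod: "z i * z j \<in> gauss_set \<iota>" .
  have "z i + z j = (z i + z j + of_nat s * (z i * z j)) - of_nat s * (z i * z j)" by simp
  also have "\<dots> \<in> gauss_set \<iota>" by (rule C(5)[OF 1 C(6)[OF C(8) prod]])
  finally have sum: "z i + z j \<in> gauss_set \<iota>" .
  have "(z i + z j) * (z i + z j) - of_nat 4 * (z i * z j) \<in> gauss_set \<iota>"
    by (rule C(5)[OF C(6)[OF sum sum] C(6)[OF C(8) prod]])
  then obtain u where u: "u \<in> gauss_set \<iota>" "u * u = (z i + z j) * (z i + z j) - of_nat 4 * (z i * z j)"
    using gauss_set_sqrt by blast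
  have "u * u = (z i - z j) * (z i - z j)" unfolding u by (simp add: algebra_simps)
  then have "z i - z j = u \<or> z i - z j = - u" by (metis square_eq_iff)
  then have "z i - z j \<in> gauss_set \<iota>" using u C(4) by auto
  then have "((z i + z j) + (z i - z j)) / of_nat 2 \<in> gauss_set \<iota>"
    by (intro C(7) C(8) C(3)[OF sum])
  then show ?case using ij by (intro exI[of _ i]) auto
qed

end

text \<open>Laplace's argument gives a root \<open>a + b i\<close>. For \<open>b \<noteq> 0\<close>
  the remainder of \<open>f\<close> modulo \<open>(X - a)^2 + b^2\<close> is linear and vanishes
  there; its slope must be 0, since otherwise \<open>\<iota>\<close> would belong to the base field,
  where squares are nonnegative.\<close>

lemma rcf_poly_quadratic_factor:
  fixes f :: "'a::real_closed_field poly"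
  assumes "degree f > 0"
  shows "(\<exists>r. poly f r = 0) \<or> (\<exists>a b. b \<noteq> 0 \<and> [:a * a + b * b, - 2 * a, 1:] dvd f)"
proof -
  obtain \<iota> :: "'a alg_closure" where ii: "\<iota> * \<iota> = -1"
  proof -
    have "\<exists>x. poly [:1, 0, 1:] x = (0 :: 'a alg_closure)" by (rule alg_closed_imp_poly_has_root) simp
    then show ?thesis using that by (auto simp: add_eq_0_iff)
  qed
  define F where "F = map_poly (to_ac :: 'a \<Rightarrow> 'a alg_closure) f"
  have cF: "coeff F i = to_ac (coeff f i)" for i unfolding F_def by (simp add: coeff_map_poly)
  have dF: "degree F = degree f" unfolding F_def by (rule degree_map_poly) auto
  have F0: "F \<noteq> 0" using assms dF by auto
  obtain A where A: "size A = degree F" "F = smult (lead_coeff F) (\<Prod>x\<in>#A. [:-x, 1:])"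
    using alg_closed_imp_factorization[OF F0] by auto
  obtain zs where zs: "mset zs = A" using ex_mset by auto
  define n where "n = degree f"
  have len: "length zs = n" using A zs dF unfolding n_def by auto
  define z where "z = (\<lambda>i. zs ! i)"
  have prod: "(\<Prod>x\<in>#A. [:-x, 1:]) = (\<Prod>i<n. [:- z i, 1:])"
    unfolding zs[symmetric] z_def len[symmetric]
    by (simp add: prod_mset_prod_list mset_map[symmetric] prod.list_conv_set_nth lessThan_atLeast0 del: mset_map)
  have lc: "lead_coeff F = to_ac (lead_coeff f)" "lead_coeff f \<noteq> 0" using cF dF assms by auto
  have "coeff (\<Prod>i<n. [:- z i, 1:]) i \<in> range to_ac" for i
  proof -
    have "coeff F i = lead_coeff F * coeff (\<Prod>i<n. [:- z i, 1:]) i"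
      by (subst A(2)) (simp add: prod)
    then have "coeff (\<Prod>i<n. [:- z i, 1:]) i = to_ac (coeff f i / lead_coeff f)"
      using lc cF by (simp add: field_simps)
    then show ?thesis by (metis rangeI)
  qed
  moreover obtain k m where "n = 2 ^ k * m" "odd m"
  proof -
    have "n \<noteq> 0" using assms unfolding n_def by simp
    then obtain y where "n = 2 ^ multiplicity 2 n * y" "\<not> 2 dvd y"
      using multiplicity_decompose'[of n 2] by (metis odd_one)
    then show ?thesis using that by blast
  qed
  ultimately obtain i where i: "i < n" "z i \<in> gauss_set \<iota>"
    using monic_root_in_gauss_set[OF ii] by blast
  then obtain a b where ab: "z i = to_ac a + \<iota> * to_ac b" unfolding gauss_set_def by auto
  have root: "poly F (z i) = 0"
    by (subst A(2)) (use i in \<open>auto simp: prod poly_prod\<close>)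
  have evF: "poly (map_poly to_ac g) (to_ac x) = to_ac (poly g x)" for g and x :: 'a
    by (induction g) (auto simp: map_poly_pCons)
  show ?thesis
  proof (cases "b = 0")
    case True
    then have "poly f a = 0" using root ab evF[of f a] unfolding F_def by simp
    then show ?thesis by auto
  next
    case False
    define q where "q = [:a * a + b * b, - 2 * a, 1:]"
    define r where "r = f mod q"
    have "degree r < 2 \<or> r = 0" using degree_mod_less[of q f] unfolding r_def q_def by auto
    then have "degree r \<le> 1" by auto
    then have "r = [:coeff r 0, coeff r 1:]"
      by (intro poly_eqI) (auto simp: coeff_pCons coeff_eq_0 split: nat.splits)
    then obtain u v where r: "r = [:v, u:]" by blast
    have f: "f = q * (f div q) + r" unfolding r_def by simp
    have mp: "map_poly to_ac (g * h + k) = map_poly to_ac g * map_poly to_ac h + map_poly (to_ac :: 'a \<Rightarrow> 'a alg_closure) k"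
      for g h k :: "'a poly"
      by (rule poly_eqI) (simp add: coeff_map_poly coeff_mult to_ac_sum)
    have "poly (map_poly to_ac q) (z i) = to_ac a * to_ac a + to_ac b * to_ac b + (to_ac a + \<iota> * to_ac b) * (- (2 * to_ac a) + (to_ac a + \<iota> * to_ac b))"
      unfolding q_def ab by (simp add: map_poly_pCons)
    also have "\<dots> = to_ac b * to_ac b + (\<iota> * \<iota>) * (to_ac b * to_ac b)" by (simp add: algebra_simps)
    also have "\<dots> = 0" unfolding ii by simp
    finally have q0: "poly (map_poly to_ac q) (z i) = 0" .
    have "poly F (z i) = poly (map_poly to_ac r) (z i)"
      unfolding F_def by (subst f, subst mp) (simp add: q0)
    also have "map_poly to_ac r = [:to_ac v, to_ac u:]"
      unfolding r by (rule poly_eqI) (simp add: coeff_map_poly coeff_pCons split: nat.split)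
    also have "poly [:to_ac v, to_ac u:] (z i) = to_ac (v + u * a) + \<iota> * to_ac (u * b)" unfolding ab by (simp add: algebra_simps)
    finally have eq: "to_ac (v + u * a) + \<iota> * to_ac (u * b) = 0" using root by simp
    have "u * b = 0"
    proof (rule ccontr)
      assume nz: "u * b \<noteq> 0"
      have "\<iota> = to_ac (- (v + u * a) / (u * b))"
      proof -
        have "\<iota> * to_ac (u * b) = to_ac (- (v + u * a))"
          using eq by (simp only: to_ac_minus eq_neg_iff_add_eq_0 add.commute)
        moreover have "to_ac (u * b) \<noteq> (0::'a alg_closure)" using nz by (simp only: to_ac_eq_0_iff not_False_eq_True)
        ultimately show ?thesis unfolding to_ac_divide by (simp only: eq_divide_eq if_False not_False_eq_True if_True refl)
      qed
      then obtain c where "\<iota> = to_ac c" by blast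
      then have "to_ac (c * c) = to_ac (-1 :: 'a)" using ii by simp
      then have "c * c = -1" by (simp only: to_ac_eq_iff)
      then show False using zero_le_square[of c] by simp
    qed
    then have "u = 0" using False by simp
    then have "v = 0" using eq by simp
    then have "q dvd f" using r \<open>u = 0\<close> unfolding r_def by (simp add: dvd_eq_mod_eq_0)
    then show ?thesis using False unfolding q_def by blast
  qed
qed

text \<open>Induction on the degree: a factor with the same sign at \<open>a\<close> and
  \<open>b\<close> is split off, and the sign change stays with the cofactor. Such factors are
  \<open>X - r\<close> for a root \<open>r\<close> outside the interval, and the quadratic factors,
  which are positive everywhere.\<close>

theorem rcf_poly_IVT:
  fixes p :: "'a::real_closed_field poly"
  assumes "a < b" "poly p a * poly p b < 0"
  shows "\<exists>x. a < x \<and> x < b \<and> poly p x = 0"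
  using assms(2)
proof (induction "degree p" arbitrary: p rule: less_induct)
  case less
  have "degree p > 0"
  proof (rule Nat.gr0I)
    assume "degree p = 0"
    then obtain c where "p = [:c:]" using degree_eq_zeroE by blast
    then show False using less.prems by (simp add: not_less)
  qed
  moreover have p0: "p \<noteq> 0" using less.prems by auto
  have step: ?case if q: "p = q * h" "degree q > 0" "poly q a * poly q b > 0" for q h
  proof -
    have "h \<noteq> 0" "q \<noteq> 0" using p0 q by auto
    then have "degree h < degree p" using q by (simp add: degree_mult_eq)
    moreover have "poly p a * poly p b = (poly q a * poly q b) * (poly h a * poly h b)" using q by (simp add: algebra_simps)
    then have "poly h a * poly h b < 0" using less.prems q(3) by (metis mult_less_0_iff order.asym)
    ultimately obtain x where "a < x" "x < b" "poly h x = 0" using less.hyps by blast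
    then show ?thesis using q by auto
  qed
  consider r where "poly p r = 0" | c d where "d \<noteq> 0" "[:c * c + d * d, - 2 * c, 1:] dvd p"
    using rcf_poly_quadratic_factor[OF \<open>degree p > 0\<close>] by blast
  then show ?case
  proof cases
    case 1
    show ?thesis
    proof (cases "a < r \<and> r < b")
      case True then show ?thesis using 1 by auto
    next
      case False
      have "r \<noteq> a" "r \<noteq> b" using 1 less.prems by auto
      then have "(a - r) * (b - r) > 0" using False assms(1) by (auto simp: zero_less_mult_iff)
      moreover obtain h where "p = [:-r, 1:] * h" using 1 poly_eq_0_iff_dvd by (metis dvdE)
      ultimately show ?thesis using step[of "[:-r, 1:]" h] by simp
    qed
  next
    case 2
    let ?q = "[:c * c + d * d, - 2 * c, 1:]"
    have pos: "poly ?q x > 0" for x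
    proof -
      have "poly ?q x = (x - c) * (x - c) + d * d" by (simp add: algebra_simps)
      also have "\<dots> > 0" using 2(1) by (intro add_nonneg_pos) (auto simp: zero_less_mult_iff linorder_neq_iff)
      finally show ?thesis .
    qed
    obtain h where "p = ?q * h" using 2 by (elim dvdE)
    then show ?thesis using step[of ?q h] pos[of a] pos[of b] by simp
  qed
qed


section \<open>Rolle's theorem, the mean value theorem and signs at infinity\<close>

lemma rcf_poly_same_sign:
  fixes p :: "'a::real_closed_field poly"
  assumes "\<And>t. min x y \<le> t \<Longrightarrow> t \<le> max x y \<Longrightarrow> poly p t \<noteq> 0"
  shows "poly p x * poly p y > 0"
proof -
  have 0: "poly p x \<noteq> 0" "poly p y \<noteq> 0" using assms by auto
  have "\<not> poly p x * poly p y < 0"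
  proof
    assume neg: "poly p x * poly p y < 0"
    then have "x \<noteq> y" by (metis not_square_less_zero)
    then have "min x y < max x y" by auto
    moreover have "poly p (min x y) * poly p (max x y) < 0"
      using neg by (auto simp: min_def max_def mult.commute)
    ultimately obtain t where "min x y < t" "t < max x y" "poly p t = 0"
      using rcf_poly_IVT by blast
    then show False using assms[of t] by (meson less_imp_le)
  qed
  then show ?thesis using 0 by (metis mult_eq_0_iff linorder_neqE)
qed

text \<open>The argument is algebraic, as no extremum is at hand. Let \<open>c\<close> be the first
  root after \<open>a\<close>. Removing all factors at \<open>a\<close> and \<open>c\<close> leaves
  \<open>q\<close> without zeros between them, and \<open>pderiv p\<close> is a product of powers of
  these factors and of \<open>s\<close>. The values of \<open>s\<close> at \<open>a\<close> and
  \<open>c\<close> have opposite signs because those of \<open>q\<close> have equal signs.\<close>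

lemma rcf_rolle:
  fixes p :: "'a::real_closed_field poly"
  assumes "a < b" "poly p a = 0" "poly p b = 0" "p \<noteq> 0"
  shows "\<exists>x. a < x \<and> x < b \<and> poly (pderiv p) x = 0"
proof -
  define R where "R = {x. poly p x = 0 \<and> a < x \<and> x \<le> b}"
  have R: "finite R" "b \<in> R"
    using poly_roots_finite[OF assms(4)] assms unfolding R_def by (auto intro: rev_finite_subset)
  define c where "c = Min R"
  have "c \<in> R" using Min_in[OF R(1)] R(2) unfolding c_def by auto
  then have c: "poly p c = 0" "a < c" "c \<le> b" unfolding R_def by auto
  have no: "poly p x \<noteq> 0" if "a < x" "x < c" for x
  proof
    assume "poly p x = 0"
    then have "x \<in> R" using that c unfolding R_def by auto
    then show False using Min_le[OF R(1)] that unfolding c_def by (meson leD)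
  qed
  obtain q1 where q1: "p = [:-a, 1:] ^ order a p * q1" "\<not> [:-a, 1:] dvd q1"
    using order_decomp[OF assms(4)] by auto
  have q1n: "q1 \<noteq> 0" "poly q1 a \<noteq> 0" using q1 poly_eq_0_iff_dvd[of q1 a] by auto
  have q1c: "poly q1 c = 0"
  proof -
    have "poly p c = (c - a) ^ order a p * poly q1 c" by (subst q1(1)) simp
    then show ?thesis using c by simp
  qed
  obtain q where q: "q1 = [:-c, 1:] ^ order c q1 * q" "\<not> [:-c, 1:] dvd q"
    using order_decomp[OF q1n(1)] by auto
  have qn: "poly q c \<noteq> 0" using q poly_eq_0_iff_dvd[of q c] by auto
  have qa: "poly q a \<noteq> 0" using q1n(2) by (subst (asm) q(1)) auto
  obtain m where m: "order a p = Suc m"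
    using assms by (metis order_root not0_implies_Suc)
  obtain n where n: "order c q1 = Suc n"
    using q1c q1n by (metis order_root not0_implies_Suc)
  have p: "p = [:-a, 1:] ^ Suc m * ([:-c, 1:] ^ Suc n * q)"
    using q1(1) q(1) unfolding m n by simp
  define s where "s = smult (of_nat (Suc m)) ([:-c, 1:] * q) + smult (of_nat (Suc n)) ([:-a, 1:] * q)
     + [:-a, 1:] * [:-c, 1:] * pderiv q"
  have d1: "pderiv [:- x, 1:] = (1 :: 'a poly)" for x by (simp add: pderiv_pCons one_pCons)
  have dp: "pderiv p = [:-a, 1:] ^ m * [:-c, 1:] ^ n * s"
  proof -
    have gen: "pderiv (A ^ Suc m * (C ^ Suc n * q)) = A ^ m * C ^ n *
        (smult (of_nat (Suc m)) (C * q) + smult (of_nat (Suc n)) (A * q) + A * C * pderiv q)"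
      if "pderiv A = 1" "pderiv C = 1" for A C :: "'a poly"
      by (simp only: pderiv_mult pderiv_power_Suc that) (simp add: algebra_simps del: of_nat_Suc)
    show ?thesis unfolding s_def by (subst p) (rule gen[OF d1 d1])
  qed
  have "poly q a * poly q c > 0"
  proof (rule rcf_poly_same_sign)
    fix t assume t: "min a c \<le> t" "t \<le> max a c"
    show "poly q t \<noteq> 0"
    proof (cases "t = a \<or> t = c")
      case True then show ?thesis using qa qn by auto
    next
      case False
      then have "poly p t \<noteq> 0" using no[of t] t c by auto
      then show ?thesis by (subst (asm) p) auto
    qed
  qed
  moreover have "poly s a * poly s c = - (of_nat (Suc m) * of_nat (Suc n) * ((c - a) * (c - a))) * (poly q a * poly q c)"
    unfolding s_def by (simp add: algebra_simps)
  moreover have "of_nat (Suc m) * of_nat (Suc n) * ((c - a) * (c - a)) > (0::'a)"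
    using c by (intro mult_pos_pos) (auto simp del: of_nat_Suc)
  ultimately have "poly s a * poly s c < 0" by (simp only: mult_neg_pos neg_less_0_iff_less)
  then obtain x where "a < x" "x < c" "poly s x = 0" using rcf_poly_IVT[OF c(2)] by blast
  then show ?thesis using c dp by (intro exI[of _ x]) auto
qed

lemma rcf_poly_MVT:
  fixes p :: "'a::real_closed_field poly"
  assumes "a < b"
  shows "\<exists>x. a < x \<and> x < b \<and> poly p b - poly p a = (b - a) * poly (pderiv p) x"
proof -
  define k where "k = (poly p b - poly p a) / (b - a)"
  define g where "g = p - [:poly p a:] - smult k [:-a, 1:]"
  have dg: "pderiv g = pderiv p - [:k:]"
    unfolding g_def by (simp add: pderiv_diff pderiv_smult pderiv_pCons)
  have "\<exists>x. a < x \<and> x < b \<and> poly (pderiv g) x = 0"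
  proof (cases "g = 0")
    case True
    obtain x where "a < x" "x < b" using dense[OF assms] by auto
    then show ?thesis using True by auto
  next
    case False
    moreover have "k * (b - a) = poly p b - poly p a" using assms unfolding k_def by simp
    then have "poly g b = 0" unfolding g_def by (simp add: algebra_simps)
    moreover have "poly g a = 0" unfolding g_def by simp
    ultimately show ?thesis using assms by (intro rcf_rolle)
  qed
  then obtain x where "a < x" "x < b" "poly (pderiv p) x = k" unfolding dg by auto
  then show ?thesis using assms unfolding k_def by (intro exI[of _ x]) auto
qed

lemma poly_sign_at_infinity:
  fixes p :: "'a::linordered_field poly"
  assumes "p \<noteq> 0"
  shows "\<exists>B>0. \<forall>x. \<bar>x\<bar> \<ge> B \<longrightarrow> sgn (poly p x) = sgn (lead_coeff p * x ^ degree p)"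
proof -
  define m where "m = degree p"
  define c where "c = lead_coeff p"
  define S where "S = (\<Sum>i<m. \<bar>coeff p i\<bar>)"
  have c0: "c \<noteq> 0" using assms unfolding c_def by simp
  have S0: "S \<ge> 0" unfolding S_def by (simp add: sum_nonneg)
  \<comment> \<open>Cauchy's bound: beyond \<open>B\<close> one has both \<open>1 \<le> |x|\<close>,
    so that lower powers are dominated by the one just below the leading one, and
    \<open>S < |c| * |x|\<close>, so that the leading term outweighs their sum.\<close>
  define B where "B = S / \<bar>c\<bar> + 1"
  have "B > 0" using S0 c0 unfolding B_def by (simp add: add_nonneg_pos)
  moreover have "sgn (poly p x) = sgn (c * x ^ m)" if x: "\<bar>x\<bar> \<ge> B" for x
  proof -
    have "0 \<le> S / \<bar>c\<bar>" using S0 by (rule divide_nonneg_nonneg) simp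
    then have x1: "\<bar>x\<bar> \<ge> 1" using x unfolding B_def by linarith
    have px: "poly p x = (\<Sum>i<m. coeff p i * x ^ i) + c * x ^ m"
      unfolding poly_altdef m_def c_def lessThan_Suc_atMost[symmetric] sum.lessThan_Suc by (rule refl)
    have "\<bar>\<Sum>i<m. coeff p i * x ^ i\<bar> < \<bar>c * x ^ m\<bar>"
    proof (cases m)
      case 0 then show ?thesis using c0 by simp
    next
      case (Suc k)
      have "\<bar>\<Sum>i<m. coeff p i * x ^ i\<bar> \<le> (\<Sum>i<m. \<bar>coeff p i\<bar> * \<bar>x\<bar> ^ k)"
      proof (rule order_trans[OF sum_abs sum_mono])
        fix i assume "i \<in> {..<m}"
        then have "\<bar>x\<bar> ^ i \<le> \<bar>x\<bar> ^ k" using x1 Suc by (intro power_increasing) auto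
        then show "\<bar>coeff p i * x ^ i\<bar> \<le> \<bar>coeff p i\<bar> * \<bar>x\<bar> ^ k"
          by (simp add: abs_mult power_abs mult_left_mono)
      qed
      also have "\<dots> = S * \<bar>x\<bar> ^ k" unfolding S_def sum_distrib_right ..
      also have "\<dots> < (\<bar>c\<bar> * \<bar>x\<bar>) * \<bar>x\<bar> ^ k"
      proof (rule mult_strict_right_mono)
        have "S / \<bar>c\<bar> < \<bar>x\<bar>" using x unfolding B_def by linarith
        then show "S < \<bar>c\<bar> * \<bar>x\<bar>" using c0 by (simp add: field_simps)
        show "0 < \<bar>x\<bar> ^ k" using x1 by (intro zero_less_power) linarith
      qed
      also have "\<dots> = \<bar>c * x ^ m\<bar>" unfolding Suc by (simp add: abs_mult power_abs)
      finally show ?thesis .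
    qed
    moreover have "sgn (u + w) = sgn w" if uw: "\<bar>u\<bar> < \<bar>w\<bar>" for u w :: 'a
    proof (cases "0 < w")
      case True
      have "u < w \<and> - u < w" using uw unfolding abs_of_pos[OF True] abs_less_iff .
      then have "0 < u + w" by linarith
      then show ?thesis using True by (simp only: sgn_pos)
    next
      case False
      have "w \<noteq> 0" using uw by auto
      then have w: "w < 0" using False by simp
      have "u < - w \<and> - u < - w" using uw unfolding abs_of_neg[OF w] abs_less_iff .
      then have "u + w < 0" by linarith
      then show ?thesis using w by (simp only: sgn_neg)
    qed
    ultimately show ?thesis unfolding px by blast
  qed
  ultimately show ?thesis unfolding c_def m_def by blast
qed

text \<open>Makes the reals available as the field with which every other one is compared. A
  polynomial of odd degree has opposite signs far to the left and far to the right.\<close>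

instance real :: real_closed_field
proof
  fix x :: real assume "0 \<le> x" then show "\<exists>y. y * y = x" by (metis real_sqrt_mult_self abs_of_nonneg)
next
  fix n :: nat and c :: "nat \<Rightarrow> real"
  assume n: "odd n" "c n \<noteq> 0"
  define p where "p = (\<Sum>i\<le>n. monom (c i) i)"
  have coeff: "coeff p i = (if i \<le> n then c i else 0)" for i
    unfolding p_def by (simp add: coeff_sum)
  have deg: "degree p = n" using n
    by (intro antisym degree_le le_degree) (auto simp: coeff)
  have "p \<noteq> 0" using n deg by auto
  then obtain B where B: "B > 0" "\<And>x. \<bar>x\<bar> \<ge> B \<Longrightarrow> sgn (poly p x) = sgn (lead_coeff p * x ^ degree p)"
    using poly_sign_at_infinity by blast
  have 1: "sgn (poly p B) = sgn (c n * B ^ n)" using B(2)[of B] B(1) deg coeff by simp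
  have 2: "sgn (poly p (- B)) = - sgn (c n * B ^ n)" using B(2)[of "- B"] B(1) deg coeff n by (simp add: sgn_mult)
  have "sgn (poly p (- B) * poly p B) = - (sgn (c n * B ^ n) * sgn (c n * B ^ n))"
    unfolding sgn_mult[of "poly p (- B)"] 1 2 by simp
  also have "\<dots> < 0" using n B by (auto simp: zero_less_mult_iff sgn_if)
  finally have "poly p (- B) * poly p B < 0" by (simp only: sgn_less)
  then obtain x where "poly p x = 0" using poly_IVT[of "- B" B p] B by auto
  then show "\<exists>x. (\<Sum>i\<le>n. c i * x ^ i) = 0"
    unfolding p_def by (auto simp: poly_sum poly_monom)
qed

section \<open>Sign diagrams of polynomial families in two ordered fields\<close>

text \<open>Two equivalences instead of an equation between values of \<open>sgn\<close>, since the
  two numbers may lie in different fields.\<close>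

definition same_sgn :: "'a::linordered_idom \<Rightarrow> 'b::linordered_idom \<Rightarrow> bool" where
  "same_sgn x y \<longleftrightarrow> (0 < x \<longleftrightarrow> 0 < y) \<and> (x < 0 \<longleftrightarrow> y < 0)"

lemma same_sgn_zero_iff: "same_sgn x y \<Longrightarrow> x = 0 \<longleftrightarrow> y = 0"
proof -
  assume "same_sgn x y"
  moreover have "x = 0 \<longleftrightarrow> \<not> 0 < x \<and> \<not> x < 0" "y = 0 \<longleftrightarrow> \<not> 0 < y \<and> \<not> y < 0" by auto
  ultimately show ?thesis unfolding same_sgn_def by blast
qed

lemma same_sgn_mult: "same_sgn a b \<Longrightarrow> same_sgn c d \<Longrightarrow> same_sgn (a * c) (b * d)"
  unfolding same_sgn_def by (auto simp: zero_less_mult_iff mult_less_0_iff)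

lemma same_sgn_power: "same_sgn a b \<Longrightarrow> same_sgn (a ^ n) (b ^ n)"
proof (induction n)
  case 0 then show ?case by (simp add: same_sgn_def)
next
  case (Suc n) then show ?case by (simp add: same_sgn_mult)
qed

lemma same_sgn_cancel: "same_sgn c d \<Longrightarrow> c \<noteq> 0 \<Longrightarrow> same_sgn (c * x) (d * y) \<Longrightarrow> same_sgn x y"
  unfolding same_sgn_def
  by (cases "0 < c"; cases "c < 0") (auto simp: zero_less_mult_iff mult_less_0_iff)

lemma same_sgn_via:
  assumes "same_sgn a b" "a * x > 0" "b * y > 0" shows "same_sgn x y"
  using assms unfolding same_sgn_def by (auto simp: zero_less_mult_iff)

lemma same_sgn_of_sgn:
  assumes "sgn x = sgn (x' :: 'a::linordered_idom)" "sgn y = sgn (y' :: 'b::linordered_idom)" "same_sgn x' y'"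
  shows "same_sgn x y"
proof -
  have "0 < x \<longleftrightarrow> 0 < x'" "x < 0 \<longleftrightarrow> x' < 0" using assms(1) by (metis sgn_greater sgn_less)+
  moreover have "0 < y \<longleftrightarrow> 0 < y'" "y < 0 \<longleftrightarrow> y' < 0" using assms(2) by (metis sgn_greater sgn_less)+
  ultimately show ?thesis using assms(3) unfolding same_sgn_def by simp
qed

definition same_cut :: "('a::linorder \<times> 'b::linorder) set \<Rightarrow> 'a \<Rightarrow> 'b \<Rightarrow> bool" where
  "same_cut Z x y \<longleftrightarrow> (\<forall>(z, w)\<in>Z. (z < x \<longleftrightarrow> w < y) \<and> (x < z \<longleftrightarrow> y < w))"

text \<open>Requiring \<open>same_cut Z z w\<close> of every pair makes \<open>Z\<close> the graph
  of an order isomorphism between two finite sets.\<close>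

definition cut_pairing :: "('a::linorder \<times> 'b::linorder) set \<Rightarrow> bool" where
  "cut_pairing Z \<longleftrightarrow> finite Z \<and> (\<forall>(z, w)\<in>Z. same_cut Z z w)"

text \<open>The families of polynomials have the same sign diagram: \<open>Z\<close> pairs off the points at which
  signs change.\<close>

definition same_diagram :: "('a::linordered_field poly \<times> 'b::linordered_field poly) set \<Rightarrow> bool" where
  "same_diagram \<Lambda> \<longleftrightarrow> (\<exists>Z. cut_pairing Z \<and>
     (\<forall>x y. same_cut Z x y \<longrightarrow> (\<forall>(p, q)\<in>\<Lambda>. same_sgn (poly p x) (poly q y))))"

lemma same_cutD:
  "same_cut Z x y \<Longrightarrow> (z, w) \<in> Z \<Longrightarrow> (z < x \<longleftrightarrow> w < y) \<and> (x < z \<longleftrightarrow> y < w) \<and> (x = z \<longleftrightarrow> y = w)"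
proof -
  assume "same_cut Z x y" "(z, w) \<in> Z"
  then have "(z < x \<longleftrightarrow> w < y) \<and> (x < z \<longleftrightarrow> y < w)" unfolding same_cut_def by blast
  moreover have "x = z \<longleftrightarrow> \<not> z < x \<and> \<not> x < z" "y = w \<longleftrightarrow> \<not> w < y \<and> \<not> y < w" by auto
  ultimately show ?thesis by blast
qed

lemma same_cut_subset: "same_cut Z x y \<Longrightarrow> Z' \<subseteq> Z \<Longrightarrow> same_cut Z' x y"
  unfolding same_cut_def by blast

lemma cut_pairing_subset: "cut_pairing Z \<Longrightarrow> Z' \<subseteq> Z \<Longrightarrow> cut_pairing Z'"
proof -
  assume *: "cut_pairing Z" "Z' \<subseteq> Z"
  then have "finite Z'" unfolding cut_pairing_def using finite_subset by blast
  moreover have "same_cut Z' z w" if "(z, w) \<in> Z'" for z w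
    using * that same_cut_subset[of Z z w Z'] unfolding cut_pairing_def by blast
  ultimately show ?thesis unfolding cut_pairing_def by blast
qed

lemma cut_pairing_same_cut: "cut_pairing Z \<Longrightarrow> (z, w) \<in> Z \<Longrightarrow> same_cut Z z w"
  unfolding cut_pairing_def by auto

lemma same_cut_converse: "same_cut (Z\<inverse>) y x \<longleftrightarrow> same_cut Z x y"
  unfolding same_cut_def by auto

lemma cut_pairing_converse: "cut_pairing Z \<Longrightarrow> cut_pairing (Z\<inverse>)"
  unfolding cut_pairing_def by (auto simp: same_cut_converse)

lemma same_sgn_sym: "same_sgn x y \<longleftrightarrow> same_sgn y x"
  unfolding same_sgn_def by auto

lemma finite_sets_separated:
  fixes L U :: "'a::linordered_field set"
  assumes "finite L" "finite U" "\<And>l u. l \<in> L \<Longrightarrow> u \<in> U \<Longrightarrow> l < u"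
  shows "\<exists>y. (\<forall>l\<in>L. l < y) \<and> (\<forall>u\<in>U. y < u)"
proof (cases "L = {} \<or> U = {}")
  case True
  then show ?thesis
  proof
    assume L: "L = {}"
    show ?thesis
    proof (cases "U = {}")
      case False
      have "Min U - 1 < u" if "u \<in> U" for u
        using Min_le[OF assms(2) that] by (metis less_add_one diff_less_eq order_le_less_trans)
      then show ?thesis using L by blast
    qed (use L in auto)
  next
    assume U: "U = {}"
    show ?thesis
    proof (cases "L = {}")
      case False
      have "l < Max L + 1" if "l \<in> L" for l
        using Max_ge[OF assms(1) that] by (metis less_add_one order_le_less_trans)
      then show ?thesis using U by blast
    qed (use U in auto)
  qed
next
  case False
  then have "Max L < Min U" using assms by simp
  then obtain y where y: "Max L < y" "y < Min U" using dense by blast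
  then have "\<forall>l\<in>L. l < y" "\<forall>u\<in>U. y < u" using assms False by auto
  then show ?thesis by blast
qed

text \<open>If \<open>x\<close> is not itself paired, any point of the matching gap in the other
  field will do; the gap is nonempty because the order is dense and without end points. This is what
  turns a witness in one field into a witness in the other.\<close>

lemma same_cut_partner:
  fixes Z :: "('a::linorder \<times> 'b::linordered_field) set"
  assumes "cut_pairing Z"
  shows "\<exists>y. same_cut Z x y"
proof (cases "\<exists>w. (x, w) \<in> Z")
  case True then show ?thesis using cut_pairing_same_cut[OF assms] by blast
next
  case False
  define L where "L = snd ` {(z, w) \<in> Z. z < x}"
  define U where "U = snd ` {(z, w) \<in> Z. x < z}"
  have fin: "finite Z" using assms unfolding cut_pairing_def by auto
  then have "finite L" "finite U" unfolding L_def U_def by (auto intro!: finite_imageI intro: rev_finite_subset)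
  moreover have "l < u" if lu: "l \<in> L" "u \<in> U" for l u
  proof -
    obtain z z' where z: "(z, l) \<in> Z" "z < x" "(z', u) \<in> Z" "x < z'" using lu unfolding L_def U_def by auto
    then have "z < z'" by simp
    then show ?thesis using same_cutD[OF cut_pairing_same_cut[OF assms z(3)] z(1)] by simp
  qed
  ultimately obtain y where y: "\<forall>l\<in>L. l < y" "\<forall>u\<in>U. y < u" using finite_sets_separated by metis
  have "same_cut Z x y" unfolding same_cut_def
  proof (safe)
    fix z w assume zw: "(z, w) \<in> Z"
    then have "z \<noteq> x" using False by auto
    then have "(z < x \<and> w < y) \<or> (x < z \<and> y < w)"
    proof (cases "z < x")
      case True then have "w \<in> L" using zw unfolding L_def by force
      then show ?thesis using True y by auto
    next
      case F: False then have "x < z" using \<open>z \<noteq> x\<close> by auto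
      then have "w \<in> U" using zw unfolding U_def by force
      then show ?thesis using \<open>x < z\<close> y by auto
    qed
    then show "z < x \<Longrightarrow> w < y" "w < y \<Longrightarrow> z < x" "x < z \<Longrightarrow> y < w" "y < w \<Longrightarrow> x < z" by auto
  qed
  then show ?thesis by auto
qed

text \<open>A root outside the pairing would lie inside a gap. All points of the gap share its
  partner \<open>y\<close>, so the polynomial would vanish on a whole interval and have infinitely
  many roots.\<close>

lemma root_in_cut_pairing:
  fixes Z :: "('a::linordered_field \<times> 'b::linordered_field) set"
  assumes Z: "cut_pairing Z" and sg: "\<And>x y. same_cut Z x y \<Longrightarrow> same_sgn (poly p x) (poly q y)"
    and p: "p \<noteq> 0" "poly p r = 0"
  shows "\<exists>w. (r, w) \<in> Z"
proof (rule ccontr)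
  assume no: "\<not> ?thesis"
  obtain y where y: "same_cut Z r y" using same_cut_partner[OF Z] by blast
  then have qy: "poly q y = 0" using sg same_sgn_zero_iff p(2) by blast
  have fin: "finite Z" using Z unfolding cut_pairing_def by auto
  have "finite {z \<in> fst ` Z. z < r}" "finite {z \<in> fst ` Z. r < z}" using fin by auto
  note finZ = this
  obtain l where l: "\<forall>z\<in>{z \<in> fst ` Z. z < r}. z < l" "l < r"
    using finite_sets_separated[OF finZ(1), of "{r}"] by blast
  obtain u where u: "\<forall>z\<in>{z \<in> fst ` Z. r < z}. u < z" "r < u"
    using finite_sets_separated[OF _ finZ(2), of "{r}"] by blast
  have "poly p x = 0" if x: "l < x" "x < u" for x
  proof -
    have "same_cut Z x y" unfolding same_cut_def
    proof (clarify)
      fix z w assume zw: "(z, w) \<in> Z"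
      then have zf: "z \<in> fst ` Z" by force
      have "z \<noteq> r" using no zw by auto
      then consider "z < r" | "r < z" by (metis linorder_neqE)
      then have "(z < r \<and> z < x) \<or> (r < z \<and> x < z)"
      proof cases
        case 1
        then have "z < l" using l(1) zf by blast
        then show ?thesis using 1 x(1) by simp
      next
        case 2
        then have "u < z" using u(1) zf by blast
        then show ?thesis using 2 x(2) by simp
      qed
      then show "(z < x) = (w < y) \<and> (x < z) = (y < w)" using same_cutD[OF y zw] by auto
    qed
    then show ?thesis using sg same_sgn_zero_iff qy by blast
  qed
  then have "{l<..<u} \<subseteq> {x. poly p x = 0}" by auto
  moreover have "infinite {l<..<u}" using l u by (intro infinite_Ioo) auto
  ultimately show False using poly_roots_finite[OF p(1)] finite_subset by blast
qed

text \<open>Equal degrees are assumed because on the left the parity of the degree decides the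
  sign.\<close>

lemma sign_at_minus_infinity:
  fixes p :: "'a::linordered_field poly" and q :: "'b::linordered_field poly"
  assumes "p \<noteq> 0" "q \<noteq> 0" "degree p = degree q" "same_sgn (lead_coeff p) (lead_coeff q)"
  shows "\<exists>a<0. \<exists>b<0. \<forall>x\<le>a. \<forall>y\<le>b. same_sgn (poly p x) (poly q y)"
proof -
  obtain A where A: "A > 0" "\<And>x. \<bar>x\<bar> \<ge> A \<Longrightarrow> sgn (poly p x) = sgn (lead_coeff p * x ^ degree p)"
    using poly_sign_at_infinity[OF assms(1)] by blast
  obtain B where B: "B > 0" "\<And>x. \<bar>x\<bar> \<ge> B \<Longrightarrow> sgn (poly q x) = sgn (lead_coeff q * x ^ degree q)"
    using poly_sign_at_infinity[OF assms(2)] by blast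
  have "same_sgn (poly p x) (poly q y)" if "x \<le> - A" "y \<le> - B" for x y
  proof (rule same_sgn_of_sgn[OF A(2) B(2)])
    have "same_sgn x y" using that A(1) B(1) unfolding same_sgn_def by auto
    then show "same_sgn (lead_coeff p * x ^ degree p) (lead_coeff q * y ^ degree q)"
      unfolding assms(3) using assms(4) by (auto intro: same_sgn_mult same_sgn_power simp: assms(3))
  qed (use that A B in auto)
  then show ?thesis using A B by (metis neg_less_0_iff_less)
qed

lemma sign_at_plus_infinity:
  fixes p :: "'a::linordered_field poly" and q :: "'b::linordered_field poly"
  assumes "p \<noteq> 0" "q \<noteq> 0" "same_sgn (lead_coeff p) (lead_coeff q)"
  shows "\<exists>a>0. \<exists>b>0. \<forall>x\<ge>a. \<forall>y\<ge>b. same_sgn (poly p x) (poly q y)"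
proof -
  obtain A where A: "A > 0" "\<And>x. \<bar>x\<bar> \<ge> A \<Longrightarrow> sgn (poly p x) = sgn (lead_coeff p * x ^ degree p)"
    using poly_sign_at_infinity[OF assms(1)] by blast
  obtain B where B: "B > 0" "\<And>x. \<bar>x\<bar> \<ge> B \<Longrightarrow> sgn (poly q x) = sgn (lead_coeff q * x ^ degree q)"
    using poly_sign_at_infinity[OF assms(2)] by blast
  have "same_sgn (poly p x) (poly q y)" if "x \<ge> A" "y \<ge> B" for x y
  proof (rule same_sgn_of_sgn[OF A(2) B(2)])
    have "x > 0" "y > 0" using that A(1) B(1) by auto
    then have "same_sgn (x ^ degree p) (y ^ degree q)" unfolding same_sgn_def by (simp add: not_less)
    then show "same_sgn (lead_coeff p * x ^ degree p) (lead_coeff q * y ^ degree q)"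
      using assms(3) by (intro same_sgn_mult)
  qed (use that A B in auto)
  then show ?thesis using A B by blast
qed

text \<open>Between neighbouring points of \<open>Z\<close> the derivative of \<open>p\<close> has
  no zero. By the mean value theorem a root \<open>r\<close> in such a gap separates opposite signs
  of \<open>p\<close> at the two ends; \<open>q\<close> has the same signs at the partners of the
  ends, and the intermediate value theorem yields \<open>s\<close>.\<close>

lemma monotone_root_partner:
  fixes p :: "'a::real_closed_field poly" and q :: "'b::real_closed_field poly"
  assumes Z: "cut_pairing Z" and pq: "p \<noteq> 0" "q \<noteq> 0" "degree p = degree q" "same_sgn (lead_coeff p) (lead_coeff q)"
    and dp: "\<And>x. poly (pderiv p) x = 0 \<Longrightarrow> \<exists>w. (x, w) \<in> Z"
    and sgZ: "\<And>z w. (z, w) \<in> Z \<Longrightarrow> same_sgn (poly p z) (poly q w)"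
    and r: "poly p r = 0" "\<And>w. (r, w) \<notin> Z"
  shows "\<exists>s. same_cut Z r s \<and> poly q s = 0"
proof -
  have fin: "finite Z" using Z unfolding cut_pairing_def by auto
  have ord: "z < z' \<longleftrightarrow> w < w'" if "(z, w) \<in> Z" "(z', w') \<in> Z" for z w z' w'
    using same_cutD[OF cut_pairing_same_cut[OF Z that(2)] that(1)] by simp
  \<comment> \<open>The left end of the gap, or else a point so far left that leading terms decide
    the signs. The conditions \<open>a' < 0\<close> and \<open>b' > 0\<close> in the second kind of
    choice ensure \<open>a' < b'\<close> even if both ends are of that kind.\<close>
  have "\<exists>a a'. a < r \<and> (\<forall>(z, w)\<in>Z. z < r \<longrightarrow> z \<le> a \<and> w \<le> a') \<and> same_sgn (poly p a) (poly q a')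
      \<and> ((a, a') \<in> Z \<or> a' < 0 \<and> (\<forall>(z, w)\<in>Z. a' < w))"
  proof (cases "\<exists>(z, w)\<in>Z. z < r")
    case True
    define L where "L = {z \<in> fst ` Z. z < r}"
    have "finite L" "L \<noteq> {}" using True fin unfolding L_def by force+
    then have "Max L \<in> L" by simp
    then obtain a' where a: "(Max L, a') \<in> Z" "Max L < r" unfolding L_def by force
    have "z \<le> Max L \<and> w \<le> a'" if "(z, w) \<in> Z" "z < r" for z w
    proof -
      have "z \<in> L" using that unfolding L_def by force
      then have "z \<le> Max L" using \<open>finite L\<close> by simp
      then show ?thesis using ord[OF a(1) that(1)] by (simp add: not_less[symmetric])
    qed
    then show ?thesis using a sgZ by blast
  next
    case False
    obtain a b where ab: "a < 0" "b < 0" "\<forall>x\<le>a. \<forall>y\<le>b. same_sgn (poly p x) (poly q y)"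
      using sign_at_minus_infinity[OF pq] by blast
    obtain c where c: "\<forall>w\<in>snd ` Z. c < w" using finite_sets_separated[of "{}" "snd ` Z"] fin by auto
    have "\<forall>(z, w)\<in>Z. min b c < w" using c by (force simp: min_less_iff_disj)
    moreover have "min b c < 0" "min a (r - 1) < r" using ab by (auto simp: min_less_iff_disj)
    moreover have "same_sgn (poly p (min a (r - 1))) (poly q (min b c))" using ab(3) by simp
    ultimately show ?thesis using False by blast
  qed
  then obtain a a' where a: "a < r" "\<forall>(z, w)\<in>Z. z < r \<longrightarrow> z \<le> a \<and> w \<le> a'" "same_sgn (poly p a) (poly q a')"
    "(a, a') \<in> Z \<or> a' < 0 \<and> (\<forall>(z, w)\<in>Z. a' < w)" by blast
  have "\<exists>b b'. r < b \<and> (\<forall>(z, w)\<in>Z. r < z \<longrightarrow> b \<le> z \<and> b' \<le> w) \<and> same_sgn (poly p b) (poly q b')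
      \<and> ((b, b') \<in> Z \<or> b' > 0 \<and> (\<forall>(z, w)\<in>Z. w < b'))"
  proof (cases "\<exists>(z, w)\<in>Z. r < z")
    case True
    define L where "L = {z \<in> fst ` Z. r < z}"
    have "finite L" "L \<noteq> {}" using True fin unfolding L_def by force+
    then have "Min L \<in> L" by simp
    then obtain a' where a: "(Min L, a') \<in> Z" "r < Min L" unfolding L_def by force
    have "Min L \<le> z \<and> a' \<le> w" if "(z, w) \<in> Z" "r < z" for z w
    proof -
      have "z \<in> L" using that unfolding L_def by force
      then have "Min L \<le> z" using \<open>finite L\<close> by simp
      then show ?thesis using ord[OF that(1) a(1)] by (simp add: not_less[symmetric])
    qed
    then show ?thesis using a sgZ by blast
  next
    case False
    obtain a b where ab: "a > 0" "b > 0" "\<forall>x\<ge>a. \<forall>y\<ge>b. same_sgn (poly p x) (poly q y)"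
      using sign_at_plus_infinity[OF pq(1,2,4)] by blast
    obtain c where c: "\<forall>w\<in>snd ` Z. w < c" using finite_sets_separated[of "snd ` Z" "{}"] fin by auto
    have "\<forall>(z, w)\<in>Z. w < max b c" using c by (force simp: less_max_iff_disj)
    moreover have "max b c > 0" "r < max a (r + 1)" using ab by (auto simp: less_max_iff_disj)
    moreover have "same_sgn (poly p (max a (r + 1))) (poly q (max b c))" using ab(3) by simp
    ultimately show ?thesis using False by blast
  qed
  then obtain b b' where b: "r < b" "\<forall>(z, w)\<in>Z. r < z \<longrightarrow> b \<le> z \<and> b' \<le> w" "same_sgn (poly p b) (poly q b')"
    "(b, b') \<in> Z \<or> b' > 0 \<and> (\<forall>(z, w)\<in>Z. w < b')" by blast
  have ab': "a' < b'" using a(1,4) b(1,4) ord[of a a' b b'] by force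
  have dp0: "poly (pderiv p) x \<noteq> 0" if "a < x" "x < b" for x
  proof
    assume "poly (pderiv p) x = 0"
    then obtain w where w: "(x, w) \<in> Z" using dp by blast
    then have "x \<noteq> r" using r by auto
    then show False using w a(2) b(2) that by (cases "x < r") (fastforce dest: bspec)+
  qed
  obtain \<xi> where \<xi>: "a < \<xi>" "\<xi> < r" "poly p r - poly p a = (r - a) * poly (pderiv p) \<xi>"
    using rcf_poly_MVT[OF a(1)] by blast
  obtain \<eta> where \<eta>: "r < \<eta>" "\<eta> < b" "poly p b - poly p r = (b - r) * poly (pderiv p) \<eta>"
    using rcf_poly_MVT[OF b(1)] by blast
  have "poly (pderiv p) \<xi> * poly (pderiv p) \<eta> > 0"
    by (rule rcf_poly_same_sign, rule dp0) (use \<xi> \<eta> in auto)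
  then have "(r - a) * (b - r) * (poly (pderiv p) \<xi> * poly (pderiv p) \<eta>) > 0"
    using a(1) b(1) by (simp add: zero_less_mult_iff)
  moreover have "poly p a * poly p b = - ((r - a) * (b - r) * (poly (pderiv p) \<xi> * poly (pderiv p) \<eta>))"
  proof -
    have "poly p a = - ((r - a) * poly (pderiv p) \<xi>)" "poly p b = (b - r) * poly (pderiv p) \<eta>"
      using \<xi>(3) \<eta>(3) r(1) by (simp_all add: neg_eq_iff_add_eq_0 eq_neg_iff_add_eq_0)
    then show ?thesis by (simp only:) (simp add: algebra_simps)
  qed
  ultimately have "poly p a * poly p b < 0" by simp
  then have "poly q a' * poly q b' < 0" using same_sgn_mult[OF a(3) b(3)] unfolding same_sgn_def by blast
  then obtain s where s: "a' < s" "s < b'" "poly q s = 0" using rcf_poly_IVT[OF ab'] by blast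
  have "same_cut Z r s" unfolding same_cut_def
  proof (clarify)
    fix z w assume zw: "(z, w) \<in> Z"
    then have "z \<noteq> r" using r by auto
    then consider "z < r" | "r < z" by (metis linorder_neqE)
    then show "(z < r) = (w < s) \<and> (r < z) = (s < w)"
    proof cases
      case 1 then have "w \<le> a'" using a(2) zw by blast
      then show ?thesis using 1 s by auto
    next
      case 2 then have "b' \<le> w" using b(2) zw by blast
      then show ?thesis using 2 s by auto
    qed
  qed
  then show ?thesis using s by blast
qed

text \<open>The inductive step of Cohen-Hoermander elimination. At a root of a member of
  \<open>H\<close> the sign of \<open>p\<close> is read off from a remainder in
  \<open>\<Gamma>\<close>. Between consecutive such roots \<open>p\<close> is monotone, since its
  derivative belongs to \<open>H\<close>, so at most one new root appears there, and in both fields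
  alike.\<close>

lemma same_diagram_insert:
  fixes p :: "'a::real_closed_field poly" and q :: "'b::real_closed_field poly"
  assumes pq: "p \<noteq> 0" "q \<noteq> 0" "degree p = degree q" "same_sgn (lead_coeff p) (lead_coeff q)"
    and H0: "\<And>h k. (h, k) \<in> H \<Longrightarrow> h \<noteq> 0 \<and> k \<noteq> 0"
    and dH: "(pderiv p, pderiv q) \<in> H"
    and \<Gamma>: "same_diagram \<Gamma>" "H \<subseteq> \<Gamma>"
    and rem: "\<And>h k. (h, k) \<in> H \<Longrightarrow> \<exists>(u, v)\<in>\<Gamma>. \<forall>x y. poly h x = 0 \<and> poly k y = 0 \<and> same_sgn (poly u x) (poly v y)
        \<longrightarrow> same_sgn (poly p x) (poly q y)"
  shows "same_diagram (insert (p, q) H)"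
proof -
  obtain Z where Z: "cut_pairing Z"
    and sg: "\<And>x y h k. same_cut Z x y \<Longrightarrow> (h, k) \<in> \<Gamma> \<Longrightarrow> same_sgn (poly h x) (poly k y)"
    using \<Gamma>(1) unfolding same_diagram_def by blast
  \<comment> \<open>Only roots of members of \<open>H\<close> are kept: at the other points of
    \<open>Z\<close>, such as roots of remainders, the sign of \<open>p\<close> is not
    controlled.\<close>
  define Z1 where "Z1 = {(z, w) \<in> Z. \<exists>(h, k)\<in>H. poly h z = 0}"
  have Z1: "Z1 \<subseteq> Z" unfolding Z1_def by auto
  have gZ1: "cut_pairing Z1" using cut_pairing_subset[OF Z Z1] .
  have rt1: "\<exists>w. (x, w) \<in> Z1" if "(h, k) \<in> H" "poly h x = 0" for h k x
  proof -
    have "\<exists>w. (x, w) \<in> Z"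
      using root_in_cut_pairing[OF Z, of h k x] sg that \<Gamma>(2) H0 by blast
    then show ?thesis using that unfolding Z1_def by blast
  qed
  have rt2: "\<exists>z. (z, y) \<in> Z1" if hk: "(h, k) \<in> H" "poly k y = 0" for h k y
  proof -
    have "\<exists>z. (y, z) \<in> Z\<inverse>"
    proof (rule root_in_cut_pairing[OF cut_pairing_converse[OF Z]])
      fix x' y' assume "same_cut (Z\<inverse>) x' y'"
      then have "same_sgn (poly h y') (poly k x')" using sg hk(1) \<Gamma>(2) unfolding same_cut_converse by blast
      then show "same_sgn (poly k x') (poly h y')" using same_sgn_sym by blast
    qed (use hk H0 in blast)+
    then obtain z where z: "(z, y) \<in> Z" by auto
    then have "same_sgn (poly h z) (poly k y)" using sg cut_pairing_same_cut[OF Z] hk \<Gamma>(2) by blast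
    then have "poly h z = 0" using same_sgn_zero_iff hk by blast
    then show ?thesis using z hk unfolding Z1_def by blast
  qed
  have sgZ: "same_sgn (poly p z) (poly q w)" if zw: "(z, w) \<in> Z1" for z w
  proof -
    obtain h k where hk: "(h, k) \<in> H" "poly h z = 0" "(z, w) \<in> Z" using zw unfolding Z1_def by auto
    then have m: "same_cut Z z w" using cut_pairing_same_cut[OF Z] by blast
    then have "poly k w = 0" using sg[OF m] hk \<Gamma>(2) same_sgn_zero_iff by blast
    moreover obtain u v where uv: "(u, v) \<in> \<Gamma>" "\<forall>x y. poly h x = 0 \<and> poly k y = 0 \<and> same_sgn (poly u x) (poly v y)
        \<longrightarrow> same_sgn (poly p x) (poly q y)" using rem[OF hk(1)] by blast
    ultimately show ?thesis using sg[OF m uv(1)] hk by blast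
  qed
  \<comment> \<open>Cuts for \<open>Z1\<close> are coarser than those for \<open>Z\<close>, so
    \<open>y\<close> is first replaced by a partner \<open>y'\<close> of \<open>x\<close> for the
    full \<open>Z\<close>. A root of \<open>k\<close> between \<open>y\<close> and \<open>y'\<close>
    would occur in a pair of \<open>Z1\<close> and separate them.\<close>
  have sg1: "same_sgn (poly h x) (poly k y)" if m: "same_cut Z1 x y" and hk: "(h, k) \<in> H" for x y h k
  proof (cases "\<exists>w. (x, w) \<in> Z1")
    case True
    then obtain w where w: "(x, w) \<in> Z1" by blast
    then have "y = w" using same_cutD[OF m w] by simp
    then show ?thesis using w Z1 sg cut_pairing_same_cut[OF Z] hk \<Gamma>(2) by blast
  next
    case False
    obtain y' where y': "same_cut Z x y'" using same_cut_partner[OF Z] by blast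
    have m': "same_cut Z1 x y'" using same_cut_subset[OF y' Z1] .
    have "poly k y' * poly k y > 0"
    proof (rule rcf_poly_same_sign)
      fix t assume t: "min y' y \<le> t" "t \<le> max y' y"
      show "poly k t \<noteq> 0"
      proof
        assume "poly k t = 0"
        then obtain z where z: "(z, t) \<in> Z1" using rt2[OF hk] by blast
        have "x \<noteq> z" using z False by auto
        then have "t \<noteq> y" "t \<noteq> y'" "t < y \<longleftrightarrow> t < y'" using same_cutD[OF m z] same_cutD[OF m' z] by auto
        then show False using t by (auto simp: min_def max_def split: if_splits)
      qed
    qed
    moreover have "same_sgn (poly h x) (poly k y')" using sg[OF y'] hk \<Gamma>(2) by blast
    ultimately show ?thesis unfolding same_sgn_def by (auto simp: zero_less_mult_iff)
  qed
  have partner1: "\<exists>s. same_cut Z1 r s \<and> poly q s = 0" if r: "poly p r = 0" for r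
  proof (cases "\<exists>w. (r, w) \<in> Z1")
    case True
    then show ?thesis using cut_pairing_same_cut[OF gZ1] sgZ same_sgn_zero_iff r by blast
  next
    case False
    then show ?thesis using rt1[OF dH] by (intro monotone_root_partner[OF gZ1 pq _ sgZ r]) auto
  qed
  have partner2: "\<exists>r. same_cut Z1 r s \<and> poly p r = 0" if s: "poly q s = 0" for s
  proof (cases "\<exists>z. (z, s) \<in> Z1")
    case True
    then show ?thesis using cut_pairing_same_cut[OF gZ1] sgZ same_sgn_zero_iff s by blast
  next
    case False
    have "\<exists>r. same_cut (Z1\<inverse>) s r \<and> poly p r = 0"
    proof (rule monotone_root_partner[OF cut_pairing_converse[OF gZ1] pq(2,1) pq(3)[symmetric]])
      show "same_sgn (lead_coeff q) (lead_coeff p)" using pq(4) same_sgn_sym by blast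
      show "same_sgn (poly q z) (poly p w)" if "(z, w) \<in> Z1\<inverse>" for z w
        using sgZ that same_sgn_sym by blast
    qed (use rt2[OF dH] s False in auto)
    then show ?thesis by (simp add: same_cut_converse)
  qed
  \<comment> \<open>Roots of \<open>p\<close> and \<open>q\<close> are paired when they have the
    same cut for \<open>Z1\<close>. Two roots of one polynomial are separated by a zero of its
    derivative, hence by a point of \<open>Z1\<close>; this gives \<open>mono\<close>.\<close>
  define N where "N = {(r, s). same_cut Z1 r s \<and> poly p r = 0 \<and> poly q s = 0}"
  define Z2 where "Z2 = Z1 \<union> N"
  have mono: "r1 < r2 \<longleftrightarrow> s1 < s2" if n: "(r1, s1) \<in> N" "(r2, s2) \<in> N" for r1 s1 r2 s2
  proof
    assume "r1 < r2"
    then obtain \<xi> where \<xi>: "r1 < \<xi>" "\<xi> < r2" "poly (pderiv p) \<xi> = 0"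
      using rcf_rolle[of r1 r2 p] n pq unfolding N_def by auto
    then obtain w where w: "(\<xi>, w) \<in> Z1" using rt1[OF dH] by blast
    then have "s1 < w" "w < s2" using n \<xi> same_cutD[OF _ w] unfolding N_def by blast+
    then show "s1 < s2" by simp
  next
    assume "s1 < s2"
    then obtain \<xi> where \<xi>: "s1 < \<xi>" "\<xi> < s2" "poly (pderiv q) \<xi> = 0"
      using rcf_rolle[of s1 s2 q] n pq unfolding N_def by auto
    then obtain w where w: "(w, \<xi>) \<in> Z1" using rt2[OF dH] by blast
    then have "r1 < w" "w < r2" using n \<xi> same_cutD[OF _ w] unfolding N_def by blast+
    then show "r1 < r2" by simp
  qed
  have gZ2: "cut_pairing Z2"
  proof -
    have "N \<subseteq> {x. poly p x = 0} \<times> {x. poly q x = 0}" unfolding N_def by auto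
    then have "finite N" by (rule finite_subset) (intro finite_SigmaI poly_roots_finite pq(1,2))
    then have "finite Z2" using gZ1 unfolding Z2_def cut_pairing_def by auto
    moreover have "same_cut Z2 z w" if zw: "(z, w) \<in> Z2" for z w
    proof -
      have m1: "same_cut Z1 z w" using zw cut_pairing_same_cut[OF gZ1] unfolding Z2_def N_def by auto
      have "(z' < z \<longleftrightarrow> w' < w) \<and> (z < z' \<longleftrightarrow> w < w')" if "(z', w') \<in> N" for z' w'
      proof (cases "(z, w) \<in> Z1")
        case True
        have "same_cut Z1 z' w'" using that unfolding N_def by auto
        from same_cutD[OF this True] show ?thesis by auto
      next
        case False
        then have "(z, w) \<in> N" using zw unfolding Z2_def by auto
        then show ?thesis using mono that by blast
      qed
      then show ?thesis using m1 unfolding Z2_def same_cut_def by blast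
    qed
    ultimately show ?thesis unfolding cut_pairing_def by blast
  qed
  have root1: "\<exists>s. (r, s) \<in> Z2 \<and> poly q s = 0" if "poly p r = 0" for r
    using partner1[OF that] that unfolding Z2_def N_def by blast
  have root2: "\<exists>r. (r, s) \<in> Z2 \<and> poly p r = 0" if "poly q s = 0" for s
    using partner2[OF that] that unfolding Z2_def N_def by blast
  have "same_sgn (poly p x) (poly q y)" if m: "same_cut Z2 x y" for x y
  proof -
    have m1: "same_cut Z1 x y" using same_cut_subset[OF m] unfolding Z2_def by auto
    consider "poly p x = 0" | "poly q y = 0" | w where "(x, w) \<in> Z1"
      | "poly p x \<noteq> 0" "poly q y \<noteq> 0" "\<And>w. (x, w) \<notin> Z1" by blast
    then show ?thesis
    proof cases
      case 1
      then obtain s where s: "(x, s) \<in> Z2" "poly q s = 0" using root1 by blast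
      then have "y = s" using same_cutD[OF m s(1)] by simp
      then show ?thesis using 1 s unfolding same_sgn_def by simp
    next
      case 2
      then obtain r where r: "(r, y) \<in> Z2" "poly p r = 0" using root2 by blast
      then have "x = r" using same_cutD[OF m r(1)] by simp
      then show ?thesis using 2 r unfolding same_sgn_def by simp
    next
      case 3
      then have "y = w" using same_cutD[OF m1 3] by simp
      then show ?thesis using sgZ 3 by blast
    next
      case 4
      have yno: "(z, y) \<notin> Z1" for z using same_cutD[OF m1, of z y] 4 by auto
      \<comment> \<open>On an open cell the sign of \<open>p\<close> is constant. It is the sign at
        the left end of the cell if that is nonzero, otherwise the sign of the derivative by the
        mean value theorem; on a cell without left end it is the sign at minus infinity.\<close>
      show ?thesis
      proof (cases "\<exists>(z, w)\<in>Z2. z < x")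
        case True
        define L where "L = {z \<in> fst ` Z2. z < x}"
        have fL: "finite L" "L \<noteq> {}" using True gZ2 unfolding L_def cut_pairing_def by force+
        then have "Max L \<in> L" by simp
        then obtain a' where a: "(Max L, a') \<in> Z2" "Max L < x" unfolding L_def by force
        define a where "a = Max L"
        have aZ: "(a, a') \<in> Z2" "a < x" using a unfolding a_def by auto
        have a'y: "a' < y" using same_cutD[OF m aZ(1)] aZ by simp
        have ge: "z \<le> a" if "(z, w) \<in> Z2" "z < x" for z w
        proof -
          have "z \<in> L" using that unfolding L_def by force
          then show ?thesis unfolding a_def using fL by simp
        qed
        have ge': "w \<le> a'" if "(z, w) \<in> Z2" "w < y" for z w
        proof -
          have "z \<le> a" using ge[OF that(1)] same_cutD[OF m that(1)] that(2) by simp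
          then show ?thesis using same_cutD[OF cut_pairing_same_cut[OF gZ2 aZ(1)] that(1)] by (metis not_less)
        qed
        have np: "poly p t \<noteq> 0" if "a < t" "t \<le> x" for t
        proof
          assume 0: "poly p t = 0"
          then have "t < x" using that 4 by (metis order_le_less)
          moreover obtain s where "(t, s) \<in> Z2" using root1[OF 0] by blast
          ultimately show False using ge that by (meson leD)
        qed
        have nq: "poly q t \<noteq> 0" if "a' < t" "t \<le> y" for t
        proof
          assume 0: "poly q t = 0"
          then have "t < y" using that 4 by (metis order_le_less)
          moreover obtain s where "(s, t) \<in> Z2" using root2[OF 0] by blast
          ultimately show False using ge' that by (meson leD)
        qed
        have ssa: "same_sgn (poly p a) (poly q a')"
        proof -
          have "(a, a') \<in> Z1 \<or> (a, a') \<in> N" using aZ unfolding Z2_def by auto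
          then show ?thesis using sgZ unfolding N_def same_sgn_def by auto
        qed
        show ?thesis
        proof (cases "poly p a = 0")
          case False
          then have False': "poly q a' \<noteq> 0" using same_sgn_zero_iff[OF ssa] by simp
          have "poly p a * poly p x > 0"
            using False np aZ by (intro rcf_poly_same_sign) (metis min.absorb3 max.absorb4 order_le_less)
          moreover have "poly q a' * poly q y > 0"
            using False' nq a'y by (intro rcf_poly_same_sign) (metis min.absorb3 max.absorb4 order_le_less)
          ultimately show ?thesis using same_sgn_via[OF ssa] by blast
        next
          case True
          then have True': "poly q a' = 0" using same_sgn_zero_iff[OF ssa] by simp
          have dpn: "poly (pderiv p) t \<noteq> 0" if "a < t" "t \<le> x" for t
          proof
            assume "poly (pderiv p) t = 0"
            then obtain w where w: "(t, w) \<in> Z1" using rt1[OF dH] by blast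
            then have "t \<noteq> x" using 4 by auto
            then show False using ge[of t w] w that unfolding Z2_def by auto
          qed
          have dqn: "poly (pderiv q) t \<noteq> 0" if "a' < t" "t \<le> y" for t
          proof
            assume "poly (pderiv q) t = 0"
            then obtain w where w: "(w, t) \<in> Z1" using rt2[OF dH] by blast
            then have "t \<noteq> y" using yno by auto
            then show False using ge'[of w t] w that unfolding Z2_def by auto
          qed
          obtain \<xi> where \<xi>: "a < \<xi>" "\<xi> < x" "poly p x - poly p a = (x - a) * poly (pderiv p) \<xi>"
            using rcf_poly_MVT[OF aZ(2)] by blast
          obtain \<eta> where \<eta>: "a' < \<eta>" "\<eta> < y" "poly q y - poly q a' = (y - a') * poly (pderiv q) \<eta>"
            using rcf_poly_MVT[OF a'y] by blast
          have "poly (pderiv p) x * poly (pderiv p) \<xi> > 0"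
            by (rule rcf_poly_same_sign, rule dpn) (use \<xi> in auto)
          then have 1: "poly (pderiv p) x * poly p x > 0" using \<xi> True aZ(2)
            by (auto simp: zero_less_mult_iff mult_less_0_iff)
          have "poly (pderiv q) y * poly (pderiv q) \<eta> > 0"
            by (rule rcf_poly_same_sign, rule dqn) (use \<eta> in auto)
          then have 2: "poly (pderiv q) y * poly q y > 0" using \<eta> True' a'y
            by (auto simp: zero_less_mult_iff mult_less_0_iff)
          show ?thesis using same_sgn_via[OF sg1[OF m1 dH] 1 2] .
        qed
      next
        case False
        have False': "\<not> w < y" if "(z, w) \<in> Z2" for z w using False same_cutD[OF m that] that by blast
        obtain a b where ab: "\<forall>x\<le>a. \<forall>y\<le>b. same_sgn (poly p x) (poly q y)"
          using sign_at_minus_infinity[OF pq] by blast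
        have "poly p (min a x) * poly p x > 0"
        proof (rule rcf_poly_same_sign)
          fix t assume t: "min (min a x) x \<le> t" "t \<le> max (min a x) x"
          then have "t \<le> x" by auto
          show "poly p t \<noteq> 0"
          proof
            assume 0: "poly p t = 0"
            then have "t < x" using \<open>t \<le> x\<close> 4 by (metis order_le_less)
            then show False using root1[OF 0] False by blast
          qed
        qed
        moreover have "poly q (min b y) * poly q y > 0"
        proof (rule rcf_poly_same_sign)
          fix t assume t: "min (min b y) y \<le> t" "t \<le> max (min b y) y"
          then have "t \<le> y" by auto
          show "poly q t \<noteq> 0"
          proof
            assume 0: "poly q t = 0"
            then have "t < y" using \<open>t \<le> y\<close> 4 by (metis order_le_less)
            then show False using root2[OF 0] False' by blast
          qed
        qed
        ultimately show ?thesis using same_sgn_via[of "poly p (min a x)" "poly q (min b y)"] ab by auto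
      qed
    qed
  qed
  moreover have "same_sgn (poly h x) (poly k y)" if "same_cut Z2 x y" "(h, k) \<in> H" for x y h k
    using sg1[OF same_cut_subset[OF that(1)] that(2)] unfolding Z2_def by auto
  ultimately show ?thesis using gZ2 unfolding same_diagram_def by blast
qed

section \<open>Polynomial expressions shared by two fields\<close>

text \<open>Pairs of functions given by one integer polynomial in the coordinates of the environment.\<close>

inductive uniform :: "((nat \<Rightarrow> 'a::linordered_field) \<Rightarrow> 'a) \<Rightarrow> ((nat \<Rightarrow> 'b::linordered_field) \<Rightarrow> 'b) \<Rightarrow> bool" where
  const: "uniform (\<lambda>e. of_int c) (\<lambda>e. of_int c)"
| var: "uniform (\<lambda>e. e i) (\<lambda>e. e i)"
| add: "uniform u v \<Longrightarrow> uniform u' v' \<Longrightarrow> uniform (\<lambda>e. u e + u' e) (\<lambda>e. v e + v' e)"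
| mult: "uniform u v \<Longrightarrow> uniform u' v' \<Longrightarrow> uniform (\<lambda>e. u e * u' e) (\<lambda>e. v e * v' e)"

lemma uniform_0: "uniform (\<lambda>e. 0) (\<lambda>e. 0)" and uniform_1: "uniform (\<lambda>e. 1) (\<lambda>e. 1)"
  and uniform_of_nat: "uniform (\<lambda>e. of_nat n) (\<lambda>e. of_nat n)"
  using uniform.const[of 0] uniform.const[of 1] uniform.const[of "int n"] by simp_all

lemma uniform_uminus: "uniform u v \<Longrightarrow> uniform (\<lambda>e. - u e) (\<lambda>e. - v e)"
  using uniform.mult[OF uniform.const[of "-1"], of u v] by simp

lemma uniform_diff: "uniform u v \<Longrightarrow> uniform u' v' \<Longrightarrow> uniform (\<lambda>e. u e - u' e) (\<lambda>e. v e - v' e)"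
  using uniform.add[OF _ uniform_uminus, of u v u' v'] by simp

lemma uniform_sum:
  "(\<And>i. i \<in> I \<Longrightarrow> uniform (u i) (v i)) \<Longrightarrow> uniform (\<lambda>e. \<Sum>i\<in>I. u i e) (\<lambda>e. \<Sum>i\<in>I. v i e)"
  by (induction I rule: infinite_finite_induct) (auto intro: uniform_0 uniform.add)

lemma uniform_prod:
  "(\<And>i. i \<in> I \<Longrightarrow> uniform (u i) (v i)) \<Longrightarrow> uniform (\<lambda>e. \<Prod>i\<in>I. u i e) (\<lambda>e. \<Prod>i\<in>I. v i e)"
  by (induction I rule: infinite_finite_induct) (auto intro: uniform_1 uniform.mult)

lemma uniform_power: "uniform u v \<Longrightarrow> uniform (\<lambda>e. u e ^ n) (\<lambda>e. v e ^ n)"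
  by (induction n) (auto intro: uniform_1 uniform.mult)

definition uniform_poly ::
  "((nat \<Rightarrow> 'a::linordered_field) \<Rightarrow> 'a poly) \<Rightarrow> ((nat \<Rightarrow> 'b::linordered_field) \<Rightarrow> 'b poly) \<Rightarrow> bool" where
  "uniform_poly P Q \<longleftrightarrow> (\<forall>i. uniform (\<lambda>e. coeff (P e) i) (\<lambda>e. coeff (Q e) i))"

lemma uniform_poly_const: "uniform u v \<Longrightarrow> uniform_poly (\<lambda>e. [:u e:]) (\<lambda>e. [:v e:])"
  unfolding uniform_poly_def
proof
  fix i assume "uniform u v" then show "uniform (\<lambda>e. coeff [:u e:] i) (\<lambda>e. coeff [:v e:] i)"
    by (cases i) (simp_all add: uniform_0)
qed

lemma uniform_poly_monom: "uniform u v \<Longrightarrow> uniform_poly (\<lambda>e. monom (u e) n) (\<lambda>e. monom (v e) n)"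
  unfolding uniform_poly_def
proof
  fix i assume "uniform u v" then show "uniform (\<lambda>e. coeff (monom (u e) n) i) (\<lambda>e. coeff (monom (v e) n) i)"
    by (cases "i = n") (simp_all add: uniform_0)
qed

lemma uniform_poly_add:
  "uniform_poly P Q \<Longrightarrow> uniform_poly P' Q' \<Longrightarrow> uniform_poly (\<lambda>e. P e + P' e) (\<lambda>e. Q e + Q' e)"
  unfolding uniform_poly_def by (auto intro: uniform.add)

lemma uniform_poly_diff:
  "uniform_poly P Q \<Longrightarrow> uniform_poly P' Q' \<Longrightarrow> uniform_poly (\<lambda>e. P e - P' e) (\<lambda>e. Q e - Q' e)"
  unfolding uniform_poly_def by (auto intro: uniform_diff)

lemma uniform_poly_mult:
  "uniform_poly P Q \<Longrightarrow> uniform_poly P' Q' \<Longrightarrow> uniform_poly (\<lambda>e. P e * P' e) (\<lambda>e. Q e * Q' e)"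
  unfolding uniform_poly_def coeff_mult by (auto intro!: uniform_sum uniform.mult)

lemma uniform_poly_pderiv: "uniform_poly P Q \<Longrightarrow> uniform_poly (\<lambda>e. pderiv (P e)) (\<lambda>e. pderiv (Q e))"
  unfolding uniform_poly_def coeff_pderiv by (auto intro!: uniform.mult uniform_of_nat simp del: of_nat_Suc)

text \<open>The coordinate to be eliminated becomes the variable of a polynomial. The bound
  \<open>m\<close> is the same for all environments: actual degrees vary with the parameters, so the
  elimination works with formal degrees.\<close>

lemma uniform_as_poly:
  assumes "uniform u v"
  shows "\<exists>P Q m. uniform_poly P Q \<and> (\<forall>e y. poly (P e) y = u (e(i := y))) \<and> (\<forall>e y. poly (Q e) y = v (e(i := y)))
    \<and> (\<forall>e. degree (P e) \<le> m) \<and> (\<forall>e. degree (Q e) \<le> m)"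
  using assms
proof (induction rule: uniform.induct)
  case (const c)
  show ?case
    by (rule exI[of _ "\<lambda>e. [:of_int c:]"], rule exI[of _ "\<lambda>e. [:of_int c:]"], rule exI[of _ 0])
       (auto intro: uniform_poly_const uniform.const)
next
  case (var j)
  show ?case
  proof (cases "j = i")
    case True
    have "uniform_poly (\<lambda>e. monom 1 1) (\<lambda>e. monom 1 1)" by (intro uniform_poly_monom uniform_1)
    then show ?thesis using True
      by (intro exI[of _ "\<lambda>e. monom 1 1"] exI[of _ 1]) (auto simp: poly_monom degree_monom_le)
  next
    case False
    have "uniform_poly (\<lambda>e. [:e j:]) (\<lambda>e. [:e j:])" by (intro uniform_poly_const uniform.var)
    then show ?thesis using False
      by (intro exI[of _ "\<lambda>e. [:e j:]"] exI[of _ 0]) auto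
  qed
next
  case (add u v u' v')
  obtain P Q m where 1: "uniform_poly P Q" "\<forall>e y. poly (P e) y = u (e(i := y))" "\<forall>e y. poly (Q e) y = v (e(i := y))"
    "\<forall>e. degree (P e) \<le> m" "\<forall>e. degree (Q e) \<le> m" using add.IH(1) by blast
  obtain P' Q' m' where 2: "uniform_poly P' Q'" "\<forall>e y. poly (P' e) y = u' (e(i := y))" "\<forall>e y. poly (Q' e) y = v' (e(i := y))"
    "\<forall>e. degree (P' e) \<le> m'" "\<forall>e. degree (Q' e) \<le> m'" using add.IH(2) by blast
  show ?case
  proof (intro exI conjI allI)
    show "uniform_poly (\<lambda>e. P e + P' e) (\<lambda>e. Q e + Q' e)" using 1 2 by (intro uniform_poly_add)
    fix e y
    show "poly (P e + P' e) y = u (e(i := y)) + u' (e(i := y))" using 1(2) 2(2) by simp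
    show "degree (P e + P' e) \<le> max m m'" using 1(4) 2(4) by (intro degree_add_le) (auto simp: le_max_iff_disj)
  next
    fix e y
    show "poly (Q e + Q' e) y = v (e(i := y)) + v' (e(i := y))" using 1(3) 2(3) by simp
    show "degree (Q e + Q' e) \<le> max m m'" using 1(5) 2(5) by (intro degree_add_le) (auto simp: le_max_iff_disj)
  qed
next
  case (mult u v u' v')
  obtain P Q m where 1: "uniform_poly P Q" "\<forall>e y. poly (P e) y = u (e(i := y))" "\<forall>e y. poly (Q e) y = v (e(i := y))"
    "\<forall>e. degree (P e) \<le> m" "\<forall>e. degree (Q e) \<le> m" using mult.IH(1) by blast
  obtain P' Q' m' where 2: "uniform_poly P' Q'" "\<forall>e y. poly (P' e) y = u' (e(i := y))" "\<forall>e y. poly (Q' e) y = v' (e(i := y))"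
    "\<forall>e. degree (P' e) \<le> m'" "\<forall>e. degree (Q' e) \<le> m'" using mult.IH(2) by blast
  show ?case
  proof (intro exI conjI allI)
    show "uniform_poly (\<lambda>e. P e * P' e) (\<lambda>e. Q e * Q' e)" using 1 2 by (intro uniform_poly_mult)
    fix e y
    show "poly (P e * P' e) y = u (e(i := y)) * u' (e(i := y))" using 1(2) 2(2) by simp
    show "degree (P e * P' e) \<le> m + m'" using 1(4) 2(4) by (intro order_trans[OF degree_mult_le] add_mono) auto
  next
    fix e y
    show "poly (Q e * Q' e) y = v (e(i := y)) * v' (e(i := y))" using 1(3) 2(3) by simp
    show "degree (Q e * Q' e) \<le> m + m'" using 1(5) 2(5) by (intro order_trans[OF degree_mult_le] add_mono) auto
  qed
qed

definition agree :: "(((nat \<Rightarrow> 'a::linordered_field) \<Rightarrow> 'a) \<times> ((nat \<Rightarrow> 'b::linordered_field) \<Rightarrow> 'b)) set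
    \<Rightarrow> (nat \<Rightarrow> 'a) \<Rightarrow> (nat \<Rightarrow> 'b) \<Rightarrow> bool" where
  "agree E a b \<longleftrightarrow> (\<forall>(u, v)\<in>E. same_sgn (u a) (v b))"

definition uniform_set :: "(((nat \<Rightarrow> 'a::linordered_field) \<Rightarrow> 'a) \<times> ((nat \<Rightarrow> 'b::linordered_field) \<Rightarrow> 'b)) set \<Rightarrow> bool" where
  "uniform_set E \<longleftrightarrow> finite E \<and> (\<forall>(u, v)\<in>E. uniform u v)"

lemma agree_Un: "agree (E \<union> F) a b \<longleftrightarrow> agree E a b \<and> agree F a b"
  unfolding agree_def by auto

lemma uniform_set_Un: "uniform_set E \<Longrightarrow> uniform_set F \<Longrightarrow> uniform_set (E \<union> F)"
  unfolding uniform_set_def by auto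

lemma degree_le_pred: "degree p \<le> m \<Longrightarrow> coeff p m = 0 \<Longrightarrow> degree p \<le> m - 1"
proof (cases m)
  case (Suc k)
  assume *: "degree p \<le> m" "coeff p m = 0"
  have "degree p \<le> k"
  proof (rule degree_le, safe)
    fix i assume "k < i"
    then show "coeff p i = 0" using * Suc by (cases "i = m") (auto simp: coeff_eq_0)
  qed
  then show ?thesis using Suc by simp
qed simp

text \<open>Pseudo-division with respect to formal degrees. Multiplying by the formal leading
  coefficient of the divisor instead of dividing by it keeps all coefficients polynomial in the
  environment, and the exponent \<open>j\<close> is the same in both fields. At zeros of the divisor
  the result is \<open>P\<close> times a known power of that coefficient.\<close>

lemma uniform_pseudo_remainder:
  assumes "uniform_poly P Q" "uniform_poly H K" "l > 0"
  shows "\<exists>R S j. uniform_poly R S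
    \<and> (\<forall>e. degree (P e) \<le> m \<and> degree (H e) \<le> l \<longrightarrow> degree (R e) \<le> l - 1 \<and>
         (\<forall>x. poly (H e) x = 0 \<longrightarrow> poly (R e) x = coeff (H e) l ^ j * poly (P e) x))
    \<and> (\<forall>e. degree (Q e) \<le> m \<and> degree (K e) \<le> l \<longrightarrow> degree (S e) \<le> l - 1 \<and>
         (\<forall>x. poly (K e) x = 0 \<longrightarrow> poly (S e) x = coeff (K e) l ^ j * poly (Q e) x))"
  using assms(1)
proof (induction m arbitrary: P Q)
  case 0
  then show ?case by (intro exI[of _ P] exI[of _ Q] exI[of _ 0]) auto
next
  case (Suc m)
  show ?case
  proof (cases "Suc m < l")
    case True
    then show ?thesis using Suc.prems by (intro exI[of _ P] exI[of _ Q] exI[of _ 0]) auto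
  next
    case False
    define P1 where "P1 = (\<lambda>e. [:coeff (H e) l:] * P e - monom (coeff (P e) (Suc m)) (Suc m - l) * H e)"
    define Q1 where "Q1 = (\<lambda>e. [:coeff (K e) l:] * Q e - monom (coeff (Q e) (Suc m)) (Suc m - l) * K e)"
    have U: "uniform_poly P1 Q1" unfolding P1_def Q1_def
      using Suc.prems assms(2)
      by (intro uniform_poly_diff uniform_poly_mult uniform_poly_const uniform_poly_monom) (auto simp: uniform_poly_def)
    have deg: "degree ([:coeff h l:] * p - monom (coeff p (Suc m)) (Suc m - l) * h) \<le> m"
      if "degree p \<le> Suc m" "degree h \<le> l" for p h :: "'c::field poly"
    proof -
      have d1: "degree ([:coeff h l:] * p - monom (coeff p (Suc m)) (Suc m - l) * h) \<le> Suc m"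
      proof (rule degree_diff_le)
        have "[:coeff h l:] * p = smult (coeff h l) p" by simp
        then show "degree ([:coeff h l:] * p) \<le> Suc m" using order_trans[OF degree_smult_le that(1)] by (simp only:)
        have "degree (monom (coeff p (Suc m)) (Suc m - l) * h) \<le> (Suc m - l) + l"
          by (intro order_trans[OF degree_mult_le] add_mono degree_monom_le that)
        then show "degree (monom (coeff p (Suc m)) (Suc m - l) * h) \<le> Suc m" using False by simp
      qed
      have d2: "coeff ([:coeff h l:] * p - monom (coeff p (Suc m)) (Suc m - l) * h) (Suc m) = 0"
        using False by (simp add: coeff_monom_mult)
      show ?thesis using degree_le_pred[OF d1 d2] by (simp only: diff_Suc_1)
    qed
    obtain R S j where RS: "uniform_poly R S"
      "\<And>e. degree (P1 e) \<le> m \<and> degree (H e) \<le> l \<Longrightarrow> degree (R e) \<le> l - 1 \<and>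
         (\<forall>x. poly (H e) x = 0 \<longrightarrow> poly (R e) x = coeff (H e) l ^ j * poly (P1 e) x)"
      "\<And>e. degree (Q1 e) \<le> m \<and> degree (K e) \<le> l \<Longrightarrow> degree (S e) \<le> l - 1 \<and>
         (\<forall>x. poly (K e) x = 0 \<longrightarrow> poly (S e) x = coeff (K e) l ^ j * poly (Q1 e) x)"
      using Suc.IH[OF U] by blast
    have 1: "degree (R e) \<le> l - 1 \<and>
         (\<forall>x. poly (H e) x = 0 \<longrightarrow> poly (R e) x = coeff (H e) l ^ Suc j * poly (P e) x)"
      if "degree (P e) \<le> Suc m \<and> degree (H e) \<le> l" for e
    proof -
      have "degree (P1 e) \<le> m" unfolding P1_def by (rule deg[OF conjunct1[OF that] conjunct2[OF that]])
      note rs = RS(2)[OF conjI[OF this conjunct2[OF that]]]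
      have "poly (R e) x = coeff (H e) l ^ Suc j * poly (P e) x" if h: "poly (H e) x = 0" for x
      proof -
        have "poly (R e) x = coeff (H e) l ^ j * poly (P1 e) x" by (rule mp[OF spec[OF conjunct2[OF rs]] h])
        also have "poly (P1 e) x = coeff (H e) l * poly (P e) x" unfolding P1_def by (simp add: h)
        finally show ?thesis by (simp only: power_Suc2 mult.assoc)
      qed
      then show ?thesis using conjunct1[OF rs] by blast
    qed
    have 2: "degree (S e) \<le> l - 1 \<and>
         (\<forall>x. poly (K e) x = 0 \<longrightarrow> poly (S e) x = coeff (K e) l ^ Suc j * poly (Q e) x)"
      if "degree (Q e) \<le> Suc m \<and> degree (K e) \<le> l" for e
    proof -
      have "degree (Q1 e) \<le> m" unfolding Q1_def by (rule deg[OF conjunct1[OF that] conjunct2[OF that]])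
      note rs = RS(3)[OF conjI[OF this conjunct2[OF that]]]
      have "poly (S e) x = coeff (K e) l ^ Suc j * poly (Q e) x" if h: "poly (K e) x = 0" for x
      proof -
        have "poly (S e) x = coeff (K e) l ^ j * poly (Q1 e) x" by (rule mp[OF spec[OF conjunct2[OF rs]] h])
        also have "poly (Q1 e) x = coeff (K e) l * poly (Q e) x" unfolding Q1_def by (simp add: h)
        finally show ?thesis by (simp only: power_Suc2 mult.assoc)
      qed
      then show ?thesis using conjunct1[OF rs] by blast
    qed
    show ?thesis using RS(1) 1 2 by blast
  qed
qed

section \<open>Sign diagrams determined by finitely many signs in the parameters\<close>

lemma same_diagram_subset: "same_diagram \<Lambda> \<Longrightarrow> \<Lambda>' \<subseteq> \<Lambda> \<Longrightarrow> same_diagram \<Lambda>'"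
  unfolding same_diagram_def by blast

lemma same_diagram_insert_const:
  assumes "same_diagram \<Lambda>" "same_sgn c d" shows "same_diagram (insert ([:c:], [:d:]) \<Lambda>)"
  using assms unfolding same_diagram_def by auto

lemma same_diagram_empty: "same_diagram {}"
  unfolding same_diagram_def cut_pairing_def by auto

definition poly_pairs where
  "poly_pairs L a b = (\<lambda>(P, Q, m). (P a, Q b)) ` set L"

definition degs_bounded where
  "degs_bounded L a b \<longleftrightarrow> (\<forall>(P, Q, m)\<in>set L. degree (P a) \<le> m \<and> degree (Q b) \<le> m)"

text \<open>\<open>L\<close> is a list of pairs with formal degrees, because termination of the
  elimination is measured by the multiset of formal degrees. Agreement on the tests in
  \<open>E\<close> takes the place of a case distinction on the parameters.\<close>

definition diagram_determined where
  "diagram_determined L E \<longleftrightarrow> uniform_set E \<and>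
     (\<forall>a b. agree E a b \<and> degs_bounded L a b \<longrightarrow> same_diagram (poly_pairs L a b))"

lemma mult_less_than_replace:
  assumes "\<And>k. k \<in># K \<Longrightarrow> k < m"
  shows "(K + M, add_mset m M) \<in> mult less_than"
  using one_step_implies_mult[of "{#m#}" K less_than M] assms by (simp add: add.commute)

text \<open>Replace a polynomial of largest formal degree by its derivative and its pseudo-remainders
  modulo the other ones; the multiset of formal degrees decreases.\<close>

theorem sign_diagram_uniform:
  fixes L :: "(((nat \<Rightarrow> 'a::real_closed_field) \<Rightarrow> 'a poly) \<times> ((nat \<Rightarrow> 'b::real_closed_field) \<Rightarrow> 'b poly) \<times> nat) list"
  assumes "\<forall>(P, Q, m)\<in>set L. uniform_poly P Q"
  shows "\<exists>E. diagram_determined L E"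
  using assms
proof (induction L rule: wf_induct[OF wf_inv_image[OF wf_mult[OF wf_less_than], of "\<lambda>L. mset (map (\<lambda>(P, Q, m). m) L)"]])
  case (1 L)
  define wt where "wt = (\<lambda>L :: (((nat \<Rightarrow> 'a) \<Rightarrow> 'a poly) \<times> ((nat \<Rightarrow> 'b) \<Rightarrow> 'b poly) \<times> nat) list. mset (map (\<lambda>(P, Q, m). m) L))"
  have IH: "\<exists>E. diagram_determined L' E" if "(wt L', wt L) \<in> mult less_than" "\<forall>(P, Q, m)\<in>set L'. uniform_poly P Q" for L'
    using 1(1) that unfolding wt_def in_inv_image by blast
  show ?case
  proof (cases "L = []")
    case True
    then have "diagram_determined L {}"
      unfolding diagram_determined_def uniform_set_def poly_pairs_def by (auto simp: same_diagram_empty)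
    then show ?thesis by blast
  next
    case False
    \<comment> \<open>The signs of the formal leading coefficients decide which branch below
      applies; testing them makes the decision the same in both fields.\<close>
    define tops :: "(((nat \<Rightarrow> 'a) \<Rightarrow> 'a) \<times> ((nat \<Rightarrow> 'b) \<Rightarrow> 'b)) set" where
      "tops = (\<lambda>(P, Q, m). (\<lambda>e. coeff (P e) m, \<lambda>e. coeff (Q e) m)) ` set L"
    have tops: "uniform_set tops" unfolding uniform_set_def tops_def using 1(2)
      by (auto simp: uniform_poly_def)
    have topsD: "same_sgn (coeff (P a) m) (coeff (Q b) m)" if "agree tops a b" "(P, Q, m) \<in> set L" for P Q m a b
    proof -
      have "(\<lambda>e. coeff (P e) m, \<lambda>e. coeff (Q e) m) \<in> tops"
        unfolding tops_def by (rule rev_image_eqI[OF that(2)]) simp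
      from bspec[OF that(1)[unfolded agree_def] this] show ?thesis by simp
    qed
    \<comment> \<open>Branch in which a formal leading coefficient vanishes: the formal degree is
      lowered by one or, at formal degree 0, the zero polynomial is dropped.\<close>
    have low: "\<exists>E. uniform_set E \<and> (\<forall>a b. agree E a b \<and> degs_bounded L a b \<and> coeff (P a) m = 0 \<and> coeff (Q b) m = 0
        \<longrightarrow> same_diagram (poly_pairs L a b))" if mem: "(P, Q, m) \<in> set L" for P Q m
    proof -
      obtain L1 L2 where L: "L = L1 @ (P, Q, m) # L2" using split_list[OF mem] by blast
      show ?thesis
      proof (cases m)
        case 0
        have "(wt (L1 @ L2), wt L) \<in> mult less_than"
          using mult_less_than_replace[of "{#}" m "wt (L1 @ L2)"] unfolding L wt_def by simp
        moreover have "\<forall>(P, Q, m)\<in>set (L1 @ L2). uniform_poly P Q" using 1(2) L by auto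
        ultimately obtain E where E: "diagram_determined (L1 @ L2) E" using IH by blast
        have "same_diagram (poly_pairs L a b)"
          if "agree E a b" "degs_bounded L a b" "coeff (P a) m = 0" "coeff (Q b) m = 0" for a b
        proof -
          have "degs_bounded (L1 @ L2) a b" "degree (P a) \<le> 0" "degree (Q b) \<le> 0"
            using that(2) 0 unfolding degs_bounded_def L by auto
          then have "same_diagram (poly_pairs (L1 @ L2) a b)" "P a = [:coeff (P a) 0:]" "Q b = [:coeff (Q b) 0:]"
            using E that unfolding diagram_determined_def by (auto elim!: degree_eq_zeroE)
          then have "same_diagram (poly_pairs (L1 @ L2) a b)" "P a = 0" "Q b = 0" using that(3,4) 0 by simp_all
          moreover from this have "poly_pairs L a b = insert ([:0:], [:0:]) (poly_pairs (L1 @ L2) a b)"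
            unfolding poly_pairs_def L by auto
          ultimately show ?thesis using same_diagram_insert_const[of _ 0 0] by (simp add: same_sgn_def)
        qed
        then show ?thesis using E unfolding diagram_determined_def by blast
      next
        case (Suc k)
        let ?L = "L1 @ (P, Q, k) # L2"
        have "(wt ?L, wt L) \<in> mult less_than"
          using mult_less_than_replace[of "{#k#}" m "wt (L1 @ L2)"] Suc unfolding L wt_def by simp
        moreover have "\<forall>(P, Q, m)\<in>set ?L. uniform_poly P Q" using 1(2) L by auto
        ultimately obtain E where E: "diagram_determined ?L E" using IH by blast
        have "same_diagram (poly_pairs L a b)"
          if "agree E a b" "degs_bounded L a b" "coeff (P a) m = 0" "coeff (Q b) m = 0" for a b
        proof -
          have "degs_bounded ?L a b"
            using that(2) degree_le_pred[of "P a" m] degree_le_pred[of "Q b" m] that(3,4) Suc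
            unfolding degs_bounded_def L by auto
          then have "same_diagram (poly_pairs ?L a b)" using E that unfolding diagram_determined_def by blast
          moreover have "poly_pairs ?L a b = poly_pairs L a b" unfolding poly_pairs_def L by auto
          ultimately show ?thesis by simp
        qed
        then show ?thesis using E unfolding diagram_determined_def by blast
      qed
    qed
    then have "\<forall>t\<in>set L. \<exists>E. uniform_set E \<and> (\<forall>a b. agree E a b \<and> degs_bounded L a b
        \<and> coeff (fst t a) (snd (snd t)) = 0 \<and> coeff (fst (snd t) b) (snd (snd t)) = 0
        \<longrightarrow> same_diagram (poly_pairs L a b))" by auto
    from bchoice[OF this] obtain El where El: "\<forall>t\<in>set L. uniform_set (El t) \<and> (\<forall>a b. agree (El t) a b \<and> degs_bounded L a b
        \<and> coeff (fst t a) (snd (snd t)) = 0 \<and> coeff (fst (snd t) b) (snd (snd t)) = 0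
        \<longrightarrow> same_diagram (poly_pairs L a b))" by blast
    define E0 where "E0 = \<Union> (El ` set L)"
    have E0: "uniform_set E0" using El unfolding E0_def uniform_set_def by blast
    have E0t: "agree (El t) a b" if "agree E0 a b" "t \<in> set L" for t a b
      using that unfolding E0_def agree_def by blast
    have "\<exists>t\<in>set L. \<forall>t'\<in>set L. snd (snd t') \<le> snd (snd t)"
    proof -
      have "Max ((\<lambda>t. snd (snd t)) ` set L) \<in> (\<lambda>t. snd (snd t)) ` set L" using False by (intro Max_in) auto
      then obtain t where "t \<in> set L" "Max ((\<lambda>t. snd (snd t)) ` set L) = snd (snd t)" by auto
      moreover have "snd (snd t') \<le> Max ((\<lambda>t. snd (snd t)) ` set L)" if "t' \<in> set L" for t'
        using that by (intro Max_ge) auto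
      ultimately show ?thesis by (intro bexI[of _ t]) simp_all
    qed
    then obtain t where tL: "t \<in> set L" "\<And>t'. t' \<in> set L \<Longrightarrow> snd (snd t') \<le> snd (snd t)" by blast
    obtain P Q m where tPQ: "t = (P, Q, m)" by (cases t)
    have mem: "(P, Q, m) \<in> set L" using tL(1) tPQ by simp
    have max: "m' \<le> m" if "(P', Q', m') \<in> set L" for P' Q' m' using tL(2)[OF that] tPQ by simp
    obtain L1 L2 where L: "L = L1 @ (P, Q, m) # L2" using split_list[OF mem] by blast
    have uPQ: "uniform_poly P Q" using 1(2) mem by auto
    \<comment> \<open>Branch in which formal degrees are actual degrees. Since \<open>m\<close> is
      the largest of them, the derivative and all remainders have formal degree below
      \<open>m\<close>, so exchanging \<open>P\<close> for them decreases the multiset.\<close>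
    have main: "\<exists>E. uniform_set E \<and> (\<forall>a b. agree E a b \<and> degs_bounded L a b \<and> agree tops a b
        \<and> (\<forall>(P, Q, m)\<in>set L. coeff (P a) m \<noteq> 0 \<and> coeff (Q b) m \<noteq> 0) \<longrightarrow> same_diagram (poly_pairs L a b))"
    proof (cases m)
      case 0
      have "(wt (L1 @ L2), wt L) \<in> mult less_than"
        using mult_less_than_replace[of "{#}" m "wt (L1 @ L2)"] unfolding L wt_def by simp
      moreover have "\<forall>(P, Q, m)\<in>set (L1 @ L2). uniform_poly P Q" using 1(2) L by auto
      ultimately obtain E where E: "diagram_determined (L1 @ L2) E" using IH by blast
      have "same_diagram (poly_pairs L a b)"
        if "agree E a b" "degs_bounded L a b" "agree tops a b" for a b
      proof -
        have "degs_bounded (L1 @ L2) a b" "degree (P a) \<le> 0" "degree (Q b) \<le> 0"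
          using that(2) 0 unfolding degs_bounded_def L by auto
        then have d: "same_diagram (poly_pairs (L1 @ L2) a b)" "P a = [:coeff (P a) 0:]" "Q b = [:coeff (Q b) 0:]"
          using E that unfolding diagram_determined_def by (auto elim!: degree_eq_zeroE)
        have "same_sgn (coeff (P a) 0) (coeff (Q b) 0)"
          using topsD[OF that(3) mem] 0 by simp
        moreover have "poly_pairs L a b = insert ([:coeff (P a) 0:], [:coeff (Q b) 0:]) (poly_pairs (L1 @ L2) a b)"
          unfolding poly_pairs_def L using d(2,3) by auto
        ultimately show ?thesis using same_diagram_insert_const[OF d(1)] by simp
      qed
      then show ?thesis using E unfolding diagram_determined_def by blast
    next
      case (Suc k)
      define M where "M = (\<lambda>e. pderiv (P e), \<lambda>e. pderiv (Q e), k) # L1 @ L2"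
      have uM: "uniform_poly H K" if "(H, K, l) \<in> set M" for H K l
      proof -
        have "(H, K) = (\<lambda>e. pderiv (P e), \<lambda>e. pderiv (Q e)) \<or> (H, K, l) \<in> set L"
          using that unfolding M_def L by auto
        then show ?thesis using 1(2) uniform_poly_pderiv[OF uPQ] by blast
      qed
      have "\<forall>t\<in>set M. \<exists>t'. (case t of (H, K, l) \<Rightarrow> case t' of (R, S, n) \<Rightarrow> n < m \<and> uniform_poly R S \<and>
         (\<exists>j. (\<forall>e. degree (P e) \<le> m \<and> degree (H e) \<le> l \<longrightarrow> degree (R e) \<le> n \<and>
         (\<forall>x. poly (H e) x = 0 \<and> coeff (H e) l \<noteq> 0 \<longrightarrow> poly (R e) x = coeff (H e) l ^ j * poly (P e) x))
    \<and> (\<forall>e. degree (Q e) \<le> m \<and> degree (K e) \<le> l \<longrightarrow> degree (S e) \<le> n \<and>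
         (\<forall>x. poly (K e) x = 0 \<and> coeff (K e) l \<noteq> 0 \<longrightarrow> poly (S e) x = coeff (K e) l ^ j * poly (Q e) x))))"
      proof
        fix t assume tM: "t \<in> set M"
        obtain H K l where t: "t = (H, K, l)" by (cases t) auto
        show "\<exists>t'. (case t of (H, K, l) \<Rightarrow> case t' of (R, S, n) \<Rightarrow> n < m \<and> uniform_poly R S \<and>
         (\<exists>j. (\<forall>e. degree (P e) \<le> m \<and> degree (H e) \<le> l \<longrightarrow> degree (R e) \<le> n \<and>
         (\<forall>x. poly (H e) x = 0 \<and> coeff (H e) l \<noteq> 0 \<longrightarrow> poly (R e) x = coeff (H e) l ^ j * poly (P e) x))
    \<and> (\<forall>e. degree (Q e) \<le> m \<and> degree (K e) \<le> l \<longrightarrow> degree (S e) \<le> n \<and>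
         (\<forall>x. poly (K e) x = 0 \<and> coeff (K e) l \<noteq> 0 \<longrightarrow> poly (S e) x = coeff (K e) l ^ j * poly (Q e) x))))"
        proof (cases l)
          case 0
          have nr: "poly p x = coeff p 0" if "degree p = 0" for p :: "'c::field poly" and x
            using that by (auto elim!: degree_eq_zeroE)
          \<comment> \<open>A constant divisor with nonzero coefficient has no zeros, so the zero
            polynomial can serve as remainder.\<close>
          show ?thesis unfolding t 0
            by (rule exI[of _ "(\<lambda>e. [:0:], \<lambda>e. [:0:], 0)"])
               (use uniform_poly_const[OF uniform_0] Suc in \<open>auto simp: nr\<close>)
        next
          case (Suc l')
          have lm: "l \<le> m"
          proof -
            have "l = k \<or> (H, K, l) \<in> set L" using tM t unfolding M_def L by auto
            then show ?thesis using max \<open>m = Suc k\<close> by auto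
          qed
          obtain R S j where RS: "uniform_poly R S"
            "\<forall>e. degree (P e) \<le> m \<and> degree (H e) \<le> l \<longrightarrow> degree (R e) \<le> l - 1 \<and>
               (\<forall>x. poly (H e) x = 0 \<longrightarrow> poly (R e) x = coeff (H e) l ^ j * poly (P e) x)"
            "\<forall>e. degree (Q e) \<le> m \<and> degree (K e) \<le> l \<longrightarrow> degree (S e) \<le> l - 1 \<and>
               (\<forall>x. poly (K e) x = 0 \<longrightarrow> poly (S e) x = coeff (K e) l ^ j * poly (Q e) x)"
            using uniform_pseudo_remainder[OF uPQ uM[of H K l], of l m] tM t Suc by auto
          show ?thesis unfolding t prod.case
            by (rule exI[of _ "(R, S, l - 1)"]) (use RS lm Suc in auto)
        qed
      qed
      from bchoice[OF this] obtain rm where rm0: "\<forall>t\<in>set M. (case t of (H, K, l) \<Rightarrow> case rm t of (R, S, n) \<Rightarrow> n < m \<and> uniform_poly R S \<and>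
         (\<exists>j. (\<forall>e. degree (P e) \<le> m \<and> degree (H e) \<le> l \<longrightarrow> degree (R e) \<le> n \<and>
         (\<forall>x. poly (H e) x = 0 \<and> coeff (H e) l \<noteq> 0 \<longrightarrow> poly (R e) x = coeff (H e) l ^ j * poly (P e) x))
    \<and> (\<forall>e. degree (Q e) \<le> m \<and> degree (K e) \<le> l \<longrightarrow> degree (S e) \<le> n \<and>
         (\<forall>x. poly (K e) x = 0 \<and> coeff (K e) l \<noteq> 0 \<longrightarrow> poly (S e) x = coeff (K e) l ^ j * poly (Q e) x))))"
        ..
      note rm = bspec[OF rm0]
      define N where "N = map rm M @ M"
      have wN: "(wt N, wt L) \<in> mult less_than"
      proof -
        have "n < m" if nn: "n \<in># wt (map rm M)" for n
        proof -
          obtain t where t: "t \<in> set M" "n = (case rm t of (R, S, n) \<Rightarrow> n)" using nn unfolding wt_def by auto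
          show ?thesis using rm[OF t(1)] t(2) by (auto split: prod.splits)
        qed
        moreover have "wt N = (wt (map rm M) + {#k#}) + wt (L1 @ L2)" unfolding N_def M_def wt_def by simp
        moreover have "wt L = add_mset m (wt (L1 @ L2))" unfolding L wt_def by simp
        ultimately show ?thesis using mult_less_than_replace[of "wt (map rm M) + {#k#}" m "wt (L1 @ L2)"] Suc by auto
      qed
      have uN: "\<forall>(P, Q, m)\<in>set N. uniform_poly P Q"
      proof (clarify)
        fix R S n assume "(R, S, n) \<in> set N"
        then consider "(R, S, n) \<in> set M" | t where "t \<in> set M" "rm t = (R, S, n)" unfolding N_def set_append set_map by (metis UnE imageE)
        then show "uniform_poly R S"
        proof cases
          case 1 then show ?thesis using uM by blast
        next
          case 2 then show ?thesis using rm[of t] by (auto split: prod.splits)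
        qed
      qed
      obtain E where E: "diagram_determined N E" using IH[OF wN uN] by blast
      have "same_diagram (poly_pairs L a b)"
        if ag: "agree E a b" "degs_bounded L a b" "agree tops a b"
          and nz: "\<forall>(P, Q, m)\<in>set L. coeff (P a) m \<noteq> 0 \<and> coeff (Q b) m \<noteq> 0" for a b
      proof -
        have degPQ: "degree (P a) \<le> m" "degree (Q b) \<le> m" and c0: "coeff (P a) m \<noteq> 0" "coeff (Q b) m \<noteq> 0"
          using ag(2) nz mem unfolding degs_bounded_def by auto
        then have deg: "degree (P a) = m" "degree (Q b) = m" using le_degree by (metis le_antisym)+
        have sgPQ: "same_sgn (coeff (P a) m) (coeff (Q b) m)"
          using topsD[OF ag(3) mem] .
        have degM: "degree (H a) \<le> l \<and> degree (K b) \<le> l \<and> coeff (H a) l \<noteq> 0 \<and> coeff (K b) l \<noteq> 0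
            \<and> same_sgn (coeff (H a) l) (coeff (K b) l)" if HK: "(H, K, l) \<in> set M" for H K l
        proof -
          consider "H = (\<lambda>e. pderiv (P e))" "K = (\<lambda>e. pderiv (Q e))" "l = k" | "(H, K, l) \<in> set L"
            using HK unfolding M_def L by auto
          then show ?thesis
          proof cases
            case 1
            have "coeff (pderiv (P a)) k = of_nat m * coeff (P a) m" "coeff (pderiv (Q b)) k = of_nat m * coeff (Q b) m"
              unfolding coeff_pderiv using Suc by simp_all
            moreover have "same_sgn (of_nat m :: 'a) (of_nat m :: 'b)" unfolding same_sgn_def by simp
            moreover have "of_nat m \<noteq> (0::'a)" "of_nat m \<noteq> (0::'b)" "m - 1 = k"
              using Suc by (simp_all del: of_nat_Suc)
            ultimately show ?thesis unfolding 1 using deg c0 sgPQ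
              by (simp add: degree_pderiv same_sgn_mult)
          next
            case 2
            have "same_sgn (coeff (H a) l) (coeff (K b) l)"
              using topsD[OF ag(3) 2] .
            then show ?thesis using 2 ag(2) nz unfolding degs_bounded_def by blast
          qed
        qed
        have degN: "degs_bounded N a b" unfolding degs_bounded_def
        proof (clarify)
          fix R S n assume "(R, S, n) \<in> set N"
          then consider "(R, S, n) \<in> set M" | t where "t \<in> set M" "rm t = (R, S, n)" unfolding N_def set_append set_map by (metis UnE imageE)
          then show "degree (R a) \<le> n \<and> degree (S b) \<le> n"
          proof cases
            case 1 then show ?thesis using degM by blast
          next
            case 2
            obtain H K l where t: "t = (H, K, l)" by (cases t) auto
            show ?thesis using rm[OF 2(1)] 2 t degM[of H K l] degPQ by auto
          qed
        qed
        have sN: "same_diagram (poly_pairs N a b)" using E ag(1) degN unfolding diagram_determined_def by blast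
        have "same_diagram (insert (P a, Q b) (poly_pairs M a b))"
        proof (rule same_diagram_insert[OF _ _ _ _ _ _ sN])
          show "P a \<noteq> 0" "Q b \<noteq> 0" using c0 by auto
          show "degree (P a) = degree (Q b)" using deg by simp
          show "same_sgn (lead_coeff (P a)) (lead_coeff (Q b))" using sgPQ deg by simp
          show "(pderiv (P a), pderiv (Q b)) \<in> poly_pairs M a b" unfolding poly_pairs_def M_def by auto
          show "poly_pairs M a b \<subseteq> poly_pairs N a b" unfolding poly_pairs_def N_def by (intro image_mono) simp
          show "h \<noteq> 0 \<and> k \<noteq> 0" if hk: "(h, k) \<in> poly_pairs M a b" for h k
          proof -
            obtain H K l where "(H, K, l) \<in> set M" "h = H a" "k = K b" using hk unfolding poly_pairs_def by auto
            then show ?thesis using degM[of H K l] by auto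
          qed
          show "\<exists>(u, v)\<in>poly_pairs N a b. \<forall>x y. poly h x = 0 \<and> poly k y = 0 \<and> same_sgn (poly u x) (poly v y) \<longrightarrow>
             same_sgn (poly (P a) x) (poly (Q b) y)" if hk: "(h, k) \<in> poly_pairs M a b" for h k
          proof -
            obtain H K l where t: "(H, K, l) \<in> set M" "h = H a" "k = K b" using hk unfolding poly_pairs_def by auto
            obtain R S n where r: "rm (H, K, l) = (R, S, n)" by (cases "rm (H, K, l)") auto
            obtain j where j: "\<And>x. poly (H a) x = 0 \<Longrightarrow> poly (R a) x = coeff (H a) l ^ j * poly (P a) x"
              "\<And>x. poly (K b) x = 0 \<Longrightarrow> poly (S b) x = coeff (K b) l ^ j * poly (Q b) x"
              using rm[OF t(1)] degM[OF t(1)] degPQ unfolding r prod.case by blast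
            have "(R, S, n) \<in> set N" using imageI[OF t(1), of rm] r unfolding N_def by simp
            then have "(R a, S b) \<in> poly_pairs N a b" unfolding poly_pairs_def by (rule rev_image_eqI) simp
            moreover have "same_sgn (poly (P a) x) (poly (Q b) y)"
              if "poly h x = 0" "poly k y = 0" "same_sgn (poly (R a) x) (poly (S b) y)" for x y
            proof (rule same_sgn_cancel)
              show "same_sgn (coeff (H a) l ^ j) (coeff (K b) l ^ j)" using degM[OF t(1)] by (intro same_sgn_power) simp
              show "coeff (H a) l ^ j \<noteq> 0" using degM[OF t(1)] by simp
              show "same_sgn (coeff (H a) l ^ j * poly (P a) x) (coeff (K b) l ^ j * poly (Q b) y)"
                using that(3) j(1)[of x] j(2)[of y] that(1,2) unfolding t(2,3) by simp
            qed
            ultimately show ?thesis by blast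
          qed
        qed
        moreover have "poly_pairs L a b \<subseteq> insert (P a, Q b) (poly_pairs M a b)"
          unfolding poly_pairs_def M_def L by (simp add: image_Un) blast
        ultimately show ?thesis using same_diagram_subset by blast
      qed
      then show ?thesis using E unfolding diagram_determined_def by blast
    qed
    then obtain E1 where E1: "uniform_set E1" "\<And>a b. agree E1 a b \<Longrightarrow> degs_bounded L a b \<Longrightarrow> agree tops a b
        \<Longrightarrow> (\<forall>(P, Q, m)\<in>set L. coeff (P a) m \<noteq> 0 \<and> coeff (Q b) m \<noteq> 0) \<Longrightarrow> same_diagram (poly_pairs L a b)"
      by blast
    have "diagram_determined L (tops \<union> E0 \<union> E1)"
      unfolding diagram_determined_def
    proof (intro conjI allI impI)
      show "uniform_set (tops \<union> E0 \<union> E1)" using tops E0 E1 by (intro uniform_set_Un)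
      fix a b assume ab: "agree (tops \<union> E0 \<union> E1) a b \<and> degs_bounded L a b"
      then have ag: "agree tops a b" "agree E0 a b" "agree E1 a b" "degs_bounded L a b" by (auto simp: agree_Un)
      show "same_diagram (poly_pairs L a b)"
      proof (cases "\<forall>(P, Q, m)\<in>set L. coeff (P a) m \<noteq> 0 \<and> coeff (Q b) m \<noteq> 0")
        case True then show ?thesis using E1(2) ag by blast
      next
        case False
        then obtain P Q m where t: "(P, Q, m) \<in> set L" "coeff (P a) m = 0 \<or> coeff (Q b) m = 0" by auto
        have "same_sgn (coeff (P a) m) (coeff (Q b) m)" using topsD[OF ag(1) t(1)] .
        then have "coeff (P a) m = 0 \<and> coeff (Q b) m = 0" using t(2) same_sgn_zero_iff by blast
        then show ?thesis using El[rule_format, OF t(1)] E0t[OF ag(2) t(1)] ag(4) by auto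
      qed
    qed
    then show ?thesis by blast
  qed
qed

section \<open>Transfer of first-order statements between real closed fields\<close>

text \<open>A semantic substitute for formulas: finitely many sign tests, common to both fields,
  force equal truth values. Closure under connectives and quantifiers is then proved for predicates
  directly.\<close>

definition transfer_rel :: "((nat \<Rightarrow> 'a::linordered_field) \<Rightarrow> bool) \<Rightarrow> ((nat \<Rightarrow> 'b::linordered_field) \<Rightarrow> bool) \<Rightarrow> bool" where
  "transfer_rel \<phi> \<psi> \<longleftrightarrow> (\<exists>E. uniform_set E \<and> (\<forall>a b. agree E a b \<longrightarrow> \<phi> a = \<psi> b))"

lemma transfer_rel_not: "transfer_rel \<phi> \<psi> \<Longrightarrow> transfer_rel (\<lambda>e. \<not> \<phi> e) (\<lambda>e. \<not> \<psi> e)"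
  unfolding transfer_rel_def by simp

lemma transfer_rel_conj:
  assumes "transfer_rel \<phi> \<psi>" "transfer_rel \<phi>' \<psi>'"
  shows "transfer_rel (\<lambda>e. \<phi> e \<and> \<phi>' e) (\<lambda>e. \<psi> e \<and> \<psi>' e)"
proof -
  obtain E F where "uniform_set E" "\<And>a b. agree E a b \<Longrightarrow> \<phi> a = \<psi> b"
    "uniform_set F" "\<And>a b. agree F a b \<Longrightarrow> \<phi>' a = \<psi>' b"
    using assms unfolding transfer_rel_def by blast
  then show ?thesis unfolding transfer_rel_def
    by (intro exI[of _ "E \<union> F"]) (auto simp: agree_Un uniform_set_Un)
qed

lemma transfer_rel_disj:
  assumes "transfer_rel \<phi> \<psi>" "transfer_rel \<phi>' \<psi>'"
  shows "transfer_rel (\<lambda>e. \<phi> e \<or> \<phi>' e) (\<lambda>e. \<psi> e \<or> \<psi>' e)"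
  using transfer_rel_not[OF transfer_rel_conj[OF transfer_rel_not[OF assms(1)] transfer_rel_not[OF assms(2)]]] by simp

lemma transfer_rel_const: "transfer_rel (\<lambda>e. c) (\<lambda>e. c)"
  unfolding transfer_rel_def by (rule exI[of _ "{}"]) (auto simp: uniform_set_def)

lemma transfer_rel_sgn:
  assumes "uniform u v"
  shows "transfer_rel (\<lambda>e. 0 < u e) (\<lambda>e. 0 < v e)" "transfer_rel (\<lambda>e. u e < 0) (\<lambda>e. v e < 0)"
    "transfer_rel (\<lambda>e. u e = 0) (\<lambda>e. v e = 0)"
proof -
  have U: "uniform_set {(u, v)}" using assms unfolding uniform_set_def by simp
  have S: "same_sgn (u a) (v b)" if "agree {(u, v)} a b" for a b using that unfolding agree_def by simp
  show "transfer_rel (\<lambda>e. 0 < u e) (\<lambda>e. 0 < v e)"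
    unfolding transfer_rel_def using U S[unfolded same_sgn_def] by (intro exI[of _ "{(u, v)}"]) simp
  show "transfer_rel (\<lambda>e. u e < 0) (\<lambda>e. v e < 0)"
    unfolding transfer_rel_def using U S[unfolded same_sgn_def] by (intro exI[of _ "{(u, v)}"]) simp
  show "transfer_rel (\<lambda>e. u e = 0) (\<lambda>e. v e = 0)"
    unfolding transfer_rel_def using U same_sgn_zero_iff[OF S] by (intro exI[of _ "{(u, v)}"]) simp
qed

lemma transfer_rel_less: "uniform u v \<Longrightarrow> uniform u' v' \<Longrightarrow> transfer_rel (\<lambda>e. u e < u' e) (\<lambda>e. v e < v' e)"
  using transfer_rel_sgn(2)[OF uniform_diff, of u v u' v'] by simp

lemma transfer_rel_le: "uniform u v \<Longrightarrow> uniform u' v' \<Longrightarrow> transfer_rel (\<lambda>e. u e \<le> u' e) (\<lambda>e. v e \<le> v' e)"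
  using transfer_rel_not[OF transfer_rel_less, of u' v' u v] by (simp add: not_less)

lemma transfer_rel_eq: "uniform u v \<Longrightarrow> uniform u' v' \<Longrightarrow> transfer_rel (\<lambda>e. u e = u' e) (\<lambda>e. v e = v' e)"
  using transfer_rel_sgn(3)[OF uniform_diff, of u v u' v'] by simp

text \<open>The tests for \<open>\<phi>\<close> become polynomials in the quantified variable, and
  their joint sign diagram is controlled by tests \<open>G\<close> in the remaining variables. When
  these agree, a witness \<open>x\<close> is matched with a point \<open>y\<close> of the same cell,
  where all tests in \<open>E\<close> agree as well.\<close>

theorem transfer_rel_ex:
  fixes \<phi> :: "(nat \<Rightarrow> 'a::real_closed_field) \<Rightarrow> bool" and \<psi> :: "(nat \<Rightarrow> 'b::real_closed_field) \<Rightarrow> bool"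
  assumes "transfer_rel \<phi> \<psi>"
  shows "transfer_rel (\<lambda>e. \<exists>y. \<phi> (e(i := y))) (\<lambda>e. \<exists>y. \<psi> (e(i := y)))"
proof -
  obtain E where E: "uniform_set E" "\<And>a b. agree E a b \<Longrightarrow> \<phi> a = \<psi> b"
    using assms unfolding transfer_rel_def by blast
  have "\<forall>t\<in>E. \<exists>s. (case t of (u, v) \<Rightarrow> case s of (P, Q, m) \<Rightarrow> uniform_poly P Q \<and>
      (\<forall>e y. poly (P e) y = u (e(i := y))) \<and> (\<forall>e y. poly (Q e) y = v (e(i := y)))
      \<and> (\<forall>e. degree (P e) \<le> m) \<and> (\<forall>e. degree (Q e) \<le> m))"
  proof
    fix t assume "t \<in> E"
    obtain u v where t: "t = (u, v)" by (cases t) auto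
    then have "uniform u v" using E(1) \<open>t \<in> E\<close> unfolding uniform_set_def by blast
    from uniform_as_poly[OF this, of i] obtain P Q m where
      "uniform_poly P Q \<and> (\<forall>e y. poly (P e) y = u (e(i := y))) \<and> (\<forall>e y. poly (Q e) y = v (e(i := y)))
      \<and> (\<forall>e. degree (P e) \<le> m) \<and> (\<forall>e. degree (Q e) \<le> m)" by blast
    then show "\<exists>s. (case t of (u, v) \<Rightarrow> case s of (P, Q, m) \<Rightarrow> uniform_poly P Q \<and>
      (\<forall>e y. poly (P e) y = u (e(i := y))) \<and> (\<forall>e y. poly (Q e) y = v (e(i := y)))
      \<and> (\<forall>e. degree (P e) \<le> m) \<and> (\<forall>e. degree (Q e) \<le> m))"
      unfolding t by (intro exI[of _ "(P, Q, m)"]) simp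
  qed
  from bchoice[OF this] obtain F where F0: "\<forall>t\<in>E. (case t of (u, v) \<Rightarrow> case F t of (P, Q, m) \<Rightarrow> uniform_poly P Q \<and>
      (\<forall>e y. poly (P e) y = u (e(i := y))) \<and> (\<forall>e y. poly (Q e) y = v (e(i := y)))
      \<and> (\<forall>e. degree (P e) \<le> m) \<and> (\<forall>e. degree (Q e) \<le> m))" ..
  note F = bspec[OF F0]
  obtain ts where ts: "set ts = E" using E(1) finite_list unfolding uniform_set_def by blast
  define L where "L = map F ts"
  have L: "uniform_poly P Q \<and> degree (P a) \<le> m \<and> degree (Q b) \<le> m" if mem: "(P, Q, m) \<in> set L" for P Q m a b
  proof -
    obtain t where t: "(P, Q, m) = F t" "t \<in> E" using mem unfolding L_def set_map ts by (rule imageE)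
    then show ?thesis using F[OF t(2)] unfolding t(1)[symmetric] by (cases t) simp
  qed
  then have "\<forall>(P, Q, m)\<in>set L. uniform_poly P Q" by blast
  then obtain G where G: "diagram_determined L G" using sign_diagram_uniform by blast
  have "(\<exists>y. \<phi> (a(i := y))) = (\<exists>y. \<psi> (b(i := y)))" if ag: "agree G a b" for a b
  proof -
    have "degs_bounded L a b" unfolding degs_bounded_def using L by blast
    then have "same_diagram (poly_pairs L a b)" using G ag unfolding diagram_determined_def by blast
    then obtain Z where Z: "cut_pairing Z"
      "\<And>x y P Q. same_cut Z x y \<Longrightarrow> (P, Q) \<in> poly_pairs L a b \<Longrightarrow> same_sgn (poly P x) (poly Q y)"
      unfolding same_diagram_def by blast
    have key: "agree E (a(i := x)) (b(i := y))" if xy: "same_cut Z x y" for x y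
      unfolding agree_def
    proof (clarify)
      fix u v assume uv: "(u, v) \<in> E"
      obtain P Q m where P: "F (u, v) = (P, Q, m)" by (cases "F (u, v)") auto
      have "(P, Q, m) \<in> set L" using imageI[OF uv, of F] P ts unfolding L_def by simp
      then have "(P a, Q b) \<in> poly_pairs L a b" unfolding poly_pairs_def by (rule rev_image_eqI) simp
      then have "same_sgn (poly (P a) x) (poly (Q b) y)" using Z(2) xy by blast
      then show "same_sgn (u (a(i := x))) (v (b(i := y)))" using F[OF uv] P by simp
    qed
    show ?thesis
    proof
      assume "\<exists>y. \<phi> (a(i := y))"
      then obtain x where x: "\<phi> (a(i := x))" by blast
      obtain y where "same_cut Z x y" using same_cut_partner[OF Z(1)] by blast
      then show "\<exists>y. \<psi> (b(i := y))" using E(2)[OF key] x by blast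
    next
      assume "\<exists>y. \<psi> (b(i := y))"
      then obtain y where y: "\<psi> (b(i := y))" by blast
      obtain x where "same_cut (Z\<inverse>) y x" using same_cut_partner[OF cut_pairing_converse[OF Z(1)]] by blast
      then show "\<exists>y. \<phi> (a(i := y))" using E(2)[OF key] y same_cut_converse by blast
    qed
  qed
  then show ?thesis unfolding transfer_rel_def using G unfolding diagram_determined_def by blast
qed

lemma transfer_rel_all:
  fixes \<phi> :: "(nat \<Rightarrow> 'a::real_closed_field) \<Rightarrow> bool" and \<psi> :: "(nat \<Rightarrow> 'b::real_closed_field) \<Rightarrow> bool"
  assumes "transfer_rel \<phi> \<psi>"
  shows "transfer_rel (\<lambda>e. \<forall>y. \<phi> (e(i := y))) (\<lambda>e. \<forall>y. \<psi> (e(i := y)))"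
  using transfer_rel_not[OF transfer_rel_ex[OF transfer_rel_not[OF assms]]] by simp

section \<open>Lengths of polynomials, determinants and characteristic polynomials\<close>

text \<open>Common frame for the absolute values on the reals and the integers and for the lengths
  of polynomials over them: one elimination then serves both coefficient rings, and lengths can be
  iterated.\<close>

definition ring_norm :: "('r::comm_ring_1 \<Rightarrow> real) \<Rightarrow> bool" where
  "ring_norm N \<longleftrightarrow> N 0 = 0 \<and> N 1 \<le> 1 \<and> (\<forall>x. 0 \<le> N x) \<and> (\<forall>x. N (- x) = N x)
     \<and> (\<forall>x y. N (x + y) \<le> N x + N y) \<and> (\<forall>x y. N (x * y) \<le> N x * N y)"

lemma ring_normD:
  assumes "ring_norm N"
  shows "N 0 = 0" "N 1 \<le> 1" "0 \<le> N x" "N (- x) = N x" "N (x + y) \<le> N x + N y" "N (x * y) \<le> N x * N y"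
  using assms unfolding ring_norm_def by auto

lemma ring_norm_sum:
  assumes "ring_norm N" shows "N (\<Sum>i\<in>I. f i) \<le> (\<Sum>i\<in>I. N (f i))"
proof (induction I rule: infinite_finite_induct)
  case (insert x F)
  have "N (f x + sum f F) \<le> N (f x) + N (sum f F)" by (rule ring_normD[OF assms])
  then show ?case using insert by simp
qed (auto simp: ring_normD[OF assms])

lemma ring_norm_prod:
  assumes "ring_norm N" "\<And>i. i \<in> I \<Longrightarrow> N (f i) \<le> B" "1 \<le> B"
  shows "N (\<Prod>i\<in>I. f i) \<le> B ^ card I"
  using assms(2)
proof (induction I rule: infinite_finite_induct)
  case (insert x F)
  have "N (f x * prod f F) \<le> N (f x) * N (prod f F)" by (rule ring_normD[OF assms(1)])
  also have "\<dots> \<le> B * B ^ card F"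
    using insert assms(3) by (intro mult_mono) (auto simp: ring_normD[OF assms(1)])
  finally show ?case using insert by simp
qed (use ring_normD(2)[OF assms(1)] assms(3) in \<open>auto simp: ring_normD(2)[OF assms(1)]\<close>)

text \<open>The length rather than the height: it is submultiplicative, hence again a
  \<open>ring_norm\<close>, and polynomials in several variables can be treated as nested univariate
  ones.\<close>

definition poly_len :: "('r::comm_ring_1 \<Rightarrow> real) \<Rightarrow> 'r poly \<Rightarrow> real" where
  "poly_len N p = (\<Sum>i\<le>degree p. N (coeff p i))"

context
  fixes N :: "'r::comm_ring_1 \<Rightarrow> real"
  assumes N: "ring_norm N"
begin

lemma poly_len_alt:
  assumes "degree p \<le> m" shows "poly_len N p = (\<Sum>i\<le>m. N (coeff p i))"
  unfolding poly_len_def using assms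
  by (intro sum.mono_neutral_left) (auto simp: coeff_eq_0 ring_normD[OF N])

lemma poly_len_nonneg: "0 \<le> poly_len N p"
  unfolding poly_len_def by (intro sum_nonneg) (auto simp: ring_normD[OF N])

lemma coeff_norm_le_poly_len: "N (coeff p i) \<le> poly_len N p"
proof (cases "i \<le> degree p")
  case True
  then show ?thesis unfolding poly_len_def
    by (intro member_le_sum) (auto simp: ring_normD[OF N])
next
  case False
  then show ?thesis using poly_len_nonneg by (simp add: coeff_eq_0 ring_normD[OF N])
qed

lemma poly_len_pCons: "poly_len N (pCons a p) = N a + poly_len N p"
proof -
  have "poly_len N (pCons a p) = (\<Sum>i\<le>Suc (degree p). N (coeff (pCons a p) i))"
    by (rule poly_len_alt) (rule degree_pCons_le)
  also have "\<dots> = N a + (\<Sum>i\<le>degree p. N (coeff p i))"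
    by (subst sum.atMost_Suc_shift) simp
  finally show ?thesis unfolding poly_len_def .
qed

lemma poly_len_0: "poly_len N 0 = 0"
  unfolding poly_len_def by (simp add: ring_normD[OF N])

lemma poly_len_add: "poly_len N (p + q) \<le> poly_len N p + poly_len N q"
proof -
  define m where "m = max (degree p) (degree q)"
  have "poly_len N (p + q) = (\<Sum>i\<le>m. N (coeff (p + q) i))"
    unfolding m_def by (intro poly_len_alt degree_add_le_max)
  also have "\<dots> \<le> (\<Sum>i\<le>m. N (coeff p i) + N (coeff q i))"
    by (intro sum_mono) (simp add: ring_normD[OF N])
  also have "\<dots> = poly_len N p + poly_len N q"
    by (simp add: sum.distrib poly_len_alt[of p m] poly_len_alt[of q m] m_def)
  finally show ?thesis .
qed

lemma poly_len_smult: "poly_len N (smult a p) \<le> N a * poly_len N p"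
proof -
  have "poly_len N (smult a p) = (\<Sum>i\<le>degree p. N (coeff (smult a p) i))"
    by (intro poly_len_alt degree_smult_le)
  also have "\<dots> \<le> (\<Sum>i\<le>degree p. N a * N (coeff p i))"
    by (intro sum_mono) (simp add: ring_normD[OF N])
  finally show ?thesis unfolding poly_len_def sum_distrib_left .
qed

lemma poly_len_mult: "poly_len N (p * q) \<le> poly_len N p * poly_len N q"
proof (induction p)
  case 0 then show ?case by (simp add: poly_len_0)
next
  case (pCons a p)
  have "poly_len N (pCons a p * q) \<le> poly_len N (smult a q) + poly_len N (pCons 0 (p * q))"
    unfolding mult_pCons_left by (rule poly_len_add)
  also have "\<dots> \<le> N a * poly_len N q + poly_len N p * poly_len N q"
    using poly_len_smult[of a q] pCons.IH by (simp add: poly_len_pCons ring_normD[OF N])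
  finally show ?case by (simp add: poly_len_pCons distrib_right)
qed

lemma ring_norm_poly_len: "ring_norm (poly_len N)"
  unfolding ring_norm_def
proof (intro conjI allI)
  show "poly_len N 1 \<le> 1" using poly_len_pCons[of 1 0] by (simp add: one_pCons poly_len_0 ring_normD[OF N])
  show "poly_len N (- x) = poly_len N x" for x
    unfolding poly_len_def by (simp add: ring_normD[OF N])
qed (auto simp: poly_len_0 poly_len_nonneg poly_len_add poly_len_mult)

lemma poly_len_monom: "poly_len N (monom a n) = N a"
  by (induction n) (simp_all add: monom_0 monom_Suc poly_len_pCons poly_len_0 ring_normD[OF N])

lemma poly_len_monom_mult: "poly_len N (monom 1 n * p) \<le> poly_len N p"
proof -
  have "poly_len N (monom 1 n * p) \<le> N 1 * poly_len N p"
    using poly_len_mult[of "monom 1 n" p] by (simp add: poly_len_monom)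
  also have "\<dots> \<le> 1 * poly_len N p"
    by (intro mult_right_mono ring_normD[OF N] poly_len_nonneg)
  finally show ?thesis by simp
qed

lemma poly_len_shift: "poly_len N (poly_shift n p) \<le> poly_len N p"
proof -
  have "degree (poly_shift n p) \<le> degree p"
    by (rule degree_le) (auto simp: coeff_poly_shift coeff_eq_0)
  then have "poly_len N (poly_shift n p) = (\<Sum>i\<le>degree p. N (coeff p (i + n)))"
    by (simp add: poly_len_alt coeff_poly_shift)
  also have "\<dots> = (\<Sum>i\<in>{n..degree p + n}. N (coeff p i))"
    by (rule sum.reindex_bij_witness[of _ "\<lambda>i. i - n" "\<lambda>i. i + n"]) auto
  also have "\<dots> \<le> (\<Sum>i\<le>degree p + n. N (coeff p i))"
    by (intro sum_mono2) (auto simp: ring_normD[OF N])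
  also have "\<dots> = poly_len N p" using poly_len_alt[of p "degree p + n"] by simp
  finally show ?thesis .
qed

end

text \<open>Leibniz expansion. The crude factor \<open>fact n\<close> is affordable, as only the
  logarithm of this bound enters the exponent of the final constant.\<close>

lemma ring_norm_det:
  fixes A :: "'r::comm_ring_1 mat"
  assumes N: "ring_norm N" and A: "A \<in> carrier_mat n n" "\<And>i j. i < n \<Longrightarrow> j < n \<Longrightarrow> N (A $$ (i, j)) \<le> B" "1 \<le> B"
  shows "N (det A) \<le> fact n * B ^ n"
proof -
  have "N (det A) \<le> (\<Sum>p\<in>{p. p permutes {0..<n}}. N (signof p * (\<Prod>i = 0..<n. A $$ (i, p i))))"
    unfolding det_def'[OF A(1)] by (rule ring_norm_sum[OF N])
  also have "\<dots> \<le> (\<Sum>p\<in>{p. p permutes {0..<n}}. B ^ n)"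
  proof (rule sum_mono)
    fix p assume p: "p \<in> {p. p permutes {0..<n}}"
    have "signof p = (1::'r) \<or> signof p = (-1::'r)" by (simp add: sign_def)
    then have "N (signof p * (\<Prod>i = 0..<n. A $$ (i, p i))) = N (\<Prod>i = 0..<n. A $$ (i, p i))"
      by (auto simp: ring_normD(4)[OF N])
    also have "\<dots> \<le> B ^ card {0..<n}"
      using p A(2,3) by (intro ring_norm_prod[OF N]) (auto dest: permutes_in_image)
    finally show "N (signof p * (\<Prod>i = 0..<n. A $$ (i, p i))) \<le> B ^ n" by simp
  qed
  also have "\<dots> = fact n * B ^ n"
    using card_permutations[of "{0..<n}" n] by simp
  finally show ?thesis .
qed

lemma char_poly_len:
  fixes A :: "'r::comm_ring_1 mat"
  assumes N: "ring_norm N" and A: "A \<in> carrier_mat n n" "\<And>i j. i < n \<Longrightarrow> j < n \<Longrightarrow> N (A $$ (i, j)) \<le> B" "0 \<le> B"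
  shows "poly_len N (char_poly A) \<le> fact n * (1 + B) ^ n"
  unfolding char_poly_def
proof (rule ring_norm_det[OF ring_norm_poly_len[OF N]])
  show "char_poly_matrix A \<in> carrier_mat n n" using A(1) by simp
  fix i j assume ij: "i < n" "j < n"
  have e: "char_poly_matrix A $$ (i, j) = (if i = j then [:- A $$ (i, j), 1:] else [:- A $$ (i, j):])"
    using A(1) ij by (auto simp: char_poly_matrix_def)
  show "poly_len N (char_poly_matrix A $$ (i, j)) \<le> 1 + B"
    unfolding e using A(2)[OF ij] ring_normD(2)[OF N]
    by (auto simp: poly_len_pCons[OF N] poly_len_0[OF N] ring_normD(4)[OF N])
qed (use A in auto)

section \<open>Evaluation through homomorphisms, and reduction modulo the critical system\<close>

text \<open>Coefficients are first sent to the reals by \<open>h\<close>, so that integer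
  polynomials can be evaluated at real points. Polynomials in \<open>\<zeta>\<close> over
  polynomials in \<open>t\<close> are evaluated by \<open>heval (heval h t) \<zeta>\<close>.\<close>

definition heval :: "('r::comm_ring_1 \<Rightarrow> real) \<Rightarrow> real \<Rightarrow> 'r poly \<Rightarrow> real" where
  "heval h x p = poly (map_poly h p) x"

lemma map_poly_mult_hom:
  assumes "comm_ring_hom h" shows "map_poly h (p * q) = map_poly h p * map_poly h q"
proof -
  interpret comm_ring_hom h by fact
  show ?thesis by (rule poly_eqI) (simp add: coeff_mult hom_distribs)
qed

lemma map_poly_diff_hom:
  assumes "comm_ring_hom h" shows "map_poly h (p - q) = map_poly h p - map_poly h q"
proof -
  interpret comm_ring_hom h by fact
  show ?thesis by (rule poly_eqI) (simp add: hom_distribs)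
qed

lemma comm_ring_hom_heval:
  assumes "comm_ring_hom h" shows "comm_ring_hom (heval h x)"
proof -
  interpret comm_ring_hom h by fact
  show ?thesis
    by unfold_locales (simp_all add: heval_def hom_distribs map_poly_mult_hom[OF assms])
qed

context
  fixes h :: "'r::comm_ring_1 \<Rightarrow> real"
  assumes h: "comm_ring_hom h"
begin

interpretation comm_ring_hom h by (rule h)

lemma heval_mult: "heval h x (p * q) = heval h x p * heval h x q"
  and heval_add: "heval h x (p + q) = heval h x p + heval h x q"
  and heval_diff: "heval h x (p - q) = heval h x p - heval h x q"
  and heval_const: "heval h x [:c:] = h c"
  and heval_monom: "heval h x (monom c n) = h c * x ^ n"
  and heval_0: "heval h x 0 = 0"
  by (simp_all add: heval_def hom_distribs map_poly_mult_hom[OF h] map_poly_diff_hom[OF h] poly_monom)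

lemma heval_sum: "heval h x (\<Sum>i\<in>I. f i) = (\<Sum>i\<in>I. heval h x (f i))"
  by (induction I rule: infinite_finite_induct) (auto simp: heval_add heval_0)

lemma heval_alt: "heval h x p = (\<Sum>i\<le>degree p. h (coeff p i) * x ^ i)"
proof -
  have "heval h x p = heval h x (\<Sum>i\<le>degree p. monom (coeff p i) i)"
    by (simp add: poly_as_sum_of_monoms)
  also have "\<dots> = (\<Sum>i\<le>degree p. h (coeff p i) * x ^ i)" by (simp add: heval_sum heval_monom)
  finally show ?thesis .
qed

lemma heval_at_0: "heval h 0 p = h (coeff p 0)"
  unfolding heval_def by (simp add: poly_0_coeff_0 coeff_map_poly)

lemma heval_shift:
  assumes "\<And>i. i < n \<Longrightarrow> coeff p i = 0"
  shows "heval h x p = x ^ n * heval h x (poly_shift n p)"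
proof -
  have "p = monom 1 n * poly_shift n p"
    by (rule poly_eqI) (use assms in \<open>auto simp: coeff_monom_mult coeff_poly_shift\<close>)
  then have "heval h x p = heval h x (monom 1 n * poly_shift n p)" by simp
  then show ?thesis by (simp add: heval_mult heval_monom)
qed

lemma tendsto_heval:
  assumes "(f \<longlongrightarrow> a) F" shows "((\<lambda>n. heval h (f n) p) \<longlongrightarrow> heval h a p) F"
  unfolding heval_def using isCont_tendsto_compose[OF poly_isCont assms] .

end

definition monval :: "nat set \<Rightarrow> (nat \<Rightarrow> nat) \<Rightarrow> (nat \<Rightarrow> real) \<Rightarrow> real" where
  "monval V \<alpha> x = (\<Prod>i\<in>V. x i ^ \<alpha> i)"

lemma monval_add: "monval V (\<lambda>i. \<alpha> i + \<beta> i) x = monval V \<alpha> x * monval V \<beta> x"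
  unfolding monval_def by (simp add: power_add prod.distrib)

lemma monval_restrict: "monval V (restrict \<alpha> V) x = monval V \<alpha> x"
  unfolding monval_def by (intro prod.cong) auto

lemma monval_0: "monval V (\<lambda>i. 0) x = 1"
  unfolding monval_def by simp

lemma monval_upd:
  assumes "finite V" "v \<in> V"
  shows "monval V (\<alpha>(v := a + \<alpha> v)) x = x v ^ a * monval V \<alpha> x"
proof -
  have "monval V (\<alpha>(v := a + \<alpha> v)) x = x v ^ (a + \<alpha> v) * (\<Prod>i\<in>V - {v}. x i ^ \<alpha> i)"
    unfolding monval_def by (subst prod.remove[OF assms]) (auto intro!: arg_cong2[where f = "(*)"] prod.cong)
  moreover have "monval V \<alpha> x = x v ^ \<alpha> v * (\<Prod>i\<in>V - {v}. x i ^ \<alpha> i)"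
    unfolding monval_def by (rule prod.remove[OF assms])
  ultimately show ?thesis by (simp add: power_add)
qed

text \<open>The equations \<open>\<zeta> x\<^sub>v\<^sup>e = \<Sum>\<^sub>j c\<^sub>v\<^sub>j x^(ex j) - [v = o] \<zeta>\<close> with \<open>deg (ex j) < e\<close>: their leading forms are
  pure powers, so every monomial reduces to the box of monomials with all exponents below \<open>e\<close>.\<close>

definition crit_system :: "nat set \<Rightarrow> nat \<Rightarrow> nat \<Rightarrow> 'j set \<Rightarrow> (nat \<Rightarrow> 'j \<Rightarrow> 's) \<Rightarrow> ('j \<Rightarrow> nat \<Rightarrow> nat)
    \<Rightarrow> ('s \<Rightarrow> real) \<Rightarrow> real \<Rightarrow> (nat \<Rightarrow> real) \<Rightarrow> bool" where
  "crit_system V ob e J c ex g \<zeta> x \<longleftrightarrow>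
     (\<forall>v\<in>V. \<zeta> * x v ^ e = (\<Sum>j\<in>J. g (c v j) * monval V (ex j) x) - (if v = ob then \<zeta> else 0))"

text \<open>Rewriting \<open>\<zeta> * x v ^ e\<close> by the system lowers the total degree and
  costs one factor \<open>\<zeta>\<close>; the power of \<open>\<zeta>\<close> on the left pays for
  this and avoids inverses. The coefficients \<open>r\<close> depend on the system alone, not on the
  point, the homomorphism or the value of \<open>\<zeta>\<close>. Each step multiplies their total
  length by at most \<open>L\<close>.\<close>

lemma monomial_reduction:
  fixes c :: "nat \<Rightarrow> 'j \<Rightarrow> 's::idom"
  assumes V: "finite V" and N: "ring_norm N" and J: "finite J"
    and ex: "\<And>j. j \<in> J \<Longrightarrow> (\<Sum>i\<in>V. ex j i) < e" and e1: "e > 0"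
    and L: "\<And>v. v \<in> V \<Longrightarrow> (\<Sum>j\<in>J. N (c v j)) + 1 \<le> L"
    and L1: "1 \<le> L"
  shows "\<exists>r. (\<Sum>\<alpha>\<in>PiE V (\<lambda>_. {..<e}). poly_len N (r \<alpha>)) \<le> L ^ (\<Sum>i\<in>V. \<beta> i) \<and>
    (\<forall>g \<zeta> x. comm_ring_hom g \<and> crit_system V ob e J c ex g \<zeta> x \<longrightarrow>
       \<zeta> ^ (\<Sum>i\<in>V. \<beta> i) * monval V \<beta> x = (\<Sum>\<alpha>\<in>PiE V (\<lambda>_. {..<e}). heval g \<zeta> (r \<alpha>) * monval V \<alpha> x))"
proof (induction "\<Sum>i\<in>V. \<beta> i" arbitrary: \<beta> rule: less_induct)
  case less
  let ?B = "PiE V (\<lambda>_. {..<e})"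
  have fB: "finite ?B" using V by (intro finite_PiE) auto
  note NP = ring_norm_poly_len[OF N]
  define \<delta> where "\<delta> = (\<Sum>i\<in>V. \<beta> i)"
  show ?case
  proof (cases "\<forall>i\<in>V. \<beta> i < e")
    case True
    then have mem: "restrict \<beta> V \<in> ?B" by auto
    define r :: "(nat \<Rightarrow> nat) \<Rightarrow> 's poly" where "r = (\<lambda>\<alpha>. if \<alpha> = restrict \<beta> V then monom 1 \<delta> else 0)"
    have "(\<Sum>\<alpha>\<in>?B. poly_len N (r \<alpha>)) = (\<Sum>\<alpha>\<in>?B. if \<alpha> = restrict \<beta> V then poly_len N (monom 1 \<delta>) else 0)"
      by (intro sum.cong) (auto simp: r_def poly_len_0[OF N])
    also have "\<dots> = N 1" using mem fB by (simp add: poly_len_monom[OF N])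
    also have "\<dots> \<le> 1" by (rule ring_normD[OF N])
    also have "1 \<le> L ^ \<delta>" using L1 by (rule one_le_power)
    finally have 1: "(\<Sum>\<alpha>\<in>?B. poly_len N (r \<alpha>)) \<le> L ^ \<delta>" .
    have 2: "\<zeta> ^ \<delta> * monval V \<beta> x = (\<Sum>\<alpha>\<in>?B. heval g \<zeta> (r \<alpha>) * monval V \<alpha> x)" if g: "comm_ring_hom g" for g \<zeta> x
    proof -
      interpret comm_ring_hom g by (rule g)
      have "(\<Sum>\<alpha>\<in>?B. heval g \<zeta> (r \<alpha>) * monval V \<alpha> x)
          = (\<Sum>\<alpha>\<in>?B. if \<alpha> = restrict \<beta> V then heval g \<zeta> (monom 1 \<delta>) * monval V \<beta> x else 0)"
        by (intro sum.cong) (auto simp: r_def heval_0[OF g] monval_restrict)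
      also have "\<dots> = \<zeta> ^ \<delta> * monval V \<beta> x" using mem fB by (simp add: heval_monom[OF g])
      finally show ?thesis by simp
    qed
    show ?thesis using 1 2 unfolding \<delta>_def by blast
  next
    case False
    then obtain v where v: "v \<in> V" "e \<le> \<beta> v" by (auto simp: not_less)
    define \<beta>' where "\<beta>' = \<beta>(v := \<beta> v - e)"
    have \<beta>: "\<beta> = \<beta>'(v := e + \<beta>' v)" unfolding \<beta>'_def using v by auto
    have sum\<beta>: "\<delta> = e + (\<Sum>i\<in>V. \<beta>' i)"
    proof -
      have "\<delta> = \<beta> v + (\<Sum>i\<in>V - {v}. \<beta> i)" unfolding \<delta>_def by (rule sum.remove[OF V v(1)])
      moreover have "(\<Sum>i\<in>V. \<beta>' i) = (\<beta> v - e) + (\<Sum>i\<in>V - {v}. \<beta> i)"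
        by (subst sum.remove[OF V v(1)]) (auto simp: \<beta>'_def intro!: sum.cong)
      ultimately show ?thesis using v by simp
    qed
    define \<delta>' where "\<delta>' = (\<Sum>i\<in>V. \<beta>' i)"
    define d where "d = (\<lambda>j. \<Sum>i\<in>V. ex j i + \<beta>' i)"
    have dj: "d j < \<delta>" if "j \<in> J" for j
      using ex[OF that] sum\<beta> unfolding d_def \<delta>'_def by (simp add: sum.distrib)
    have IH: "\<exists>r. (\<Sum>\<alpha>\<in>?B. poly_len N (r \<alpha>)) \<le> L ^ d j \<and>
      (\<forall>g \<zeta> x. comm_ring_hom g \<and> crit_system V ob e J c ex g \<zeta> x \<longrightarrow>
       \<zeta> ^ d j * monval V (\<lambda>i. ex j i + \<beta>' i) x = (\<Sum>\<alpha>\<in>?B. heval g \<zeta> (r \<alpha>) * monval V \<alpha> x))" if "j \<in> J" for j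
      using less.hyps[of "\<lambda>i. ex j i + \<beta>' i"] dj[OF that] unfolding d_def \<delta>_def by blast
    then have "\<forall>j\<in>J. \<exists>r. (\<Sum>\<alpha>\<in>?B. poly_len N (r \<alpha>)) \<le> L ^ d j \<and>
      (\<forall>g \<zeta> x. comm_ring_hom g \<and> crit_system V ob e J c ex g \<zeta> x \<longrightarrow>
       \<zeta> ^ d j * monval V (\<lambda>i. ex j i + \<beta>' i) x = (\<Sum>\<alpha>\<in>?B. heval g \<zeta> (r \<alpha>) * monval V \<alpha> x))" by blast
    from bchoice[OF this] obtain R where R: "\<forall>j\<in>J. (\<Sum>\<alpha>\<in>?B. poly_len N (R j \<alpha>)) \<le> L ^ d j \<and>
      (\<forall>g \<zeta> x. comm_ring_hom g \<and> crit_system V ob e J c ex g \<zeta> x \<longrightarrow>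
       \<zeta> ^ d j * monval V (\<lambda>i. ex j i + \<beta>' i) x = (\<Sum>\<alpha>\<in>?B. heval g \<zeta> (R j \<alpha>) * monval V \<alpha> x))" ..
    have R1: "(\<Sum>\<alpha>\<in>?B. poly_len N (R j \<alpha>)) \<le> L ^ d j" if "j \<in> J" for j
      using bspec[OF R that] by blast
    have R2: "\<zeta> ^ d j * monval V (\<lambda>i. ex j i + \<beta>' i) x = (\<Sum>\<alpha>\<in>?B. heval g \<zeta> (R j \<alpha>) * monval V \<alpha> x)"
      if "j \<in> J" "comm_ring_hom g" "crit_system V ob e J c ex g \<zeta> x" for j g \<zeta> x
      using bspec[OF R that(1)] that(2,3) by blast
    have "\<delta>' < \<delta>" using sum\<beta> e1 unfolding \<delta>'_def by simp
    then obtain R' where R'1: "(\<Sum>\<alpha>\<in>?B. poly_len N (R' \<alpha>)) \<le> L ^ \<delta>'"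
      and R'2: "\<And>g \<zeta> x. comm_ring_hom g \<Longrightarrow> crit_system V ob e J c ex g \<zeta> x \<Longrightarrow>
       \<zeta> ^ \<delta>' * monval V \<beta>' x = (\<Sum>\<alpha>\<in>?B. heval g \<zeta> (R' \<alpha>) * monval V \<alpha> x)"
      using less.hyps[of \<beta>'] unfolding \<delta>_def \<delta>'_def by blast
    \<comment> \<open>The monomials in front bring all summands to the common power
      \<open>\<delta>\<close> of \<open>\<zeta>\<close>. The summand for \<open>v = ob\<close> has
      lost degree \<open>e\<close> at once, hence \<open>monom 1 e\<close>.\<close>
    define r where "r = (\<lambda>\<alpha>. (\<Sum>j\<in>J. [:c v j:] * (monom 1 (\<delta> - 1 - d j) * R j \<alpha>))
        - (if v = ob then monom 1 e * R' \<alpha> else 0))"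
    have "(\<Sum>\<alpha>\<in>?B. poly_len N (r \<alpha>)) \<le> L ^ \<delta>"
    proof -
      have "poly_len N (r \<alpha>) \<le> (\<Sum>j\<in>J. N (c v j) * poly_len N (R j \<alpha>)) + poly_len N (R' \<alpha>)" for \<alpha>
      proof -
        have a: "poly_len N (p - q) \<le> poly_len N p + poly_len N q" for p q
          using ring_normD(5)[OF NP, of p "- q"] ring_normD(4)[OF NP, of q] by simp
        have b: "poly_len N (if v = ob then monom 1 e * R' \<alpha> else 0) \<le> poly_len N (R' \<alpha>)"
          using poly_len_monom_mult[OF N] poly_len_nonneg[OF N] by (auto simp: poly_len_0[OF N])
        have c: "poly_len N ([:c v j:] * (monom 1 (\<delta> - 1 - d j) * R j \<alpha>)) \<le> N (c v j) * poly_len N (R j \<alpha>)" for j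
        proof -
          have "poly_len N ([:c v j:] * (monom 1 (\<delta> - 1 - d j) * R j \<alpha>)) \<le> N (c v j) * poly_len N (monom 1 (\<delta> - 1 - d j) * R j \<alpha>)"
            using poly_len_smult[OF N] by simp
          also have "\<dots> \<le> N (c v j) * poly_len N (R j \<alpha>)"
            by (intro mult_left_mono poly_len_monom_mult[OF N] ring_normD[OF N])
          finally show ?thesis .
        qed
        have "poly_len N (r \<alpha>) \<le> poly_len N (\<Sum>j\<in>J. [:c v j:] * (monom 1 (\<delta> - 1 - d j) * R j \<alpha>)) + poly_len N (R' \<alpha>)"
          unfolding r_def using a b by (meson add_left_mono order_trans)
        also have "\<dots> \<le> (\<Sum>j\<in>J. N (c v j) * poly_len N (R j \<alpha>)) + poly_len N (R' \<alpha>)"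
          by (intro add_right_mono order_trans[OF ring_norm_sum[OF NP]] sum_mono c)
        finally show ?thesis .
      qed
      then have "(\<Sum>\<alpha>\<in>?B. poly_len N (r \<alpha>)) \<le> (\<Sum>\<alpha>\<in>?B. (\<Sum>j\<in>J. N (c v j) * poly_len N (R j \<alpha>)) + poly_len N (R' \<alpha>))"
        by (intro sum_mono)
      also have "\<dots> = (\<Sum>j\<in>J. N (c v j) * (\<Sum>\<alpha>\<in>?B. poly_len N (R j \<alpha>))) + (\<Sum>\<alpha>\<in>?B. poly_len N (R' \<alpha>))"
        unfolding sum.distrib sum_distrib_left by (subst sum.swap) simp
      also have "\<dots> \<le> (\<Sum>j\<in>J. N (c v j) * L ^ (\<delta> - 1)) + L ^ (\<delta> - 1)"
      proof (intro add_mono sum_mono mult_left_mono ring_normD(3)[OF N])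
        fix j assume j: "j \<in> J"
        have "L ^ d j \<le> L ^ (\<delta> - 1)" using dj[OF j] L1 by (intro power_increasing) auto
        then show "(\<Sum>\<alpha>\<in>?B. poly_len N (R j \<alpha>)) \<le> L ^ (\<delta> - 1)" using R1[OF j] by linarith
      next
        have "L ^ \<delta>' \<le> L ^ (\<delta> - 1)" using \<open>\<delta>' < \<delta>\<close> L1 by (intro power_increasing) auto
        then show "(\<Sum>\<alpha>\<in>?B. poly_len N (R' \<alpha>)) \<le> L ^ (\<delta> - 1)" using R'1 by linarith
      qed
      also have "\<dots> = ((\<Sum>j\<in>J. N (c v j)) + 1) * L ^ (\<delta> - 1)"
        by (simp add: distrib_right sum_distrib_right)
      also have "\<dots> \<le> L * L ^ (\<delta> - 1)" using L[OF v(1)] L1 by (intro mult_right_mono) auto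
      also have "\<dots> = L ^ \<delta>" using \<open>\<delta>' < \<delta>\<close> by (metis Suc_diff_1 gr_implies_not0 not_gr_zero power_Suc)
      finally show ?thesis .
    qed
    moreover have "\<zeta> ^ \<delta> * monval V \<beta> x = (\<Sum>\<alpha>\<in>?B. heval g \<zeta> (r \<alpha>) * monval V \<alpha> x)"
      if g: "comm_ring_hom g" and s: "crit_system V ob e J c ex g \<zeta> x" for g \<zeta> x
    proof -
      interpret comm_ring_hom g by (rule g)
      have hr: "heval g \<zeta> (r \<alpha>) = (\<Sum>j\<in>J. g (c v j) * (\<zeta> ^ (\<delta> - 1 - d j) * heval g \<zeta> (R j \<alpha>)))
          - (if v = ob then \<zeta> ^ e * heval g \<zeta> (R' \<alpha>) else 0)" for \<alpha>
        unfolding r_def heval_diff[OF g] heval_sum[OF g] heval_mult[OF g] heval_monom[OF g] heval_const[OF g]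
        by (simp add: heval_mult[OF g] heval_monom[OF g] heval_0[OF g])
      have "(\<Sum>\<alpha>\<in>?B. heval g \<zeta> (r \<alpha>) * monval V \<alpha> x)
          = (\<Sum>\<alpha>\<in>?B. \<Sum>j\<in>J. g (c v j) * \<zeta> ^ (\<delta> - 1 - d j) * (heval g \<zeta> (R j \<alpha>) * monval V \<alpha> x))
            - (\<Sum>\<alpha>\<in>?B. (if v = ob then \<zeta> ^ e else 0) * (heval g \<zeta> (R' \<alpha>) * monval V \<alpha> x))"
        unfolding hr left_diff_distrib sum_subtractf sum_distrib_right by (auto simp: mult_ac intro!: sum.cong arg_cong2[where f = "(-)"])
      also have "\<dots> = (\<Sum>j\<in>J. g (c v j) * \<zeta> ^ (\<delta> - 1 - d j) * (\<Sum>\<alpha>\<in>?B. heval g \<zeta> (R j \<alpha>) * monval V \<alpha> x))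
            - (if v = ob then \<zeta> ^ e else 0) * (\<Sum>\<alpha>\<in>?B. heval g \<zeta> (R' \<alpha>) * monval V \<alpha> x)"
        unfolding sum_distrib_left by (subst sum.swap) simp
      also have "\<dots> = (\<Sum>j\<in>J. g (c v j) * \<zeta> ^ (\<delta> - 1) * monval V (\<lambda>i. ex j i + \<beta>' i) x)
            - (if v = ob then \<zeta> ^ \<delta> else 0) * monval V \<beta>' x"
      proof (intro arg_cong2[where f = "(-)"] sum.cong refl)
        fix j assume j: "j \<in> J"
        have "\<zeta> ^ (\<delta> - 1) = \<zeta> ^ (\<delta> - 1 - d j) * \<zeta> ^ d j" using dj[OF j] by (simp flip: power_add)
        then show "g (c v j) * \<zeta> ^ (\<delta> - 1 - d j) * (\<Sum>\<alpha>\<in>?B. heval g \<zeta> (R j \<alpha>) * monval V \<alpha> x)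
            = g (c v j) * \<zeta> ^ (\<delta> - 1) * monval V (\<lambda>i. ex j i + \<beta>' i) x"
          unfolding R2[OF j g s, symmetric] by (simp add: mult_ac)
      next
        have "\<zeta> ^ \<delta> = \<zeta> ^ e * \<zeta> ^ \<delta>'" using sum\<beta> unfolding \<delta>'_def by (simp flip: power_add)
        then show "(if v = ob then \<zeta> ^ e else 0) * (\<Sum>\<alpha>\<in>?B. heval g \<zeta> (R' \<alpha>) * monval V \<alpha> x)
            = (if v = ob then \<zeta> ^ \<delta> else 0) * monval V \<beta>' x"
          unfolding R'2[OF g s, symmetric] by (simp add: mult_ac)
      qed
      also have "\<dots> = \<zeta> ^ (\<delta> - 1) * ((\<Sum>j\<in>J. g (c v j) * monval V (ex j) x) - (if v = ob then \<zeta> else 0)) * monval V \<beta>' x"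
      proof -
        have "\<zeta> ^ \<delta> = \<zeta> ^ (\<delta> - 1) * \<zeta>" using \<open>\<delta>' < \<delta>\<close> by (metis Suc_diff_1 gr_implies_not0 not_gr_zero power_Suc2)
        then show ?thesis
          by (simp add: monval_add sum_distrib_left sum_distrib_right right_diff_distrib left_diff_distrib mult_ac)
      qed
      also have "\<dots> = \<zeta> ^ (\<delta> - 1) * (\<zeta> * x v ^ e) * monval V \<beta>' x"
        using s v(1) unfolding crit_system_def by simp
      also have "\<dots> = \<zeta> ^ \<delta> * monval V \<beta> x"
      proof -
        have "\<zeta> ^ \<delta> = \<zeta> ^ (\<delta> - 1) * \<zeta>" using \<open>\<delta>' < \<delta>\<close> by (metis Suc_diff_1 gr_implies_not0 not_gr_zero power_Suc2)
        moreover have "monval V \<beta> x = x v ^ e * monval V \<beta>' x" by (subst \<beta>) (rule monval_upd[OF V v(1)])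
        ultimately show ?thesis by simp
      qed
      finally show ?thesis by simp
    qed
    ultimately show ?thesis unfolding \<delta>_def by blast
  qed
qed


text \<open>Eigenvalue method: multiplication by \<open>\<zeta> ^ T * x ob\<close> acts on the box
  monomials through a matrix \<open>A\<close>, and at a solution their values form an eigenvector,
  nonzero because the monomial 1 is in the box. So \<open>\<zeta> ^ T * x ob\<close> is a root of
  the characteristic polynomial. That this is monic makes the relation nontrivial, with no
  genericity assumption on the solutions.\<close>

lemma elimination:
  fixes c :: "nat \<Rightarrow> 'j \<Rightarrow> 's::idom"
  assumes V: "finite V" "ob \<in> V" and N: "ring_norm N" and J: "finite J"
    and ex: "\<And>j. j \<in> J \<Longrightarrow> (\<Sum>i\<in>V. ex j i) < e" and e1: "e > 0"
    and L: "\<And>v. v \<in> V \<Longrightarrow> (\<Sum>j\<in>J. N (c v j)) + 1 \<le> L"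
    and L1: "1 \<le> L"
    and D: "D = e ^ card V" and T: "T = card V * e"
  shows "\<exists>C :: nat \<Rightarrow> 's poly. C D \<noteq> 0 \<and> (\<forall>i. poly_len N (C i) \<le> fact D * (1 + L ^ T) ^ D) \<and>
    (\<forall>g \<zeta> x. comm_ring_hom g \<and> crit_system V ob e J c ex g \<zeta> x \<longrightarrow>
       (\<Sum>i\<le>D. heval g \<zeta> (C i) * x ob ^ i) = 0)"
proof -
  let ?B = "PiE V (\<lambda>_. {..<e})"
  have fB: "finite ?B" using V by (intro finite_PiE) auto
  have cB: "card ?B = D" unfolding D using V by (simp add: card_PiE)
  obtain \<sigma> where \<sigma>: "bij_betw \<sigma> {0..<D} ?B" using ex_bij_betw_nat_finite[OF fB] unfolding cB by blast
  have \<sigma>B: "\<sigma> i \<in> ?B" if "i < D" for i using bij_betwE[OF \<sigma>] that by auto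
  note NP = ring_norm_poly_len[OF N]
  have k1: "card V \<ge> 1" using card_gt_0_iff[of V] V by (simp add: Suc_le_eq) blast
  have "\<exists>r. (\<Sum>\<alpha>\<in>?B. poly_len N (r \<alpha>)) \<le> L ^ T \<and>
    (\<forall>g \<zeta> x. comm_ring_hom g \<and> crit_system V ob e J c ex g \<zeta> x \<longrightarrow>
       \<zeta> ^ T * x ob * monval V b x = (\<Sum>\<alpha>\<in>?B. heval g \<zeta> (r \<alpha>) * monval V \<alpha> x))" if b: "b \<in> ?B" for b
  proof -
    define \<beta> where "\<beta> = b(ob := 1 + b ob)"
    define \<delta> where "\<delta> = (\<Sum>i\<in>V. \<beta> i)"
    have "(\<Sum>i\<in>V. b i) \<le> card V * (e - 1)"
    proof -
      have "b i \<le> e - 1" if "i \<in> V" for i using PiE_mem[OF b that] by simp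
      from sum_bounded_above[of V b "e - 1", OF this] show ?thesis by simp
    qed
    moreover have "\<delta> = 1 + (\<Sum>i\<in>V. b i)"
    proof -
      have "\<delta> = (1 + b ob) + (\<Sum>i\<in>V - {ob}. b i)"
        unfolding \<delta>_def \<beta>_def by (subst sum.remove[OF V]) (auto intro!: sum.cong)
      moreover have "(\<Sum>i\<in>V. b i) = b ob + (\<Sum>i\<in>V - {ob}. b i)" by (rule sum.remove[OF V])
      ultimately show ?thesis by simp
    qed
    moreover have "1 + card V * (e - 1) \<le> T"
    proof -
      obtain e' where "e = Suc e'" using e1 gr0_implies_Suc by blast
      then show ?thesis using k1 unfolding T by simp
    qed
    \<comment> \<open>A box monomial times \<open>x ob\<close> has degree at most
      \<open>1 + card V * (e - 1)\<close>, so a single power \<open>T\<close> of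
      \<open>\<zeta>\<close> serves all rows of the matrix.\<close>
    ultimately have \<delta>T: "\<delta> \<le> T" by linarith
    obtain r where r1: "(\<Sum>\<alpha>\<in>?B. poly_len N (r \<alpha>)) \<le> L ^ \<delta>"
      and r2: "\<And>g \<zeta> x. comm_ring_hom g \<Longrightarrow> crit_system V ob e J c ex g \<zeta> x \<Longrightarrow>
       \<zeta> ^ \<delta> * monval V \<beta> x = (\<Sum>\<alpha>\<in>?B. heval g \<zeta> (r \<alpha>) * monval V \<alpha> x)"
      using monomial_reduction[where V = V and J = J and ex = ex and c = c and \<beta> = \<beta> and ob = ob, OF V(1) N J ex e1 L L1]
      unfolding \<delta>_def by blast
    show ?thesis
    proof (intro exI[of _ "\<lambda>\<alpha>. monom 1 (T - \<delta>) * r \<alpha>"] conjI allI impI)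
      have "(\<Sum>\<alpha>\<in>?B. poly_len N (monom 1 (T - \<delta>) * r \<alpha>)) \<le> (\<Sum>\<alpha>\<in>?B. poly_len N (r \<alpha>))"
        by (intro sum_mono poly_len_monom_mult[OF N])
      also have "\<dots> \<le> L ^ T" using r1 power_increasing[OF \<delta>T L1] by linarith
      finally show "(\<Sum>\<alpha>\<in>?B. poly_len N (monom 1 (T - \<delta>) * r \<alpha>)) \<le> L ^ T" .
      fix g \<zeta> x assume gs: "comm_ring_hom g \<and> crit_system V ob e J c ex g \<zeta> x"
      then have g: "comm_ring_hom g" by simp
      interpret comm_ring_hom g by (rule g)
      have "\<zeta> ^ T * x ob * monval V b x = \<zeta> ^ (T - \<delta>) * (\<zeta> ^ \<delta> * monval V \<beta> x)"
      proof -
        have "monval V \<beta> x = x ob * monval V b x" unfolding \<beta>_def using monval_upd[OF V, of b 1 x] by simp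
        moreover have "\<zeta> ^ T = \<zeta> ^ (T - \<delta>) * \<zeta> ^ \<delta>" using \<delta>T by (simp flip: power_add)
        ultimately show ?thesis by simp
      qed
      also have "\<dots> = (\<Sum>\<alpha>\<in>?B. heval g \<zeta> (monom 1 (T - \<delta>) * r \<alpha>) * monval V \<alpha> x)"
      proof -
        have "\<zeta> ^ \<delta> * monval V \<beta> x = (\<Sum>\<alpha>\<in>?B. heval g \<zeta> (r \<alpha>) * monval V \<alpha> x)" using r2 gs by blast
        then show ?thesis by (simp add: sum_distrib_left heval_mult[OF g] heval_monom[OF g] mult.assoc)
      qed
      finally show "\<zeta> ^ T * x ob * monval V b x = (\<Sum>\<alpha>\<in>?B. heval g \<zeta> (monom 1 (T - \<delta>) * r \<alpha>) * monval V \<alpha> x)" .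
    qed
  qed
  then have "\<forall>b\<in>?B. \<exists>r. (\<Sum>\<alpha>\<in>?B. poly_len N (r \<alpha>)) \<le> L ^ T \<and>
    (\<forall>g \<zeta> x. comm_ring_hom g \<and> crit_system V ob e J c ex g \<zeta> x \<longrightarrow>
       \<zeta> ^ T * x ob * monval V b x = (\<Sum>\<alpha>\<in>?B. heval g \<zeta> (r \<alpha>) * monval V \<alpha> x))" by blast
  from bchoice[OF this] obtain r where r: "\<forall>b\<in>?B. (\<Sum>\<alpha>\<in>?B. poly_len N (r b \<alpha>)) \<le> L ^ T \<and>
    (\<forall>g \<zeta> x. comm_ring_hom g \<and> crit_system V ob e J c ex g \<zeta> x \<longrightarrow>
       \<zeta> ^ T * x ob * monval V b x = (\<Sum>\<alpha>\<in>?B. heval g \<zeta> (r b \<alpha>) * monval V \<alpha> x))" ..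
  have r1: "poly_len N (r b \<alpha>) \<le> L ^ T" if "b \<in> ?B" "\<alpha> \<in> ?B" for b \<alpha>
  proof -
    have "poly_len N (r b \<alpha>) \<le> (\<Sum>\<alpha>\<in>?B. poly_len N (r b \<alpha>))"
      using that fB by (intro member_le_sum) (auto simp: poly_len_nonneg[OF N])
    then show ?thesis using bspec[OF r that(1)] by linarith
  qed
  define A where "A = mat D D (\<lambda>(i, j). r (\<sigma> i) (\<sigma> j))"
  have A: "A \<in> carrier_mat D D" unfolding A_def by simp
  define P where "P = char_poly A"
  have degP: "degree P = D" "coeff P D = 1" unfolding P_def using degree_monic_char_poly[OF A] by auto
  have lenP: "poly_len (poly_len N) P \<le> fact D * (1 + L ^ T) ^ D"
    unfolding P_def
  proof (rule char_poly_len[OF NP A])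
    show "poly_len N (A $$ (i, j)) \<le> L ^ T" if "i < D" "j < D" for i j
      unfolding A_def using that r1 \<sigma>B by simp
    show "0 \<le> L ^ T" using L1 by simp
  qed
  \<comment> \<open>Expanding \<open>(\<zeta> ^ T * x ob) ^ i\<close> moves the powers of
    \<open>\<zeta>\<close> into the coefficients. The top one becomes a pure power of
    \<open>\<zeta>\<close>, which is nonzero as a polynomial.\<close>
  define C where "C = (\<lambda>i. monom 1 (T * i) * coeff P i)"
  show ?thesis
  proof (intro exI[of _ C] conjI allI impI)
    show "C D \<noteq> 0" unfolding C_def by (simp add: degP)
    fix i
    have "poly_len N (C i) \<le> poly_len N (coeff P i)" unfolding C_def by (rule poly_len_monom_mult[OF N])
    also have "\<dots> \<le> poly_len (poly_len N) P" by (rule coeff_norm_le_poly_len[OF NP])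
    finally show "poly_len N (C i) \<le> fact D * (1 + L ^ T) ^ D" using lenP by linarith
  next
    fix g \<zeta> x assume gs: "comm_ring_hom g \<and> crit_system V ob e J c ex g \<zeta> x"
    then have g: "comm_ring_hom g" by simp
    interpret g: comm_ring_hom g by (rule g)
    interpret E: comm_ring_hom "heval g \<zeta>" by (rule comm_ring_hom_heval[OF g])
    define M where "M = map_mat (heval g \<zeta>) A"
    have M: "M \<in> carrier_mat D D" unfolding M_def using A by simp
    define u where "u = vec D (\<lambda>i. monval V (\<sigma> i) x)"
    define lam where "lam = \<zeta> ^ T * x ob"
    have "M *\<^sub>v u = lam \<cdot>\<^sub>v u"
    proof (rule eq_vecI)
      fix i assume "i < dim_vec (lam \<cdot>\<^sub>v u)"
      then have i: "i < D" unfolding u_def by simp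
      have "(M *\<^sub>v u) $ i = (\<Sum>j = 0..<D. heval g \<zeta> (r (\<sigma> i) (\<sigma> j)) * monval V (\<sigma> j) x)"
        using i M unfolding M_def A_def u_def by (simp add: scalar_prod_def)
      also have "\<dots> = (\<Sum>\<alpha>\<in>?B. heval g \<zeta> (r (\<sigma> i) \<alpha>) * monval V \<alpha> x)"
        by (rule sum.reindex_bij_betw[OF \<sigma>])
      also have "\<dots> = lam * monval V (\<sigma> i) x"
        using bspec[OF r \<sigma>B[OF i]] gs unfolding lam_def by simp
      finally show "(M *\<^sub>v u) $ i = (lam \<cdot>\<^sub>v u) $ i" using i unfolding u_def by simp
    qed (use M in \<open>simp add: u_def\<close>)
    moreover have "u \<noteq> 0\<^sub>v D"
    proof -
      have "restrict (\<lambda>i. 0) V \<in> ?B" using e1 by auto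
      then have "restrict (\<lambda>i. 0) V \<in> \<sigma> ` {0..<D}" using bij_betw_imp_surj_on[OF \<sigma>] by simp
      then obtain i where i: "i < D" "\<sigma> i = restrict (\<lambda>i. 0) V" by (elim imageE) simp
      then have "u $ i = 1" unfolding u_def by (simp add: monval_restrict monval_0)
      then show ?thesis using i by auto
    qed
    ultimately have "eigenvalue M lam" unfolding eigenvalue_def eigenvector_def
      using M unfolding u_def by (intro exI[of _ "vec D (\<lambda>i. monval V (\<sigma> i) x)"]) auto
    then have "poly (char_poly M) lam = 0" using eigenvalue_root_char_poly[OF M] by simp
    moreover have "char_poly M = map_poly (heval g \<zeta>) P" unfolding M_def P_def by (rule E.char_poly_hom[OF A])
    ultimately have "heval (heval g \<zeta>) lam P = 0" unfolding heval_def by simp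
    then have "(\<Sum>i\<le>D. heval g \<zeta> (coeff P i) * lam ^ i) = 0"
      unfolding heval_alt[OF comm_ring_hom_heval[OF g]] degP .
    then show "(\<Sum>i\<le>D. heval g \<zeta> (C i) * x ob ^ i) = 0"
      unfolding C_def lam_def heval_mult[OF g] heval_monom[OF g]
      by (simp add: power_mult_distrib mult_ac flip: power_mult)
  qed
qed

lemma least_nonzero_coeff:
  fixes C :: "nat \<Rightarrow> 's::zero poly"
  assumes "C i \<noteq> 0" "i \<le> D"
  shows "\<exists>j. (\<exists>i\<le>D. coeff (C i) j \<noteq> 0) \<and> (\<forall>i\<le>D. \<forall>k<j. coeff (C i) k = 0)"
proof -
  define P where "P = (\<lambda>j. \<exists>i\<le>D. coeff (C i) j \<noteq> 0)"
  have "P (degree (C i))" unfolding P_def using assms by (intro exI[of _ i]) auto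
  then have "P (LEAST j. P j)" by (rule LeastI)
  moreover have "\<not> P k" if "k < (LEAST j. P j)" for k using not_less_Least[OF that] .
  ultimately show ?thesis unfolding P_def by blast
qed

text \<open>The common factor \<open>\<zeta> ^ j\<close> is cancelled before \<open>\<zeta>\<close>
  tends to 0. With \<open>j\<close> from \<open>least_nonzero_coeff\<close> the limiting relation is
  nontrivial.\<close>

lemma limit_relation:
  fixes C :: "nat \<Rightarrow> 's::idom poly"
  assumes g: "comm_ring_hom g" and C: "\<forall>i\<le>D. \<forall>k<j. coeff (C i) k = 0"
    and \<zeta>: "\<And>n. \<zeta> n \<noteq> 0" "\<zeta> \<longlonglongrightarrow> 0" and v: "v \<longlonglongrightarrow> v0"
    and eq: "\<And>n. (\<Sum>i\<le>D. heval g (\<zeta> n) (C i) * v n ^ i) = 0"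
  shows "(\<Sum>i\<le>D. g (coeff (C i) j) * v0 ^ i) = 0"
proof -
  have "(\<Sum>i\<le>D. heval g (\<zeta> n) (poly_shift j (C i)) * v n ^ i) = 0" for n
  proof -
    have "(\<Sum>i\<le>D. heval g (\<zeta> n) (C i) * v n ^ i) = \<zeta> n ^ j * (\<Sum>i\<le>D. heval g (\<zeta> n) (poly_shift j (C i)) * v n ^ i)"
      unfolding sum_distrib_left
    proof (intro sum.cong refl)
      fix i assume "i \<in> {..D}"
      then have "heval g (\<zeta> n) (C i) = \<zeta> n ^ j * heval g (\<zeta> n) (poly_shift j (C i))"
        using C by (intro heval_shift[OF g]) auto
      then show "heval g (\<zeta> n) (C i) * v n ^ i = \<zeta> n ^ j * (heval g (\<zeta> n) (poly_shift j (C i)) * v n ^ i)" by simp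
    qed
    then show ?thesis using eq[of n] \<zeta>(1)[of n] by simp
  qed
  moreover have "(\<lambda>n. \<Sum>i\<le>D. heval g (\<zeta> n) (poly_shift j (C i)) * v n ^ i)
      \<longlonglongrightarrow> (\<Sum>i\<le>D. heval g 0 (poly_shift j (C i)) * v0 ^ i)"
    by (intro tendsto_intros tendsto_heval[OF g] \<zeta>(2) v)
  ultimately have "(\<Sum>i\<le>D. heval g 0 (poly_shift j (C i)) * v0 ^ i) = 0"
    by (simp add: LIMSEQ_const_iff)
  then show ?thesis by (simp add: heval_at_0[OF g] coeff_poly_shift)
qed

abbreviation lk :: "('a \<Rightarrow>\<^sub>0 'b::zero) \<Rightarrow> 'a \<Rightarrow> 'b" where "lk \<equiv> Poly_Mapping.lookup"
abbreviation ks :: "('a \<Rightarrow>\<^sub>0 'b::zero) \<Rightarrow> 'a set" where "ks \<equiv> Poly_Mapping.keys"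

section \<open>Sequential compactness in finitely many coordinates\<close>

definition conv_on :: "nat set \<Rightarrow> (nat \<Rightarrow> nat \<Rightarrow> real) \<Rightarrow> (nat \<Rightarrow> real) \<Rightarrow> bool" where
  "conv_on V Xs l \<longleftrightarrow> (\<forall>i\<in>V. (\<lambda>n. Xs n i) \<longlonglongrightarrow> l i)"

text \<open>Points are functions on all of \<open>nat\<close> of which only the coordinates in
  \<open>V\<close> matter. Compactness is therefore stated through sequences and convergence on
  \<open>V\<close>; elsewhere a limit is arbitrary.\<close>

definition seq_compact_on :: "nat set \<Rightarrow> (nat \<Rightarrow> real) set \<Rightarrow> bool" where
  "seq_compact_on V K \<longleftrightarrow> (\<forall>Xs :: nat \<Rightarrow> nat \<Rightarrow> real. (\<forall>n. Xs n \<in> K) \<longrightarrow>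
     (\<exists>r l. strict_mono r \<and> l \<in> K \<and> conv_on V (\<lambda>n. Xs (r n)) l))"

lemma seq_compact_onD:
  fixes Xs :: "nat \<Rightarrow> nat \<Rightarrow> real"
  shows "seq_compact_on V K \<Longrightarrow> (\<And>n. Xs n \<in> K) \<Longrightarrow> \<exists>r l. strict_mono r \<and> l \<in> K \<and> conv_on V (\<lambda>n. Xs (r n)) l"
proof -
  assume K: "seq_compact_on V K" and "\<And>n. Xs n \<in> K"
  then have "\<forall>n. Xs n \<in> K" by simp
  then show ?thesis by (rule mp[OF spec[OF K[unfolded seq_compact_on_def]]])
qed

lemma conv_on_subseq: "conv_on V Xs l \<Longrightarrow> strict_mono r \<Longrightarrow> conv_on V (\<lambda>n. Xs (r n)) l"
  unfolding conv_on_def using LIMSEQ_subseq_LIMSEQ by (fastforce simp: o_def)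

lemma bolzano_on:
  fixes Xs :: "nat \<Rightarrow> nat \<Rightarrow> real"
  assumes "finite V" "\<And>n i. i \<in> V \<Longrightarrow> \<bar>Xs n i\<bar> \<le> B"
  shows "\<exists>r l. strict_mono r \<and> conv_on V (\<lambda>n. Xs (r n)) l"
  using assms
proof (induction V rule: finite_induct)
  case empty
  have "strict_mono (\<lambda>n::nat. n)" by (simp add: strict_mono_def)
  then show ?case unfolding conv_on_def by (intro exI[of _ "\<lambda>n. n"]) simp
next
  case (insert v V)
  obtain r l where r: "strict_mono r" "conv_on V (\<lambda>n. Xs (r n)) l" using insert by blast
  define Y where "Y = (\<lambda>n. Xs (r n) v)"
  obtain s where s: "strict_mono s" "monoseq (\<lambda>n. Y (s n))" using seq_monosub[of Y] by blast
  have "Bseq (\<lambda>n. Y (s n))" using insert.prems unfolding Y_def by (intro BseqI'[of _ B]) auto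
  then have "convergent (\<lambda>n. Y (s n))" using Bseq_monoseq_convergent s by blast
  then obtain y where y: "(\<lambda>n. Y (s n)) \<longlonglongrightarrow> y" unfolding convergent_def by blast
  have "strict_mono (r \<circ> s)" using strict_mono_o r s by blast
  moreover have "conv_on (insert v V) (\<lambda>n. Xs ((r \<circ> s) n)) (l(v := y))"
    using conv_on_subseq[OF r(2) s(1)] y insert(2) unfolding conv_on_def Y_def by auto
  ultimately show ?case by blast
qed

lemma seq_compact_on_bounded:
  assumes "seq_compact_on V K" "v \<in> V"
  shows "\<exists>B. \<forall>x\<in>K. \<bar>x v\<bar> \<le> B"
proof (rule ccontr)
  assume "\<not> ?thesis"
  then have "\<forall>n::nat. \<exists>x\<in>K. \<bar>x v\<bar> > real n" by (meson not_le)
  then obtain Xs where Xs: "\<And>n. Xs n \<in> K" "\<And>n. \<bar>Xs n v\<bar> > real n" by metis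
  then obtain r l where r: "strict_mono r" "conv_on V (\<lambda>n. Xs (r n)) l" using assms(1) unfolding seq_compact_on_def by blast
  then have "(\<lambda>n. Xs (r n) v) \<longlonglongrightarrow> l v" using assms(2) unfolding conv_on_def by blast
  then have "Bseq (\<lambda>n. Xs (r n) v)" using convergentI convergent_imp_Bseq by blast
  then obtain B where "\<forall>n. norm (Xs (r n) v) \<le> B" using BseqE by blast
  then have B: "\<bar>Xs (r n) v\<bar> \<le> B" for n by simp
  obtain n where n: "real n > B" using reals_Archimedean2 by blast
  have "n \<le> r n" using r(1) seq_suble by blast
  then have "real n < \<bar>Xs (r n) v\<bar>" using Xs(2)[of "r n"] by (meson of_nat_le_iff order_le_less_trans)
  then show False using B[of n] n by linarith
qed

lemma seq_compact_on_attains: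
  assumes K: "seq_compact_on V K" "K \<noteq> {}" and f: "\<And>Xs l. conv_on V Xs l \<Longrightarrow> (\<lambda>n. f (Xs n)) \<longlonglongrightarrow> (f l :: real)"
    and bd: "\<And>x. x \<in> K \<Longrightarrow> f x \<le> B"
  shows "\<exists>x\<in>K. \<forall>y\<in>K. f y \<le> f x"
proof -
  define Sp where "Sp = Sup (f ` K)"
  have bdd: "bdd_above (f ` K)" using bd by (rule bdd_aboveI2)
  have "\<exists>x\<in>K. f x > Sp - inverse (real (Suc n))" for n
    using less_cSup_iff[of "f ` K" "Sp - inverse (real (Suc n))"] bdd K(2) unfolding Sp_def by auto
  then obtain Xs where Xs: "\<And>n. Xs n \<in> K" "\<And>n. f (Xs n) > Sp - inverse (real (Suc n))" by metis
  then obtain r l where r: "strict_mono r" "l \<in> K" "conv_on V (\<lambda>n. Xs (r n)) l" using K(1) unfolding seq_compact_on_def by blast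
  have lim: "(\<lambda>n. f (Xs (r n))) \<longlonglongrightarrow> f l" by (rule f[OF r(3)])
  have "(\<lambda>n. Sp - inverse (real (Suc (r n)))) \<longlonglongrightarrow> Sp - 0"
    by (intro tendsto_diff tendsto_const LIMSEQ_subseq_LIMSEQ[OF LIMSEQ_inverse_real_of_nat r(1), unfolded o_def])
  then have "Sp - 0 \<le> f l" by (rule LIMSEQ_le[OF _ lim]) (use Xs(2) in \<open>auto intro: less_imp_le\<close>)
  moreover have "f y \<le> Sp" if "y \<in> K" for y unfolding Sp_def using that bdd by (auto intro: cSup_upper)
  ultimately show ?thesis using r(2) by force
qed

lemma tendsto_monval:
  "conv_on V Xs l \<Longrightarrow> (\<lambda>n. monval V \<alpha> (Xs n)) \<longlonglongrightarrow> monval V \<alpha> l"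
  unfolding monval_def conv_on_def by (intro tendsto_prod tendsto_power) auto

lemma monval_cong: "(\<And>i. i \<in> V \<Longrightarrow> x i = y i) \<Longrightarrow> monval V \<alpha> x = monval V \<alpha> y"
  unfolding monval_def by (intro prod.cong) auto

section \<open>Critical points on the deformed hypersurface\<close>

text \<open>A maximum of \<open>\<sigma> X\<^sub>o\<close> on \<open>{Q \<le> \<zeta> H}\<close>, \<open>H = 1 + \<Sum> X\<^sub>v\<^sup>e\<close>, satisfies \<open>Q = \<zeta> H\<close> and
  \<open>\<partial>\<^sub>v (Q - \<zeta> H) = 0\<close> for \<open>v \<noteq> o\<close>; multiplying the latter by \<open>X\<^sub>v\<close> and using the former gives a
  system with pure-power leading forms.\<close>

lemma local_max_crit_system:
  fixes a :: "'j \<Rightarrow> real"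
  assumes V: "finite V" "ob \<in> V" and J: "finite J"
    and ex: "\<And>j. j \<in> J \<Longrightarrow> (\<Sum>i\<in>V. ex j i) < e" and e: "0 < e" "even e"
    and \<zeta>: "0 < \<zeta>" and \<rho>: "0 < \<rho>" and \<sigma>: "\<bar>\<sigma>\<bar> = (1::real)"
    and Q: "\<And>x. Q x = (\<Sum>j\<in>J. a j * monval V (ex j) x)"
    and G: "\<And>x. G x = Q x - \<zeta> * (1 + (\<Sum>v\<in>V. x v ^ e))"
    and x0: "G x0 \<le> 0"
    and mx: "\<And>y. (\<forall>i\<in>V. \<bar>y i - x0 i\<bar> \<le> \<rho>) \<Longrightarrow> G y \<le> 0 \<Longrightarrow> \<sigma> * y ob \<le> \<sigma> * x0 ob"
    and c: "\<And>v j. v \<in> V \<Longrightarrow> j \<in> J \<Longrightarrow> g (c v j)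
        = of_nat (if v = ob then e - (\<Sum>i\<in>V - {ob}. ex j i) else ex j v) * a j"
  shows "crit_system V ob e J c ex g (\<zeta> * real e) x0"
proof -
  have \<sigma>2: "\<sigma> * \<sigma> = 1" using \<sigma> by (metis abs_mult_self_eq mult_1)
  \<comment> \<open>If the constraint were strict at \<open>x0\<close>, the coordinate
    \<open>ob\<close> could still be moved a little in direction \<open>\<sigma>\<close>.\<close>
  have G0: "G x0 = 0"
  proof (rule ccontr)
    assume "G x0 \<noteq> 0"
    then have neg: "G x0 < 0" using x0 by simp
    define Xs where "Xs = (\<lambda>n. x0(ob := x0 ob + \<sigma> * inverse (real (Suc n))))"
    have "(\<lambda>n. x0 ob + \<sigma> * inverse (real (Suc n))) \<longlonglongrightarrow> x0 ob + \<sigma> * 0"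
      by (intro tendsto_intros LIMSEQ_inverse_real_of_nat)
    then have Xs: "conv_on V Xs x0" unfolding conv_on_def Xs_def
    proof (intro ballI)
      fix i assume "i \<in> V"
      show "(\<lambda>n. (x0(ob := x0 ob + \<sigma> * inverse (real (Suc n)))) i) \<longlonglongrightarrow> x0 i"
        if "(\<lambda>n. x0 ob + \<sigma> * inverse (real (Suc n))) \<longlonglongrightarrow> x0 ob + \<sigma> * 0"
        using that by (cases "i = ob") simp_all
    qed
    then have "(\<lambda>n. G (Xs n)) \<longlonglongrightarrow> G x0" unfolding G Q
      by (intro tendsto_intros tendsto_monval) (auto simp: conv_on_def)
    then have "eventually (\<lambda>n. G (Xs n) < 0) sequentially" using neg by (rule order_tendstoD)
    moreover have "eventually (\<lambda>n. inverse (real (Suc n)) < \<rho>) sequentially"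
      using LIMSEQ_inverse_real_of_nat \<rho> by (rule order_tendstoD)
    ultimately have "eventually (\<lambda>n. G (Xs n) < 0 \<and> inverse (real (Suc n)) < \<rho>) sequentially" by eventually_elim simp
    then obtain n where n: "G (Xs n) < 0" "inverse (real (Suc n)) < \<rho>" by (auto simp: eventually_sequentially)
    have "\<bar>Xs n i - x0 i\<bar> \<le> \<rho>" for i using n(2) \<rho> \<sigma> unfolding Xs_def by (auto simp: abs_mult)
    then have "\<sigma> * Xs n ob \<le> \<sigma> * x0 ob" using mx n(1) by (simp add: less_imp_le)
    moreover have "\<sigma> * Xs n ob = \<sigma> * x0 ob + (\<sigma> * \<sigma>) * inverse (real (Suc n))" unfolding Xs_def by (simp add: algebra_simps)
    ultimately have "inverse (real (Suc n)) \<le> 0" unfolding \<sigma>2 by simp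
    moreover have "inverse (real (Suc n)) > 0" by simp
    ultimately show False by linarith
  qed
  have E: "(\<Sum>j\<in>J. a j * (of_nat (ex j v) * monval V (ex j) x0)) = \<zeta> * real e * x0 v ^ e"
    if v: "v \<in> V" "v \<noteq> ob" for v
  proof -
    define V' where "V' = V - {ob} - {v}"
    define cc where "cc = (\<lambda>\<alpha>. \<Prod>i\<in>V'. x0 i ^ \<alpha> i)"
    have split: "monval V \<alpha> y = y ob ^ \<alpha> ob * (y v ^ \<alpha> v * (\<Prod>i\<in>V'. y i ^ \<alpha> i))" for \<alpha> y
      unfolding monval_def V'_def using V v by (simp add: prod.remove[of V ob] prod.remove[of "V - {ob}" v])
    have splits: "(\<Sum>i\<in>V. y i ^ e) = y ob ^ e + (y v ^ e + (\<Sum>i\<in>V'. y i ^ e))" for y :: "nat \<Rightarrow> real"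
      unfolding V'_def using V v by (simp add: sum.remove[of V ob] sum.remove[of "V - {ob}" v])
    define A where "A = (\<Sum>j\<in>J. a j * (of_nat (ex j ob) * x0 ob ^ (ex j ob - 1) * (x0 v ^ ex j v * cc (ex j))))
        - \<zeta> * (real e * x0 ob ^ (e - 1))"
    define B where "B = (\<Sum>j\<in>J. a j * (x0 ob ^ ex j ob * (of_nat (ex j v) * x0 v ^ (ex j v - 1) * cc (ex j))))
        - \<zeta> * (real e * x0 v ^ (e - 1))"
    have "B = 0"
    proof (rule ccontr)
      assume B0: "B \<noteq> 0"
      \<comment> \<open>The direction \<open>(\<sigma>, b)\<close> in the plane of \<open>ob\<close>
        and \<open>v\<close> is chosen so that \<open>G\<close>, with partial derivatives
        \<open>A\<close> and \<open>B\<close>, has derivative -1 along it. A short move then keeps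
        \<open>G \<le> 0\<close> and increases \<open>\<sigma> * x ob\<close>, against maximality.
        This is a Lagrange condition without multipliers.\<close>
      define b where "b = - (\<sigma> * A + 1) / B"
      define Y where "Y = (\<lambda>t. (x0(ob := x0 ob + \<sigma> * t))(v := x0 v + b * t))"
      have Y: "Y t ob = x0 ob + \<sigma> * t" "Y t v = x0 v + b * t" "i \<in> V' \<Longrightarrow> Y t i = x0 i" for t i
        using v unfolding Y_def V'_def by auto
      have YP: "(\<Prod>i\<in>V'. Y t i ^ \<alpha> i) = cc \<alpha>" for t \<alpha> unfolding cc_def by (intro prod.cong) (auto simp: Y)
      have YS: "(\<Sum>i\<in>V'. Y t i ^ e) = (\<Sum>i\<in>V'. x0 i ^ e)" for t by (intro sum.cong) (auto simp: Y)
      have GY: "G (Y t) = (\<Sum>j\<in>J. a j * ((x0 ob + \<sigma> * t) ^ ex j ob * ((x0 v + b * t) ^ ex j v * cc (ex j))))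
         - \<zeta> * (1 + ((x0 ob + \<sigma> * t) ^ e + ((x0 v + b * t) ^ e + (\<Sum>i\<in>V'. x0 i ^ e))))" for t
        unfolding G Q split splits YP YS Y(1,2) ..
      have mono_deriv: "((\<lambda>t. (p + s * t) ^ k) has_real_derivative (of_nat k * p ^ (k - 1)) * s) (at 0)" for p s :: real and k
        by (auto intro!: derivative_eq_intros)
      have "((\<lambda>t. G (Y t)) has_real_derivative
         (\<Sum>j\<in>J. a j * ((of_nat (ex j ob) * x0 ob ^ (ex j ob - 1)) * \<sigma> * ((x0 v + b * 0) ^ ex j v * cc (ex j))
            + ((of_nat (ex j v) * x0 v ^ (ex j v - 1)) * b * cc (ex j)) * (x0 ob + \<sigma> * 0) ^ ex j ob))
         - \<zeta> * (0 + ((of_nat e * x0 ob ^ (e - 1)) * \<sigma> + ((of_nat e * x0 v ^ (e - 1)) * b + 0)))) (at 0)"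
        unfolding GY by (intro DERIV_diff DERIV_sum DERIV_cmult DERIV_add DERIV_mult DERIV_cmult_right mono_deriv DERIV_const)
      also have "(\<Sum>j\<in>J. a j * ((of_nat (ex j ob) * x0 ob ^ (ex j ob - 1)) * \<sigma> * ((x0 v + b * 0) ^ ex j v * cc (ex j))
            + ((of_nat (ex j v) * x0 v ^ (ex j v - 1)) * b * cc (ex j)) * (x0 ob + \<sigma> * 0) ^ ex j ob))
         - \<zeta> * (0 + ((of_nat e * x0 ob ^ (e - 1)) * \<sigma> + ((of_nat e * x0 v ^ (e - 1)) * b + 0))) = \<sigma> * A + b * B"
        unfolding A_def B_def by (simp add: algebra_simps sum.distrib sum_distrib_left)
      also have "\<sigma> * A + b * B = -1" unfolding b_def using B0 by simp
      finally have D: "((\<lambda>t. G (Y t)) has_real_derivative -1) (at 0)" .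
      have "\<exists>d>0. \<forall>h>0. h < d \<longrightarrow> G (Y (0 + h)) < G (Y 0)"
        by (rule DERIV_neg_dec_right[OF D]) simp
      then obtain d where d: "d > 0" "\<And>h. h > 0 \<Longrightarrow> h < d \<Longrightarrow> G (Y h) < G (Y 0)" by auto
      define h where "h = min (d / 2) (\<rho> / (1 + \<bar>b\<bar>))"
      have h: "h > 0" "h < d" unfolding h_def using d(1) \<rho> by (auto simp: min_less_iff_disj)
      have hb: "h * (1 + \<bar>b\<bar>) \<le> \<rho>" unfolding h_def using \<rho>
        by (metis abs_ge_zero add_pos_nonneg less_numeral_extra(1) min.cobounded2 pos_le_divide_eq)
      have "0 \<le> h * \<bar>b\<bar>" using h(1) by simp
      then have "h \<le> \<rho>" "\<bar>b\<bar> * h \<le> \<rho>" using hb h(1) unfolding distrib_left mult_1_right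
        by (linarith, simp add: mult.commute)
      then have near: "\<forall>i\<in>V. \<bar>Y h i - x0 i\<bar> \<le> \<rho>"
        unfolding Y_def using \<rho> \<sigma> h(1) by (auto simp: abs_mult)
      have "Y 0 = x0" unfolding Y_def by auto
      then have "G (Y h) \<le> 0" using d(2)[OF h] G0 by simp
      then have "\<sigma> * Y h ob \<le> \<sigma> * x0 ob" using mx near by blast
      moreover have "\<sigma> * Y h ob = \<sigma> * x0 ob + (\<sigma> * \<sigma>) * h" unfolding Y by (simp add: algebra_simps)
      ultimately show False using h(1) unfolding \<sigma>2 by simp
    qed
    have pw: "x0 v * (of_nat k * x0 v ^ (k - 1)) = of_nat k * x0 v ^ k" for k
      by (cases k) auto
    have "0 = x0 v * B" using \<open>B = 0\<close> by simp
    also have "\<dots> = (\<Sum>j\<in>J. a j * (x0 ob ^ ex j ob * ((x0 v * (of_nat (ex j v) * x0 v ^ (ex j v - 1))) * cc (ex j))))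
        - \<zeta> * (x0 v * (real e * x0 v ^ (e - 1)))"
      unfolding B_def by (simp add: right_diff_distrib sum_distrib_left mult_ac)
    also have "\<dots> = (\<Sum>j\<in>J. a j * (of_nat (ex j v) * monval V (ex j) x0)) - \<zeta> * real e * x0 v ^ e"
      unfolding pw split cc_def by (simp add: mult_ac)
    finally show ?thesis by simp
  qed
  show ?thesis unfolding crit_system_def
  proof
    fix v assume v: "v \<in> V"
    show "\<zeta> * real e * x0 v ^ e = (\<Sum>j\<in>J. g (c v j) * monval V (ex j) x0) - (if v = ob then \<zeta> * real e else 0)"
    proof (cases "v = ob")
      case False
      have "(\<Sum>j\<in>J. g (c v j) * monval V (ex j) x0) = (\<Sum>j\<in>J. a j * (of_nat (ex j v) * monval V (ex j) x0))"
        using False v by (intro sum.cong) (auto simp: c)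
      then show ?thesis using E[OF v False] False by simp
    next
      \<comment> \<open>An Euler-type combination: \<open>e\<close> times the equation
        \<open>G x0 = 0\<close>, minus the equations \<open>E\<close> for all other variables. The
        powers \<open>x0 i ^ e\<close> with \<open>i \<noteq> ob\<close> cancel and
        \<open>\<zeta> * e * (1 + x0 ob ^ e)\<close> remains. This explains the extra term at
        \<open>v = ob\<close> and the parameter \<open>\<zeta> * e\<close>.\<close>
      case True
      have le: "(\<Sum>i\<in>V - {ob}. ex j i) \<le> e" if "j \<in> J" for j
        using ex[OF that] sum.remove[OF V, of "ex j"] by linarith
      have "(\<Sum>j\<in>J. g (c v j) * monval V (ex j) x0)
          = (\<Sum>j\<in>J. real e * (a j * monval V (ex j) x0) - (\<Sum>i\<in>V - {ob}. a j * (of_nat (ex j i) * monval V (ex j) x0)))"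
      proof (intro sum.cong refl)
        fix j assume j: "j \<in> J"
        have "g (c v j) = (real e - (\<Sum>i\<in>V - {ob}. real (ex j i))) * a j"
          using c[OF v j] True le[OF j] by (simp add: of_nat_diff)
        then show "g (c v j) * monval V (ex j) x0 = real e * (a j * monval V (ex j) x0) - (\<Sum>i\<in>V - {ob}. a j * (of_nat (ex j i) * monval V (ex j) x0))"
          by (simp add: left_diff_distrib right_diff_distrib sum_distrib_right sum_distrib_left mult_ac)
      qed
      also have "\<dots> = real e * Q x0 - (\<Sum>i\<in>V - {ob}. \<Sum>j\<in>J. a j * (of_nat (ex j i) * monval V (ex j) x0))"
        unfolding Q sum_subtractf sum_distrib_left by (subst sum.swap) simp
      also have "\<dots> = real e * Q x0 - (\<Sum>i\<in>V - {ob}. \<zeta> * real e * x0 i ^ e)"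
        using E by simp
      also have "Q x0 = \<zeta> * (1 + (x0 ob ^ e + (\<Sum>i\<in>V - {ob}. x0 i ^ e)))"
        using G0 unfolding G sum.remove[OF V] by simp
      finally show ?thesis using True by (simp add: algebra_simps sum_distrib_left)
    qed
  qed
qed


section \<open>Approximating extremal values on slices by critical values\<close>

definition slice_eval :: "('r::comm_ring_1 \<Rightarrow> real) \<Rightarrow> nat \<Rightarrow> nat set \<Rightarrow> 'r mpoly \<Rightarrow> real \<Rightarrow> (nat \<Rightarrow> real) \<Rightarrow> real" where
  "slice_eval h s V f t x = (\<Sum>\<mu>\<in>ks f. h (lk f \<mu>) * (t ^ lk \<mu> s * monval V (lk \<mu>) x))"

text \<open>All that is kept of a quantifier-free description: membership in the slice depends only
  on the signs of the polynomials in \<open>F\<close>.\<close>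

definition sign_saturated :: "('r::comm_ring_1 \<Rightarrow> real) \<Rightarrow> nat \<Rightarrow> nat set \<Rightarrow> 'r mpoly set \<Rightarrow> real \<Rightarrow> (nat \<Rightarrow> real) set \<Rightarrow> bool" where
  "sign_saturated h s V F t K \<longleftrightarrow> (\<forall>p\<in>K. \<forall>q.
     (\<forall>f\<in>F. sgn (slice_eval h s V f t q) = sgn (slice_eval h s V f t p)) \<longrightarrow> q \<in> K)"

definition sq_index :: "'r::comm_ring_1 mpoly set \<Rightarrow> ('r mpoly \<times> (nat \<Rightarrow>\<^sub>0 nat) \<times> (nat \<Rightarrow>\<^sub>0 nat)) set" where
  "sq_index I = Sigma I (\<lambda>f. ks f \<times> ks f)"

definition sq_expo :: "'r mpoly \<times> (nat \<Rightarrow>\<^sub>0 nat) \<times> (nat \<Rightarrow>\<^sub>0 nat) \<Rightarrow> nat \<Rightarrow> nat" where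
  "sq_expo = (\<lambda>(f, \<mu>, \<nu>) i. lk \<mu> i + lk \<nu> i)"

definition sq_coeff :: "nat \<Rightarrow> 'r::comm_ring_1 mpoly \<times> (nat \<Rightarrow>\<^sub>0 nat) \<times> (nat \<Rightarrow>\<^sub>0 nat) \<Rightarrow> 'r poly" where
  "sq_coeff s = (\<lambda>(f, \<mu>, \<nu>). monom (lk f \<mu> * lk f \<nu>) (lk \<mu> s + lk \<nu> s))"

text \<open>The multipliers that \<open>local_max_crit_system\<close> asks for: differentiating by
  \<open>X_v\<close> and multiplying by \<open>X_v\<close> again brings out the exponent, and the
  equation for \<open>ob\<close> subtracts all these from \<open>e\<close> times the sum of
  squares.\<close>

definition sq_weight :: "nat set \<Rightarrow> nat \<Rightarrow> nat \<Rightarrow> nat \<Rightarrow> 'r mpoly \<times> (nat \<Rightarrow>\<^sub>0 nat) \<times> (nat \<Rightarrow>\<^sub>0 nat) \<Rightarrow> nat" where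
  "sq_weight V ob e v j = (if v = ob then e - (\<Sum>i\<in>V - {ob}. sq_expo j i) else sq_expo j v)"

definition sq_system :: "nat \<Rightarrow> nat set \<Rightarrow> nat \<Rightarrow> nat \<Rightarrow> nat \<Rightarrow> 'r::comm_ring_1 mpoly \<times> (nat \<Rightarrow>\<^sub>0 nat) \<times> (nat \<Rightarrow>\<^sub>0 nat) \<Rightarrow> 'r poly" where
  "sq_system s V ob e v j = of_nat (sq_weight V ob e v j) * sq_coeff s j"

lemma sum_squares_expand:
  assumes h: "comm_ring_hom h" and I: "finite I"
  shows "(\<Sum>f\<in>I. (slice_eval h s V f t x)\<^sup>2) = (\<Sum>j\<in>sq_index I. heval h t (sq_coeff s j) * monval V (sq_expo j) x)"
proof -
  interpret comm_ring_hom h by (rule h)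
  have "(slice_eval h s V f t x)\<^sup>2 = (\<Sum>(\<mu>, \<nu>)\<in>ks f \<times> ks f. heval h t (sq_coeff s (f, \<mu>, \<nu>)) * monval V (sq_expo (f, \<mu>, \<nu>)) x)" for f
  proof -
    have "(slice_eval h s V f t x)\<^sup>2 = (\<Sum>\<mu>\<in>ks f. \<Sum>\<nu>\<in>ks f. (h (lk f \<mu>) * (t ^ lk \<mu> s * monval V (lk \<mu>) x)) * (h (lk f \<nu>) * (t ^ lk \<nu> s * monval V (lk \<nu>) x)))"
      unfolding slice_eval_def power2_eq_square sum_product ..
    also have "\<dots> = (\<Sum>\<mu>\<in>ks f. \<Sum>\<nu>\<in>ks f. heval h t (sq_coeff s (f, \<mu>, \<nu>)) * monval V (sq_expo (f, \<mu>, \<nu>)) x)"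
      by (intro sum.cong refl)
         (simp add: sq_coeff_def sq_expo_def heval_monom[OF h] monval_add hom_mult power_add mult_ac)
    finally show ?thesis by (simp add: sum.cartesian_product)
  qed
  then show ?thesis unfolding sq_index_def using I by (simp add: sum.Sigma case_prod_beta)
qed


lemma tendsto_slice_eval:
  "conv_on V Xs l \<Longrightarrow> (\<lambda>n. slice_eval h s V f t (Xs n)) \<longlonglongrightarrow> slice_eval h s V f t l"
  unfolding slice_eval_def by (intro tendsto_sum tendsto_mult tendsto_const tendsto_monval)

lemma conv_on_shrink:
  assumes "conv_on V Ps l" "\<And>n i. i \<in> V \<Longrightarrow> \<bar>Qs n i - Ps n i\<bar> \<le> \<epsilon> n" "\<epsilon> \<longlonglongrightarrow> 0"
  shows "conv_on V Qs l"
  unfolding conv_on_def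
proof
  fix i assume i: "i \<in> V"
  have "(\<lambda>n. Qs n i - Ps n i) \<longlonglongrightarrow> 0"
    by (rule tendsto_0_le[OF assms(3), of _ 1]) (use assms(2)[OF i] in \<open>auto intro!: always_eventually order_trans[OF _ abs_ge_self]\<close>)
  then have "(\<lambda>n. (Qs n i - Ps n i) + Ps n i) \<longlonglongrightarrow> 0 + l i"
    using assms(1) i unfolding conv_on_def by (intro tendsto_add) auto
  then show "(\<lambda>n. Qs n i) \<longlonglongrightarrow> l i" by simp
qed

lemma uniform_radius:
  assumes "finite S" "\<And>f. f \<in> S \<Longrightarrow> \<exists>\<rho>>0. \<forall>p\<in>M. \<forall>q. (\<forall>i\<in>V. \<bar>q i - p i\<bar> \<le> \<rho>) \<longrightarrow> P f p q"
  shows "\<exists>\<rho>>0::real. \<forall>f\<in>S. \<forall>p\<in>M. \<forall>q. (\<forall>i\<in>V. \<bar>q i - p i\<bar> \<le> \<rho>) \<longrightarrow> P f p q"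
  using assms
proof (induction S rule: finite_induct)
  case empty show ?case by (intro exI[of _ 1]) simp
next
  case (insert f S)
  obtain \<rho> where \<rho>: "\<rho> > 0" "\<forall>f\<in>S. \<forall>p\<in>M. \<forall>q. (\<forall>i\<in>V. \<bar>q i - p i\<bar> \<le> \<rho>) \<longrightarrow> P f p q" using insert by blast
  obtain \<rho>' where \<rho>': "\<rho>' > 0" "\<forall>p\<in>M. \<forall>q. (\<forall>i\<in>V. \<bar>q i - p i\<bar> \<le> \<rho>') \<longrightarrow> P f p q" using insert.prems by blast
  show ?case
    by (intro exI[of _ "min \<rho> \<rho>'"]) (use \<rho> \<rho>' in auto)
qed

text \<open>Only the extremal value is approximated: the critical points approach some maximizer,
  not necessarily \<open>p0\<close>. The sum of squares has degree at most \<open>2 * d\<close>, so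
  \<open>e = 2 * d + 2\<close> is even and larger.\<close>

lemma extremal_value_approx:
  fixes F :: "'r::comm_ring_1 mpoly set"
  assumes V: "finite V" "ob \<in> V" and F: "finite F" and h: "comm_ring_hom h"
    and deg: "\<And>f \<mu>. f \<in> F \<Longrightarrow> \<mu> \<in> ks f \<Longrightarrow> (\<Sum>i\<in>V. lk \<mu> i) \<le> d" and e: "e = 2 * d + 2"
    and K: "seq_compact_on V K" "sign_saturated h s V F t K"
    and p0: "p0 \<in> K" "\<And>q. q \<in> K \<Longrightarrow> \<sigma> * q ob \<le> \<sigma> * p0 ob" and \<sigma>: "\<bar>\<sigma>\<bar> = (1::real)"
  shows "\<exists>I\<subseteq>F. \<exists>\<zeta> x. (\<forall>n::nat. \<zeta> n > 0) \<and> \<zeta> \<longlonglongrightarrow> 0 \<and> (\<lambda>n. x n ob) \<longlonglongrightarrow> p0 ob \<and>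
     (\<forall>n. crit_system V ob e (sq_index I) (sq_system s V ob e) sq_expo (heval h t) (\<zeta> n) (x n))"
proof -
  define ev where "ev = (\<lambda>f x. slice_eval h s V f t x)"
  have ev_lim: "conv_on V Xs l \<Longrightarrow> (\<lambda>n. ev f (Xs n)) \<longlonglongrightarrow> ev f l" for Xs l f
    unfolding ev_def by (rule tendsto_slice_eval)
  have sat: "q \<in> K" if "p \<in> K" "\<And>f. f \<in> F \<Longrightarrow> sgn (ev f q) = sgn (ev f p)" for p q
    using K(2) that unfolding sign_saturated_def ev_def by blast
  have obl: "conv_on V Xs l \<Longrightarrow> (\<lambda>n. Xs n ob) \<longlonglongrightarrow> l ob" for Xs l using V unfolding conv_on_def by blast
  have \<sigma>0: "\<sigma> \<noteq> 0" using \<sigma> by auto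
  define v where "v = p0 ob"
  define M where "M = {p \<in> K. p ob = v}"
  define zeros where "zeros = (\<lambda>p. {f \<in> F. ev f p = 0})"
  \<comment> \<open>Among the maximizers choose one at which the most polynomials vanish: this makes the set of
    maximizers with these vanishing polynomials isolated inside their common zero set.\<close>
  have "\<exists>p\<in>M. \<forall>q\<in>M. card (zeros q) \<le> card (zeros p)"
  proof -
    define S where "S = (\<lambda>p. card (zeros p)) ` M"
    have "S \<subseteq> {..card F}" unfolding S_def zeros_def using F by (auto intro: card_mono)
    then have "finite S" using finite_subset by blast
    moreover have "S \<noteq> {}" using p0 unfolding S_def M_def v_def by auto
    ultimately have "Max S \<in> S" "\<forall>k\<in>S. k \<le> Max S" by auto
    moreover from this obtain p where "p \<in> M" "Max S = card (zeros p)" unfolding S_def by blast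
    ultimately show ?thesis unfolding S_def by (intro bexI[of _ p]) auto
  qed
  then obtain p1 where p1: "p1 \<in> M" "\<And>q. q \<in> M \<Longrightarrow> card (zeros q) \<le> card (zeros p1)" by blast
  define I where "I = zeros p1"
  have IF: "I \<subseteq> F" "finite I" using F unfolding I_def zeros_def by auto
  define M' where "M' = {p \<in> M. \<forall>f\<in>I. ev f p = 0}"
  have p1M: "p1 \<in> M'" using p1 unfolding M'_def I_def zeros_def by auto
  have zM: "zeros p = I" if "p \<in> M'" for p
  proof -
    have "I \<subseteq> zeros p" using that IF unfolding M'_def zeros_def by auto
    moreover have "card (zeros p) \<le> card I" using p1(2) that unfolding M'_def I_def by auto
    moreover have "finite (zeros p)" using F unfolding zeros_def by auto
    ultimately show ?thesis by (metis card_seteq)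
  qed
  have M'K: "p \<in> K" "p ob = v" if "p \<in> M'" for p using that unfolding M'_def M_def by auto
  have compM': "\<exists>r l. strict_mono r \<and> l \<in> M' \<and> conv_on V (\<lambda>n. Ps (r n)) l" if Ps: "\<And>n. Ps n \<in> M'" for Ps :: "nat \<Rightarrow> nat \<Rightarrow> real"
  proof -
    from seq_compact_onD[where Xs = Ps, OF K(1) M'K(1)[OF Ps]] obtain r l
      where r: "strict_mono r" "l \<in> K" "conv_on V (\<lambda>n. Ps (r n)) l" by blast
    have "(\<lambda>n. Ps (r n) ob) \<longlonglongrightarrow> l ob" using obl[OF r(3)] .
    then have "l ob = v" using M'K(2)[OF Ps] by (simp add: LIMSEQ_const_iff)
    moreover have "ev f l = 0" if "f \<in> I" for f
    proof -
      have "ev f (Ps n) = 0" for n using Ps that unfolding M'_def by auto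
      then show ?thesis using ev_lim[OF r(3), of f] by (simp add: LIMSEQ_const_iff)
    qed
    ultimately have "l \<in> M'" using r(2) unfolding M'_def M_def by auto
    then show ?thesis using r by blast
  qed
  \<comment> \<open>By maximality of \<open>card I\<close> no polynomial outside \<open>I\<close>
    vanishes on \<open>M'\<close> (\<open>zM\<close>). If no radius worked, offending points would
    accumulate at a point of \<open>M'\<close>, near which \<open>f\<close> keeps its sign.\<close>
  have rad: "\<exists>\<rho>>0. \<forall>p\<in>M'. \<forall>q. (\<forall>i\<in>V. \<bar>q i - p i\<bar> \<le> \<rho>) \<longrightarrow> sgn (ev f q) = sgn (ev f p)" if f: "f \<in> F - I" for f
  proof (rule ccontr)
    assume "\<not> ?thesis"
    then have neg: "\<exists>p. p \<in> M' \<and> (\<exists>q. (\<forall>i\<in>V. \<bar>q i - p i\<bar> \<le> \<rho>) \<and> sgn (ev f q) \<noteq> sgn (ev f p))" if "\<rho> > 0" for \<rho>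
      using that by blast
    have "\<forall>n. \<exists>p. p \<in> M' \<and> (\<exists>q. (\<forall>i\<in>V. \<bar>q i - p i\<bar> \<le> inverse (real (Suc n))) \<and> sgn (ev f q) \<noteq> sgn (ev f p))"
      by (intro allI neg) simp
    from choice[OF this] obtain Ps where Ps: "\<forall>n. Ps n \<in> M' \<and> (\<exists>q. (\<forall>i\<in>V. \<bar>q i - Ps n i\<bar> \<le> inverse (real (Suc n)))
      \<and> sgn (ev f q) \<noteq> sgn (ev f (Ps n)))" ..
    then have "\<forall>n. \<exists>q. (\<forall>i\<in>V. \<bar>q i - Ps n i\<bar> \<le> inverse (real (Suc n))) \<and> sgn (ev f q) \<noteq> sgn (ev f (Ps n))" by blast
    from choice[OF this] obtain Qs where Qs: "\<forall>n. (\<forall>i\<in>V. \<bar>Qs n i - Ps n i\<bar> \<le> inverse (real (Suc n))) \<and> sgn (ev f (Qs n)) \<noteq> sgn (ev f (Ps n))" ..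
    have PQ: "Ps n \<in> M'" "i \<in> V \<Longrightarrow> \<bar>Qs n i - Ps n i\<bar> \<le> inverse (real (Suc n))"
      "sgn (ev f (Qs n)) \<noteq> sgn (ev f (Ps n))" for n i using Ps Qs by blast+
    obtain r l where r: "strict_mono r" "l \<in> M'" "conv_on V (\<lambda>n. Ps (r n)) l" using compM'[of Ps, OF PQ(1)] by blast
    have lim0: "(\<lambda>n. inverse (real (Suc (r n)))) \<longlonglongrightarrow> 0"
      using LIMSEQ_subseq_LIMSEQ[OF LIMSEQ_inverse_real_of_nat r(1)] by (simp add: o_def)
    have c2: "conv_on V (\<lambda>n. Qs (r n)) l" by (rule conv_on_shrink[OF r(3) _ lim0]) (rule PQ(2))
    have ne: "ev f l \<noteq> 0" using zM[OF r(2)] f unfolding zeros_def by auto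
    have sg: "eventually (\<lambda>n. sgn (ev f (Ys n)) = sgn (ev f l)) sequentially" if "conv_on V Ys l" for Ys
    proof (cases "ev f l > 0")
      case True
      then have "eventually (\<lambda>n. ev f (Ys n) > 0) sequentially" using ev_lim[OF that] by (rule order_tendstoD(1)[rotated])
      then show ?thesis using True by (auto elim!: eventually_mono)
    next
      case False
      then have neg: "ev f l < 0" using ne by simp
      then have "eventually (\<lambda>n. ev f (Ys n) < 0) sequentially" using ev_lim[OF that] by (rule order_tendstoD(2)[rotated])
      then show ?thesis using neg by (auto elim!: eventually_mono)
    qed
    have "eventually (\<lambda>n. sgn (ev f (Ps (r n))) = sgn (ev f (Qs (r n)))) sequentially"
      using sg[OF r(3)] sg[OF c2] by eventually_elim simp
    then obtain k where "\<forall>n\<ge>k. sgn (ev f (Ps (r n))) = sgn (ev f (Qs (r n)))" unfolding eventually_sequentially by blast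
    then show False using PQ(3)[of "r k"] by simp
  qed
  have "\<exists>\<rho>>0. \<forall>f\<in>F - I. \<forall>p\<in>M'. \<forall>q. (\<forall>i\<in>V. \<bar>q i - p i\<bar> \<le> \<rho>) \<longrightarrow> sgn (ev f q) = sgn (ev f p)"
    by (rule uniform_radius[OF finite_Diff[OF F]]) (rule rad)
  then obtain \<rho> where \<rho>: "\<rho> > 0" "\<And>f p q. f \<in> F - I \<Longrightarrow> p \<in> M' \<Longrightarrow> (\<forall>i\<in>V. \<bar>q i - p i\<bar> \<le> \<rho>) \<Longrightarrow> sgn (ev f q) = sgn (ev f p)"
    by blast
  \<comment> \<open>The closed \<open>\<rho>\<close>-neighbourhood of \<open>M'\<close>. In it a
    zero of \<open>Q\<close> has the same signs as a point of \<open>M'\<close>, so it lies in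
    \<open>K\<close>, and it can reach the level \<open>v\<close> only inside
    \<open>M'\<close>.\<close>
  define Nb where "Nb = {q. \<exists>p\<in>M'. \<forall>i\<in>V. \<bar>q i - p i\<bar> \<le> \<rho>}"
  define Q where "Q = (\<lambda>x. \<Sum>f\<in>I. (ev f x)\<^sup>2)"
  define H where "H = (\<lambda>x :: nat \<Rightarrow> real. 1 + (\<Sum>v\<in>V. x v ^ e))"
  have Q_lim: "conv_on V Xs l \<Longrightarrow> (\<lambda>n. Q (Xs n)) \<longlonglongrightarrow> Q l" for Xs l
    unfolding Q_def by (intro tendsto_sum tendsto_power ev_lim)
  have H_lim: "conv_on V Xs l \<Longrightarrow> (\<lambda>n. H (Xs n)) \<longlonglongrightarrow> H l" for Xs l
    unfolding H_def conv_on_def by (intro tendsto_intros) auto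
  have H1: "H x \<ge> 1" for x 
  proof -
    have "even e" unfolding e by simp
    then show ?thesis unfolding H_def by (simp add: sum_nonneg zero_le_even_power)
  qed
  have Q0: "Q x \<ge> 0" for x unfolding Q_def by (simp add: sum_nonneg)
  have inM': "q \<in> K \<and> \<sigma> * q ob \<le> \<sigma> * v \<and> (q ob = v \<longrightarrow> q \<in> M')" if q: "q \<in> Nb" "Q q = 0" for q
  proof -
    obtain p where p: "p \<in> M'" "\<forall>i\<in>V. \<bar>q i - p i\<bar> \<le> \<rho>" using q unfolding Nb_def by blast
    have z: "ev f q = 0" if "f \<in> I" for f
      using q(2) that IF(2) unfolding Q_def by (simp add: sum_nonneg_eq_0_iff)
    have "q \<in> K"
    proof (rule sat[OF M'K(1)[OF p(1)]])
      fix f assume f: "f \<in> F"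
      show "sgn (ev f q) = sgn (ev f p)"
      proof (cases "f \<in> I")
        case True
        then have "ev f p = 0" using p(1) unfolding M'_def by auto
        then show ?thesis using z[OF True] by simp
      next
        case False then show ?thesis using \<rho>(2)[OF _ p] f by blast
      qed
    qed
    moreover have "\<sigma> * q ob \<le> \<sigma> * v" using p0(2)[OF \<open>q \<in> K\<close>] unfolding v_def .
    ultimately show ?thesis using z unfolding M'_def M_def by simp
  qed
  have compNb: "\<exists>r l. strict_mono r \<and> l \<in> Nb \<and> conv_on V (\<lambda>n. Qs (r n)) l" if Qs: "\<And>n. Qs n \<in> Nb" for Qs :: "nat \<Rightarrow> nat \<Rightarrow> real"
  proof -
    have "\<forall>n. \<exists>p. p \<in> M' \<and> (\<forall>i\<in>V. \<bar>Qs n i - p i\<bar> \<le> \<rho>)" using Qs unfolding Nb_def by blast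
    from choice[OF this] obtain Ps where Ps0: "\<forall>n. Ps n \<in> M' \<and> (\<forall>i\<in>V. \<bar>Qs n i - Ps n i\<bar> \<le> \<rho>)" ..
    have Ps: "Ps n \<in> M'" "i \<in> V \<Longrightarrow> \<bar>Qs n i - Ps n i\<bar> \<le> \<rho>" for n i using Ps0 by blast+
    obtain r l where r: "strict_mono r" "l \<in> M'" "conv_on V (\<lambda>n. Ps (r n)) l" using compM'[of Ps, OF Ps(1)] by blast
    define D where "D = (\<lambda>n i. Qs (r n) i - Ps (r n) i)"
    have Db: "\<bar>D n i\<bar> \<le> \<rho>" if "i \<in> V" for n i using Ps(2)[OF that] unfolding D_def by simp
    obtain r' l' where r': "strict_mono r'" "conv_on V (\<lambda>n. D (r' n)) l'"
      using bolzano_on[OF V(1), of D \<rho>] Db by blast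
    define L where "L = (\<lambda>i. l' i + l i)"
    have "conv_on V (\<lambda>n. Qs ((r \<circ> r') n)) L"
      unfolding conv_on_def
    proof
      fix i assume i: "i \<in> V"
      have "(\<lambda>n. D (r' n) i + Ps (r (r' n)) i) \<longlonglongrightarrow> l' i + l i"
        using r'(2) conv_on_subseq[OF r(3) r'(1)] i unfolding conv_on_def by (intro tendsto_add) auto
      then show "(\<lambda>n. Qs ((r \<circ> r') n) i) \<longlonglongrightarrow> L i" unfolding D_def L_def by simp
    qed
    moreover have "L \<in> Nb" unfolding Nb_def
    proof (clarify, intro bexI[OF _ r(2)] ballI)
      fix i assume i: "i \<in> V"
      have "(\<lambda>n. \<bar>D (r' n) i\<bar>) \<longlonglongrightarrow> \<bar>l' i\<bar>" using r'(2) i unfolding conv_on_def by (intro tendsto_rabs) auto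
      then have "\<bar>l' i\<bar> \<le> \<rho>" by (rule LIMSEQ_le_const2) (use Db[OF i] in auto)
      then show "\<bar>L i - l i\<bar> \<le> \<rho>" unfolding L_def by simp
    qed
    moreover have "strict_mono (r \<circ> r')" using strict_mono_o r(1) r'(1) by blast
    ultimately show ?thesis by blast
  qed
  define z where "z = (\<lambda>n. inverse (real (Suc n)))"
  have z0: "z n > 0" for n unfolding z_def by simp
  have zlim: "z \<longlonglongrightarrow> 0" unfolding z_def by (rule LIMSEQ_inverse_real_of_nat)
  have obNb: "\<exists>B. \<forall>x\<in>Nb. \<bar>x ob\<bar> \<le> B"
  proof (rule seq_compact_on_bounded[OF _ V(2)])
    show "seq_compact_on V Nb" unfolding seq_compact_on_def
    proof (intro allI impI)
      fix Xs :: "nat \<Rightarrow> nat \<Rightarrow> real" assume "\<forall>n. Xs n \<in> Nb"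
      then show "\<exists>r l. strict_mono r \<and> l \<in> Nb \<and> conv_on V (\<lambda>n. Xs (r n)) l" by (intro compNb) (rule spec)
    qed
  qed
  \<comment> \<open>The set is compact and contains \<open>p1\<close>, where \<open>Q\<close>
    vanishes; so a maximizer exists and its value is not below the level \<open>v\<close>.\<close>
  have "\<exists>x\<in>{q \<in> Nb. Q q \<le> z n * H q}. \<forall>y\<in>{q \<in> Nb. Q q \<le> z n * H q}. \<sigma> * y ob \<le> \<sigma> * x ob" for n
  proof -
    obtain B where B: "\<And>x. x \<in> Nb \<Longrightarrow> \<bar>x ob\<bar> \<le> B" using obNb by blast
    show ?thesis
    proof (rule seq_compact_on_attains[where V = V and f = "\<lambda>x. \<sigma> * x ob" and B = B])
      show "seq_compact_on V {q \<in> Nb. Q q \<le> z n * H q}"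
        unfolding seq_compact_on_def
      proof (intro allI impI)
        fix Xs :: "nat \<Rightarrow> nat \<Rightarrow> real" assume Xs: "\<forall>k. Xs k \<in> {q \<in> Nb. Q q \<le> z n * H q}"
        have "Xs k \<in> Nb" for k using spec[OF Xs, of k] by simp
        from compNb[of Xs, OF this] obtain r l where r: "strict_mono r" "l \<in> Nb" "conv_on V (\<lambda>k. Xs (r k)) l" by blast
        have "Q l \<le> z n * H l"
          by (rule LIMSEQ_le[OF Q_lim[OF r(3)] tendsto_mult[OF tendsto_const H_lim[OF r(3)]]]) (use Xs in auto)
        then have "l \<in> {q \<in> Nb. Q q \<le> z n * H q}" using r(2) by simp
        then show "\<exists>r l. strict_mono r \<and> l \<in> {q \<in> Nb. Q q \<le> z n * H q} \<and> conv_on V (\<lambda>k. Xs (r k)) l"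
          using r(1,3) by (intro exI[of _ r] exI[of _ l] conjI)
      qed
      have "p1 \<in> Nb" unfolding Nb_def using p1M \<rho>(1) by (auto intro!: bexI[of _ p1])
      moreover have "Q p1 = 0" using p1M unfolding Q_def M'_def by simp
      ultimately show "{q \<in> Nb. Q q \<le> z n * H q} \<noteq> {}" using H1[of p1] z0[of n]
        by (auto intro!: exI[of _ p1] mult_nonneg_nonneg)
      show "\<sigma> * x ob \<le> B" if "x \<in> {q \<in> Nb. Q q \<le> z n * H q}" for x
      proof -
        have "\<sigma> * x ob \<le> \<bar>\<sigma> * x ob\<bar>" by simp
        also have "\<dots> = \<bar>x ob\<bar>" using \<sigma> by (simp add: abs_mult)
        finally show ?thesis using B[of x] that by simp
      qed
    qed (intro tendsto_mult tendsto_const obl)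
  qed
  then have "\<forall>n. \<exists>x. x \<in> Nb \<and> Q x \<le> z n * H x \<and> (\<forall>y. y \<in> Nb \<and> Q y \<le> z n * H y \<longrightarrow> \<sigma> * y ob \<le> \<sigma> * x ob)" by blast
  from choice[OF this] obtain Xs where Xs0: "\<forall>n. Xs n \<in> Nb \<and> Q (Xs n) \<le> z n * H (Xs n)
    \<and> (\<forall>y. y \<in> Nb \<and> Q y \<le> z n * H y \<longrightarrow> \<sigma> * y ob \<le> \<sigma> * Xs n ob)" ..
  have Xs: "Xs n \<in> Nb" "Q (Xs n) \<le> z n * H (Xs n)"
    "y \<in> Nb \<Longrightarrow> Q y \<le> z n * H y \<Longrightarrow> \<sigma> * y ob \<le> \<sigma> * Xs n ob" for n y
    using Xs0 by blast+
  have ge: "\<sigma> * v \<le> \<sigma> * Xs n ob" for n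
  proof -
    have "p1 \<in> Nb" unfolding Nb_def using p1M \<rho>(1) by (auto intro!: bexI[of _ p1])
    moreover have "Q p1 \<le> z n * H p1" using p1M H1[of p1] z0[of n] unfolding Q_def M'_def by simp
    ultimately show ?thesis using Xs(3)[of p1 n] M'K(2)[OF p1M] by simp
  qed
  \<comment> \<open>A limit \<open>l\<close> of the maximizers satisfies \<open>Q l = 0\<close> and
    reaches the level \<open>v\<close>, so it belongs to \<open>M'\<close>. Hence late maximizers
    are within \<open>\<rho> / 2\<close> of \<open>l\<close>, and balls of radius
    \<open>\<rho> / 2\<close> around them stay in \<open>Nb\<close>: they are local maxima subject
    to the single constraint on \<open>Q\<close>.\<close>
  obtain r l where r: "strict_mono r" "l \<in> Nb" "conv_on V (\<lambda>n. Xs (r n)) l" using compNb[of Xs, OF Xs(1)] by blast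
  have zr: "(\<lambda>n. z (r n)) \<longlonglongrightarrow> 0" using LIMSEQ_subseq_LIMSEQ[OF zlim r(1)] by (simp add: o_def)
  have "Q l \<le> 0 * H l"
    by (rule LIMSEQ_le[OF Q_lim[OF r(3)] tendsto_mult[OF zr H_lim[OF r(3)]]]) (use Xs(2) in auto)
  then have Ql: "Q l = 0" using Q0[of l] by simp
  have "\<sigma> * v \<le> \<sigma> * l ob"
    by (rule LIMSEQ_le_const[OF tendsto_mult[OF tendsto_const obl[OF r(3)]]]) (use ge in auto)
  then have "\<sigma> * l ob = \<sigma> * v" using inM'[OF r(2) Ql] by linarith
  then have lv: "l ob = v" using \<sigma>0 by simp
  then have lM': "l \<in> M'" using inM'[OF r(2) Ql] by blast
  have "eventually (\<lambda>n. \<forall>i\<in>V. \<bar>Xs (r n) i - l i\<bar> < \<rho> / 2) sequentially"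
  proof (intro eventually_ball_finite ballI V(1))
    fix i assume "i \<in> V"
    then have "(\<lambda>n. Xs (r n) i) \<longlonglongrightarrow> l i" using r(3) unfolding conv_on_def by blast
    then show "eventually (\<lambda>n. \<bar>Xs (r n) i - l i\<bar> < \<rho> / 2) sequentially"
      using \<rho>(1) tendstoD[of _ "l i" sequentially "\<rho> / 2"] by (simp add: dist_real_def)
  qed
  then obtain n0 where n0: "\<And>n i. n \<ge> n0 \<Longrightarrow> i \<in> V \<Longrightarrow> \<bar>Xs (r n) i - l i\<bar> < \<rho> / 2"
    by (auto simp: eventually_sequentially)
  define \<zeta> where "\<zeta> = (\<lambda>n. z (r (n + n0)) * real e)"
  define x where "x = (\<lambda>n. Xs (r (n + n0)))"
  show ?thesis
  proof (intro exI[of _ I] conjI exI[of _ \<zeta>] exI[of _ x] allI IF(1))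
    show "\<zeta> n > 0" for n unfolding \<zeta>_def e using z0 by simp
    have "(\<lambda>n. z (r (n + n0)) * real e) \<longlonglongrightarrow> 0 * real e"
      by (intro tendsto_mult tendsto_const LIMSEQ_ignore_initial_segment[OF zr])
    then show "\<zeta> \<longlonglongrightarrow> 0" unfolding \<zeta>_def by simp
    show "(\<lambda>n. x n ob) \<longlonglongrightarrow> p0 ob"
      using LIMSEQ_ignore_initial_segment[OF obl[OF r(3)], of n0] lv unfolding x_def v_def by simp
    fix n
    let ?m = "r (n + n0)"
    define G where "G = (\<lambda>y. Q y - z ?m * H y)"
    show "crit_system V ob e (sq_index I) (sq_system s V ob e) sq_expo (heval h t) (\<zeta> n) (x n)"
      unfolding \<zeta>_def
    proof (rule local_max_crit_system[where Q = Q and G = G and \<rho> = "\<rho> / 2" and \<sigma> = \<sigma> and a = "\<lambda>j. heval h t (sq_coeff s j)", OF V])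
      show "finite (sq_index I)" unfolding sq_index_def using IF(2) by (intro finite_SigmaI) auto
      show "(\<Sum>i\<in>V. sq_expo j i) < e" if jI: "j \<in> sq_index I" for j
      proof -
        obtain f \<mu> \<nu> where j: "j = (f, \<mu>, \<nu>)" "f \<in> I" "\<mu> \<in> ks f" "\<nu> \<in> ks f" using jI unfolding sq_index_def by auto
        have "(\<Sum>i\<in>V. lk \<mu> i) \<le> d" "(\<Sum>i\<in>V. lk \<nu> i) \<le> d" using deg j IF by auto
        then show ?thesis unfolding j sq_expo_def e by (simp add: sum.distrib)
      qed
      show "0 < e" "even e" unfolding e by auto
      show "z ?m > 0" "\<rho> / 2 > 0" "\<bar>\<sigma>\<bar> = 1" using z0 \<rho> \<sigma> by auto
      show "Q y = (\<Sum>j\<in>sq_index I. heval h t (sq_coeff s j) * monval V (sq_expo j) y)" for y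
        unfolding Q_def ev_def by (rule sum_squares_expand[OF h IF(2)])
      show "G y = Q y - z ?m * (1 + (\<Sum>v\<in>V. y v ^ e))" for y unfolding G_def H_def ..
      show "G (x n) \<le> 0" unfolding G_def x_def using Xs(2)[of ?m] by simp
      show "\<sigma> * y ob \<le> \<sigma> * x n ob" if y: "\<forall>i\<in>V. \<bar>y i - x n i\<bar> \<le> \<rho> / 2" "G y \<le> 0" for y
      proof -
        have "\<bar>y i - l i\<bar> \<le> \<rho>" if "i \<in> V" for i
        proof -
          have "\<bar>y i - Xs ?m i\<bar> \<le> \<rho> / 2" using y(1) that unfolding x_def by blast
          moreover have "\<bar>Xs ?m i - l i\<bar> < \<rho> / 2" using n0[of "n + n0" i] that by simp
          ultimately show ?thesis by linarith
        qed
        then have "y \<in> Nb" unfolding Nb_def using lM' by blast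
        then show ?thesis using Xs(3)[of y ?m] y(2) unfolding G_def x_def by simp
      qed
      show "heval h t (sq_system s V ob e v j) = of_nat (if v = ob then e - (\<Sum>i\<in>V - {ob}. sq_expo j i) else sq_expo j v) * heval h t (sq_coeff s j)"
        if "v \<in> V" "j \<in> sq_index I" for v j
      proof -
        interpret E: comm_ring_hom "heval h t" by (rule comm_ring_hom_heval[OF h])
        show ?thesis unfolding sq_system_def sq_weight_def by (simp add: E.hom_mult E.hom_of_nat)
      qed
    qed
  qed
qed


section \<open>A relation between the slice parameter and extremal values\<close>

lemma ring_norm_of_nat_mult:
  assumes "ring_norm N" shows "N (of_nat n * x) \<le> real n * N x"
proof (induction n)
  case 0 then show ?case by (simp add: ring_normD[OF assms])
next
  case (Suc n)
  have "N (of_nat (Suc n) * x) \<le> N x + N (of_nat n * x)"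
    using ring_normD(5)[OF assms, of x "of_nat n * x"] by (simp add: distrib_right)
  then show ?case using Suc by (simp add: distrib_right)
qed

definition mlen :: "('r::comm_ring_1 \<Rightarrow> real) \<Rightarrow> 'r mpoly \<Rightarrow> real" where
  "mlen N f = (\<Sum>\<mu>\<in>ks f. N (lk f \<mu>))"

lemma mlen_nonneg: "ring_norm N \<Longrightarrow> 0 \<le> mlen N f"
  unfolding mlen_def by (intro sum_nonneg) (auto simp: ring_normD)

lemma sq_system_norm:
  fixes I :: "'r::comm_ring_1 mpoly set"
  assumes V: "finite V" and N: "ring_norm N" and I: "finite I" and v: "v \<in> V"
    and deg: "\<And>f \<mu>. f \<in> I \<Longrightarrow> \<mu> \<in> ks f \<Longrightarrow> (\<Sum>i\<in>V. lk \<mu> i) \<le> d" and e: "e = 2 * d + 2"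
  shows "(\<Sum>j\<in>sq_index I. poly_len N (sq_system s V ob e v j)) \<le> real e * (\<Sum>f\<in>I. (mlen N f)\<^sup>2)"
proof -
  have "(\<Sum>j\<in>sq_index I. poly_len N (sq_system s V ob e v j))
      \<le> (\<Sum>j\<in>sq_index I. case j of (f, \<mu>, \<nu>) \<Rightarrow> real e * (N (lk f \<mu>) * N (lk f \<nu>)))"
  proof (rule sum_mono)
    fix j assume jI: "j \<in> sq_index I"
    obtain f \<mu> \<nu> where j: "j = (f, \<mu>, \<nu>)" "f \<in> I" "\<mu> \<in> ks f" "\<nu> \<in> ks f" using jI unfolding sq_index_def by auto
    have w: "sq_weight V ob e v j \<le> e"
    proof (cases "v = ob")
      case False
      have "lk \<mu> v \<le> (\<Sum>i\<in>V. lk \<mu> i)" "lk \<nu> v \<le> (\<Sum>i\<in>V. lk \<nu> i)" using V v by (auto intro: member_le_sum)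
      then have "lk \<mu> v \<le> d" "lk \<nu> v \<le> d" using deg[OF j(2,3)] deg[OF j(2,4)] by auto
      then show ?thesis using False unfolding sq_weight_def j sq_expo_def e by simp
    qed (simp add: sq_weight_def)
    have "poly_len N (sq_system s V ob e v j) \<le> real (sq_weight V ob e v j) * poly_len N (sq_coeff s j)"
      unfolding sq_system_def by (rule ring_norm_of_nat_mult[OF ring_norm_poly_len[OF N]])
    also have "\<dots> \<le> real e * poly_len N (sq_coeff s j)"
      using w poly_len_nonneg[OF N] by (intro mult_right_mono) auto
    also have "poly_len N (sq_coeff s j) \<le> N (lk f \<mu>) * N (lk f \<nu>)"
      unfolding sq_coeff_def j by (simp add: poly_len_monom[OF N] ring_normD(6)[OF N])
    finally show "poly_len N (sq_system s V ob e v j) \<le> (case j of (f, \<mu>, \<nu>) \<Rightarrow> real e * (N (lk f \<mu>) * N (lk f \<nu>)))"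
      unfolding j by (simp add: mult_left_mono)
  qed
  also have "\<dots> = (\<Sum>f\<in>I. \<Sum>(\<mu>, \<nu>)\<in>ks f \<times> ks f. real e * (N (lk f \<mu>) * N (lk f \<nu>)))"
    unfolding sq_index_def using I by (subst sum.Sigma) (auto simp: case_prod_beta)
  also have "\<dots> = real e * (\<Sum>f\<in>I. (mlen N f)\<^sup>2)"
  proof -
    have "(\<Sum>(\<mu>, \<nu>)\<in>ks f \<times> ks f. real e * (N (lk f \<mu>) * N (lk f \<nu>))) = real e * (mlen N f)\<^sup>2" for f
      unfolding mlen_def power2_eq_square sum_product unfolding sum_distrib_left sum.cartesian_product
      by (rule sum.cong) auto
    then show ?thesis by (simp add: sum_distrib_left)
  qed
  finally show ?thesis .
qed

text \<open>The length bound of \<open>elimination\<close> for \<open>k\<close> variables with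
  \<open>L = e * S + 1\<close>, where \<open>S\<close> stands for the sum of the squared lengths of
  the polynomials.\<close>

definition elim_bound :: "nat \<Rightarrow> nat \<Rightarrow> real \<Rightarrow> real" where
  "elim_bound k e S = fact (e ^ k) * (1 + (real e * S + 1) ^ (k * e)) ^ (e ^ k)"

text \<open>The relations \<open>R I\<close> are fixed before \<open>t\<close>, \<open>K\<close> and
  the extremal point, so that one of finitely many relations holds on every slice. Besides the least
  power of \<open>\<zeta>\<close> also the least power of \<open>t\<close> is cancelled, which is
  where \<open>t \<noteq> 0\<close> enters; \<open>R I\<close> thus stays nontrivial at
  \<open>t = 0\<close>.\<close>

theorem extremal_value_relation:
  fixes F :: "'r::idom mpoly set"
  assumes V: "finite V" "ob \<in> V" and F: "finite F" and h: "comm_ring_hom h" and N: "ring_norm N"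
    and deg: "\<And>f \<mu>. f \<in> F \<Longrightarrow> \<mu> \<in> ks f \<Longrightarrow> (\<Sum>i\<in>V. lk \<mu> i) \<le> d" and e: "e = 2 * d + 2"
    and D: "D = e ^ card V"
  shows "\<exists>R. (\<forall>I\<in>Pow F. (\<exists>i\<le>D. coeff (R I i) 0 \<noteq> 0) \<and>
       (\<forall>i. poly_len N (R I i) \<le> elim_bound (card V) e (\<Sum>f\<in>F. (mlen N f)\<^sup>2))) \<and>
     (\<forall>t K \<sigma> p. t \<noteq> 0 \<and> seq_compact_on V K \<and> sign_saturated h s V F t K \<and> p \<in> K \<and> \<bar>\<sigma>\<bar> = (1::real)
        \<and> (\<forall>q\<in>K. \<sigma> * q ob \<le> \<sigma> * p ob) \<longrightarrow> (\<exists>I\<in>Pow F. (\<Sum>i\<le>D. heval h t (R I i) * p ob ^ i) = 0))"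
proof -
  define L where "L = real e * (\<Sum>f\<in>F. (mlen N f)\<^sup>2) + 1"
  note NP = ring_norm_poly_len[OF N]
  have S0: "0 \<le> (\<Sum>f\<in>F. (mlen N f)\<^sup>2)" by (intro sum_nonneg) simp
  have L1: "1 \<le> L" unfolding L_def using S0 by simp
  have e0: "e > 0" unfolding e by simp
  have bd: "fact D * (1 + L ^ (card V * e)) ^ D = elim_bound (card V) e (\<Sum>f\<in>F. (mlen N f)\<^sup>2)"
    unfolding elim_bound_def L_def D ..
  have "\<exists>R. (\<exists>i\<le>D. coeff (R i) 0 \<noteq> 0) \<and> (\<forall>i. poly_len N (R i) \<le> fact D * (1 + L ^ (card V * e)) ^ D) \<and>
     (\<forall>t \<zeta> x v. t \<noteq> 0 \<and> (\<forall>n::nat. \<zeta> n > 0) \<and> \<zeta> \<longlonglongrightarrow> 0 \<and> (\<lambda>n. x n ob) \<longlonglongrightarrow> v \<and>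
       (\<forall>n. crit_system V ob e (sq_index I) (sq_system s V ob e) sq_expo (heval h t) (\<zeta> n) (x n)) \<longrightarrow>
       (\<Sum>i\<le>D. heval h t (R i) * v ^ i) = 0)" if I: "I \<in> Pow F" for I
  proof -
    have IF: "I \<subseteq> F" using I by simp
    then have fI: "finite I" using F finite_subset by blast
    have fJ: "finite (sq_index I)" unfolding sq_index_def using fI by (intro finite_SigmaI) auto
    have exj: "(\<Sum>i\<in>V. sq_expo j i) < e" if jI: "j \<in> sq_index I" for j
    proof -
      obtain f \<mu> \<nu> where j: "j = (f, \<mu>, \<nu>)" "f \<in> I" "\<mu> \<in> ks f" "\<nu> \<in> ks f" using jI unfolding sq_index_def by auto
      have "(\<Sum>i\<in>V. lk \<mu> i) \<le> d" "(\<Sum>i\<in>V. lk \<nu> i) \<le> d" using deg j IF by auto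
      then show ?thesis unfolding j sq_expo_def e by (simp add: sum.distrib)
    qed
    have Lv: "(\<Sum>j\<in>sq_index I. poly_len N (sq_system s V ob e v j)) + 1 \<le> L" if "v \<in> V" for v
    proof -
      have "(\<Sum>j\<in>sq_index I. poly_len N (sq_system s V ob e v j)) \<le> real e * (\<Sum>f\<in>I. (mlen N f)\<^sup>2)"
        by (rule sq_system_norm[OF V(1) N fI that _ e]) (use deg IF in blast)
      also have "\<dots> \<le> real e * (\<Sum>f\<in>F. (mlen N f)\<^sup>2)"
        by (intro mult_left_mono sum_mono2 F IF) auto
      finally show ?thesis unfolding L_def by simp
    qed
    from elimination[where c = "sq_system s V ob e" and ex = sq_expo and ob = ob and D = D and T = "card V * e",
        OF V NP fJ exj e0 Lv L1 D refl]
    obtain C :: "nat \<Rightarrow> 'r poly poly" where C: "C D \<noteq> 0"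
      "\<And>i. poly_len (poly_len N) (C i) \<le> fact D * (1 + L ^ (card V * e)) ^ D"
      "\<And>g \<zeta> x. comm_ring_hom g \<Longrightarrow> crit_system V ob e (sq_index I) (sq_system s V ob e) sq_expo g \<zeta> x \<Longrightarrow>
         (\<Sum>i\<le>D. heval g \<zeta> (C i) * x ob ^ i) = 0" by blast
    obtain j0 where j0: "\<exists>i\<le>D. coeff (C i) j0 \<noteq> 0" "\<forall>i\<le>D. \<forall>k<j0. coeff (C i) k = 0"
      using least_nonzero_coeff[of C D D] C(1) by blast
    define R0 where "R0 = (\<lambda>i. coeff (C i) j0)"
    obtain i0 where i0: "i0 \<le> D" "R0 i0 \<noteq> 0" using j0(1) unfolding R0_def by blast
    obtain j1 where j1: "\<exists>i\<le>D. coeff (R0 i) j1 \<noteq> 0" "\<forall>i\<le>D. \<forall>k<j1. coeff (R0 i) k = 0"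
      using least_nonzero_coeff[of R0 i0 D] i0 by blast
    define R where "R = (\<lambda>i. poly_shift j1 (R0 i))"
    show ?thesis
    proof (intro exI[of _ R] conjI allI impI)
      show "\<exists>i\<le>D. coeff (R i) 0 \<noteq> 0" using j1(1) unfolding R_def by (simp add: coeff_poly_shift)
      fix i
      have "poly_len N (R i) \<le> poly_len N (R0 i)" unfolding R_def by (rule poly_len_shift[OF N])
      also have "\<dots> \<le> poly_len (poly_len N) (C i)" unfolding R0_def by (rule coeff_norm_le_poly_len[OF NP])
      finally show "poly_len N (R i) \<le> fact D * (1 + L ^ (card V * e)) ^ D" using C(2)[of i] by linarith
    next
      fix t \<zeta> x v
      assume a: "t \<noteq> 0 \<and> (\<forall>n::nat. \<zeta> n > 0) \<and> \<zeta> \<longlonglongrightarrow> 0 \<and> (\<lambda>n. x n ob) \<longlonglongrightarrow> v \<and>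
         (\<forall>n. crit_system V ob e (sq_index I) (sq_system s V ob e) sq_expo (heval h t) (\<zeta> n) (x n))"
      note ht = comm_ring_hom_heval[OF h, of t]
      have "(\<Sum>i\<le>D. heval h t (R0 i) * v ^ i) = 0"
        unfolding R0_def
      proof (rule limit_relation[where g = "heval h t" and \<zeta> = \<zeta> and v = "\<lambda>n. x n ob", OF ht j0(2)])
        show "\<zeta> n \<noteq> 0" for n using a by (metis less_irrefl)
        show "\<zeta> \<longlonglongrightarrow> 0" "(\<lambda>n. x n ob) \<longlonglongrightarrow> v" using a by auto
        show "(\<Sum>i\<le>D. heval (heval h t) (\<zeta> n) (C i) * x n ob ^ i) = 0" for n using C(3)[OF ht] a by blast
      qed
      moreover have "(\<Sum>i\<le>D. heval h t (R0 i) * v ^ i) = t ^ j1 * (\<Sum>i\<le>D. heval h t (R i) * v ^ i)"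
        unfolding sum_distrib_left
      proof (intro sum.cong refl)
        fix i assume "i \<in> {..D}"
        then have "heval h t (R0 i) = t ^ j1 * heval h t (R i)"
          unfolding R_def using j1(2) by (intro heval_shift[OF h]) auto
        then show "heval h t (R0 i) * v ^ i = t ^ j1 * (heval h t (R i) * v ^ i)" by simp
      qed
      ultimately show "(\<Sum>i\<le>D. heval h t (R i) * v ^ i) = 0" using a by simp
    qed
  qed
  then have "\<forall>I\<in>Pow F. \<exists>R. (\<exists>i\<le>D. coeff (R i) 0 \<noteq> 0) \<and> (\<forall>i. poly_len N (R i) \<le> fact D * (1 + L ^ (card V * e)) ^ D) \<and>
     (\<forall>t \<zeta> x v. t \<noteq> 0 \<and> (\<forall>n::nat. \<zeta> n > 0) \<and> \<zeta> \<longlonglongrightarrow> 0 \<and> (\<lambda>n. x n ob) \<longlonglongrightarrow> v \<and>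
       (\<forall>n. crit_system V ob e (sq_index I) (sq_system s V ob e) sq_expo (heval h t) (\<zeta> n) (x n)) \<longrightarrow>
       (\<Sum>i\<le>D. heval h t (R i) * v ^ i) = 0)" by (rule ballI)
  from bchoice[OF this] obtain R where R: "\<forall>I\<in>Pow F. (\<exists>i\<le>D. coeff (R I i) 0 \<noteq> 0) \<and> (\<forall>i. poly_len N (R I i) \<le> fact D * (1 + L ^ (card V * e)) ^ D) \<and>
     (\<forall>t \<zeta> x v. t \<noteq> 0 \<and> (\<forall>n::nat. \<zeta> n > 0) \<and> \<zeta> \<longlonglongrightarrow> 0 \<and> (\<lambda>n. x n ob) \<longlonglongrightarrow> v \<and>
       (\<forall>n. crit_system V ob e (sq_index I) (sq_system s V ob e) sq_expo (heval h t) (\<zeta> n) (x n)) \<longrightarrow>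
       (\<Sum>i\<le>D. heval h t (R I i) * v ^ i) = 0)" ..
  show ?thesis
  proof (intro exI[of _ R] conjI ballI allI impI)
    fix I assume I: "I \<in> Pow F"
    show "\<exists>i\<le>D. coeff (R I i) 0 \<noteq> 0" using bspec[OF R I] by (elim conjE)
    show "poly_len N (R I i) \<le> elim_bound (card V) e (\<Sum>f\<in>F. (mlen N f)\<^sup>2)" for i
      using bspec[OF R I] unfolding bd by blast
  next
    fix t K \<sigma> p
    assume a: "t \<noteq> 0 \<and> seq_compact_on V K \<and> sign_saturated h s V F t K \<and> p \<in> K \<and> \<bar>\<sigma>\<bar> = (1::real)
        \<and> (\<forall>q\<in>K. \<sigma> * q ob \<le> \<sigma> * p ob)"
    then have "\<exists>I\<subseteq>F. \<exists>\<zeta> x. (\<forall>n::nat. \<zeta> n > 0) \<and> \<zeta> \<longlonglongrightarrow> 0 \<and> (\<lambda>n. x n ob) \<longlonglongrightarrow> p ob \<and>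
     (\<forall>n. crit_system V ob e (sq_index I) (sq_system s V ob e) sq_expo (heval h t) (\<zeta> n) (x n))"
      by (intro extremal_value_approx[where K = K and \<sigma> = \<sigma>, OF V F h deg e]) auto
    then obtain I \<zeta> x where I: "I \<in> Pow F" and z: "(\<forall>n::nat. \<zeta> n > 0) \<and> \<zeta> \<longlonglongrightarrow> 0 \<and> (\<lambda>n. x n ob) \<longlonglongrightarrow> p ob \<and>
     (\<forall>n. crit_system V ob e (sq_index I) (sq_system s V ob e) sq_expo (heval h t) (\<zeta> n) (x n))" by blast
    have "t \<noteq> 0" using a by simp
    then have "(\<Sum>i\<le>D. heval h t (R I i) * p ob ^ i) = 0"
      using bspec[OF R I] z by blast
    then show "\<exists>I\<in>Pow F. (\<Sum>i\<le>D. heval h t (R I i) * p ob ^ i) = 0" using I by blast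
  qed
qed

section \<open>The inequality deduced from the relation near \<open>t = 0\<close>\<close>

lemma heval_bound:
  assumes h: "comm_ring_hom h" and N: "ring_norm N" and hN: "\<And>c. \<bar>h c\<bar> \<le> N c" and t: "\<bar>t\<bar> \<le> 1"
  shows "\<bar>heval h t p\<bar> \<le> poly_len N p"
proof -
  have "\<bar>heval h t p\<bar> \<le> (\<Sum>i\<le>degree p. \<bar>h (coeff p i) * t ^ i\<bar>)"
    unfolding heval_alt[OF h] by (rule sum_abs)
  also have "\<dots> \<le> (\<Sum>i\<le>degree p. N (coeff p i))"
  proof (rule sum_mono)
    fix i
    have "\<bar>h (coeff p i) * t ^ i\<bar> \<le> N (coeff p i) * 1"
      unfolding abs_mult using hN t by (intro mult_mono) (auto simp: power_abs power_le_one ring_normD(3)[OF N])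
    then show "\<bar>h (coeff p i) * t ^ i\<bar> \<le> N (coeff p i)" by simp
  qed
  finally show ?thesis unfolding poly_len_def .
qed

lemma heval_tail:
  assumes h: "comm_ring_hom h"
  shows "heval h t p = h (coeff p 0) + t * heval h t (poly_shift 1 p)"
proof -
  have p: "p = [:coeff p 0:] + monom 1 1 * poly_shift 1 p"
    by (rule poly_eqI) (auto simp: coeff_monom_mult coeff_poly_shift coeff_pCons split: nat.splits)
  interpret comm_ring_hom h by (rule h)
  have "heval h t p = heval h t ([:coeff p 0:] + monom 1 1 * poly_shift 1 p)" using p by simp
  then show ?thesis by (simp add: heval_add[OF h] heval_mult[OF h] heval_const[OF h] heval_monom[OF h])
qed

text \<open>If \<open>R(0, v) = v\<^sup>k U(v)\<close> with \<open>U(0) \<noteq> 0\<close>, then \<open>R(t, v) = 0\<close> bounds \<open>|v|\<^sup>k\<close> by a multiple of \<open>|t|\<close>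
  for small \<open>v\<close>.\<close>

lemma small_root_bound:
  assumes h: "comm_ring_hom h" and N: "ring_norm N" and hN: "\<And>c. \<bar>h c\<bar> \<le> N c"
    and R: "\<exists>i\<le>D. coeff (R i) 0 \<noteq> 0" "\<And>i. poly_len N (R i) \<le> B" and B: "1 \<le> B"
    and m: "0 < m" "\<And>i. i \<le> D \<Longrightarrow> coeff (R i) 0 \<noteq> 0 \<Longrightarrow> m \<le> \<bar>h (coeff (R i) 0)\<bar>"
    and eq: "(\<Sum>i\<le>D. heval h t (R i) * v ^ i) = 0" and t: "\<bar>t\<bar> \<le> 1" and v: "\<bar>v\<bar> \<le> 1" "\<bar>v\<bar> * (2 * (D + 1) * B) \<le> m"
    and M: "D \<le> M"
  shows "\<bar>v\<bar> ^ M \<le> 2 * (D + 1) * B / m * \<bar>t\<bar>"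
proof -
  define c where "c = (\<lambda>i. h (coeff (R i) 0))"
  define k where "k = (LEAST i. i \<le> D \<and> coeff (R i) 0 \<noteq> 0)"
  have k: "k \<le> D" "coeff (R k) 0 \<noteq> 0" using LeastI_ex[OF R(1)] unfolding k_def by auto
  have below: "c i = 0" if "i < k" for i
  proof -
    have "coeff (R i) 0 = 0" using not_less_Least[of i "\<lambda>i. i \<le> D \<and> coeff (R i) 0 \<noteq> 0"] that k(1) unfolding k_def by auto
    interpret comm_ring_hom h by (rule h)
    show ?thesis unfolding c_def \<open>coeff (R i) 0 = 0\<close> by simp
  qed
  have cB: "\<bar>c i\<bar> \<le> B" for i
    using hN[of "coeff (R i) 0"] coeff_norm_le_poly_len[OF N, of "R i" 0] R(2)[of i] unfolding c_def by linarith
  define T where "T = (\<Sum>i\<le>D. heval h t (poly_shift 1 (R i)) * v ^ i)"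
  have "(\<Sum>i\<le>D. heval h t (R i) * v ^ i) = (\<Sum>i\<le>D. c i * v ^ i) + t * T"
    unfolding T_def sum_distrib_left sum.distrib[symmetric] c_def
    by (intro sum.cong refl) (subst heval_tail[OF h], simp add: algebra_simps)
  then have eq0: "(\<Sum>i\<le>D. c i * v ^ i) = - (t * T)" using eq by simp
  have TB: "\<bar>T\<bar> \<le> (D + 1) * B"
  proof -
    have "\<bar>T\<bar> \<le> (\<Sum>i\<le>D. \<bar>heval h t (poly_shift 1 (R i)) * v ^ i\<bar>)" unfolding T_def by (rule sum_abs)
    also have "\<dots> \<le> (\<Sum>i\<le>D. B)"
    proof (rule sum_mono)
      fix i
      have "\<bar>heval h t (poly_shift 1 (R i))\<bar> \<le> B"
        using heval_bound[OF h N hN t, of "poly_shift 1 (R i)"] poly_len_shift[OF N, of 1 "R i"] R(2)[of i] by linarith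
      then have "\<bar>heval h t (poly_shift 1 (R i)) * v ^ i\<bar> \<le> B * 1"
        unfolding abs_mult using v(1) B by (intro mult_mono) (auto simp: power_abs power_le_one)
      then show "\<bar>heval h t (poly_shift 1 (R i)) * v ^ i\<bar> \<le> B" by simp
    qed
    finally show ?thesis by simp
  qed
  have split: "(\<Sum>i\<le>D. c i * v ^ i) = c k * v ^ k + (\<Sum>i\<in>{k<..D}. c i * v ^ i)"
  proof -
    have "{..D} = {..<k} \<union> ({k} \<union> {k<..D})" using k(1) by auto
    then have "(\<Sum>i\<le>D. c i * v ^ i) = (\<Sum>i<k. c i * v ^ i) + (\<Sum>i\<in>{k} \<union> {k<..D}. c i * v ^ i)"
      by (simp only:) (intro sum.union_disjoint, auto)
    also have "(\<Sum>i<k. c i * v ^ i) = 0" using below by (intro sum.neutral) auto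
    finally show ?thesis by simp
  qed
  \<comment> \<open>The smallness of \<open>v\<close> makes all terms after the first nonzero one
    together at most half of its lower bound \<open>m * |v| ^ k\<close>.\<close>
  have "\<bar>\<Sum>i\<in>{k<..D}. c i * v ^ i\<bar> \<le> (\<Sum>i\<in>{k<..D}. \<bar>c i * v ^ i\<bar>)" by (rule sum_abs)
  also have "\<dots> \<le> (\<Sum>i\<in>{k<..D}. B * \<bar>v\<bar> ^ (k + 1))"
  proof (rule sum_mono)
    fix i assume "i \<in> {k<..D}"
    then have "\<bar>v\<bar> ^ i \<le> \<bar>v\<bar> ^ (k + 1)" using v(1) by (intro power_decreasing) auto
    then show "\<bar>c i * v ^ i\<bar> \<le> B * \<bar>v\<bar> ^ (k + 1)"
      unfolding abs_mult power_abs using cB B by (intro mult_mono) auto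
  qed
  also have "\<dots> = real (D - k) * (B * \<bar>v\<bar> ^ (k + 1))" by simp
  also have "\<dots> \<le> (D + 1) * (B * \<bar>v\<bar> ^ (k + 1))" using B by (intro mult_right_mono) auto
  also have "\<dots> = \<bar>v\<bar> ^ k * ((\<bar>v\<bar> * (2 * (D + 1) * B)) / 2)" by (simp add: field_simps)
  also have "\<dots> \<le> \<bar>v\<bar> ^ k * (m / 2)" using v(2) by (intro mult_left_mono) auto
  finally have tail: "\<bar>\<Sum>i\<in>{k<..D}. c i * v ^ i\<bar> \<le> \<bar>v\<bar> ^ k * (m / 2)" .
  have "m * \<bar>v\<bar> ^ k \<le> \<bar>c k * v ^ k\<bar>"
    unfolding abs_mult power_abs c_def using m(2)[OF k] by (intro mult_right_mono) auto
  then have "\<bar>v\<bar> ^ k * (m / 2) \<le> \<bar>\<Sum>i\<le>D. c i * v ^ i\<bar>"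
    unfolding split using tail by (simp add: field_simps abs_if split: if_splits)
  also have "\<dots> = \<bar>t\<bar> * \<bar>T\<bar>" unfolding eq0 by (simp add: abs_mult)
  also have "\<dots> \<le> \<bar>t\<bar> * ((D + 1) * B)" using TB by (intro mult_left_mono) auto
  finally have "\<bar>v\<bar> ^ k \<le> 2 * (D + 1) * B / m * \<bar>t\<bar>" using m(1) by (simp add: field_simps)
  moreover have "\<bar>v\<bar> ^ M \<le> \<bar>v\<bar> ^ k" using v(1) k(1) M by (intro power_decreasing) auto
  ultimately show ?thesis by linarith
qed

definition full_eval :: "('r::comm_ring_1 \<Rightarrow> real) \<Rightarrow> nat set \<Rightarrow> 'r mpoly \<Rightarrow> (nat \<Rightarrow> real) \<Rightarrow> real" where
  "full_eval h W f x = (\<Sum>\<mu>\<in>ks f. h (lk f \<mu>) * monval W (lk \<mu>) x)"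

definition saturated :: "('r::comm_ring_1 \<Rightarrow> real) \<Rightarrow> nat set \<Rightarrow> 'r mpoly set \<Rightarrow> (nat \<Rightarrow> real) set \<Rightarrow> bool" where
  "saturated h W F K \<longleftrightarrow> (\<forall>p\<in>K. \<forall>q. (\<forall>f\<in>F. sgn (full_eval h W f q) = sgn (full_eval h W f p)) \<longrightarrow> q \<in> K)"

lemma full_eval_slice:
  assumes "finite W" "y \<in> W"
  shows "full_eval h W f (x(y := t)) = slice_eval h y (W - {y}) f t x"
proof -
  have "monval W \<alpha> (x(y := t)) = t ^ \<alpha> y * monval (W - {y}) \<alpha> x" for \<alpha>
    unfolding monval_def by (subst prod.remove[OF assms]) (auto intro!: arg_cong2[where f = "(*)"] prod.cong)
  then show ?thesis unfolding full_eval_def slice_eval_def by simp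
qed

lemma seq_compact_slice:
  assumes K: "seq_compact_on W K" and y: "y \<in> W"
  shows "seq_compact_on (W - {y}) {p. p(y := t) \<in> K}"
  unfolding seq_compact_on_def
proof (intro allI impI)
  fix Xs :: "nat \<Rightarrow> nat \<Rightarrow> real" assume Xs: "\<forall>n. Xs n \<in> {p. p(y := t) \<in> K}"
  define Ys where "Ys = (\<lambda>n. (Xs n)(y := t))"
  have "Ys n \<in> K" for n using spec[OF Xs, of n] unfolding Ys_def by simp
  from seq_compact_onD[where Xs = Ys, OF K this] obtain r l
    where r: "strict_mono r" "l \<in> K" "conv_on W (\<lambda>n. Ys (r n)) l" by blast
  have "(\<lambda>n. Ys (r n) y) \<longlonglongrightarrow> l y" using r(3) y unfolding conv_on_def by blast
  then have "l y = t" unfolding Ys_def by (simp add: LIMSEQ_const_iff)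
  then have "l(y := t) = l" by auto
  moreover have "conv_on (W - {y}) (\<lambda>n. Xs (r n)) l"
    unfolding conv_on_def
  proof
    fix i assume i: "i \<in> W - {y}"
    then have "(\<lambda>n. Ys (r n) i) \<longlonglongrightarrow> l i" using r(3) unfolding conv_on_def by blast
    then show "(\<lambda>n. Xs (r n) i) \<longlonglongrightarrow> l i" using i unfolding Ys_def by simp
  qed
  ultimately show "\<exists>r l. strict_mono r \<and> l \<in> {p. p(y := t) \<in> K} \<and> conv_on (W - {y}) (\<lambda>n. Xs (r n)) l"
    using r(1,2) by (intro exI[of _ r] exI[of _ l]) simp
qed

lemma sign_saturated_slice:
  assumes "saturated h W F K" "finite W" "y \<in> W"
  shows "sign_saturated h y (W - {y}) F t {p. p(y := t) \<in> K}"
  using assms(1) unfolding sign_saturated_def saturated_def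
  by (simp add: full_eval_slice[OF assms(2,3), symmetric])

text \<open>With \<open>\<sigma>\<close> the sign of the extremal value, a maximum of the absolute
  value is also one of the linear form \<open>\<sigma> * q z\<close>, the shape that the elimination
  handles.\<close>

lemma attains_abs_max:
  assumes K: "seq_compact_on V K" "K \<noteq> {}" and z: "z \<in> V"
  shows "\<exists>q\<in>K. \<exists>\<sigma>. \<bar>\<sigma>\<bar> = (1::real) \<and> (\<forall>p\<in>K. \<bar>p z\<bar> \<le> \<bar>q z\<bar>) \<and> (\<forall>p\<in>K. \<sigma> * p z \<le> \<sigma> * q z)"
proof -
  obtain B where B: "\<forall>x\<in>K. \<bar>x z\<bar> \<le> B" using seq_compact_on_bounded[OF K(1) z] by blast
  have "\<exists>x\<in>K. \<forall>y\<in>K. \<bar>y z\<bar> \<le> \<bar>x z\<bar>"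
    by (rule seq_compact_on_attains[where f = "\<lambda>x. \<bar>x z\<bar>" and B = B, OF K])
       (use B z in \<open>auto simp: conv_on_def intro!: tendsto_rabs\<close>)
  then obtain q where q: "q \<in> K" "\<forall>p\<in>K. \<bar>p z\<bar> \<le> \<bar>q z\<bar>" by blast
  define \<sigma> :: real where "\<sigma> = (if q z \<ge> 0 then 1 else -1)"
  have \<sigma>: "\<bar>\<sigma>\<bar> = 1" "\<sigma> * q z = \<bar>q z\<bar>" unfolding \<sigma>_def by auto
  have "\<sigma> * p z \<le> \<sigma> * q z" if "p \<in> K" for p
  proof -
    have "\<sigma> * p z \<le> \<bar>\<sigma> * p z\<bar>" by simp
    also have "\<dots> = \<bar>p z\<bar>" using \<sigma> by (simp add: abs_mult)
    finally show ?thesis using q(2) that \<sigma>(2) by force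
  qed
  then show ?thesis using q \<sigma>(1) by blast
qed

text \<open>Where \<open>|p y| \<ge> t0\<close>, boundedness of \<open>z\<close> suffices. Otherwise
  the slice through \<open>p\<close> is considered: the maximum of \<open>|q z|\<close> on it is at
  most \<open>\<eta>\<close> by the choice of \<open>t0\<close>, and in this range
  \<open>small_root_bound\<close> turns the relation into an inequality. The degree \<open>D\<close>
  of the relation in the extremal value is what bounds the exponent from below.\<close>

lemma lojasiewicz_abstract:
  assumes h: "comm_ring_hom h" and N: "ring_norm N" and hN: "\<And>c. \<bar>h c\<bar> \<le> N c"
    and W: "finite W" "y \<in> W" "z \<in> W" "y \<noteq> z"
    and K: "seq_compact_on W K" "saturated h W F K"
    and R: "\<And>I. I \<in> Pow F \<Longrightarrow> \<exists>i\<le>D. coeff (R I i) 0 \<noteq> 0"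
      "\<And>I i. I \<in> Pow F \<Longrightarrow> poly_len N (R I i) \<le> B"
      "\<And>t K \<sigma> p. t \<noteq> 0 \<Longrightarrow> seq_compact_on (W - {y}) K \<Longrightarrow> sign_saturated h y (W - {y}) F t K \<Longrightarrow> p \<in> K \<Longrightarrow> \<bar>\<sigma>\<bar> = (1::real)
        \<Longrightarrow> (\<forall>q\<in>K. \<sigma> * q z \<le> \<sigma> * p z) \<Longrightarrow> (\<exists>I\<in>Pow F. (\<Sum>i\<le>D. heval h t (R I i) * p z ^ i) = 0)"
    and B: "1 \<le> B"
    and m: "0 < m" "\<And>I i. I \<in> Pow F \<Longrightarrow> i \<le> D \<Longrightarrow> coeff (R I i) 0 \<noteq> 0 \<Longrightarrow> m \<le> \<bar>h (coeff (R I i) 0)\<bar>"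
    and \<eta>: "\<eta> \<le> 1" "\<eta> * (2 * (D + 1) * B) \<le> m"
    and t0: "0 < t0" "t0 \<le> 1" "\<And>p. p \<in> K \<Longrightarrow> \<eta> \<le> \<bar>p z\<bar> \<Longrightarrow> t0 \<le> \<bar>p y\<bar>"
    and M: "1 \<le> M" "\<And>p. p \<in> K \<Longrightarrow> \<bar>p z\<bar> \<le> M"
    and zero: "\<And>p. p \<in> K \<Longrightarrow> p y = 0 \<Longrightarrow> p z = 0"
    and E: "D \<le> E" "0 < E" and p: "p \<in> K"
  shows "\<bar>p z\<bar> ^ E \<le> (M ^ E / t0 + 2 * (D + 1) * B / m) * \<bar>p y\<bar>"
proof -
  have nn: "0 \<le> 2 * (D + 1) * B / m" "0 \<le> M ^ E / t0" using B m(1) M(1) t0(1) by auto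
  consider "p y = 0" | "t0 \<le> \<bar>p y\<bar>" | "p y \<noteq> 0" "\<bar>p y\<bar> < t0" by linarith
  then show ?thesis
  proof cases
    case 1
    have "(0::real) ^ E = 0" using E(2) by (rule zero_power)
    then show ?thesis using zero[OF p 1] 1 by (simp only: abs_zero mult_zero_right order_refl)
  next
    case 2
    have "\<bar>p z\<bar> ^ E \<le> M ^ E" using M(2)[OF p] by (intro power_mono) auto
    also have "\<dots> = M ^ E / t0 * t0" using t0 by simp
    also have "\<dots> \<le> M ^ E / t0 * \<bar>p y\<bar>" using 2 nn(2) by (intro mult_left_mono)
    also have "\<dots> \<le> (M ^ E / t0 + 2 * (D + 1) * B / m) * \<bar>p y\<bar>" using nn by (intro mult_right_mono) auto
    finally show ?thesis .
  next
    case 3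
    define t where "t = p y"
    let ?K = "{q. q(y := t) \<in> K}"
    have "p(y := t) = p" unfolding t_def by auto
    then have pK: "p \<in> ?K" using p by simp
    have cK: "seq_compact_on (W - {y}) ?K" by (rule seq_compact_slice[OF K(1) W(2)])
    have sK: "sign_saturated h y (W - {y}) F t ?K" by (rule sign_saturated_slice[OF K(2) W(1,2)])
    have zV: "z \<in> W - {y}" using W by auto
    obtain q \<sigma> where q: "q \<in> ?K" "\<bar>\<sigma>\<bar> = (1::real)" "\<forall>p\<in>?K. \<bar>p z\<bar> \<le> \<bar>q z\<bar>" "\<forall>p\<in>?K. \<sigma> * p z \<le> \<sigma> * q z"
      using attains_abs_max[OF cK _ zV] pK by blast
    obtain I where I: "I \<in> Pow F" "(\<Sum>i\<le>D. heval h t (R I i) * q z ^ i) = 0"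
      using R(3)[OF _ cK sK q(1,2,4)] 3(1) unfolding t_def by blast
    have qz: "\<bar>q z\<bar> \<le> \<eta>"
    proof (rule ccontr)
      assume "\<not> \<bar>q z\<bar> \<le> \<eta>"
      moreover have "q(y := t) \<in> K" using q(1) by simp
      ultimately have "t0 \<le> \<bar>(q(y := t)) y\<bar>" using t0(3)[of "q(y := t)"] W(4) by simp
      then show False using 3(2) unfolding t_def by simp
    qed
    have "\<bar>q z\<bar> * (2 * (D + 1) * B) \<le> \<eta> * (2 * (D + 1) * B)" using qz B by (intro mult_right_mono) auto
    then have "\<bar>q z\<bar> ^ E \<le> 2 * (D + 1) * B / m * \<bar>t\<bar>"
      using small_root_bound[OF h N hN R(1)[OF I(1)] R(2)[OF I(1)] B m(1) m(2)[OF I(1)] I(2) _ _ _ E(1)] 3(2) t0(2) qz \<eta>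
      unfolding t_def by linarith
    moreover have "\<bar>p z\<bar> ^ E \<le> \<bar>q z\<bar> ^ E" using q(3) pK by (intro power_mono) auto
    moreover have "2 * (D + 1) * B / m * \<bar>t\<bar> \<le> (M ^ E / t0 + 2 * (D + 1) * B / m) * \<bar>p y\<bar>"
      unfolding t_def using nn by (intro mult_right_mono) auto
    ultimately show ?thesis by linarith
  qed
qed

lemma positive_min_on_compact:
  assumes K: "seq_compact_on W K" and W: "y \<in> W" "z \<in> W" and zero: "\<And>p. p \<in> K \<Longrightarrow> p y = 0 \<Longrightarrow> p z = 0" and \<eta>: "0 < \<eta>"
  shows "\<exists>t0>0. t0 \<le> 1 \<and> (\<forall>p\<in>K. \<eta> \<le> \<bar>p z\<bar> \<longrightarrow> t0 \<le> \<bar>p y\<bar>)"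
proof (cases "{p \<in> K. \<eta> \<le> \<bar>p z\<bar>} = {}")
  case True
  then show ?thesis by (intro exI[of _ 1]) auto
next
  case False
  have "\<exists>q\<in>{p \<in> K. \<eta> \<le> \<bar>p z\<bar>}. \<forall>p\<in>{p \<in> K. \<eta> \<le> \<bar>p z\<bar>}. - \<bar>p y\<bar> \<le> - \<bar>q y\<bar>"
  proof (rule seq_compact_on_attains[where V = W and B = 0, OF _ False])
    show "seq_compact_on W {p \<in> K. \<eta> \<le> \<bar>p z\<bar>}"
      unfolding seq_compact_on_def
    proof (intro allI impI)
      fix Xs :: "nat \<Rightarrow> nat \<Rightarrow> real" assume Xs: "\<forall>n. Xs n \<in> {p \<in> K. \<eta> \<le> \<bar>p z\<bar>}"
      have "Xs n \<in> K" for n using spec[OF Xs, of n] by simp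
      from seq_compact_onD[where Xs = Xs, OF K this] obtain r l
        where r: "strict_mono r" "l \<in> K" "conv_on W (\<lambda>n. Xs (r n)) l" by blast
      have "(\<lambda>n. \<bar>Xs (r n) z\<bar>) \<longlonglongrightarrow> \<bar>l z\<bar>" using r(3) W unfolding conv_on_def by (intro tendsto_rabs) blast
      then have "\<eta> \<le> \<bar>l z\<bar>" by (rule LIMSEQ_le_const) (use Xs in auto)
      then show "\<exists>r l. strict_mono r \<and> l \<in> {p \<in> K. \<eta> \<le> \<bar>p z\<bar>} \<and> conv_on W (\<lambda>n. Xs (r n)) l"
        using r by (intro exI[of _ r] exI[of _ l]) simp
    qed
    show "(\<lambda>n. - \<bar>Xs n y\<bar>) \<longlonglongrightarrow> - \<bar>l y\<bar>" if "conv_on W Xs l" for Xs l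
      using that W unfolding conv_on_def by (intro tendsto_minus tendsto_rabs) blast
  qed auto
  then obtain q where q: "q \<in> K" "\<eta> \<le> \<bar>q z\<bar>" "\<forall>p\<in>{p \<in> K. \<eta> \<le> \<bar>p z\<bar>}. \<bar>q y\<bar> \<le> \<bar>p y\<bar>" by auto
  then have "q y \<noteq> 0" using zero[of q] \<eta> by auto
  then show ?thesis using q by (intro exI[of _ "min 1 \<bar>q y\<bar>"]) (auto simp: min_le_iff_disj)
qed

text \<open>The least nonzero absolute value among the finitely many \<open>coeff (R I i) 0\<close>
  serves as \<open>m\<close>; it may depend on the polynomials in any way, as \<open>c\<close> is
  left unspecified.\<close>

theorem lojasiewicz_real:
  fixes F :: "real mpoly set"
  assumes W: "finite W" "y \<in> W" "z \<in> W" "y \<noteq> z"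
    and F: "finite F" "\<And>f \<mu>. f \<in> F \<Longrightarrow> \<mu> \<in> ks f \<Longrightarrow> (\<Sum>i\<in>W. lk \<mu> i) \<le> d"
    and K: "seq_compact_on W K" "saturated (\<lambda>x. x) W F K"
    and zero: "\<And>p. p \<in> K \<Longrightarrow> p y = 0 \<Longrightarrow> p z = 0"
    and E: "(2 * d + 2) ^ (card W - 1) \<le> E"
  shows "\<exists>c. \<forall>p\<in>K. \<bar>p z\<bar> ^ E \<le> c * \<bar>p y\<bar>"
proof -
  let ?h = "\<lambda>x::real. x"
  let ?V = "W - {y}"
  have h: "comm_ring_hom ?h" by unfold_locales auto
  have N: "ring_norm (\<lambda>x::real. \<bar>x\<bar>)" unfolding ring_norm_def by (auto simp: abs_mult)
  have V: "finite ?V" "z \<in> ?V" "card ?V = card W - 1" using W by auto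
  have deg: "(\<Sum>i\<in>?V. lk \<mu> i) \<le> d" if "f \<in> F" "\<mu> \<in> ks f" for f \<mu>
    using F(2)[OF that] W(1) by (meson Diff_subset le_trans sum_mono2 zero_le)
  define D where "D = (2 * d + 2) ^ card ?V"
  define B where "B = max 1 (elim_bound (card ?V) (2 * d + 2) (\<Sum>f\<in>F. (mlen (\<lambda>x. \<bar>x\<bar>) f)\<^sup>2))"
  have "\<exists>R. (\<forall>I\<in>Pow F. (\<exists>i\<le>D. coeff (R I i) 0 \<noteq> 0) \<and>
       (\<forall>i. poly_len (\<lambda>x. \<bar>x\<bar>) (R I i) \<le> elim_bound (card ?V) (2 * d + 2) (\<Sum>f\<in>F. (mlen (\<lambda>x. \<bar>x\<bar>) f)\<^sup>2))) \<and>
     (\<forall>t K \<sigma> p. t \<noteq> 0 \<and> seq_compact_on ?V K \<and> sign_saturated ?h y ?V F t K \<and> p \<in> K \<and> \<bar>\<sigma>\<bar> = (1::real)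
        \<and> (\<forall>q\<in>K. \<sigma> * q z \<le> \<sigma> * p z) \<longrightarrow> (\<exists>I\<in>Pow F. (\<Sum>i\<le>D. heval ?h t (R I i) * p z ^ i) = 0))"
    by (rule extremal_value_relation[OF V(1,2) F(1) h N _ refl D_def]) (rule deg)
  then obtain R where R: "\<forall>I\<in>Pow F. (\<exists>i\<le>D. coeff (R I i) 0 \<noteq> 0) \<and>
       (\<forall>i. poly_len (\<lambda>x. \<bar>x\<bar>) (R I i) \<le> elim_bound (card ?V) (2 * d + 2) (\<Sum>f\<in>F. (mlen (\<lambda>x. \<bar>x\<bar>) f)\<^sup>2))"
     "\<forall>t K \<sigma> p. t \<noteq> 0 \<and> seq_compact_on ?V K \<and> sign_saturated ?h y ?V F t K \<and> p \<in> K \<and> \<bar>\<sigma>\<bar> = (1::real)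
        \<and> (\<forall>q\<in>K. \<sigma> * q z \<le> \<sigma> * p z) \<longrightarrow> (\<exists>I\<in>Pow F. (\<Sum>i\<le>D. heval ?h t (R I i) * p z ^ i) = 0)"
    by (elim exE conjE)
  define S where "S = (\<lambda>(I, i). \<bar>coeff (R I i) 0\<bar>) ` (Pow F \<times> {..D}) - {0}"
  define m where "m = Min (insert 1 S)"
  have fS: "finite S" unfolding S_def using F(1) by auto
  have m0: "0 < m" unfolding m_def using fS by (subst Min_gr_iff) (auto simp: S_def)
  have mle: "m \<le> \<bar>coeff (R I i) 0\<bar>" if "I \<in> Pow F" "i \<le> D" "coeff (R I i) 0 \<noteq> 0" for I i
    unfolding m_def using that fS by (intro Min_le) (auto simp: S_def)
  define \<eta> where "\<eta> = min 1 (m / (2 * (D + 1) * B))"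
  have B1: "1 \<le> B" unfolding B_def by simp
  have pos: "0 < 2 * (D + 1) * B" using B1 by simp
  have \<eta>: "0 < \<eta>" "\<eta> \<le> 1" "\<eta> * (2 * (D + 1) * B) \<le> m"
  proof -
    show "0 < \<eta>" unfolding \<eta>_def using m0 pos by simp
    show "\<eta> \<le> 1" unfolding \<eta>_def by simp
    have "\<eta> \<le> m / (2 * (D + 1) * B)" unfolding \<eta>_def by simp
    then show "\<eta> * (2 * (D + 1) * B) \<le> m" using pos by (simp add: pos_le_divide_eq)
  qed
  have "\<exists>t0>0. t0 \<le> 1 \<and> (\<forall>p\<in>K. \<eta> \<le> \<bar>p z\<bar> \<longrightarrow> t0 \<le> \<bar>p y\<bar>)"
    by (rule positive_min_on_compact[OF K(1) W(2,3) _ \<eta>(1)]) (rule zero)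
  then obtain t0 where t0: "0 < t0" "t0 \<le> 1" "\<forall>p\<in>K. \<eta> \<le> \<bar>p z\<bar> \<longrightarrow> t0 \<le> \<bar>p y\<bar>" by blast
  obtain M0 where M0: "\<forall>p\<in>K. \<bar>p z\<bar> \<le> M0" using seq_compact_on_bounded[OF K(1) W(3)] by blast
  define M where "M = max 1 M0"
  have M: "1 \<le> M" "\<And>p. p \<in> K \<Longrightarrow> \<bar>p z\<bar> \<le> M" unfolding M_def using M0 by (auto simp: le_max_iff_disj)
  have E0: "D \<le> E" "0 < E" 
  proof -
    have "0 < (2 * d + 2) ^ (card W - 1)" by simp
    then show "D \<le> E" "0 < E" using E unfolding D_def V(3) by linarith+
  qed
  show ?thesis
  proof (intro exI ballI)
    fix p assume "p \<in> K"
    show "\<bar>p z\<bar> ^ E \<le> (M ^ E / t0 + 2 * (D + 1) * B / m) * \<bar>p y\<bar>"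
    proof (rule lojasiewicz_abstract[where R = R and \<eta> = \<eta>, OF h N _ W K])
      show "\<exists>i\<le>D. coeff (R I i) 0 \<noteq> 0" if "I \<in> Pow F" for I using bspec[OF R(1) that] by (elim conjE)
      show "poly_len (\<lambda>x. \<bar>x\<bar>) (R I i) \<le> B" if "I \<in> Pow F" for I i
        using bspec[OF R(1) that] unfolding B_def by (auto simp: le_max_iff_disj)
      show "\<exists>I\<in>Pow F. (\<Sum>i\<le>D. heval ?h t (R I i) * p z ^ i) = 0"
        if "t \<noteq> 0" "seq_compact_on ?V K" "sign_saturated ?h y ?V F t K" "p \<in> K" "\<bar>\<sigma>\<bar> = 1" "\<forall>q\<in>K. \<sigma> * q z \<le> \<sigma> * p z" for t K \<sigma> p
        using R(2) that by blast
    qed (use B1 m0 mle \<eta> t0 M zero E0 \<open>p \<in> K\<close> in auto)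
  qed
qed


section \<open>Explicit constants for integer coefficients\<close>

lemma seq_compact_on_restrict:
  assumes K: "seq_compact_on W K" and g: "\<And>Xs l. conv_on W Xs l \<Longrightarrow> (\<lambda>n. g (Xs n)) \<longlonglongrightarrow> (g l :: real)"
  shows "seq_compact_on W {p \<in> K. 0 \<le> g p}"
  unfolding seq_compact_on_def
proof (intro allI impI)
  fix Xs :: "nat \<Rightarrow> nat \<Rightarrow> real" assume Xs: "\<forall>n. Xs n \<in> {p \<in> K. 0 \<le> g p}"
  have "Xs n \<in> K" for n using spec[OF Xs, of n] by simp
  from seq_compact_onD[where Xs = Xs, OF K this] obtain r l
    where r: "strict_mono r" "l \<in> K" "conv_on W (\<lambda>n. Xs (r n)) l" by blast
  have "0 \<le> g l" by (rule LIMSEQ_le_const[OF g[OF r(3)]]) (use Xs in auto)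
  then show "\<exists>r l. strict_mono r \<and> l \<in> {p \<in> K. 0 \<le> g p} \<and> conv_on W (\<lambda>n. Xs (r n)) l"
    using r by (intro exI[of _ r] exI[of _ l]) simp
qed

definition int_norm :: "int \<Rightarrow> real" where "int_norm a = \<bar>real_of_int a\<bar>"

lemma ring_norm_int: "ring_norm int_norm"
  unfolding ring_norm_def int_norm_def by (auto simp: abs_mult)

lemma comm_ring_hom_real_of_int: "comm_ring_hom real_of_int"
  by unfold_locales auto

text \<open>The slice parameter is taken as a variable \<open>s\<close> outside \<open>W\<close>, so
  every slice is \<open>K\<close> itself. A relation holds for each \<open>t \<noteq> 0\<close>;
  since only finitely many sets \<open>I\<close> compete, one of them still holds in the limit
  \<open>t = 0\<close>, and it is an integer polynomial annihilating the extremal value.\<close>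

lemma int_extremal_value:
  fixes F :: "int mpoly set"
  assumes W: "finite W" "ob \<in> W" and F: "finite F"
    and ksW: "\<And>f \<mu>. f \<in> F \<Longrightarrow> \<mu> \<in> ks f \<Longrightarrow> ks \<mu> \<subseteq> W"
    and deg: "\<And>f \<mu>. f \<in> F \<Longrightarrow> \<mu> \<in> ks f \<Longrightarrow> (\<Sum>i\<in>W. lk \<mu> i) \<le> d"
    and K: "seq_compact_on W K" "saturated real_of_int W F K"
    and p: "p \<in> K" "\<bar>\<sigma>\<bar> = 1" "\<forall>q\<in>K. \<sigma> * q ob \<le> \<sigma> * p ob"
    and D: "D = (2 * d + 2) ^ card W"
  shows "\<exists>S :: nat \<Rightarrow> int. (\<exists>i\<le>D. S i \<noteq> 0) \<and>
     (\<forall>i. \<bar>real_of_int (S i)\<bar> \<le> elim_bound (card W) (2 * d + 2) (\<Sum>f\<in>F. (mlen int_norm f)\<^sup>2)) \<and>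
     (\<Sum>i\<le>D. real_of_int (S i) * p ob ^ i) = 0"
proof -
  note h = comm_ring_hom_real_of_int
  obtain s where s: "s \<notin> W" using ex_new_if_finite[OF infinite_UNIV_nat W(1)] by blast
  have "\<exists>R. (\<forall>I\<in>Pow F. (\<exists>i\<le>D. coeff (R I i) 0 \<noteq> 0) \<and>
       (\<forall>i. poly_len int_norm (R I i) \<le> elim_bound (card W) (2 * d + 2) (\<Sum>f\<in>F. (mlen int_norm f)\<^sup>2))) \<and>
     (\<forall>t K \<sigma> p. t \<noteq> 0 \<and> seq_compact_on W K \<and> sign_saturated real_of_int s W F t K \<and> p \<in> K \<and> \<bar>\<sigma>\<bar> = (1::real)
        \<and> (\<forall>q\<in>K. \<sigma> * q ob \<le> \<sigma> * p ob) \<longrightarrow> (\<exists>I\<in>Pow F. (\<Sum>i\<le>D. heval real_of_int t (R I i) * p ob ^ i) = 0))"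
    by (rule extremal_value_relation[OF W F h ring_norm_int _ refl D]) (rule deg)
  then obtain R where R1: "\<forall>I\<in>Pow F. (\<exists>i\<le>D. coeff (R I i) 0 \<noteq> 0) \<and>
       (\<forall>i. poly_len int_norm (R I i) \<le> elim_bound (card W) (2 * d + 2) (\<Sum>f\<in>F. (mlen int_norm f)\<^sup>2))"
    and R2: "\<forall>t K \<sigma> p. t \<noteq> 0 \<and> seq_compact_on W K \<and> sign_saturated real_of_int s W F t K \<and> p \<in> K \<and> \<bar>\<sigma>\<bar> = (1::real)
        \<and> (\<forall>q\<in>K. \<sigma> * q ob \<le> \<sigma> * p ob) \<longrightarrow> (\<exists>I\<in>Pow F. (\<Sum>i\<le>D. heval real_of_int t (R I i) * p ob ^ i) = 0)"
    by (elim exE conjE)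
  have se: "slice_eval real_of_int s W f t x = full_eval real_of_int W f x" if "f \<in> F" for f t x
  proof -
    have "lk \<mu> s = 0" if "\<mu> \<in> ks f" for \<mu>
      using ksW[OF \<open>f \<in> F\<close> that] s by (auto simp: in_keys_iff)
    then show ?thesis unfolding slice_eval_def full_eval_def by (intro sum.cong) auto
  qed
  have sat: "sign_saturated real_of_int s W F t K" for t
    using K(2) unfolding sign_saturated_def saturated_def by (simp add: se)
  define G where "G = (\<lambda>I t. \<Sum>i\<le>D. heval real_of_int t (R I i) * p ob ^ i)"
  have ex: "\<exists>I\<in>Pow F. G I t = 0" if "t \<noteq> 0" for t
    unfolding G_def using R2 that K(1) sat p by blast
  have "\<exists>I\<in>Pow F. G I 0 = 0"
  proof (rule ccontr)
    assume no: "\<not> ?thesis"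
    have "eventually (\<lambda>n. \<forall>I\<in>Pow F. G I (inverse (real (Suc n))) \<noteq> 0) sequentially"
    proof (intro eventually_ball_finite ballI)
      fix I assume "I \<in> Pow F"
      then have "G I 0 \<noteq> 0" using no by blast
      moreover have "(\<lambda>n. G I (inverse (real (Suc n)))) \<longlonglongrightarrow> G I 0"
        unfolding G_def by (intro tendsto_sum tendsto_mult tendsto_const tendsto_heval[OF h] LIMSEQ_inverse_real_of_nat)
      ultimately show "eventually (\<lambda>n. G I (inverse (real (Suc n))) \<noteq> 0) sequentially"
        by (intro tendsto_imp_eventually_ne)
    qed (use F in simp)
    then obtain n where "\<forall>I\<in>Pow F. G I (inverse (real (Suc n))) \<noteq> 0" by (auto simp: eventually_sequentially)
    moreover have "inverse (real (Suc n)) \<noteq> 0" by simp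
    ultimately show False using ex by blast
  qed
  then obtain I where I: "I \<in> Pow F" "G I 0 = 0" by blast
  show ?thesis
  proof (intro exI[of _ "\<lambda>i. coeff (R I i) 0"] conjI allI)
    show "\<exists>i\<le>D. coeff (R I i) 0 \<noteq> 0" using bspec[OF R1 I(1)] by (elim conjE)
    show "\<bar>real_of_int (coeff (R I i) 0)\<bar> \<le> elim_bound (card W) (2 * d + 2) (\<Sum>f\<in>F. (mlen int_norm f)\<^sup>2)" for i
    proof -
      have "\<bar>real_of_int (coeff (R I i) 0)\<bar> \<le> poly_len int_norm (R I i)"
        using coeff_norm_le_poly_len[OF ring_norm_int, of "R I i" 0] unfolding int_norm_def .
      then show ?thesis using bspec[OF R1 I(1)] by (meson order_trans)
    qed
    show "(\<Sum>i\<le>D. real_of_int (coeff (R I i) 0) * p ob ^ i) = 0"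
      using I(2) unfolding G_def by (simp add: heval_at_0[OF h])
  qed
qed

text \<open>A nonzero integer has absolute value at least 1. Cauchy's estimate with the leading
  coefficient then gives the upper bound, and with the lowest nonzero coefficient the lower bound
  for nonzero roots.\<close>

lemma int_root_bounds:
  fixes S :: "nat \<Rightarrow> int"
  assumes S: "\<exists>i\<le>D. S i \<noteq> 0" "\<And>i. \<bar>real_of_int (S i)\<bar> \<le> B" and B: "1 \<le> B"
    and eq: "(\<Sum>i\<le>D. real_of_int (S i) * v ^ i) = 0"
  shows "\<bar>v\<bar> \<le> (D + 1) * B" "v \<noteq> 0 \<Longrightarrow> 1 \<le> \<bar>v\<bar> * ((D + 1) * B)"
proof -
  have DB: "1 \<le> (D + 1) * B" using B by (simp add: mult_ge1_I)
  have one: "1 \<le> \<bar>real_of_int (S i)\<bar>" if "S i \<noteq> 0" for i using that by linarith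
  show "\<bar>v\<bar> \<le> (D + 1) * B"
  proof (rule ccontr)
    assume "\<not> ?thesis"
    then have big: "(D + 1) * B < \<bar>v\<bar>" by simp
    then have v1: "1 < \<bar>v\<bar>" using DB by linarith
    define P where "P = {i. i \<le> D \<and> S i \<noteq> 0}"
    have P: "finite P" "P \<noteq> {}" using S(1) unfolding P_def by auto
    define k where "k = Max P"
    have k: "k \<le> D" "S k \<noteq> 0" using Max_in[OF P] unfolding k_def P_def by auto
    have above: "S i = 0" if "k < i" "i \<le> D" for i
    proof (rule ccontr)
      assume "S i \<noteq> 0"
      then have "i \<in> P" using that unfolding P_def by simp
      then show False using Max_ge[OF P(1)] that unfolding k_def by (meson leD)
    qed
    have "(\<Sum>i\<le>D. real_of_int (S i) * v ^ i) = (\<Sum>i\<le>k. real_of_int (S i) * v ^ i)"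
      by (rule sum.mono_neutral_right) (use k above in auto)
    then have "real_of_int (S k) * v ^ k = - (\<Sum>i<k. real_of_int (S i) * v ^ i)"
      using eq by (simp add: lessThan_Suc_atMost[symmetric] add_eq_0_iff2)
    then have "\<bar>v\<bar> ^ k * 1 \<le> \<bar>\<Sum>i<k. real_of_int (S i) * v ^ i\<bar>"
      using one[OF k(2)] mult_right_mono[of 1 "\<bar>real_of_int (S k)\<bar>" "\<bar>v\<bar> ^ k"]
      by (metis abs_ge_zero abs_minus_cancel abs_mult mult.commute mult_1 power_abs zero_le_power)
    also have "\<dots> \<le> (\<Sum>i<k. B * \<bar>v\<bar> ^ (k - 1))"
    proof (rule order_trans[OF sum_abs sum_mono])
      fix i assume "i \<in> {..<k}"
      then have "\<bar>v\<bar> ^ i \<le> \<bar>v\<bar> ^ (k - 1)" using v1 by (intro power_increasing) auto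
      then show "\<bar>real_of_int (S i) * v ^ i\<bar> \<le> B * \<bar>v\<bar> ^ (k - 1)"
        unfolding abs_mult power_abs using S(2) B by (intro mult_mono) auto
    qed
    also have "\<dots> = (k * B) * \<bar>v\<bar> ^ (k - 1)" by simp
    finally have le: "\<bar>v\<bar> ^ k \<le> (k * B) * \<bar>v\<bar> ^ (k - 1)" by simp
    show False
    proof (cases k)
      case 0 then show ?thesis using le by simp
    next
      case (Suc k')
      then have "\<bar>v\<bar> * \<bar>v\<bar> ^ k' \<le> (k * B) * \<bar>v\<bar> ^ k'" using le by simp
      then have "\<bar>v\<bar> \<le> k * B" using v1 by (simp add: mult_le_cancel_right)
      also have "\<dots> \<le> (D + 1) * B" using k(1) B by (intro mult_right_mono) auto
      finally show False using big by simp
    qed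
  qed
  show "1 \<le> \<bar>v\<bar> * ((D + 1) * B)" if v: "v \<noteq> 0"
  proof (cases "\<bar>v\<bar> \<le> 1")
    case False
    then have "1 * 1 \<le> \<bar>v\<bar> * ((D + 1) * B)" using DB by (intro mult_mono) auto
    then show ?thesis by simp
  next
    case True
    define k where "k = (LEAST i. i \<le> D \<and> S i \<noteq> 0)"
    have k: "k \<le> D" "S k \<noteq> 0" using LeastI_ex[OF S(1)] unfolding k_def by auto
    have below: "S i = 0" if "i < k" for i
      using not_less_Least[of i "\<lambda>i. i \<le> D \<and> S i \<noteq> 0"] that k(1) unfolding k_def by auto
    have "(\<Sum>i\<le>D. real_of_int (S i) * v ^ i) = (\<Sum>i\<in>{k..D}. real_of_int (S i) * v ^ i)"
      by (rule sum.mono_neutral_right) (use below in auto)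
    also have "\<dots> = real_of_int (S k) * v ^ k + (\<Sum>i\<in>{k<..D}. real_of_int (S i) * v ^ i)"
      using k(1) by (subst sum.head) auto
    finally have "real_of_int (S k) * v ^ k = - (\<Sum>i\<in>{k<..D}. real_of_int (S i) * v ^ i)"
      using eq by (simp add: add_eq_0_iff2)
    then have "\<bar>v\<bar> ^ k * 1 \<le> \<bar>\<Sum>i\<in>{k<..D}. real_of_int (S i) * v ^ i\<bar>"
      using one[OF k(2)] mult_right_mono[of 1 "\<bar>real_of_int (S k)\<bar>" "\<bar>v\<bar> ^ k"]
      by (metis abs_ge_zero abs_minus_cancel abs_mult mult.commute mult_1 power_abs zero_le_power)
    also have "\<dots> \<le> (\<Sum>i\<in>{k<..D}. B * \<bar>v\<bar> ^ (k + 1))"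
    proof (rule order_trans[OF sum_abs sum_mono])
      fix i assume "i \<in> {k<..D}"
      then have "\<bar>v\<bar> ^ i \<le> \<bar>v\<bar> ^ (k + 1)" using True by (intro power_decreasing) auto
      then show "\<bar>real_of_int (S i) * v ^ i\<bar> \<le> B * \<bar>v\<bar> ^ (k + 1)"
        unfolding abs_mult power_abs using S(2) B by (intro mult_mono) auto
    qed
    also have "\<dots> = real (D - k) * (B * \<bar>v\<bar> ^ (k + 1))" by simp
    also have "\<dots> \<le> (D + 1) * (B * \<bar>v\<bar> ^ (k + 1))" using B by (intro mult_right_mono) auto
    also have "\<dots> = \<bar>v\<bar> ^ k * (\<bar>v\<bar> * ((D + 1) * B))" by simp
    finally have "\<bar>v\<bar> ^ k * 1 \<le> \<bar>v\<bar> ^ k * (\<bar>v\<bar> * ((D + 1) * B))" .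
    then show ?thesis using v by (simp add: mult_le_cancel_left)
  qed
qed

text \<open>Supplies the integer polynomials that cut out the part of a set where
  \<open>|z| \<ge> 1 / 2 ^ hh\<close> and where \<open>z\<close> and \<open>y\<close> have
  prescribed signs.\<close>

definition linpoly :: "nat \<Rightarrow> int \<Rightarrow> int \<Rightarrow> int mpoly" where
  "linpoly v a b = Poly_Mapping.single (Poly_Mapping.single v 1) a + Poly_Mapping.single 0 b"

lemma linpoly_keys: "ks (linpoly v a b) \<subseteq> {Poly_Mapping.single v 1, 0}"
  unfolding linpoly_def by (rule order_trans[OF keys_add]) simp

lemma single_neq_0: "Poly_Mapping.single v (1::nat) \<noteq> 0"
  by (metis lookup_single_eq lookup_zero zero_neq_one)

lemma linpoly_lookup:
  "lk (linpoly v a b) (Poly_Mapping.single v 1) = a" "lk (linpoly v a b) 0 = b"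
  unfolding linpoly_def lookup_add using single_neq_0[of v] by (auto simp: lookup_single when_def)

lemma full_eval_linpoly:
  assumes "finite W" "v \<in> W"
  shows "full_eval real_of_int W (linpoly v a b) x = a * x v + b"
proof -
  have "full_eval real_of_int W (linpoly v a b) x
      = (\<Sum>\<mu>\<in>{Poly_Mapping.single v 1, 0}. real_of_int (lk (linpoly v a b) \<mu>) * monval W (lk \<mu>) x)"
    unfolding full_eval_def by (rule sum.mono_neutral_left) (use linpoly_keys in \<open>auto simp: in_keys_iff\<close>)
  also have "\<dots> = a * monval W (lk (Poly_Mapping.single v 1)) x + b * monval W (lk 0) x"
    using single_neq_0[of v] by (simp add: linpoly_lookup[unfolded One_nat_def] linpoly_lookup)
  also have "monval W (lk 0) x = 1" unfolding monval_def by simp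
  also have "monval W (lk (Poly_Mapping.single v 1)) x = x v"
    unfolding monval_def by (subst prod.remove[OF assms]) (auto simp: lookup_single when_def intro!: prod.neutral)
  finally show ?thesis by simp
qed

lemma mlen_linpoly: "mlen int_norm (linpoly v a b) \<le> \<bar>real_of_int a\<bar> + \<bar>real_of_int b\<bar>"
proof -
  have "mlen int_norm (linpoly v a b) \<le> (\<Sum>\<mu>\<in>{Poly_Mapping.single v 1, 0}. int_norm (lk (linpoly v a b) \<mu>))"
    unfolding mlen_def by (rule sum_mono2) (use linpoly_keys in \<open>auto simp: int_norm_def\<close>)
  also have "\<dots> = \<bar>real_of_int a\<bar> + \<bar>real_of_int b\<bar>"
    using single_neq_0[of v] by (simp add: linpoly_lookup[unfolded One_nat_def] linpoly_lookup int_norm_def)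
  finally show ?thesis .
qed

lemma elim_bound_mono: "0 \<le> S \<Longrightarrow> S \<le> S' \<Longrightarrow> elim_bound k e S \<le> elim_bound k e S'"
  unfolding elim_bound_def
  by (intro mult_left_mono power_mono add_left_mono add_right_mono) auto

lemma elim_bound_ge_1: "0 \<le> S \<Longrightarrow> 1 \<le> elim_bound k e S"
  unfolding elim_bound_def by (intro mult_ge1_I one_le_power) (auto simp: fact_ge_1)


text \<open>Integrality makes the quantities of \<open>lojasiewicz_abstract\<close> explicit:
  \<open>m\<close> is 1, while \<open>M\<close> and \<open>1 / t0\<close> come from root bounds for
  integer polynomials annihilating the extremal values of \<open>z\<close> on \<open>K\<close> and
  of \<open>y\<close> on the part where \<open>|z| \<ge> \<eta>\<close>.\<close>

theorem lojasiewicz_int: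
  fixes F :: "int mpoly set" and d e D D' E hh :: nat
  assumes W: "finite W" "y \<in> W" "z \<in> W" "y \<noteq> z"
    and F: "finite F" "\<And>f \<mu>. f \<in> F \<Longrightarrow> \<mu> \<in> ks f \<Longrightarrow> ks \<mu> \<subseteq> W"
      "\<And>f \<mu>. f \<in> F \<Longrightarrow> \<mu> \<in> ks f \<Longrightarrow> (\<Sum>i\<in>W. lk \<mu> i) \<le> d" and d: "1 \<le> d"
    and K: "seq_compact_on W K" "saturated real_of_int W F K"
    and zero: "\<And>p. p \<in> K \<Longrightarrow> p y = 0 \<Longrightarrow> p z = 0"
    and e: "e = 2 * d + 2" and D: "D = e ^ (card W - 1)" and D': "D' = e ^ card W" and E: "D \<le> E"
    and S: "(\<Sum>f\<in>F. (mlen int_norm f)\<^sup>2) \<le> S"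
    and hh: "2 * (D + 1) * elim_bound (card W - 1) e S \<le> 2 ^ hh"
    and p: "p \<in> K"
  shows "\<bar>p z\<bar> ^ E \<le> (((D' + 1) * elim_bound (card W) e S) ^ E * ((D' + 1) * elim_bound (card W) e (S + 2 * (2 ^ hh + 1)\<^sup>2 + 1))
      + 2 ^ hh) * \<bar>p y\<bar>"
proof -
  let ?h = real_of_int
  let ?V = "W - {y}"
  note h = comm_ring_hom_real_of_int
  have V: "finite ?V" "z \<in> ?V" "card ?V = card W - 1" using W by auto
  have degV: "(\<Sum>i\<in>?V. lk \<mu> i) \<le> d" if "f \<in> F" "\<mu> \<in> ks f" for f \<mu>
    using F(3)[OF that] W(1) by (meson Diff_subset le_trans sum_mono2 zero_le)
  define SF where "SF = (\<Sum>f\<in>F. (mlen int_norm f)\<^sup>2)"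
  have SF0: "0 \<le> SF" unfolding SF_def by (intro sum_nonneg) simp
  then have S0: "0 \<le> S" using S unfolding SF_def by simp
  have SFS: "SF \<le> S" using S unfolding SF_def .
  define B1 where "B1 = elim_bound (card W - 1) e S"
  define B2 where "B2 = elim_bound (card W) e S"
  define S' where "S' = S + 2 * (2 ^ hh + 1)\<^sup>2 + 1"
  define B3 where "B3 = elim_bound (card W) e S'"
  have S'0: "0 \<le> S'" unfolding S'_def using S0 by simp
  have B: "1 \<le> B1" "1 \<le> B2" "1 \<le> B3" unfolding B1_def B2_def B3_def using S0 S'0 by (auto intro: elim_bound_ge_1)
  have DV: "D = e ^ card ?V" unfolding D V(3) ..
  have "\<exists>R. (\<forall>I\<in>Pow F. (\<exists>i\<le>D. coeff (R I i) 0 \<noteq> 0) \<and>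
       (\<forall>i. poly_len int_norm (R I i) \<le> elim_bound (card ?V) e (\<Sum>f\<in>F. (mlen int_norm f)\<^sup>2))) \<and>
     (\<forall>t K \<sigma> p. t \<noteq> 0 \<and> seq_compact_on ?V K \<and> sign_saturated ?h y ?V F t K \<and> p \<in> K \<and> \<bar>\<sigma>\<bar> = (1::real)
        \<and> (\<forall>q\<in>K. \<sigma> * q z \<le> \<sigma> * p z) \<longrightarrow> (\<exists>I\<in>Pow F. (\<Sum>i\<le>D. heval ?h t (R I i) * p z ^ i) = 0))"
    by (rule extremal_value_relation[OF V(1,2) F(1) h ring_norm_int _ e DV]) (rule degV)
  then obtain R where R1: "\<forall>I\<in>Pow F. (\<exists>i\<le>D. coeff (R I i) 0 \<noteq> 0) \<and>
       (\<forall>i. poly_len int_norm (R I i) \<le> elim_bound (card ?V) e SF)"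
    and R2: "\<forall>t K \<sigma> p. t \<noteq> 0 \<and> seq_compact_on ?V K \<and> sign_saturated ?h y ?V F t K \<and> p \<in> K \<and> \<bar>\<sigma>\<bar> = (1::real)
        \<and> (\<forall>q\<in>K. \<sigma> * q z \<le> \<sigma> * p z) \<longrightarrow> (\<exists>I\<in>Pow F. (\<Sum>i\<le>D. heval ?h t (R I i) * p z ^ i) = 0)"
    unfolding SF_def by (elim exE conjE)
  have Rlen: "poly_len int_norm (R I i) \<le> B1" if "I \<in> Pow F" for I i
  proof -
    have "poly_len int_norm (R I i) \<le> elim_bound (card ?V) e SF" using bspec[OF R1 that] by blast
    also have "\<dots> \<le> B1" unfolding B1_def V(3) by (rule elim_bound_mono[OF SF0 SFS])
    finally show ?thesis .
  qed
  \<comment> \<open>A negative power of 2, so that the condition \<open>|z| \<ge> \<eta>\<close> is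
    expressible with the integer coefficient \<open>2 ^ hh\<close>; \<open>hh\<close> was assumed
    large enough for the smallness condition with \<open>m = 1\<close>.\<close>
  define \<eta> :: real where "\<eta> = 1 / 2 ^ hh"
  have \<eta>0: "0 < \<eta>" "\<eta> \<le> 1" unfolding \<eta>_def by auto
  have \<eta>B: "\<eta> * (2 * (D + 1) * B1) \<le> 1" using hh unfolding \<eta>_def B1_def by (simp add: field_simps)
  have lenF: "(\<Sum>f\<in>F. (mlen int_norm f)\<^sup>2) = SF" unfolding SF_def ..
  have upper: "\<bar>q z\<bar> \<le> (D' + 1) * B2" if qK: "q \<in> K" for q
  proof -
    obtain x \<sigma> where x: "x \<in> K" "\<bar>\<sigma>\<bar> = (1::real)" "\<forall>p\<in>K. \<bar>p z\<bar> \<le> \<bar>x z\<bar>" "\<forall>p\<in>K. \<sigma> * p z \<le> \<sigma> * x z"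
      using attains_abs_max[OF K(1) _ W(3)] qK by blast
    have "\<exists>T :: nat \<Rightarrow> int. (\<exists>i\<le>D'. T i \<noteq> 0) \<and> (\<forall>i. \<bar>real_of_int (T i)\<bar> \<le> elim_bound (card W) (2 * d + 2) (\<Sum>f\<in>F. (mlen int_norm f)\<^sup>2)) \<and>
       (\<Sum>i\<le>D'. real_of_int (T i) * x z ^ i) = 0"
      by (rule int_extremal_value[OF W(1,3) F(1) _ _ K x(1,2,4) D'[unfolded e]]) (rule F(2), assumption+, rule F(3))
    then obtain T :: "nat \<Rightarrow> int" where T: "\<exists>i\<le>D'. T i \<noteq> 0" "\<And>i. \<bar>real_of_int (T i)\<bar> \<le> elim_bound (card W) e SF"
      "(\<Sum>i\<le>D'. real_of_int (T i) * x z ^ i) = 0" unfolding e[symmetric] lenF by blast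
    have TB: "\<bar>real_of_int (T i)\<bar> \<le> B2" for i
      using T(2)[of i] elim_bound_mono[OF SF0 SFS, of "card W" e] unfolding B2_def by linarith
    have "\<bar>x z\<bar> \<le> (D' + 1) * B2" by (rule int_root_bounds(1)[OF T(1) TB B(2) T(3)])
    then show ?thesis using x(3) qK by force
  qed
  define F' where "F' = F \<union> {linpoly z (2 ^ hh) (-1), linpoly z (2 ^ hh) 1, linpoly y 1 0}"
  have fF': "finite F'" unfolding F'_def using F(1) by simp
  have ev': "full_eval ?h W (linpoly z (2 ^ hh) (-1)) q = 2 ^ hh * q z - 1" "full_eval ?h W (linpoly z (2 ^ hh) 1) q = 2 ^ hh * q z + 1"
    "full_eval ?h W (linpoly y 1 0) q = q y" for q
    using W by (simp_all add: full_eval_linpoly)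
  have lin: "ks \<mu> \<subseteq> W \<and> (\<Sum>i\<in>W. lk \<mu> i) \<le> d" if v: "v \<in> W" and \<mu>: "\<mu> \<in> ks (linpoly v a b)" for v a b \<mu>
  proof -
    have "\<mu> = Poly_Mapping.single v 1 \<or> \<mu> = 0" using linpoly_keys \<mu> by blast
    then show ?thesis
    proof
      assume \<mu>: "\<mu> = Poly_Mapping.single v 1"
      have "(\<Sum>i\<in>W. lk \<mu> i) = (\<Sum>i\<in>W. if i = v then 1 else 0)"
        unfolding \<mu> by (intro sum.cong) (auto simp: lookup_single when_def)
      then show ?thesis using \<mu> v W(1) d by simp
    qed simp
  qed
  have F'k: "ks \<mu> \<subseteq> W" and F'd: "(\<Sum>i\<in>W. lk \<mu> i) \<le> d" if "f \<in> F'" "\<mu> \<in> ks f" for f \<mu>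
  proof -
    have "ks \<mu> \<subseteq> W \<and> (\<Sum>i\<in>W. lk \<mu> i) \<le> d"
      using that F(2,3) lin W(2,3) unfolding F'_def by blast
    then show "ks \<mu> \<subseteq> W" "(\<Sum>i\<in>W. lk \<mu> i) \<le> d" by auto
  qed
  have SF': "(\<Sum>f\<in>F'. (mlen int_norm f)\<^sup>2) \<le> S'" "0 \<le> (\<Sum>f\<in>F'. (mlen int_norm f)\<^sup>2)"
  proof -
    let ?m = "\<lambda>f. (mlen int_norm f)\<^sup>2"
    let ?L = "{linpoly z (2 ^ hh) (-1), linpoly z (2 ^ hh) 1, linpoly y 1 0}"
    have ml: "?m (linpoly v a b) \<le> (\<bar>real_of_int a\<bar> + \<bar>real_of_int b\<bar>)\<^sup>2" for v a b
      using mlen_linpoly[of v a b] mlen_nonneg[OF ring_norm_int] by (intro power_mono) auto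
    have ins: "sum ?m (insert a A) \<le> ?m a + sum ?m A" if "finite A" for a A
      using that by (cases "a \<in> A") (auto simp: insert_absorb)
    have "sum ?m ?L \<le> ?m (linpoly z (2 ^ hh) (-1)) + (?m (linpoly z (2 ^ hh) 1) + ?m (linpoly y 1 0))"
      by (rule order_trans[OF ins], simp, rule add_left_mono, rule order_trans[OF ins]) auto
    also have "\<dots> \<le> (2 ^ hh + 1)\<^sup>2 + ((2 ^ hh + 1)\<^sup>2 + 1)"
      using ml[of z "2 ^ hh" "-1"] ml[of z "2 ^ hh" 1] ml[of y 1 0] by (intro add_mono) auto
    finally have L: "sum ?m ?L \<le> 2 * (2 ^ hh + 1)\<^sup>2 + 1" by simp
    have "sum ?m F' \<le> sum ?m F + sum ?m ?L"
      unfolding F'_def using F(1) by (subst sum.union_inter[symmetric]) (auto intro!: sum_nonneg)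
    then show "(\<Sum>f\<in>F'. ?m f) \<le> S'" using L SFS unfolding S'_def lenF by linarith
    show "0 \<le> (\<Sum>f\<in>F'. ?m f)" by (intro sum_nonneg) simp
  qed
  define t0 where "t0 = 1 / ((D' + 1) * B3)"
  have D'B3: "1 \<le> (D' + 1) * B3" using B(3) by (simp add: mult_ge1_I)
  have t0: "0 < t0" "t0 \<le> 1" unfolding t0_def using D'B3 by auto
  have lower: "t0 \<le> \<bar>q y\<bar>" if qK: "q \<in> K" and q: "\<eta> \<le> \<bar>q z\<bar>" for q
  proof -
    obtain \<sigma>1 :: real where \<sigma>1: "\<sigma>1 = 1 \<or> \<sigma>1 = -1" "\<sigma>1 * q z = \<bar>q z\<bar>"
      by (cases "q z \<ge> 0") (auto intro: that[of 1] that[of "-1"])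
    obtain \<sigma>2 :: real where \<sigma>2: "\<sigma>2 = 1 \<or> \<sigma>2 = -1" "\<sigma>2 * q y = \<bar>q y\<bar>"
      by (cases "q y \<ge> 0") (auto intro: that[of 1] that[of "-1"])
    \<comment> \<open>The part of \<open>K\<close> on which \<open>z\<close> and \<open>y\<close>
      have the same signs as at \<open>q\<close>. Absolute values are linear there, so
      \<open>L\<close> is described by signs of \<open>F'\<close>, and minimizing \<open>|y|\<close>
      means maximizing \<open>- \<sigma>2\<close> times a coordinate.\<close>
    define L where "L = {p \<in> {p \<in> K. 0 \<le> \<sigma>1 * (2 ^ hh * p z) - 1}. 0 \<le> \<sigma>2 * p y}"
    have lim: "conv_on W Xs l \<Longrightarrow> v \<in> W \<Longrightarrow> (\<lambda>n. Xs n v) \<longlonglongrightarrow> l v" for Xs l v unfolding conv_on_def by blast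
    have cL: "seq_compact_on W L" unfolding L_def
      by (intro seq_compact_on_restrict K(1) tendsto_diff tendsto_mult tendsto_const lim W(2,3))
    have sL: "saturated ?h W F' L" unfolding saturated_def
    proof (intro ballI allI impI)
      fix a b assume a: "a \<in> L" and sg: "\<forall>f\<in>F'. sgn (full_eval ?h W f b) = sgn (full_eval ?h W f a)"
      have "b \<in> K" using K(2) a sg unfolding saturated_def L_def F'_def by blast
      moreover have s1: "sgn (2 ^ hh * b z - 1) = sgn (2 ^ hh * a z - 1)" "sgn (2 ^ hh * b z + 1) = sgn (2 ^ hh * a z + 1)"
        "sgn (b y) = sgn (a y)" using sg unfolding F'_def by (simp_all add: ev')
      have sgn_le: "0 \<le> u \<longleftrightarrow> 0 \<le> w" "u \<le> 0 \<longleftrightarrow> w \<le> 0" if "sgn u = sgn w" for u w :: real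
        using that by (auto simp: sgn_if split: if_splits)
      have "0 \<le> \<sigma>1 * (2 ^ hh * b z) - 1" using a sgn_le(1)[OF s1(1)] sgn_le(2)[OF s1(2)] \<sigma>1(1) unfolding L_def by auto
      moreover have "0 \<le> \<sigma>2 * b y" using a sgn_le[OF s1(3)] \<sigma>2(1) unfolding L_def by auto
      ultimately show "b \<in> L" unfolding L_def by simp
    qed
    have "1 \<le> 2 ^ hh * \<bar>q z\<bar>" using q unfolding \<eta>_def by (simp add: field_simps)
    moreover have "\<sigma>1 * (2 ^ hh * q z) = 2 ^ hh * \<bar>q z\<bar>" unfolding \<sigma>1(2)[symmetric] by (rule mult.left_commute)
    ultimately have "0 \<le> \<sigma>1 * (2 ^ hh * q z) - 1" by linarith
    then have qL: "q \<in> L" using qK \<sigma>2(2) unfolding L_def by simp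
    have yL: "\<sigma>2 * p y = \<bar>p y\<bar>" if "p \<in> L" for p using that \<sigma>2(1) unfolding L_def by auto
    have "\<exists>x\<in>L. \<forall>p\<in>L. (- \<sigma>2) * p y \<le> (- \<sigma>2) * x y"
    proof (rule seq_compact_on_attains[where V = W and B = 0, OF cL])
      show "L \<noteq> {}" using qL by blast
      show "(\<lambda>n. (- \<sigma>2) * Xs n y) \<longlonglongrightarrow> (- \<sigma>2) * l y" if "conv_on W Xs l" for Xs l
        using lim[OF that W(2)] by (intro tendsto_mult tendsto_const)
      show "(- \<sigma>2) * x y \<le> 0" if "x \<in> L" for x using that unfolding L_def by simp
    qed
    then obtain x where x: "x \<in> L" "\<forall>p\<in>L. (- \<sigma>2) * p y \<le> (- \<sigma>2) * x y" by blast
    have \<sigma>2': "\<bar>- \<sigma>2\<bar> = 1" using \<sigma>2(1) by auto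
    have xK: "x \<in> K" "x z \<noteq> 0" using x(1) unfolding L_def by auto
    then have xy: "x y \<noteq> 0" using zero by blast
    have "\<exists>T :: nat \<Rightarrow> int. (\<exists>i\<le>D'. T i \<noteq> 0) \<and> (\<forall>i. \<bar>real_of_int (T i)\<bar> \<le> elim_bound (card W) (2 * d + 2) (\<Sum>f\<in>F'. (mlen int_norm f)\<^sup>2)) \<and>
       (\<Sum>i\<le>D'. real_of_int (T i) * x y ^ i) = 0"
      by (rule int_extremal_value[OF W(1,2) fF' _ _ cL sL x(1) \<sigma>2' x(2) D'[unfolded e]]) (rule F'k, assumption+, rule F'd)
    then obtain T :: "nat \<Rightarrow> int" where T: "\<exists>i\<le>D'. T i \<noteq> 0"
      "\<And>i. \<bar>real_of_int (T i)\<bar> \<le> elim_bound (card W) e (\<Sum>f\<in>F'. (mlen int_norm f)\<^sup>2)"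
      "(\<Sum>i\<le>D'. real_of_int (T i) * x y ^ i) = 0" unfolding e[symmetric] by blast
    have TB: "\<bar>real_of_int (T i)\<bar> \<le> B3" for i
      using T(2)[of i] elim_bound_mono[OF SF'(2,1), of "card W" e] unfolding B3_def by linarith
    have "1 \<le> \<bar>x y\<bar> * ((D' + 1) * B3)" by (rule int_root_bounds(2)[OF T(1) TB B(3) T(3) xy])
    then have "t0 \<le> \<bar>x y\<bar>" unfolding t0_def using D'B3 by (simp add: pos_divide_le_eq)
    also have "\<bar>x y\<bar> \<le> \<bar>q y\<bar>" using x(2) qL yL[OF qL] yL[OF x(1)] by fastforce
    finally show ?thesis .
  qed
  have E0: "0 < E"
  proof -
    have "0 < D" unfolding D e by simp
    then show ?thesis using E by linarith
  qed
  have M: "1 \<le> (D' + 1) * B2" using B(2) by (simp add: mult_ge1_I)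
  have main: "\<bar>p z\<bar> ^ E \<le> (((D' + 1) * B2) ^ E / t0 + 2 * (D + 1) * B1 / 1) * \<bar>p y\<bar>"
  proof (rule lojasiewicz_abstract[where R = R and \<eta> = \<eta> and N = int_norm, OF h ring_norm_int _ W K])
    show "\<bar>real_of_int c\<bar> \<le> int_norm c" for c unfolding int_norm_def by simp
    show "\<exists>i\<le>D. coeff (R I i) 0 \<noteq> 0" if "I \<in> Pow F" for I using bspec[OF R1 that] by (elim conjE)
    show "poly_len int_norm (R I i) \<le> B1" if "I \<in> Pow F" for I i using Rlen[OF that] .
    show "\<exists>I\<in>Pow F. (\<Sum>i\<le>D. heval ?h t (R I i) * p z ^ i) = 0"
      if "t \<noteq> 0" "seq_compact_on ?V K" "sign_saturated ?h y ?V F t K" "p \<in> K" "\<bar>\<sigma>\<bar> = 1" "\<forall>q\<in>K. \<sigma> * q z \<le> \<sigma> * p z" for t K \<sigma> p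
      using R2 that by blast
    show "1 \<le> \<bar>real_of_int (coeff (R I i) 0)\<bar>" if "coeff (R I i) 0 \<noteq> 0" for I i using that by linarith
  qed (use B \<eta>0 \<eta>B t0 lower upper M zero E E0 p in auto)
  also have "\<dots> \<le> (((D' + 1) * B2) ^ E * ((D' + 1) * B3) + 2 ^ hh) * \<bar>p y\<bar>"
  proof (intro mult_right_mono add_mono)
    show "((D' + 1) * B2) ^ E / t0 \<le> ((D' + 1) * B2) ^ E * ((D' + 1) * B3)" unfolding t0_def by simp
    show "2 * (D + 1) * B1 / 1 \<le> 2 ^ hh" using hh unfolding B1_def by simp
  qed simp
  finally show ?thesis unfolding B2_def B3_def S'_def .
qed


section \<open>Numerical estimates for the constant\<close>

text \<open>Both \<open>k\<close> and \<open>e\<close> are at most \<open>Y = e ^ k\<close>, so the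
  exponent of 2 is bounded by a polynomial in \<open>Y\<close> that is linear in
  \<open>\<sigma>\<close>; the fifth power absorbs all lower terms.\<close>

lemma elim_bound_le_power:
  assumes "6 \<le> e" "1 \<le> k" "0 \<le> S" "S \<le> 2 ^ \<sigma>"
  shows "elim_bound k e S \<le> 2 ^ ((e ^ k) ^ 5 * (\<sigma> + 1))"
proof -
  define Y where "Y = e ^ k"
  have kY: "k \<le> Y"
  proof -
    have "k < 2 ^ k" by (rule less_exp)
    also have "(2::nat) ^ k \<le> e ^ k" using assms(1) by (intro power_mono) auto
    finally show ?thesis unfolding Y_def by simp
  qed
  have eY: "e \<le> Y" unfolding Y_def using assms by (simp add: self_le_power)
  have Y2: "2 \<le> Y" using eY assms(1) by simp
  have 1: "real e * S + 1 \<le> 2 ^ (e + \<sigma>)"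
  proof -
    have "real e * S + 1 \<le> real e * 2 ^ \<sigma> + 1 * 2 ^ \<sigma>" using assms(4) by (intro add_mono mult_left_mono) auto
    also have "\<dots> = real (e + 1) * 2 ^ \<sigma>" by (simp add: algebra_simps)
    also have "\<dots> \<le> 2 ^ e * 2 ^ \<sigma>"
    proof (rule mult_right_mono)
      have "e < 2 ^ e" by (rule less_exp)
      then have "e + 1 \<le> 2 ^ e" by linarith
      then show "real (e + 1) \<le> 2 ^ e" by (metis of_nat_le_iff of_nat_numeral of_nat_power)
    qed simp
    finally show ?thesis by (simp add: power_add)
  qed
  have "1 + (real e * S + 1) ^ (k * e) \<le> 1 + (2 ^ (e + \<sigma>)) ^ (k * e)"
    using 1 assms(3) by (intro add_left_mono power_mono) auto
  also have "\<dots> \<le> 2 * (2 ^ (e + \<sigma>)) ^ (k * e)" using one_le_power[of "2 ^ (e + \<sigma>) :: real" "k * e"] by simp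
  also have "\<dots> = 2 ^ ((e + \<sigma>) * (k * e) + 1)" by (simp flip: power_mult)
  finally have 2: "1 + (real e * S + 1) ^ (k * e) \<le> 2 ^ ((e + \<sigma>) * (k * e) + 1)" .
  have 3: "fact Y \<le> (2::real) ^ (Y * Y)"
  proof -
    have "fact Y \<le> real (Y ^ Y)" using fact_le_power[of Y, where ?'a = real] by simp
    also have "\<dots> \<le> real ((2 ^ Y) ^ Y)" using less_imp_le[OF less_exp[of Y]] by (intro of_nat_mono power_mono) auto
    finally show ?thesis by (simp flip: power_mult)
  qed
  have "elim_bound k e S \<le> 2 ^ (Y * Y) * (2 ^ ((e + \<sigma>) * (k * e) + 1)) ^ Y"
    unfolding elim_bound_def Y_def[symmetric] using 2 3 assms(3) by (intro mult_mono power_mono) auto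
  also have "\<dots> = 2 ^ (Y * Y + ((e + \<sigma>) * (k * e) + 1) * Y)" by (simp add: power_add power_mult)
  also have "\<dots> \<le> 2 ^ (Y ^ 5 * (\<sigma> + 1))"
  proof (rule power_increasing)
    have "(e + \<sigma>) * (k * e) \<le> (Y + \<sigma>) * (Y * Y)" using eY kY by (intro mult_mono add_mono) auto
    then have "Y * Y + ((e + \<sigma>) * (k * e) + 1) * Y \<le> Y * Y + ((Y + \<sigma>) * (Y * Y) + 1) * Y" by simp
    also have "\<dots> = Y ^ 2 + Y + Y ^ 4 + \<sigma> * Y ^ 3" by (simp add: algebra_simps eval_nat_numeral)
    also have "\<dots> \<le> Y ^ 4 + Y ^ 4 + Y ^ 4 + \<sigma> * Y ^ 5"
    proof -
      have "Y ^ 2 \<le> Y ^ 4" "Y ^ 3 \<le> Y ^ 5" "Y ^ 1 \<le> Y ^ 4" using Y2 by (intro power_increasing; simp)+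
      then show ?thesis by (intro add_mono mult_left_mono) auto
    qed
    also have "\<dots> \<le> Y ^ 5 * (\<sigma> + 1)"
    proof -
      have "3 * Y ^ 4 \<le> Y * Y ^ 4" using eY assms(1) by (intro mult_right_mono) auto
      also have "\<dots> = Y ^ 5" by (simp add: eval_nat_numeral)
      finally show ?thesis by (simp add: algebra_simps)
    qed
    finally show "Y * Y + ((e + \<sigma>) * (k * e) + 1) * Y \<le> Y ^ 5 * (\<sigma> + 1)" .
  qed simp
  finally show ?thesis unfolding Y_def .
qed

text \<open>The bound of \<open>lojasiewicz_int\<close> nests \<open>elim_bound\<close>: the second
  use has a sum of squares of order \<open>2 ^ (2 * hh)\<close>, where \<open>hh\<close> comes from
  the first. The exponent nevertheless stays linear in \<open>\<sigma>\<close>, which becomes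
  linearity in the bit-size.\<close>

theorem lojasiewicz_int_power:
  fixes F :: "int mpoly set" and d e E \<sigma> :: nat
  assumes W: "finite W" "y \<in> W" "z \<in> W" "y \<noteq> z"
    and F: "finite F" "\<And>f \<mu>. f \<in> F \<Longrightarrow> \<mu> \<in> ks f \<Longrightarrow> ks \<mu> \<subseteq> W"
      "\<And>f \<mu>. f \<in> F \<Longrightarrow> \<mu> \<in> ks f \<Longrightarrow> (\<Sum>i\<in>W. lk \<mu> i) \<le> d" and d: "2 \<le> d"
    and K: "seq_compact_on W K" "saturated real_of_int W F K"
    and zero: "\<And>p. p \<in> K \<Longrightarrow> p y = 0 \<Longrightarrow> p z = 0"
    and e: "e = 2 * d + 2" and Y: "Y = e ^ card W" and E: "e ^ (card W - 1) \<le> E"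
    and S: "(\<Sum>f\<in>F. (mlen int_norm f)\<^sup>2) \<le> 2 ^ \<sigma>"
    and p: "p \<in> K"
  shows "\<bar>p z\<bar> ^ E \<le> 2 ^ (3 * Y ^ 5 * (\<sigma> + 1) * (E + 11 * Y ^ 5)) * \<bar>p y\<bar>"
proof -
  define D where "D = e ^ (card W - 1)"
  \<comment> \<open>The three summands account for the factors 2, \<open>D + 1\<close> and
    \<open>elim_bound\<close> in \<open>hhb\<close>.\<close>
  define hh where "hh = 1 + Y + Y ^ 5 * (\<sigma> + 1)"
  have e6: "6 \<le> e" using d e by simp
  have "card {y, z} \<le> card W" using W by (intro card_mono) auto
  then have cW: "2 \<le> card W" using W(4) by simp
  have DY: "D \<le> Y" unfolding D_def Y using e6 by (intro power_increasing) auto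
  have Y1: "1 \<le> Y" unfolding Y using e6 by simp
  have Yexp: "real (Y + 1) \<le> 2 ^ Y"
  proof -
    have "Y < 2 ^ Y" by (rule less_exp)
    then have "Y + 1 \<le> 2 ^ Y" by linarith
    then show ?thesis by (metis of_nat_le_iff of_nat_numeral of_nat_power)
  qed
  have eb: "elim_bound k e S' \<le> 2 ^ (Y ^ 5 * (\<tau> + 1))" if "1 \<le> k" "k \<le> card W" "0 \<le> S'" "S' \<le> 2 ^ \<tau>" for k S' \<tau>
  proof -
    have "elim_bound k e S' \<le> 2 ^ ((e ^ k) ^ 5 * (\<tau> + 1))" by (rule elim_bound_le_power[OF e6 that(1,3,4)])
    also have "\<dots> \<le> 2 ^ (Y ^ 5 * (\<tau> + 1))"
      unfolding Y using that(2) e6 by (intro power_increasing mult_right_mono power_mono) auto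
    finally show ?thesis .
  qed
  have hhb: "2 * (D + 1) * elim_bound (card W - 1) e (2 ^ \<sigma>) \<le> 2 ^ hh"
  proof -
    have "2 * real (D + 1) * elim_bound (card W - 1) e (2 ^ \<sigma>) \<le> 2 * 2 ^ Y * 2 ^ (Y ^ 5 * (\<sigma> + 1))"
      using eb[of "card W - 1" "2 ^ \<sigma>" \<sigma>] cW Yexp DY elim_bound_ge_1[of "2 ^ \<sigma>" "card W - 1" e]
      by (intro mult_mono) auto
    also have "\<dots> = 2 ^ hh" unfolding hh_def by (simp add: power_add)
    finally show ?thesis by simp
  qed
  define S' :: real where "S' = 2 ^ \<sigma> + 2 * (2 ^ hh + 1)\<^sup>2 + 1"
  have hh\<sigma>: "\<sigma> \<le> hh" "Y + Y ^ 5 * (\<sigma> + 1) \<le> hh" "1 \<le> hh"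
  proof -
    have "1 * (\<sigma> + 1) \<le> Y ^ 5 * (\<sigma> + 1)" using Y1 by (intro mult_right_mono) auto
    then have "\<sigma> \<le> Y ^ 5 * (\<sigma> + 1)" by simp
    then show "\<sigma> \<le> hh" unfolding hh_def by (rule trans_le_add2)
  qed (auto simp: hh_def)
  have S': "0 \<le> S'" "S' \<le> 2 ^ (2 * hh + 5)"
  proof -
    show "0 \<le> S'" unfolding S'_def by simp
    have "(2 ^ hh + 1 :: real) \<le> 2 * 2 ^ hh" by simp
    then have "(2 ^ hh + 1 :: real)\<^sup>2 \<le> (2 * 2 ^ hh)\<^sup>2" by (intro power_mono) auto
    also have "\<dots> = 4 * 2 ^ (2 * hh)" by (simp add: power_mult_distrib mult.commute flip: power_mult)
    finally have a: "2 * (2 ^ hh + 1 :: real)\<^sup>2 \<le> 8 * 2 ^ (2 * hh)" by simp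
    have b: "(2::real) ^ \<sigma> \<le> 2 ^ (2 * hh)" using hh\<sigma>(1) by (intro power_increasing) auto
    have c: "(1::real) \<le> 2 ^ (2 * hh)" by simp
    have "S' \<le> 10 * 2 ^ (2 * hh)" unfolding S'_def using a b c by linarith
    also have "\<dots> \<le> 2 ^ (2 * hh + 5)" by (simp add: power_add)
    finally show "S' \<le> 2 ^ (2 * hh + 5)" .
  qed
  have "\<bar>p z\<bar> ^ E \<le> (((Y + 1) * elim_bound (card W) e (2 ^ \<sigma>)) ^ E * ((Y + 1) * elim_bound (card W) e (2 ^ \<sigma> + 2 * (2 ^ hh + 1)\<^sup>2 + 1))
      + 2 ^ hh) * \<bar>p y\<bar>"
  proof (rule lojasiewicz_int[where F = F and D = D and d = d and K = K, OF W F(1) _ _ _ K _ e D_def Y _ S hhb p])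
    show "ks \<mu> \<subseteq> W" "(\<Sum>i\<in>W. lk \<mu> i) \<le> d" if "f \<in> F" "\<mu> \<in> ks f" for f \<mu> using F(2,3) that by blast+
    show "p z = 0" if "p \<in> K" "p y = 0" for p using zero that by blast
    show "1 \<le> d" "D \<le> E" using d E unfolding D_def by auto
  qed
  also have "\<dots> \<le> 2 ^ (3 * Y ^ 5 * (\<sigma> + 1) * (E + 11 * Y ^ 5)) * \<bar>p y\<bar>"
  proof (rule mult_right_mono)
    have b2: "(Y + 1) * elim_bound (card W) e (2 ^ \<sigma>) \<le> 2 ^ hh"
    proof -
      have "real (Y + 1) * elim_bound (card W) e (2 ^ \<sigma>) \<le> 2 ^ Y * 2 ^ (Y ^ 5 * (\<sigma> + 1))"
        using eb[of "card W" "2 ^ \<sigma>" \<sigma>] cW Yexp elim_bound_ge_1[of "2 ^ \<sigma>" "card W" e] by (intro mult_mono) auto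
      also have "\<dots> = 2 ^ (Y + Y ^ 5 * (\<sigma> + 1))" by (simp add: power_add)
      also have "\<dots> \<le> 2 ^ hh" using hh\<sigma>(2) by (intro power_increasing) auto
      finally show ?thesis .
    qed
    have b3: "(Y + 1) * elim_bound (card W) e S' \<le> 2 ^ (Y + Y ^ 5 * (2 * hh + 6))"
    proof -
      have "real (Y + 1) * elim_bound (card W) e S' \<le> 2 ^ Y * 2 ^ (Y ^ 5 * (2 * hh + 5 + 1))"
        using eb[of "card W" S' "2 * hh + 5"] cW Yexp S' elim_bound_ge_1[of S' "card W" e] by (intro mult_mono) auto
      moreover have "2 * hh + 5 + 1 = 2 * hh + 6" by simp
      ultimately show ?thesis by (simp only: power_add)
    qed
    have "((Y + 1) * elim_bound (card W) e (2 ^ \<sigma>)) ^ E * ((Y + 1) * elim_bound (card W) e S') + 2 ^ hh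
        \<le> (2 ^ hh) ^ E * 2 ^ (Y + Y ^ 5 * (2 * hh + 6)) + 2 ^ hh"
      using b2 b3 elim_bound_ge_1[of "2 ^ \<sigma>" "card W" e] elim_bound_ge_1[of S' "card W" e] S'(1)
      by (intro add_mono mult_mono power_mono) auto
    also have "\<dots> = 2 ^ (hh * E + (Y + Y ^ 5 * (2 * hh + 6))) + 2 ^ hh" by (simp add: power_add flip: power_mult)
    also have "\<dots> \<le> 2 ^ (hh * E + (Y + Y ^ 5 * (2 * hh + 6)) + hh) + 2 ^ (hh * E + (Y + Y ^ 5 * (2 * hh + 6)) + hh)"
      by (rule add_mono; rule power_increasing; simp)
    also have "\<dots> = 2 ^ (hh * E + (Y + Y ^ 5 * (2 * hh + 6)) + hh + 1)" by simp
    also have "\<dots> \<le> 2 ^ (3 * Y ^ 5 * (\<sigma> + 1) * (E + 11 * Y ^ 5))"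
    proof (rule power_increasing)
      have Y5: "1 \<le> Y ^ 5" "Y \<le> Y ^ 5" using Y1 by (auto simp: self_le_power)
      have h1: "hh \<le> 3 * Y ^ 5 * (\<sigma> + 1)"
      proof -
        have "1 \<le> Y ^ 5 * (\<sigma> + 1)" "Y \<le> Y ^ 5 * (\<sigma> + 1)"
          using Y5 mult_mono[of 1 "Y ^ 5" 1 "\<sigma> + 1"] mult_mono[of Y "Y ^ 5" 1 "\<sigma> + 1"] by auto
        then show ?thesis unfolding hh_def by linarith
      qed
      have "Y + Y ^ 5 * (2 * hh + 6) + hh + 1 \<le> Y ^ 5 * hh * 11"
      proof -
        have a: "Y ^ 5 * (2 * hh + 6) \<le> Y ^ 5 * (8 * hh)" using hh\<sigma>(3) by (intro mult_left_mono) auto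
        have b: "Y \<le> Y ^ 5 * hh" using mult_mono[of Y "Y ^ 5" 1 hh] Y5 hh\<sigma>(3) by auto
        have c: "hh \<le> Y ^ 5 * hh" using mult_mono[of 1 "Y ^ 5" hh hh] Y5 by auto
        have d: "1 \<le> Y ^ 5 * hh" using mult_mono[of 1 "Y ^ 5" 1 hh] Y5 hh\<sigma>(3) by auto
        have "Y ^ 5 * (8 * hh) = 8 * (Y ^ 5 * hh)" by simp
        then show ?thesis using a b c d by linarith
      qed
      then have "hh * E + (Y + Y ^ 5 * (2 * hh + 6)) + hh + 1 \<le> hh * (E + 11 * Y ^ 5)" by (simp add: algebra_simps)
      also have "\<dots> \<le> 3 * Y ^ 5 * (\<sigma> + 1) * (E + 11 * Y ^ 5)" using h1 by (rule mult_right_mono) simp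
      finally show "hh * E + (Y + Y ^ 5 * (2 * hh + 6)) + hh + 1 \<le> 3 * Y ^ 5 * (\<sigma> + 1) * (E + 11 * Y ^ 5)" .
    qed simp
    finally show "((Y + 1) * elim_bound (card W) e (2 ^ \<sigma>)) ^ E * ((Y + 1) * elim_bound (card W) e (2 ^ \<sigma> + 2 * (2 ^ hh + 1)\<^sup>2 + 1)) + 2 ^ hh
      \<le> 2 ^ (3 * Y ^ 5 * (\<sigma> + 1) * (E + 11 * Y ^ 5))" unfolding S'_def .
  qed simp
  finally show ?thesis .
qed

section \<open>Transfer with quantifiers over vectors\<close>

text \<open>Vectors are functions on \<open>nat\<close>. Dependence on the entries up to
  \<open>m\<close> only makes a quantifier over such a vector equivalent to finitely many scalar
  quantifiers.\<close>

definition coord_local :: "nat \<Rightarrow> ((nat \<Rightarrow> nat \<Rightarrow> 'a) \<Rightarrow> 'c) \<Rightarrow> bool" where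
  "coord_local m u \<longleftrightarrow> (\<forall>E E'. (\<forall>b. \<forall>i\<le>m. E b i = E' b i) \<longrightarrow> u E = u E')"

lemma coord_localD: "coord_local m u \<Longrightarrow> (\<And>b i. i \<le> m \<Longrightarrow> E b i = E' b i) \<Longrightarrow> u E = u E'"
  unfolding coord_local_def by blast

text \<open>An environment is read as a family of vectors, block \<open>b\<close> being the value of
  the vector variable \<open>b\<close>. Since \<open>prod_encode\<close> is injective, blocks occupy
  disjoint coordinates.\<close>

definition block_env :: "(nat \<Rightarrow> 'a) \<Rightarrow> nat \<Rightarrow> nat \<Rightarrow> 'a" where
  "block_env e b i = e (prod_encode (b, i))"

definition uniform_blk :: "nat \<Rightarrow> ((nat \<Rightarrow> nat \<Rightarrow> 'a::linordered_field) \<Rightarrow> 'a) \<Rightarrow> ((nat \<Rightarrow> nat \<Rightarrow> 'b::linordered_field) \<Rightarrow> 'b) \<Rightarrow> bool" where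
  "uniform_blk m u v \<longleftrightarrow> uniform (\<lambda>e. u (block_env e)) (\<lambda>e. v (block_env e)) \<and> coord_local m u \<and> coord_local m v"

definition transfer_blk :: "nat \<Rightarrow> ((nat \<Rightarrow> nat \<Rightarrow> 'a::linordered_field) \<Rightarrow> bool) \<Rightarrow> ((nat \<Rightarrow> nat \<Rightarrow> 'b::linordered_field) \<Rightarrow> bool) \<Rightarrow> bool" where
  "transfer_blk m \<phi> \<psi> \<longleftrightarrow> transfer_rel (\<lambda>e. \<phi> (block_env e)) (\<lambda>e. \<psi> (block_env e)) \<and> coord_local m \<phi> \<and> coord_local m \<psi>"

lemma coord_local_const: "coord_local m (\<lambda>E. c)"
  unfolding coord_local_def by simp

lemma coord_local_comp: "coord_local m u \<Longrightarrow> coord_local m (\<lambda>E. k (u E))"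
  unfolding coord_local_def by metis

lemma coord_local_comp2: "coord_local m u \<Longrightarrow> coord_local m v \<Longrightarrow> coord_local m (\<lambda>E. k (u E) (v E))"
  unfolding coord_local_def by metis

lemma uniform_blk_var: "i \<le> m \<Longrightarrow> uniform_blk m (\<lambda>E. E b i) (\<lambda>E. E b i)"
  unfolding uniform_blk_def block_env_def by (auto simp: coord_local_def intro: uniform.var)

lemma uniform_blk_0: "uniform_blk m (\<lambda>E. 0) (\<lambda>E. 0)"
  unfolding uniform_blk_def by (simp add: uniform_0 coord_local_const)

lemma uniform_blk_mult: "uniform_blk m u v \<Longrightarrow> uniform_blk m u' v' \<Longrightarrow> uniform_blk m (\<lambda>E. u E * u' E) (\<lambda>E. v E * v' E)"
  unfolding uniform_blk_def by (simp add: uniform.mult coord_local_comp2)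

lemma uniform_blk_diff: "uniform_blk m u v \<Longrightarrow> uniform_blk m u' v' \<Longrightarrow> uniform_blk m (\<lambda>E. u E - u' E) (\<lambda>E. v E - v' E)"
  unfolding uniform_blk_def by (simp add: uniform_diff coord_local_comp2)

lemma uniform_blk_uminus: "uniform_blk m u v \<Longrightarrow> uniform_blk m (\<lambda>E. - u E) (\<lambda>E. - v E)"
  unfolding uniform_blk_def by (simp add: uniform_uminus coord_local_comp)

lemma uniform_blk_power: "uniform_blk m u v \<Longrightarrow> uniform_blk m (\<lambda>E. u E ^ n) (\<lambda>E. v E ^ n)"
  unfolding uniform_blk_def by (simp add: uniform_power coord_local_comp[where k = "\<lambda>x. x ^ n"])

lemma coord_local_sum: "(\<And>i. i \<in> I \<Longrightarrow> coord_local m (u i)) \<Longrightarrow> coord_local m (\<lambda>E. \<Sum>i\<in>I. u i E)"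
  unfolding coord_local_def by (intro allI impI sum.cong) auto

lemma coord_local_prod: "(\<And>i. i \<in> I \<Longrightarrow> coord_local m (u i)) \<Longrightarrow> coord_local m (\<lambda>E. \<Prod>i\<in>I. u i E)"
  unfolding coord_local_def by (intro allI impI prod.cong) auto

lemma uniform_blk_sum:
  "(\<And>i. i \<in> I \<Longrightarrow> uniform_blk m (u i) (v i)) \<Longrightarrow> uniform_blk m (\<lambda>E. \<Sum>i\<in>I. u i E) (\<lambda>E. \<Sum>i\<in>I. v i E)"
  unfolding uniform_blk_def by (intro conjI uniform_sum coord_local_sum) auto

lemma uniform_blk_prod:
  "(\<And>i. i \<in> I \<Longrightarrow> uniform_blk m (u i) (v i)) \<Longrightarrow> uniform_blk m (\<lambda>E. \<Prod>i\<in>I. u i E) (\<lambda>E. \<Prod>i\<in>I. v i E)"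
  unfolding uniform_blk_def by (intro conjI uniform_prod coord_local_prod) auto

lemma transfer_blk_less: "uniform_blk m u v \<Longrightarrow> uniform_blk m u' v' \<Longrightarrow> transfer_blk m (\<lambda>E. u E < u' E) (\<lambda>E. v E < v' E)"
  unfolding uniform_blk_def transfer_blk_def by (simp add: transfer_rel_less coord_local_comp2)

lemma transfer_blk_le: "uniform_blk m u v \<Longrightarrow> uniform_blk m u' v' \<Longrightarrow> transfer_blk m (\<lambda>E. u E \<le> u' E) (\<lambda>E. v E \<le> v' E)"
  unfolding uniform_blk_def transfer_blk_def by (simp add: transfer_rel_le coord_local_comp2)

lemma transfer_blk_eq: "uniform_blk m u v \<Longrightarrow> uniform_blk m u' v' \<Longrightarrow> transfer_blk m (\<lambda>E. u E = u' E) (\<lambda>E. v E = v' E)"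
  unfolding uniform_blk_def transfer_blk_def by (simp add: transfer_rel_eq coord_local_comp2)

lemma transfer_blk_const: "transfer_blk m (\<lambda>E. c) (\<lambda>E. c)"
  unfolding transfer_blk_def by (simp add: transfer_rel_const coord_local_const)

lemma transfer_blk_not: "transfer_blk m \<phi> \<psi> \<Longrightarrow> transfer_blk m (\<lambda>E. \<not> \<phi> E) (\<lambda>E. \<not> \<psi> E)"
  unfolding transfer_blk_def by (simp add: transfer_rel_not coord_local_comp)

lemma transfer_blk_conj:
  "transfer_blk m \<phi> \<psi> \<Longrightarrow> transfer_blk m \<phi>' \<psi>' \<Longrightarrow> transfer_blk m (\<lambda>E. \<phi> E \<and> \<phi>' E) (\<lambda>E. \<psi> E \<and> \<psi>' E)"
  unfolding transfer_blk_def by (simp add: transfer_rel_conj coord_local_comp2)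

lemma transfer_blk_disj:
  "transfer_blk m \<phi> \<psi> \<Longrightarrow> transfer_blk m \<phi>' \<psi>' \<Longrightarrow> transfer_blk m (\<lambda>E. \<phi> E \<or> \<phi>' E) (\<lambda>E. \<psi> E \<or> \<psi>' E)"
  unfolding transfer_blk_def by (simp add: transfer_rel_disj coord_local_comp2)

lemma transfer_blk_imp:
  assumes "transfer_blk m \<phi> \<psi>" "transfer_blk m \<phi>' \<psi>'"
  shows "transfer_blk m (\<lambda>E. \<phi> E \<longrightarrow> \<phi>' E) (\<lambda>E. \<psi> E \<longrightarrow> \<psi>' E)"
  using transfer_blk_disj[OF transfer_blk_not[OF assms(1)] assms(2)] by (simp only: imp_conv_disj)

lemma transfer_blk_all_less:
  assumes "\<And>i::nat. i < n \<Longrightarrow> transfer_blk m (\<phi> i) (\<psi> i)"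
  shows "transfer_blk m (\<lambda>E. \<forall>i<n. \<phi> i E) (\<lambda>E. \<forall>i<n. \<psi> i E)"
  using assms
proof (induction n)
  case 0
  then show ?case using transfer_blk_const[of m True] by simp
next
  case (Suc n)
  then show ?case using transfer_blk_conj[OF Suc.IH Suc.prems[of n]] by (simp add: All_less_Suc conj_commute)
qed

lemma transfer_rel_all_block:
  fixes \<phi> :: "(nat \<Rightarrow> 'a::real_closed_field) \<Rightarrow> bool" and \<psi> :: "(nat \<Rightarrow> 'b::real_closed_field) \<Rightarrow> bool"
  assumes "finite S" "transfer_rel \<phi> \<psi>"
  shows "transfer_rel (\<lambda>e. \<forall>u. \<phi> (\<lambda>j. if j \<in> S then u j else e j)) (\<lambda>e. \<forall>u. \<psi> (\<lambda>j. if j \<in> S then u j else e j))"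
  using assms(1)
proof (induction S rule: finite_induct)
  case empty
  then show ?case using assms(2) by simp
next
  case (insert s S)
  have eq: "(\<forall>u. \<xi> (\<lambda>j. if j \<in> insert s S then u j else e j)) \<longleftrightarrow> (\<forall>y u. \<xi> (\<lambda>j. if j \<in> S then u j else (e(s := y)) j))"
    for \<xi> :: "(nat \<Rightarrow> 'c) \<Rightarrow> bool" and e
  proof (intro iffI allI)
    fix y u assume "\<forall>u. \<xi> (\<lambda>j. if j \<in> insert s S then u j else e j)"
    from spec[OF this, of "u(s := y)"] show "\<xi> (\<lambda>j. if j \<in> S then u j else (e(s := y)) j)"
      using insert(2) by (elim back_subst[of \<xi>]) auto
  next
    fix u assume "\<forall>y u. \<xi> (\<lambda>j. if j \<in> S then u j else (e(s := y)) j)"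
    from spec[OF spec[OF this, of "u s"], of u] show "\<xi> (\<lambda>j. if j \<in> insert s S then u j else e j)"
      by (elim back_subst[of \<xi>]) auto
  qed
  show ?case unfolding eq by (rule transfer_rel_all[OF insert.IH])
qed

text \<open>The two independence conditions make \<open>b\<close> a fresh variable, so the bound
  vector may be stored in block \<open>b\<close>. Locality then leaves \<open>m + 1\<close> scalar
  quantifiers, treated by \<open>transfer_rel_all_block\<close>.\<close>

lemma transfer_blk_all:
  fixes \<phi> :: "(nat \<Rightarrow> nat \<Rightarrow> 'a::real_closed_field) \<Rightarrow> (nat \<Rightarrow> 'a) \<Rightarrow> bool"
    and \<psi> :: "(nat \<Rightarrow> nat \<Rightarrow> 'b::real_closed_field) \<Rightarrow> (nat \<Rightarrow> 'b) \<Rightarrow> bool"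
  assumes T: "transfer_blk m (\<lambda>E. \<phi> E (E b)) (\<lambda>E. \<psi> E (E b))"
    and \<phi>: "\<And>E x y. \<phi> (E(b := y)) x = \<phi> E x" and \<psi>: "\<And>E x y. \<psi> (E(b := y)) x = \<psi> E x"
  shows "transfer_blk m (\<lambda>E. \<forall>x. \<phi> E x) (\<lambda>E. \<forall>x. \<psi> E x)"
proof -
  let ?S = "prod_encode ` ({b} \<times> {..m})"
  have fS: "finite ?S" by blast
  have eq: "(\<forall>u. \<xi> (block_env (\<lambda>j. if j \<in> ?S then u j else e j)) (block_env (\<lambda>j. if j \<in> ?S then u j else e j) b)) \<longleftrightarrow> (\<forall>x. \<xi> (block_env e) x)"
    if loc: "coord_local m (\<lambda>E. \<xi> E (E b))" and ind: "\<And>E x y. \<xi> (E(b := y)) x = \<xi> E x"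
    for \<xi> :: "(nat \<Rightarrow> nat \<Rightarrow> 'c) \<Rightarrow> (nat \<Rightarrow> 'c) \<Rightarrow> bool" and e
  proof -
    have 1: "\<xi> (block_env (\<lambda>j. if j \<in> ?S then u j else e j)) (block_env (\<lambda>j. if j \<in> ?S then u j else e j) b) =
        \<xi> (block_env e) (\<lambda>i. u (prod_encode (b, i)))" for u
    proof -
      have "\<xi> (block_env (\<lambda>j. if j \<in> ?S then u j else e j)) (block_env (\<lambda>j. if j \<in> ?S then u j else e j) b)
        = \<xi> ((block_env e)(b := \<lambda>i. u (prod_encode (b, i)))) (((block_env e)(b := \<lambda>i. u (prod_encode (b, i)))) b)"
        by (rule coord_localD[OF loc]) (auto simp: block_env_def)
      then show ?thesis by (simp add: ind)
    qed
    have 2: "\<exists>u. x = (\<lambda>i. u (prod_encode (b, i)))" for x :: "nat \<Rightarrow> 'c"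
      by (rule exI[of _ "\<lambda>j. x (snd (prod_decode j))"]) simp
    show ?thesis unfolding 1 using 2 by metis
  qed
  have l: "coord_local m (\<lambda>E. \<forall>x. \<xi> E x)"
    if loc: "coord_local m (\<lambda>E. \<xi> E (E b))" and ind: "\<And>E x y. \<xi> (E(b := y)) x = \<xi> E x"
    for \<xi> :: "(nat \<Rightarrow> nat \<Rightarrow> 'c) \<Rightarrow> (nat \<Rightarrow> 'c) \<Rightarrow> bool"
  proof -
    have "\<xi> E x = \<xi> E' x" if "\<forall>b. \<forall>i\<le>m. E b i = E' b i" for E E' x
      using coord_localD[OF loc, of "E(b := x)" "E'(b := x)"] that by (simp add: ind)
    then show ?thesis unfolding coord_local_def by blast
  qed
  have T': "transfer_rel (\<lambda>e. \<phi> (block_env e) (block_env e b)) (\<lambda>e. \<psi> (block_env e) (block_env e b))"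
    "coord_local m (\<lambda>E. \<phi> E (E b))" "coord_local m (\<lambda>E. \<psi> E (E b))" using T unfolding transfer_blk_def by blast+
  show ?thesis
    using transfer_rel_all_block[OF fS T'(1)] l[of \<phi>, OF T'(2) \<phi>] l[of \<psi>, OF T'(3) \<psi>]
    unfolding transfer_blk_def by (simp only: eq[of \<phi>, OF T'(2) \<phi>] eq[of \<psi>, OF T'(3) \<psi>] simp_thms)
qed

lemma transfer_blk_ex:
  fixes \<phi> :: "(nat \<Rightarrow> nat \<Rightarrow> 'a::real_closed_field) \<Rightarrow> (nat \<Rightarrow> 'a) \<Rightarrow> bool"
    and \<psi> :: "(nat \<Rightarrow> nat \<Rightarrow> 'b::real_closed_field) \<Rightarrow> (nat \<Rightarrow> 'b) \<Rightarrow> bool"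
  assumes T: "transfer_blk m (\<lambda>E. \<phi> E (E b)) (\<lambda>E. \<psi> E (E b))"
    and \<phi>: "\<And>E x y. \<phi> (E(b := y)) x = \<phi> E x" and \<psi>: "\<And>E x y. \<psi> (E(b := y)) x = \<psi> E x"
  shows "transfer_blk m (\<lambda>E. \<exists>x. \<phi> E x) (\<lambda>E. \<exists>x. \<psi> E x)"
  using transfer_blk_not[OF transfer_blk_all[where b = b and \<phi> = "\<lambda>E x. \<not> \<phi> E x" and \<psi> = "\<lambda>E x. \<not> \<psi> E x", OF transfer_blk_not[OF T]]]
  by (simp add: \<phi> \<psi>)

lemma uniform_at_0: "uniform u v \<Longrightarrow> \<exists>k::int. u (\<lambda>_. 0) = of_int k \<and> v (\<lambda>_. 0) = of_int k"
proof (induction rule: uniform.induct)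
  case (var i)
  then show ?case by (intro exI[of _ 0]) simp
next
  case (add u v u' v')
  then obtain k k' :: int where "u (\<lambda>_. 0) = of_int k" "v (\<lambda>_. 0) = of_int k" "u' (\<lambda>_. 0) = of_int k'" "v' (\<lambda>_. 0) = of_int k'" by blast
  then show ?case by (intro exI[of _ "k + k'"]) simp
next
  case (mult u v u' v')
  then obtain k k' :: int where "u (\<lambda>_. 0) = of_int k" "v (\<lambda>_. 0) = of_int k" "u' (\<lambda>_. 0) = of_int k'" "v' (\<lambda>_. 0) = of_int k'" by blast
  then show ?case by (intro exI[of _ "k * k'"]) simp
qed auto

text \<open>For statements without parameters the tests may be evaluated at the zero environment,
  where each of them yields the same integer in both fields; hence they agree.\<close>

lemma transfer_blk_closed:
  assumes "transfer_blk m (\<lambda>E :: nat \<Rightarrow> nat \<Rightarrow> 'a::linordered_field. A) (\<lambda>E :: nat \<Rightarrow> nat \<Rightarrow> 'b::linordered_field. B)"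
  shows "A = B"
proof -
  obtain E where E: "uniform_set E" "\<And>a b. agree E (a :: nat \<Rightarrow> 'a) (b :: nat \<Rightarrow> 'b) \<Longrightarrow> A = B"
    using assms unfolding transfer_blk_def transfer_rel_def by blast
  have "agree E (\<lambda>_. 0) (\<lambda>_. 0)" unfolding agree_def
  proof (clarify)
    fix u v assume "(u, v) \<in> E"
    then have "uniform u v" using E(1) unfolding uniform_set_def by blast
    from uniform_at_0[OF this] show "same_sgn (u (\<lambda>_. 0)) (v (\<lambda>_. 0))" unfolding same_sgn_def by auto
  qed
  then show ?thesis by (rule E(2))
qed

section \<open>Graphs of semi-algebraic functions in first-order form\<close>

text \<open>Satisfaction relative to arbitrary values of the atoms: the atoms of a formula can
  remain polynomials over one field and serve as mere names when the formula is interpreted in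
  another.\<close>

primrec qf_sem :: "('p \<Rightarrow> 'a::linordered_idom) \<Rightarrow> 'p qf_formula \<Rightarrow> bool" where
  "qf_sem v QTrue = True"
| "qf_sem v QFalse = False"
| "qf_sem v (AtomEq p) = (v p = 0)"
| "qf_sem v (AtomGt p) = (0 < v p)"
| "qf_sem v (AtomLt p) = (v p < 0)"
| "qf_sem v (QNot \<phi>) = (\<not> qf_sem v \<phi>)"
| "qf_sem v (QAnd \<phi> \<psi>) = (qf_sem v \<phi> \<and> qf_sem v \<psi>)"
| "qf_sem v (QOr \<phi> \<psi>) = (qf_sem v \<phi> \<or> qf_sem v \<psi>)"

lemma qf_sat_qf_sem: "qf_sat \<phi> x = qf_sem (\<lambda>p. mpoly_eval p x) \<phi>"
  by (induction \<phi>) auto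

lemma qf_sem_cong_sgn:
  "(\<And>p. p \<in> qf_atoms \<phi> \<Longrightarrow> sgn (v p) = sgn (w p)) \<Longrightarrow> qf_sem v \<phi> = qf_sem w \<phi>"
proof (induction \<phi>)
  case (AtomEq p)
  then show ?case using AtomEq[of p] by (auto simp: sgn_0_0 sgn_if split: if_splits)
next
  case (AtomGt p)
  then show ?case using AtomGt[of p] by (auto simp: sgn_if split: if_splits)
next
  case (AtomLt p)
  then show ?case using AtomLt[of p] by (auto simp: sgn_if split: if_splits)
qed auto

text \<open>The supports \<open>M\<close> are fixed while the coefficients \<open>co\<close> vary;
  the latter become the parameters over which the transferred sentence quantifies.\<close>

definition coeff_eval :: "nat \<Rightarrow> ('p \<Rightarrow> (nat \<Rightarrow>\<^sub>0 nat) set) \<Rightarrow> ('p \<Rightarrow> (nat \<Rightarrow>\<^sub>0 nat) \<Rightarrow> 'a::comm_ring_1) \<Rightarrow> (nat \<Rightarrow> 'a) \<Rightarrow> 'p \<Rightarrow> 'a" where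
  "coeff_eval n M co x q = (\<Sum>\<mu>\<in>M q. co q \<mu> * (\<Prod>i\<le>n. x i ^ lk \<mu> i))"

lemma transfer_blk_qf_sem:
  assumes "n \<le> m" "\<And>q \<mu>. q \<in> qf_atoms \<phi> \<Longrightarrow> \<mu> \<in> M q \<Longrightarrow> k q \<mu> \<le> m"
  shows "transfer_blk m (\<lambda>E :: nat \<Rightarrow> nat \<Rightarrow> 'a::linordered_field. qf_sem (coeff_eval n M (\<lambda>q \<mu>. E a (k q \<mu>)) (E b)) \<phi>)
    (\<lambda>E :: nat \<Rightarrow> nat \<Rightarrow> 'b::linordered_field. qf_sem (coeff_eval n M (\<lambda>q \<mu>. E a (k q \<mu>)) (E b)) \<phi>)"
  using assms(2)
proof -
  have U: "uniform_blk m (\<lambda>E :: nat \<Rightarrow> nat \<Rightarrow> 'a. coeff_eval n M (\<lambda>q \<mu>. E a (k q \<mu>)) (E b) q) (\<lambda>E :: nat \<Rightarrow> nat \<Rightarrow> 'b. coeff_eval n M (\<lambda>q \<mu>. E a (k q \<mu>)) (E b) q)"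
    if "q \<in> qf_atoms \<phi>" for q unfolding coeff_eval_def
    by (intro uniform_blk_sum uniform_blk_mult uniform_blk_prod uniform_blk_power uniform_blk_var) (use assms that in auto)
  from U show ?thesis
  proof (induction \<phi>)
    case (AtomEq p)
    then show ?case by (simp add: transfer_blk_eq uniform_blk_0)
  next
    case (AtomGt p)
    then show ?case by (simp add: transfer_blk_less uniform_blk_0)
  next
    case (AtomLt p)
    then show ?case by (simp add: transfer_blk_less uniform_blk_0)
  qed (simp_all add: transfer_blk_const transfer_blk_not transfer_blk_conj transfer_blk_disj)
qed

text \<open>Here and below scalars are quantified as vectors of which only the entry at 0 matters, so that
the transfer argument deals with a single sort of quantifier. A relation \<open>K\<close> stands for a graph
over the coordinates below \<open>n\<close>, with the function value at index \<open>n\<close>.\<close>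

definition graph_continuous :: "nat \<Rightarrow> ((nat \<Rightarrow> 'a::linordered_field) \<Rightarrow> bool) \<Rightarrow> bool" where
  "graph_continuous n K \<longleftrightarrow> (\<forall>x. K x \<longrightarrow> (\<forall>\<epsilon>. 0 < \<epsilon> (0::nat) \<longrightarrow> (\<exists>\<delta>. 0 < \<delta> (0::nat) \<and>
     (\<forall>y. K y \<longrightarrow> (\<forall>i<n. \<bar>y i - x i\<bar> < \<delta> 0) \<longrightarrow> \<bar>y n - x n\<bar> < \<epsilon> 0))))"

text \<open>Stated without function symbols, so as to be first order. The first clause is closedness
  of the domain: a point with no graph point above it has a neighbourhood of such points. The fifth
  puts the domain of the first graph inside that of the second.\<close>

definition graph_hyps :: "nat \<Rightarrow> ((nat \<Rightarrow> 'a::linordered_field) \<Rightarrow> bool) \<Rightarrow> ((nat \<Rightarrow> 'a) \<Rightarrow> bool) \<Rightarrow> bool" where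
  "graph_hyps n Kf Kg \<longleftrightarrow>
     (\<forall>x. (\<forall>y. (\<forall>i<n. y i = x i) \<longrightarrow> \<not> Kf y) \<longrightarrow>
        (\<exists>\<epsilon>. 0 < \<epsilon> (0::nat) \<and> (\<forall>y. (\<forall>i<n. \<bar>y i - x i\<bar> < \<epsilon> 0) \<longrightarrow> \<not> Kf y))) \<and>
     (\<exists>r. \<forall>x. Kf x \<longrightarrow> (\<forall>i<n. \<bar>x i\<bar> \<le> r (0::nat))) \<and>
     graph_continuous n Kf \<and> graph_continuous n Kg \<and>
     (\<forall>x. Kf x \<longrightarrow> (\<exists>y. (\<forall>i<n. y i = x i) \<and> Kg y)) \<and>
     (\<forall>x. Kf x \<longrightarrow> x n = 0 \<longrightarrow> (\<forall>y. Kg y \<longrightarrow> (\<forall>i<n. y i = x i) \<longrightarrow> y n = 0))"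

definition graph_concl :: "nat \<Rightarrow> nat \<Rightarrow> ((nat \<Rightarrow> 'a::linordered_field) \<Rightarrow> bool) \<Rightarrow> ((nat \<Rightarrow> 'a) \<Rightarrow> bool) \<Rightarrow> bool" where
  "graph_concl n N Kf Kg \<longleftrightarrow>
     (\<exists>c. \<forall>x. Kf x \<longrightarrow> (\<forall>y. Kg y \<longrightarrow> (\<forall>i<n. y i = x i) \<longrightarrow> \<bar>y n\<bar> ^ N \<le> c (0::nat) * \<bar>x n\<bar>))"

text \<open>Absolute values are not polynomial; splitting by the sign of \<open>b\<close> brings the
  inequality into a form to which transfer applies.\<close>

lemma abs_power_le_iff:
  fixes a b c :: "'a::linordered_field"
  shows "\<bar>a\<bar> ^ N \<le> c * \<bar>b\<bar> \<longleftrightarrow> (0 \<le> b \<and> a ^ N \<le> c * b \<and> - (a ^ N) \<le> c * b) \<or> (b < 0 \<and> a ^ N \<le> c * (- b) \<and> - (a ^ N) \<le> c * (- b))"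
proof -
  have "\<bar>a\<bar> ^ N \<le> t \<longleftrightarrow> a ^ N \<le> t \<and> - (a ^ N) \<le> t" for t by (simp add: abs_le_iff flip: power_abs)
  then show ?thesis by (cases "0 \<le> b") auto
qed

lemmas transfer_blk_intros = transfer_blk_imp transfer_blk_conj transfer_blk_disj transfer_blk_not transfer_blk_all_less transfer_blk_less transfer_blk_le
  transfer_blk_eq uniform_blk_diff uniform_blk_uminus uniform_blk_mult uniform_blk_power uniform_blk_var uniform_blk_0

lemma transfer_graph_continuous:
  fixes \<Phi> :: "(nat \<Rightarrow> 'a::real_closed_field) \<Rightarrow> (nat \<Rightarrow> 'a) \<Rightarrow> bool" and \<Psi> :: "(nat \<Rightarrow> 'b::real_closed_field) \<Rightarrow> (nat \<Rightarrow> 'b) \<Rightarrow> bool"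
  assumes K: "\<And>b. transfer_blk m (\<lambda>E. \<Phi> (E 0) (E b)) (\<lambda>E. \<Psi> (E 0) (E b))" and nm: "n \<le> m"
  shows "transfer_blk m (\<lambda>E. graph_continuous n (\<Phi> (E 0))) (\<lambda>E. graph_continuous n (\<Psi> (E 0)))"
  unfolding graph_continuous_def abs_less_iff
  by (rule transfer_blk_all[where b = 1], rule transfer_blk_imp, rule K, rule transfer_blk_all[where b = 2],
      rule transfer_blk_imp, rule transfer_blk_less, rule uniform_blk_0, rule uniform_blk_var, simp,
      rule transfer_blk_ex[where b = 3], rule transfer_blk_conj, rule transfer_blk_less, rule uniform_blk_0, rule uniform_blk_var, simp,
      rule transfer_blk_all[where b = 4])
    (intro transfer_blk_intros K | use nm in force)+

text \<open>Block 0 holds the parameter \<open>p\<close>, and \<open>N\<close> is a fixed number, so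
  hypotheses and conclusion are both first order. After quantifying over \<open>p\<close> no free
  block remains and the two truth values coincide.\<close>

lemma transfer_graph_sentence:
  fixes \<Phi> \<Phi>' :: "(nat \<Rightarrow> 'a::real_closed_field) \<Rightarrow> (nat \<Rightarrow> 'a) \<Rightarrow> bool" and \<Psi> \<Psi>' :: "(nat \<Rightarrow> 'b::real_closed_field) \<Rightarrow> (nat \<Rightarrow> 'b) \<Rightarrow> bool"
  assumes K: "\<And>b. transfer_blk m (\<lambda>E. \<Phi> (E 0) (E b)) (\<lambda>E. \<Psi> (E 0) (E b))"
    and K': "\<And>b. transfer_blk m (\<lambda>E. \<Phi>' (E 0) (E b)) (\<lambda>E. \<Psi>' (E 0) (E b))" and nm: "n \<le> m"
  shows "(\<forall>p. graph_hyps n (\<Phi> p) (\<Phi>' p) \<longrightarrow> graph_concl n N (\<Phi> p) (\<Phi>' p)) \<longleftrightarrow>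
    (\<forall>p. graph_hyps n (\<Psi> p) (\<Psi>' p) \<longrightarrow> graph_concl n N (\<Psi> p) (\<Psi>' p))"
proof -
  have 1: "transfer_blk m (\<lambda>E. \<forall>x. (\<forall>y. (\<forall>i<n. y i = x i) \<longrightarrow> \<not> \<Phi> (E 0) y) \<longrightarrow>
        (\<exists>\<epsilon>. 0 < \<epsilon> (0::nat) \<and> (\<forall>y. (\<forall>i<n. \<bar>y i - x i\<bar> < \<epsilon> 0) \<longrightarrow> \<not> \<Phi> (E 0) y)))
     (\<lambda>E. \<forall>x. (\<forall>y. (\<forall>i<n. y i = x i) \<longrightarrow> \<not> \<Psi> (E 0) y) \<longrightarrow>
        (\<exists>\<epsilon>. 0 < \<epsilon> (0::nat) \<and> (\<forall>y. (\<forall>i<n. \<bar>y i - x i\<bar> < \<epsilon> 0) \<longrightarrow> \<not> \<Psi> (E 0) y)))"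
    unfolding abs_less_iff
    by (rule transfer_blk_all[where b = 1], rule transfer_blk_imp, rule transfer_blk_all[where b = 2], intro transfer_blk_intros K, use nm in force, use nm in force, simp, simp,
      rule transfer_blk_ex[where b = 3], rule transfer_blk_conj, rule transfer_blk_less, rule uniform_blk_0, rule uniform_blk_var, simp,
      rule transfer_blk_all[where b = 4])
    (intro transfer_blk_intros K | use nm in force)+
  have 2: "transfer_blk m (\<lambda>E. \<exists>r. \<forall>x. \<Phi> (E 0) x \<longrightarrow> (\<forall>i<n. \<bar>x i\<bar> \<le> r (0::nat))) (\<lambda>E. \<exists>r. \<forall>x. \<Psi> (E 0) x \<longrightarrow> (\<forall>i<n. \<bar>x i\<bar> \<le> r (0::nat)))"
    unfolding abs_le_iff
    by (rule transfer_blk_ex[where b = 1], rule transfer_blk_all[where b = 2]) (intro transfer_blk_intros K | use nm in force)+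
  have 3: "transfer_blk m (\<lambda>E. \<forall>x. \<Phi> (E 0) x \<longrightarrow> (\<exists>y. (\<forall>i<n. y i = x i) \<and> \<Phi>' (E 0) y)) (\<lambda>E. \<forall>x. \<Psi> (E 0) x \<longrightarrow> (\<exists>y. (\<forall>i<n. y i = x i) \<and> \<Psi>' (E 0) y))"
    by (rule transfer_blk_all[where b = 1], rule transfer_blk_imp, rule K, rule transfer_blk_ex[where b = 2]) (intro transfer_blk_intros K' | use nm in force)+
  have 4: "transfer_blk m (\<lambda>E. \<forall>x. \<Phi> (E 0) x \<longrightarrow> x n = 0 \<longrightarrow> (\<forall>y. \<Phi>' (E 0) y \<longrightarrow> (\<forall>i<n. y i = x i) \<longrightarrow> y n = 0))
      (\<lambda>E. \<forall>x. \<Psi> (E 0) x \<longrightarrow> x n = 0 \<longrightarrow> (\<forall>y. \<Psi>' (E 0) y \<longrightarrow> (\<forall>i<n. y i = x i) \<longrightarrow> y n = 0))"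
    by (rule transfer_blk_all[where b = 1], rule transfer_blk_imp, rule K, rule transfer_blk_imp, rule transfer_blk_eq, rule uniform_blk_var, rule nm, rule uniform_blk_0,
      rule transfer_blk_all[where b = 2]) (intro transfer_blk_intros K' | use nm in force)+
  have 5: "transfer_blk m (\<lambda>E. graph_concl n N (\<Phi> (E 0)) (\<Phi>' (E 0))) (\<lambda>E. graph_concl n N (\<Psi> (E 0)) (\<Psi>' (E 0)))"
    unfolding graph_concl_def abs_power_le_iff
    by (rule transfer_blk_ex[where b = 1], rule transfer_blk_all[where b = 2], rule transfer_blk_imp, rule K,
      rule transfer_blk_all[where b = 3]) (intro transfer_blk_intros K' | use nm in force)+
  have 6: "transfer_blk m (\<lambda>E. graph_hyps n (\<Phi> (E 0)) (\<Phi>' (E 0))) (\<lambda>E. graph_hyps n (\<Psi> (E 0)) (\<Psi>' (E 0)))"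
    unfolding graph_hyps_def
    by (intro transfer_blk_conj 1 2 3 4 transfer_graph_continuous[of m \<Phi> \<Psi>, OF K nm] transfer_graph_continuous[of m \<Phi>' \<Psi>', OF K' nm])
  have "transfer_blk m (\<lambda>E :: nat \<Rightarrow> nat \<Rightarrow> 'a. \<forall>p. graph_hyps n (\<Phi> p) (\<Phi>' p) \<longrightarrow> graph_concl n N (\<Phi> p) (\<Phi>' p))
     (\<lambda>E :: nat \<Rightarrow> nat \<Rightarrow> 'b. \<forall>p. graph_hyps n (\<Psi> p) (\<Psi>' p) \<longrightarrow> graph_concl n N (\<Psi> p) (\<Psi>' p))"
    by (rule transfer_blk_all[where b = 0]) (rule transfer_blk_imp[OF 6 5], simp_all)
  then show ?thesis by (rule transfer_blk_closed)
qed

text \<open>Both values are stored over one base point, the first at \<open>n\<close> and the second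
  at \<open>n + 1\<close>. The base points have a convergent subsequence by boundedness, its limit
  is in the domain by closedness, and continuity makes the two values converge.\<close>

lemma graph_seq_compact:
  fixes Kf Kg :: "(nat \<Rightarrow> real) \<Rightarrow> bool"
  assumes H: "graph_hyps n Kf Kg"
    and dep: "\<And>x y. (\<And>i. i \<le> n \<Longrightarrow> y i = x i) \<Longrightarrow> Kf x \<Longrightarrow> Kf y" "\<And>x y. (\<And>i. i \<le> n \<Longrightarrow> y i = x i) \<Longrightarrow> Kg x \<Longrightarrow> Kg y"
  shows "seq_compact_on {..<n + 2} {p. Kf p \<and> Kg (p(n := p (n + 1)))}"
  unfolding seq_compact_on_def
proof (intro allI impI)
  fix Xs :: "nat \<Rightarrow> nat \<Rightarrow> real"
  assume Xs: "\<forall>m. Xs m \<in> {p. Kf p \<and> Kg (p(n := p (n + 1)))}"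
  note H = H[unfolded graph_hyps_def]
  have X1: "Kf (Xs m)" and X2: "Kg ((Xs m)(n := Xs m (n + 1)))" for m using spec[OF Xs, of m] by simp_all
  have gc: "graph_continuous n Kf" "graph_continuous n Kg"
    using H[THEN conjunct2, THEN conjunct2, THEN conjunct1] H[THEN conjunct2, THEN conjunct2, THEN conjunct2, THEN conjunct1] .
  obtain B :: "nat \<Rightarrow> real" where B: "\<forall>x. Kf x \<longrightarrow> (\<forall>i<n. \<bar>x i\<bar> \<le> B 0)" using H[THEN conjunct2, THEN conjunct1] ..
  have "\<exists>r l. strict_mono r \<and> conv_on {..<n} (\<lambda>m. Xs (r m)) l" by (rule bolzano_on[where B = "B 0"]) (use B X1 in auto)
  then obtain r l where r: "strict_mono r" "conv_on {..<n} (\<lambda>m. Xs (r m)) l" by blast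
  have close: "\<forall>\<^sub>F m in sequentially. \<forall>i\<in>{..<n}. \<bar>Xs (r m) i - l i\<bar> < \<epsilon>" if "0 < \<epsilon>" for \<epsilon> :: real
  proof (rule eventually_ball_finite)
    show "\<forall>i\<in>{..<n}. \<forall>\<^sub>F m in sequentially. \<bar>Xs (r m) i - l i\<bar> < \<epsilon>"
    proof
      fix i assume "i \<in> {..<n}"
      then have "(\<lambda>m. Xs (r m) i) \<longlonglongrightarrow> l i" using r(2) unfolding conv_on_def by blast
      from tendstoD[OF this that] show "\<forall>\<^sub>F m in sequentially. \<bar>Xs (r m) i - l i\<bar> < \<epsilon>" by (simp add: dist_real_def)
    qed
  qed simp
  have "\<exists>y. (\<forall>i<n. y i = l i) \<and> Kf y"
  proof (rule ccontr)
    assume "\<not> ?thesis"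
    then have "\<forall>y. (\<forall>i<n. y i = l i) \<longrightarrow> \<not> Kf y" by blast
    from mp[OF spec[OF H[THEN conjunct1]] this]
    obtain \<epsilon> :: "nat \<Rightarrow> real" where \<epsilon>: "0 < \<epsilon> 0 \<and> (\<forall>y. (\<forall>i<n. \<bar>y i - l i\<bar> < \<epsilon> 0) \<longrightarrow> \<not> Kf y)" ..
    note e = \<epsilon>[THEN conjunct1] spec[OF \<epsilon>[THEN conjunct2]]
    from eventually_happens[OF close[OF e(1)]] obtain m where "\<forall>i\<in>{..<n}. \<bar>Xs (r m) i - l i\<bar> < \<epsilon> 0" by auto
    then show False using e(2)[of "Xs (r m)"] X1 by simp
  qed
  then obtain y where y: "\<And>i. i < n \<Longrightarrow> y i = l i" "Kf y" by blast
  have "\<exists>z. (\<forall>i<n. z i = y i) \<and> Kg z"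
    by (rule mp[OF spec[OF H[THEN conjunct2, THEN conjunct2, THEN conjunct2, THEN conjunct2, THEN conjunct1]] y(2)])
  then obtain z where z: "\<And>i. i < n \<Longrightarrow> z i = l i" "Kg z" using y(1) by auto
  have lim: "(\<lambda>m. Y m) \<longlonglongrightarrow> w n"
    if gc: "graph_continuous n K" and w: "K w" "\<And>i. i < n \<Longrightarrow> w i = l i" and Y: "\<And>m. K (Z m)" "\<And>m i. i < n \<Longrightarrow> Z m i = Xs (r m) i" "\<And>m. Z m n = Y m"
    for K w and Z :: "nat \<Rightarrow> nat \<Rightarrow> real" and Y
  proof (rule tendstoI)
    fix e :: real assume "0 < e"
    from mp[OF spec[OF mp[OF spec[OF gc[unfolded graph_continuous_def]] w(1)]], of "\<lambda>_. e", OF this]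
    obtain \<delta> :: "nat \<Rightarrow> real" where \<delta>: "0 < \<delta> 0 \<and> (\<forall>v. K v \<longrightarrow> (\<forall>i<n. \<bar>v i - w i\<bar> < \<delta> 0) \<longrightarrow> \<bar>v n - w n\<bar> < e)" ..
    note d = \<delta>[THEN conjunct1] mp[OF spec[OF \<delta>[THEN conjunct2]]]
    show "\<forall>\<^sub>F m in sequentially. dist (Y m) (w n) < e"
      using close[OF d(1)]
    proof eventually_elim
      case (elim m)
      then show ?case using d(2)[OF Y(1)[of m]] Y(2,3) w(2) by (simp add: dist_real_def)
    qed
  qed
  let ?L = "l(n := y n, n + 1 := z n)"
  have L1: "Kf ?L" by (rule dep(1)[OF _ y(2)]) (use y(1) in \<open>auto simp: le_less\<close>)
  have L2: "Kg (?L(n := ?L (n + 1)))" by (rule dep(2)[OF _ z(2)]) (use z(1) in \<open>auto simp: le_less\<close>)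
  have c1: "(\<lambda>m. Xs (r m) n) \<longlonglongrightarrow> y n"
    by (rule lim[of Kf y "\<lambda>m. Xs (r m)"]) (simp_all add: y X1 gc)
  have c2: "(\<lambda>m. Xs (r m) (n + 1)) \<longlonglongrightarrow> z n"
    by (rule lim[of Kg z "\<lambda>m. (Xs (r m))(n := Xs (r m) (n + 1))"]) (simp_all add: z X2[simplified] gc)
  have "conv_on {..<n + 2} (\<lambda>m. Xs (r m)) ?L"
    unfolding conv_on_def
  proof
    fix i assume "i \<in> {..<n + 2}"
    then consider "i < n" | "i = n" | "i = n + 1" by fastforce
    then show "(\<lambda>m. Xs (r m) i) \<longlonglongrightarrow> ?L i"
      by cases (use r(2) c1 c2 in \<open>auto simp: conv_on_def\<close>)
  qed
  then show "\<exists>r l. strict_mono r \<and> l \<in> {p. Kf p \<and> Kg (p(n := p (n + 1)))} \<and> conv_on {..<n + 2} (\<lambda>m. Xs (r m)) l"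
    using r(1) L1 L2 by blast
qed

section \<open>The inequality for a pair of graphs\<close>

text \<open>The polynomials describe either graph in the variable \<open>n\<close>, but in the joint
  set the second value is stored at \<open>n + 1\<close>. Exchanging the two variables is an
  involution, so supports, degrees and lengths are preserved.\<close>

definition mon_swap :: "nat \<Rightarrow> (nat \<Rightarrow>\<^sub>0 nat) \<Rightarrow> (nat \<Rightarrow>\<^sub>0 nat)" where
  "mon_swap n \<mu> = Poly_Mapping.map_key (Transposition.transpose n (n + 1)) \<mu>"

definition poly_swap :: "nat \<Rightarrow> 'a::zero mpoly \<Rightarrow> 'a mpoly" where
  "poly_swap n f = Poly_Mapping.map_key (mon_swap n) f"

lemma lookup_mon_swap: "lk (mon_swap n \<mu>) i = lk \<mu> (Transposition.transpose n (n + 1) i)"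
  unfolding mon_swap_def by (simp add: Poly_Mapping.map_key.rep_eq)

lemma mon_swap_swap: "mon_swap n (mon_swap n \<mu>) = \<mu>"
  by (rule poly_mapping_eqI) (simp add: lookup_mon_swap)

lemma inj_mon_swap: "inj (mon_swap n)"
  by (metis injI mon_swap_swap)

lemma lookup_poly_swap: "lk (poly_swap n f) \<mu> = lk f (mon_swap n \<mu>)"
  unfolding poly_swap_def using inj_mon_swap by (simp add: Poly_Mapping.map_key.rep_eq)

lemma keys_poly_swap: "ks (poly_swap n f) = mon_swap n ` ks f"
proof -
  have "ks (poly_swap n f) = mon_swap n -` ks f" by (auto simp: in_keys_iff lookup_poly_swap)
  also have "\<dots> = mon_swap n ` ks f"
  proof (intro equalityI subsetI)
    fix \<mu> assume "\<mu> \<in> mon_swap n -` ks f"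
    then have "mon_swap n \<mu> \<in> ks f" by simp
    from imageI[OF this, of "mon_swap n"] show "\<mu> \<in> mon_swap n ` ks f" by (simp only: mon_swap_swap)
  qed (auto simp: mon_swap_swap)
  finally show ?thesis .
qed

lemma bij_swap: "bij_betw (Transposition.transpose n (n + 1)) {..<n + 2} {..<(n::nat) + 2}"
  by (rule bij_betw_byWitness[where f' = "Transposition.transpose n (n + 1)"]) (auto simp: Transposition.transpose_def)

lemma full_eval_poly_swap:
  "full_eval h {..<n + 2} (poly_swap n f) x = full_eval h {..<n + 2} f (x \<circ> Transposition.transpose n (n + 1))"
proof -
  have mv: "monval {..<n + 2} (lk (mon_swap n \<nu>)) x = monval {..<n + 2} (lk \<nu>) (x \<circ> Transposition.transpose n (n + 1))" for \<nu>
    unfolding monval_def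
    by (subst prod.reindex_bij_betw[OF bij_swap, of "\<lambda>i. x i ^ lk (mon_swap n \<nu>) i", symmetric]) (simp add: lookup_mon_swap)
  show ?thesis unfolding full_eval_def keys_poly_swap
    by (subst sum.reindex[OF inj_on_subset[OF inj_mon_swap subset_UNIV], unfolded comp_def]) (simp only: lookup_poly_swap mon_swap_swap mv)
qed

definition sign_determined :: "('r::comm_ring_1 \<Rightarrow> real) \<Rightarrow> nat \<Rightarrow> 'r mpoly set \<Rightarrow> ((nat \<Rightarrow> real) \<Rightarrow> bool) \<Rightarrow> bool" where
  "sign_determined h n Q K \<longleftrightarrow> (\<forall>x y. (\<forall>q\<in>Q. sgn (full_eval h {..n} q y) = sgn (full_eval h {..n} q x)) \<longrightarrow> K x \<longrightarrow> K y)"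

lemma full_eval_cong: "(\<And>i. i \<in> W \<Longrightarrow> x i = y i) \<Longrightarrow> full_eval h W f x = full_eval h W f y"
  unfolding full_eval_def by (rule sum.cong[OF refl], rule arg_cong[where f = "(*) _"], rule monval_cong)

lemma full_eval_Suc:
  assumes "\<And>\<mu>. \<mu> \<in> ks f \<Longrightarrow> ks \<mu> \<subseteq> {..n}"
  shows "full_eval h {..<n + 2} f x = full_eval h {..n} f x"
proof -
  have "monval {..<n + 2} (lk \<mu>) x = monval {..n} (lk \<mu>) x" if "\<mu> \<in> ks f" for \<mu>
  proof -
    have "lk \<mu> i = 0" if "\<not> i \<le> n" for i using assms[OF \<open>\<mu> \<in> ks f\<close>] that in_keys_iff[of i \<mu>] by auto
    then show ?thesis unfolding monval_def by (intro prod.mono_neutral_right) auto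
  qed
  then show ?thesis unfolding full_eval_def by simp
qed

lemma saturated_graph_pair:
  assumes Q: "\<And>q \<mu>. q \<in> Q \<Longrightarrow> \<mu> \<in> ks q \<Longrightarrow> ks \<mu> \<subseteq> {..n}"
    and K: "sign_determined h n Q Kf" "sign_determined h n Q Kg"
  shows "saturated h {..<n + 2} (Q \<union> poly_swap n ` Q) {p. Kf p \<and> Kg (p(n := p (n + 1)))}"
  unfolding saturated_def
proof (intro ballI allI impI)
  fix p q assume p: "p \<in> {p. Kf p \<and> Kg (p(n := p (n + 1)))}"
    and s: "\<forall>f\<in>Q \<union> poly_swap n ` Q. sgn (full_eval h {..<n + 2} f q) = sgn (full_eval h {..<n + 2} f p)"
  have 1: "full_eval h {..<n + 2} f x = full_eval h {..n} f x" if "f \<in> Q" for f x by (rule full_eval_Suc) (rule Q[OF that])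
  have 2: "full_eval h {..<n + 2} (poly_swap n f) x = full_eval h {..n} f (x(n := x (n + 1)))" if "f \<in> Q" for f x
    unfolding full_eval_poly_swap 1[OF that] by (rule full_eval_cong) (auto simp: Transposition.transpose_def)
  have "\<forall>f\<in>Q. sgn (full_eval h {..n} f q) = sgn (full_eval h {..n} f p)"
  proof
    fix f assume f: "f \<in> Q"
    then have "f \<in> Q \<union> poly_swap n ` Q" by blast
    from bspec[OF s this] show "sgn (full_eval h {..n} f q) = sgn (full_eval h {..n} f p)" by (simp only: 1[OF f])
  qed
  moreover have "Kf p" "Kg (p(n := p (n + 1)))" using p by simp_all
  ultimately have "Kf q" using K(1) unfolding sign_determined_def by blast
  have "\<forall>f\<in>Q. sgn (full_eval h {..n} f (q(n := q (n + 1)))) = sgn (full_eval h {..n} f (p(n := p (n + 1))))"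
  proof
    fix f assume f: "f \<in> Q"
    then have "poly_swap n f \<in> Q \<union> poly_swap n ` Q" by blast
    from bspec[OF s this] show "sgn (full_eval h {..n} f (q(n := q (n + 1)))) = sgn (full_eval h {..n} f (p(n := p (n + 1))))" by (simp only: 2[OF f])
  qed
  then have "Kg (q(n := q (n + 1)))" using K(2) \<open>Kg (p(n := p (n + 1)))\<close> unfolding sign_determined_def by blast
  with \<open>Kf q\<close> show "q \<in> {p. Kf p \<and> Kg (p(n := p (n + 1)))}" by blast
qed

lemma sign_determined_dep:
  assumes "sign_determined h n Q K" "\<And>i. i \<le> n \<Longrightarrow> y i = x i" "K x"
  shows "K y"
proof -
  have "\<forall>q\<in>Q. sgn (full_eval h {..n} q y) = sgn (full_eval h {..n} q x)" using assms(2) by (intro ballI arg_cong[where f = sgn] full_eval_cong) auto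
  then show ?thesis using assms(1,3) unfolding sign_determined_def by blast
qed

lemma mon_swap_degree: "(\<Sum>i<n + 2. lk (mon_swap n \<mu>) i) = (\<Sum>i<n + 2. lk \<mu> i)"
  unfolding lookup_mon_swap by (rule sum.reindex_bij_betw[OF bij_swap])

lemma mon_swap_keys:
  assumes "ks \<mu> \<subseteq> {..n}"
  shows "ks (mon_swap n \<mu>) \<subseteq> {..<n + 2}"
proof
  fix i assume "i \<in> ks (mon_swap n \<mu>)"
  then have "Transposition.transpose n (n + 1) i \<in> ks \<mu>" by (simp add: in_keys_iff lookup_mon_swap)
  then have "Transposition.transpose n (n + 1) i \<le> n" using assms by auto
  then show "i \<in> {..<n + 2}" by (auto simp: Transposition.transpose_def split: if_splits)
qed

lemma graph_pair_zero:
  assumes "graph_hyps n Kf Kg" "p \<in> {p. Kf p \<and> Kg (p(n := p (n + 1)))}" "p n = 0"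
  shows "p (n + 1) = 0"
proof -
  have "\<forall>x. Kf x \<longrightarrow> x n = 0 \<longrightarrow> (\<forall>y. Kg y \<longrightarrow> (\<forall>i<n. y i = x i) \<longrightarrow> y n = 0)" using assms(1) unfolding graph_hyps_def by (elim conjE)
  moreover have "Kf p" "Kg (p(n := p (n + 1)))" using assms(2) by simp_all
  moreover have "\<forall>i<n. (p(n := p (n + 1))) i = p i" by simp
  ultimately have "(p(n := p (n + 1))) n = 0" using assms(3) by blast
  then show ?thesis by simp
qed

lemma swap_union_degree:
  assumes Q: "\<And>q \<mu>. q \<in> Q \<Longrightarrow> \<mu> \<in> ks q \<Longrightarrow> (\<Sum>i<n + 2. lk \<mu> i) \<le> d"
    and f: "f \<in> Q \<union> poly_swap n ` Q" "\<mu> \<in> ks f"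
  shows "(\<Sum>i<n + 2. lk \<mu> i) \<le> d"
proof (cases "f \<in> Q")
  case True
  then show ?thesis using Q f(2) by blast
next
  case False
  then obtain q where q: "q \<in> Q" "f = poly_swap n q" using f(1) by blast
  then obtain \<nu> where \<nu>: "\<nu> \<in> ks q" "\<mu> = mon_swap n \<nu>" using f(2) by (auto simp: keys_poly_swap)
  show ?thesis unfolding \<nu>(2) mon_swap_degree by (rule Q[OF q(1) \<nu>(1)])
qed

text \<open>There are \<open>n + 2\<close> coordinates and slicing fixes the one at
  \<open>n\<close>; elimination in the remaining \<open>n + 1\<close> produces the exponent
  \<open>(2 * d + 2) ^ (n + 1)\<close>.\<close>

theorem graph_lojasiewicz_real:
  fixes Q :: "real mpoly set"
  assumes Q: "finite Q" "\<And>q \<mu>. q \<in> Q \<Longrightarrow> \<mu> \<in> ks q \<Longrightarrow> ks \<mu> \<subseteq> {..n}"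
      "\<And>q \<mu>. q \<in> Q \<Longrightarrow> \<mu> \<in> ks q \<Longrightarrow> (\<Sum>i<n + 2. lk \<mu> i) \<le> d"
    and K: "sign_determined (\<lambda>x. x) n Q Kf" "sign_determined (\<lambda>x. x) n Q Kg"
    and H: "graph_hyps n Kf Kg" and N: "(2 * d + 2) ^ (n + 1) \<le> N"
  shows "graph_concl n N Kf Kg"
proof -
  let ?K = "{p. Kf p \<and> Kg (p(n := p (n + 1)))}"
  have c: "seq_compact_on {..<n + 2} ?K"
  proof (rule graph_seq_compact[OF H])
    show "Kf y" if "\<And>i. i \<le> n \<Longrightarrow> y i = x i" "Kf x" for x y by (rule sign_determined_dep[OF K(1) that])
    show "Kg y" if "\<And>i. i \<le> n \<Longrightarrow> y i = x i" "Kg x" for x y by (rule sign_determined_dep[OF K(2) that])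
  qed
  have s: "saturated (\<lambda>x. x) {..<n + 2} (Q \<union> poly_swap n ` Q) ?K" by (rule saturated_graph_pair[OF _ K]) (rule Q(2))
  have dg: "(\<Sum>i<n + 2. lk \<mu> i) \<le> d" if "f \<in> Q \<union> poly_swap n ` Q" "\<mu> \<in> ks f" for f \<mu>
    by (rule swap_union_degree[OF _ that]) (rule Q(3))
  have "\<exists>c. \<forall>p\<in>?K. \<bar>p (n + 1)\<bar> ^ N \<le> c * \<bar>p n\<bar>"
  proof (rule lojasiewicz_real[where W = "{..<n + 2}" and F = "Q \<union> poly_swap n ` Q" and d = d])
    show "(\<Sum>i<n + 2. lk \<mu> i) \<le> d" if "f \<in> Q \<union> poly_swap n ` Q" "\<mu> \<in> ks f" for f \<mu> by (rule dg[OF that])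
    show "p (n + 1) = 0" if "p \<in> ?K" "p n = 0" for p by (rule graph_pair_zero[OF H that])
    show "(2 * d + 2) ^ (card {..<n + 2} - 1) \<le> N" using N by simp
  qed (use Q(1) c s in simp_all)
  then obtain c where c: "\<And>p. p \<in> ?K \<Longrightarrow> \<bar>p (n + 1)\<bar> ^ N \<le> c * \<bar>p n\<bar>" by blast
  show ?thesis unfolding graph_concl_def
  proof (intro exI[of _ "\<lambda>_. c"] allI impI)
    fix x y assume *: "Kf x" "Kg y" "\<forall>i<n. y i = x i"
    have "Kf (x(n + 1 := y n))" by (rule sign_determined_dep[OF K(1) _ *(1)]) auto
    moreover have "Kg ((x(n + 1 := y n))(n := (x(n + 1 := y n)) (n + 1)))" by (rule sign_determined_dep[OF K(2) _ *(2)]) (use *(3) in \<open>auto simp: le_less\<close>)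
    ultimately show "\<bar>y n\<bar> ^ N \<le> c * \<bar>x n\<bar>" using c[of "x(n + 1 := y n)"] by simp
  qed
qed

text \<open>The factor 2 in the assumption on \<open>\<sigma>\<close> pays for the swapped copies of
  the polynomials, which have the same lengths.\<close>

theorem graph_lojasiewicz_int:
  fixes Q :: "int mpoly set"
  assumes Q: "finite Q" "\<And>q \<mu>. q \<in> Q \<Longrightarrow> \<mu> \<in> ks q \<Longrightarrow> ks \<mu> \<subseteq> {..n}"
      "\<And>q \<mu>. q \<in> Q \<Longrightarrow> \<mu> \<in> ks q \<Longrightarrow> (\<Sum>i<n + 2. lk \<mu> i) \<le> d" and d: "2 \<le> d"
    and K: "sign_determined real_of_int n Q Kf" "sign_determined real_of_int n Q Kg"
    and H: "graph_hyps n Kf Kg" and N: "(2 * d + 2) ^ (n + 1) \<le> N"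
    and Y: "Y = (2 * d + 2) ^ (n + 2)"
    and S: "2 * (\<Sum>q\<in>Q. (mlen int_norm q)\<^sup>2) \<le> 2 ^ \<sigma>"
    and xy: "Kf x" "Kg y" "\<And>i. i < n \<Longrightarrow> y i = x i"
  shows "\<bar>y n\<bar> ^ N \<le> 2 ^ (3 * Y ^ 5 * (\<sigma> + 1) * (N + 11 * Y ^ 5)) * \<bar>x n\<bar>"
proof -
  let ?K = "{p. Kf p \<and> Kg (p(n := p (n + 1)))}"
  let ?F = "Q \<union> poly_swap n ` Q"
  have c: "seq_compact_on {..<n + 2} ?K"
  proof (rule graph_seq_compact[OF H])
    show "Kf y" if "\<And>i. i \<le> n \<Longrightarrow> y i = x i" "Kf x" for x y by (rule sign_determined_dep[OF K(1) that])
    show "Kg y" if "\<And>i. i \<le> n \<Longrightarrow> y i = x i" "Kg x" for x y by (rule sign_determined_dep[OF K(2) that])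
  qed
  have s: "saturated real_of_int {..<n + 2} ?F ?K" by (rule saturated_graph_pair[OF _ K]) (rule Q(2))
  have dg: "(\<Sum>i<n + 2. lk \<mu> i) \<le> d" if "f \<in> ?F" "\<mu> \<in> ks f" for f \<mu>
    by (rule swap_union_degree[OF _ that]) (rule Q(3))
  have kW: "ks \<mu> \<subseteq> {..<n + 2}" if "f \<in> ?F" "\<mu> \<in> ks f" for f \<mu>
    using that
  proof (elim UnE)
    assume "f \<in> Q" "\<mu> \<in> ks f"
    from Q(2)[OF this] show ?thesis by auto
  next
    assume "f \<in> poly_swap n ` Q" "\<mu> \<in> ks f"
    then obtain q \<nu> where "q \<in> Q" "\<nu> \<in> ks q" "\<mu> = mon_swap n \<nu>" unfolding keys_poly_swap by (auto simp: keys_poly_swap)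
    then show ?thesis using mon_swap_keys[OF Q(2)] by blast
  qed
  have ml: "mlen int_norm (poly_swap n q) = mlen int_norm q" for q
    unfolding mlen_def keys_poly_swap
    by (subst sum.reindex[OF inj_on_subset[OF inj_mon_swap subset_UNIV], unfolded comp_def]) (simp only: lookup_poly_swap mon_swap_swap)
  have "(\<Sum>f\<in>?F. (mlen int_norm f)\<^sup>2) \<le> (\<Sum>f\<in>Q. (mlen int_norm f)\<^sup>2) + (\<Sum>f\<in>poly_swap n ` Q. (mlen int_norm f)\<^sup>2)"
    using Q(1) by (simp add: sum_Un sum_nonneg)
  also have "(\<Sum>f\<in>poly_swap n ` Q. (mlen int_norm f)\<^sup>2) \<le> (\<Sum>f\<in>Q. (mlen int_norm f)\<^sup>2)"
    using sum_image_le[OF Q(1), of "\<lambda>f. (mlen int_norm f)\<^sup>2" "poly_swap n"] by (simp add: ml)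
  finally have S': "(\<Sum>f\<in>?F. (mlen int_norm f)\<^sup>2) \<le> 2 ^ \<sigma>" using S by simp
  let ?p = "x(n + 1 := y n)"
  have "Kf ?p" by (rule sign_determined_dep[OF K(1) _ xy(1)]) auto
  moreover have "Kg (?p(n := ?p (n + 1)))" by (rule sign_determined_dep[OF K(2) _ xy(2)]) (use xy(3) in \<open>auto simp: le_less\<close>)
  ultimately have p: "?p \<in> ?K" by simp
  have Y': "Y = (2 * d + 2) ^ card {..<n + 2}" using Y by simp
  have "\<bar>?p (n + 1)\<bar> ^ N \<le> 2 ^ (3 * Y ^ 5 * (\<sigma> + 1) * (N + 11 * Y ^ 5)) * \<bar>?p n\<bar>"
  proof (rule lojasiewicz_int_power[where W = "{..<n + 2}" and F = ?F and d = d and K = ?K and e = "2 * d + 2"])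
    show "(2 * d + 2) ^ (card {..<n + 2} - 1) \<le> N" using N by simp
    show "ks \<mu> \<subseteq> {..<n + 2}" "(\<Sum>i<n + 2. lk \<mu> i) \<le> d" if "f \<in> ?F" "\<mu> \<in> ks f" for f \<mu> using kW[OF that] dg[OF that] .
    show "p (n + 1) = 0" if "p \<in> ?K" "p n = 0" for p by (rule graph_pair_zero[OF H that])
  qed (fact d c s Y' S' p | use Q(1) in simp)+
  then show ?thesis by simp
qed

text \<open>Transfer is applied to all formulas with the same supports at once: the coefficients are
  numbered by \<open>k\<close> and become a parameter vector. Over the reals each choice of
  parameters is covered by \<open>graph_lojasiewicz_real\<close>; specializing to \<open>par\<close>
  returns the given formulas.\<close>

theorem graph_lojasiewicz:
  fixes Q :: "'a::real_closed_field mpoly set"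
  assumes Q: "finite Q" "\<And>q \<mu>. q \<in> Q \<Longrightarrow> \<mu> \<in> ks q \<Longrightarrow> ks \<mu> \<subseteq> {..n}"
      "\<And>q \<mu>. q \<in> Q \<Longrightarrow> \<mu> \<in> ks q \<Longrightarrow> (\<Sum>i<n + 2. lk \<mu> i) \<le> d"
    and at: "qf_atoms \<phi> \<subseteq> Q" "qf_atoms \<gamma> \<subseteq> Q" and N: "(2 * d + 2) ^ (n + 1) \<le> N"
    and H: "graph_hyps n (\<lambda>x. qf_sem (coeff_eval n ks lk x) \<phi>) (\<lambda>x. qf_sem (coeff_eval n ks lk x) \<gamma>)"
  shows "graph_concl n N (\<lambda>x. qf_sem (coeff_eval n ks lk x) \<phi>) (\<lambda>x. qf_sem (coeff_eval n ks lk x) \<gamma>)"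
proof -
  let ?I = "Sigma Q ks"
  have fI: "finite ?I" using Q(1) by auto
  then obtain k where k: "bij_betw k ?I {0..<card ?I}" using ex_bij_betw_finite_nat by blast
  define m where "m = n + card ?I"
  define par where "par j = (case inv_into ?I k j of (q, \<mu>) \<Rightarrow> lk q \<mu>)" for j
  have km: "k (q, \<mu>) \<le> m" if "q \<in> Q" "\<mu> \<in> ks q" for q \<mu>
  proof -
    have "k (q, \<mu>) \<in> {0..<card ?I}" using bij_betwE[OF k] that by blast
    then show ?thesis unfolding m_def by simp
  qed
  have par: "par (k (q, \<mu>)) = lk q \<mu>" if "q \<in> Q" "\<mu> \<in> ks q" for q \<mu>
    unfolding par_def using bij_betw_inv_into_left[OF k, of "(q, \<mu>)"] that by simp
  define \<Phi> :: "'a mpoly qf_formula \<Rightarrow> (nat \<Rightarrow> 'a) \<Rightarrow> (nat \<Rightarrow> 'a) \<Rightarrow> bool"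
    where "\<Phi> \<xi> p x = qf_sem (coeff_eval n ks (\<lambda>q \<mu>. p (k (q, \<mu>))) x) \<xi>" for \<xi> p x
  define \<Psi> :: "'a mpoly qf_formula \<Rightarrow> (nat \<Rightarrow> real) \<Rightarrow> (nat \<Rightarrow> real) \<Rightarrow> bool"
    where "\<Psi> \<xi> p x = qf_sem (coeff_eval n ks (\<lambda>q \<mu>. p (k (q, \<mu>))) x) \<xi>" for \<xi> p x
  have tr: "transfer_blk m (\<lambda>E. \<Phi> \<xi> (E 0) (E b)) (\<lambda>E. \<Psi> \<xi> (E 0) (E b))" if "qf_atoms \<xi> \<subseteq> Q" for \<xi> b
    unfolding \<Phi>_def \<Psi>_def using that km by (intro transfer_blk_qf_sem[where k = "\<lambda>q \<mu>. k (q, \<mu>)"]) (auto simp: m_def)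
  have "\<forall>p. graph_hyps n (\<Psi> \<phi> p) (\<Psi> \<gamma> p) \<longrightarrow> graph_concl n N (\<Psi> \<phi> p) (\<Psi> \<gamma> p)"
  proof (intro allI impI)
    fix p :: "nat \<Rightarrow> real" assume H: "graph_hyps n (\<Psi> \<phi> p) (\<Psi> \<gamma> p)"
    \<comment> \<open>The real polynomial with the parameters as coefficients. Some of them may
      vanish, so its support is only contained in that of \<open>q\<close>, and the bounds on
      variables and degree persist.\<close>
    define rp where "rp q = (\<Sum>\<mu>\<in>ks q. Poly_Mapping.single \<mu> (p (k (q, \<mu>))))" for q
    have lrp: "lk (rp q) \<mu> = (if \<mu> \<in> ks q then p (k (q, \<mu>)) else 0)" for q \<mu>
      unfolding rp_def by (simp add: lookup_sum lookup_single when_def)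
    have krp: "ks (rp q) \<subseteq> ks q" for q using lrp by (auto simp: in_keys_iff split: if_splits)
    have ev: "full_eval (\<lambda>x. x) {..n} (rp q) x = coeff_eval n ks (\<lambda>q \<mu>. p (k (q, \<mu>))) x q" for q x
      unfolding full_eval_def coeff_eval_def monval_def
      by (rule sum.mono_neutral_cong_left) (use krp in \<open>auto simp: lrp in_keys_iff split: if_splits\<close>)
    have sd: "sign_determined (\<lambda>x. x) n (rp ` Q) (\<Psi> \<xi> p)" if "qf_atoms \<xi> \<subseteq> Q" for \<xi>
      unfolding sign_determined_def
    proof (intro allI impI)
      fix x y assume s: "\<forall>q\<in>rp ` Q. sgn (full_eval (\<lambda>x. x) {..n} q y) = sgn (full_eval (\<lambda>x. x) {..n} q x)" and "\<Psi> \<xi> p x"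
      moreover have "\<Psi> \<xi> p y = \<Psi> \<xi> p x" unfolding \<Psi>_def
        by (rule qf_sem_cong_sgn) (use s that in \<open>auto simp: ev\<close>)
      ultimately show "\<Psi> \<xi> p y" by simp
    qed
    show "graph_concl n N (\<Psi> \<phi> p) (\<Psi> \<gamma> p)"
    proof (rule graph_lojasiewicz_real[OF _ _ _ sd[OF at(1)] sd[OF at(2)] H N])
      show "ks \<mu> \<subseteq> {..n}" "(\<Sum>i<n + 2. lk \<mu> i) \<le> d" if "f \<in> rp ` Q" "\<mu> \<in> ks f" for f \<mu> using that krp Q(2,3) by blast+
    qed (use Q(1) in simp)
  qed
  moreover have "n \<le> m" unfolding m_def by simp
  ultimately have all: "\<forall>p. graph_hyps n (\<Phi> \<phi> p) (\<Phi> \<gamma> p) \<longrightarrow> graph_concl n N (\<Phi> \<phi> p) (\<Phi> \<gamma> p)"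
    using transfer_graph_sentence[of m "\<Phi> \<phi>" "\<Psi> \<phi>" "\<Phi> \<gamma>" "\<Psi> \<gamma>" n N, OF tr[OF at(1)] tr[OF at(2)]] by blast
  have eq: "\<Phi> \<xi> par = (\<lambda>x. qf_sem (coeff_eval n ks lk x) \<xi>)" if "qf_atoms \<xi> \<subseteq> Q" for \<xi>
  proof
    fix x
    have "coeff_eval n ks (\<lambda>q \<mu>. par (k (q, \<mu>))) x q = coeff_eval n ks lk x q" if "q \<in> Q" for q
      unfolding coeff_eval_def using par[OF that] by simp
    then show "\<Phi> \<xi> par x = qf_sem (coeff_eval n ks lk x) \<xi>" unfolding \<Phi>_def
      by (intro qf_sem_cong_sgn) (use that in auto)
  qed
  show ?thesis by (rule mp[OF spec[OF all, of par, unfolded eq[OF at(1)] eq[OF at(2)]] H])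
qed

section \<open>From functions on lists to graph relations\<close>

lemma mpoly_eval_coeff_eval:
  fixes q :: "'a::comm_ring_1 mpoly"
  assumes "poly_in_vars_deg (Suc n) d q"
  shows "mpoly_eval q (map x [0..<Suc n]) = coeff_eval n ks lk x q"
  unfolding mpoly_eval_def coeff_eval_def
proof (rule sum.cong[OF refl])
  fix \<mu> assume "\<mu> \<in> ks q"
  then have k: "ks \<mu> \<subseteq> {..<Suc n}" using assms unfolding poly_in_vars_deg_def by blast
  have "(\<Prod>i\<in>ks \<mu>. map x [0..<Suc n] ! i ^ lk \<mu> i) = (\<Prod>i\<in>ks \<mu>. x i ^ lk \<mu> i)"
  proof (rule prod.cong[OF refl])
    fix i assume "i \<in> ks \<mu>"
    then have "i < Suc n" using k by blast
    then have "map x [0..<Suc n] ! i = x i" by (simp del: upt_Suc)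
    then show "map x [0..<Suc n] ! i ^ lk \<mu> i = x i ^ lk \<mu> i" by simp
  qed
  also have "\<dots> = (\<Prod>i\<le>n. x i ^ lk \<mu> i)"
    by (rule prod.mono_neutral_left) (use k in \<open>auto simp: in_keys_iff lessThan_Suc_atMost\<close>)
  finally show "lk q \<mu> * (\<Prod>i\<in>ks \<mu>. map x [0..<Suc n] ! i ^ lk \<mu> i) = lk q \<mu> * (\<Prod>i\<le>n. x i ^ lk \<mu> i)" by simp
qed

lemma semialg_fun_graph:
  fixes Q :: "'a::linordered_field mpoly set"
  assumes f: "semialg_fun n Q A f" and Q: "\<And>q. q \<in> Q \<Longrightarrow> poly_in_vars_deg (Suc n) d q"
    and A: "\<And>z. z \<in> A \<Longrightarrow> length z = n"
  shows "\<exists>\<phi>. qf_atoms \<phi> \<subseteq> Q \<and>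
    (\<forall>x. qf_sem (coeff_eval n ks lk x) \<phi> \<longleftrightarrow> map x [0..<n] \<in> A \<and> f (map x [0..<n]) = x n)"
proof -
  obtain \<phi> where \<phi>: "qf_atoms \<phi> \<subseteq> Q" "(\<lambda>x. x @ [f x]) ` A = {x. length x = Suc n \<and> qf_sat \<phi> x}"
    using f unfolding semialg_fun_def semialg_def by auto
  have K: "qf_sem (coeff_eval n ks lk x) \<phi> \<longleftrightarrow> map x [0..<n] \<in> A \<and> f (map x [0..<n]) = x n" for x
  proof -
    have "qf_sem (coeff_eval n ks lk x) \<phi> = qf_sem (\<lambda>q. mpoly_eval q (map x [0..<Suc n])) \<phi>"
    proof (rule qf_sem_cong_sgn)
      fix q assume "q \<in> qf_atoms \<phi>"
      then have "q \<in> Q" using \<phi>(1) by blast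
      show "sgn (coeff_eval n ks lk x q) = sgn (mpoly_eval q (map x [0..<Suc n]))"
        unfolding mpoly_eval_coeff_eval[OF Q[OF \<open>q \<in> Q\<close>]] by (rule refl)
    qed
    also have "\<dots> \<longleftrightarrow> map x [0..<Suc n] \<in> {x. length x = Suc n \<and> qf_sat \<phi> x}" unfolding qf_sat_qf_sem by (simp del: upt_Suc)
    also have "\<dots> \<longleftrightarrow> map x [0..<n] @ [x n] \<in> (\<lambda>x. x @ [f x]) ` A" unfolding \<phi>(2)[symmetric] by simp
    also have "\<dots> \<longleftrightarrow> map x [0..<n] \<in> A \<and> f (map x [0..<n]) = x n" by auto
    finally show ?thesis .
  qed
  show ?thesis by (intro exI[of _ \<phi>] conjI allI \<phi>(1) K)
qed

lemma graph_hypsI: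
  fixes Kf Kg :: "(nat \<Rightarrow> 'a::linordered_field) \<Rightarrow> bool"
  assumes Kf: "\<And>x. Kf x \<longleftrightarrow> map x [0..<n] \<in> A \<and> f (map x [0..<n]) = x n"
    and Kg: "\<And>x. Kg x \<longleftrightarrow> map x [0..<n] \<in> A \<and> g (map x [0..<n]) = x n"
    and cl: "sa_closed n A" and bd: "sa_bounded n A" and cf: "sa_continuous_on n A f" and cg: "sa_continuous_on n A g"
    and zero: "\<forall>x\<in>A. f x = 0 \<longrightarrow> g x = 0"
  shows "graph_hyps n Kf Kg"
proof -
  have eq: "map y [0..<n] = map x [0..<n]" if "\<forall>i<n. y i = x i" for x y :: "nat \<Rightarrow> 'a" using that by simp
  have cont: "graph_continuous n K"
    if K: "\<And>x. K x \<longleftrightarrow> map x [0..<n] \<in> A \<and> k (map x [0..<n]) = x n" and k: "sa_continuous_on n A k"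
    for K and k :: "'a list \<Rightarrow> 'a" unfolding graph_continuous_def
  proof (intro allI impI)
    fix x \<epsilon> :: "nat \<Rightarrow> 'a" assume x: "K x" and e: "0 < \<epsilon> 0"
    have "map x [0..<n] \<in> A" using x K by blast
    from mp[OF spec[OF bspec[OF k[unfolded sa_continuous_on_def] this]] e]
    obtain \<delta> where \<delta>: "\<delta> > 0 \<and> (\<forall>y\<in>A. (\<forall>i<n. \<bar>y ! i - map x [0..<n] ! i\<bar> < \<delta>) \<longrightarrow> \<bar>k y - k (map x [0..<n])\<bar> < \<epsilon> 0)" ..
    note d = \<delta>[THEN conjunct1] bspec[OF \<delta>[THEN conjunct2]]
    have "\<bar>y n - x n\<bar> < \<epsilon> 0" if y: "K y" and "\<forall>i<n. \<bar>y i - x i\<bar> < \<delta>" for y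
      using d(2)[of "map y [0..<n]"] that y[unfolded K] x[unfolded K] by simp
    then show "\<exists>\<delta>. 0 < \<delta> (0::nat) \<and> (\<forall>y. K y \<longrightarrow> (\<forall>i<n. \<bar>y i - x i\<bar> < \<delta> 0) \<longrightarrow> \<bar>y n - x n\<bar> < \<epsilon> 0)"
      using d(1) by (intro exI[of _ "\<lambda>_. \<delta>"]) simp
  qed
  have 1: "\<exists>\<epsilon>. 0 < \<epsilon> (0::nat) \<and> (\<forall>y. (\<forall>i<n. \<bar>y i - x i\<bar> < \<epsilon> 0) \<longrightarrow> \<not> Kf y)"
    if x: "\<forall>y. (\<forall>i<n. y i = x i) \<longrightarrow> \<not> Kf y" for x
  proof -
    have "\<not> Kf (x(n := f (map x [0..<n])))" by (rule mp[OF spec[OF x]]) simp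
    moreover have "map (x(n := f (map x [0..<n]))) [0..<n] = map x [0..<n]" by (rule eq) simp
    ultimately have "map x [0..<n] \<notin> A" unfolding Kf by simp
    then have "length (map x [0..<n]) = n \<and> map x [0..<n] \<notin> A" by simp
    from mp[OF spec[OF cl[unfolded sa_closed_def]] this]
    obtain e where e': "e > 0 \<and> (\<forall>y. length y = n \<and> (\<forall>i<n. \<bar>y ! i - map x [0..<n] ! i\<bar> < e) \<longrightarrow> y \<notin> A)" ..
    note e = e'[THEN conjunct1] spec[OF e'[THEN conjunct2]]
    have "\<not> Kf y" if "\<forall>i<n. \<bar>y i - x i\<bar> < e" for y using e(2)[of "map y [0..<n]"] that unfolding Kf by simp
    then show ?thesis using e(1) by (intro exI[of _ "\<lambda>_. e"]) simp
  qed
  obtain r where r: "\<And>x i. x \<in> A \<Longrightarrow> i < n \<Longrightarrow> \<bar>x ! i\<bar> \<le> r" using bd unfolding sa_bounded_def by blast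
  have 2: "\<exists>r. \<forall>x. Kf x \<longrightarrow> (\<forall>i<n. \<bar>x i\<bar> \<le> r (0::nat))"
  proof (intro exI[of _ "\<lambda>_. r"] allI impI)
    fix x i assume "Kf x" "i < n"
    then show "\<bar>x i\<bar> \<le> r" using r[of "map x [0..<n]" i] unfolding Kf by simp
  qed
  have 3: "\<exists>y. (\<forall>i<n. y i = x i) \<and> Kg y" if "Kf x" for x
  proof (intro exI[of _ "x(n := g (map x [0..<n]))"] conjI)
    have "map (x(n := g (map x [0..<n]))) [0..<n] = map x [0..<n]" by (rule eq) simp
    then show "Kg (x(n := g (map x [0..<n])))" using that unfolding Kg Kf by simp
  qed simp
  have 4: "y n = 0" if "Kf x" "x n = 0" "Kg y" "\<forall>i<n. y i = x i" for x y
    using that(1,2,3) zero unfolding Kf Kg eq[OF that(4)] by auto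
  show ?thesis unfolding graph_hyps_def
  proof (intro conjI)
    show "\<forall>x. (\<forall>y. (\<forall>i<n. y i = x i) \<longrightarrow> \<not> Kf y) \<longrightarrow>
        (\<exists>\<epsilon>. 0 < \<epsilon> (0::nat) \<and> (\<forall>y. (\<forall>i<n. \<bar>y i - x i\<bar> < \<epsilon> 0) \<longrightarrow> \<not> Kf y))" by (intro allI impI, rule 1, assumption)
    show "\<forall>x. Kf x \<longrightarrow> (\<exists>y. (\<forall>i<n. y i = x i) \<and> Kg y)" by (intro allI impI, rule 3, assumption)
    show "\<forall>x. Kf x \<longrightarrow> x n = 0 \<longrightarrow> (\<forall>y. Kg y \<longrightarrow> (\<forall>i<n. y i = x i) \<longrightarrow> y n = 0)" by (intro allI impI) (rule 4)
    show "graph_continuous n Kf" by (rule cont[of Kf f, OF Kf cf])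
    show "graph_continuous n Kg" by (rule cont[of Kg g, OF Kg cg])
  qed (fact 2)
qed

lemma graph_function_points:
  fixes z :: "'a::linordered_field list"
  assumes "z \<in> A" "length z = n"
    and Kf: "\<And>x. Kf x \<longleftrightarrow> map x [0..<n] \<in> A \<and> f (map x [0..<n]) = x n"
    and Kg: "\<And>x. Kg x \<longleftrightarrow> map x [0..<n] \<in> A \<and> g (map x [0..<n]) = x n"
  shows "\<exists>x y. Kf x \<and> Kg y \<and> (\<forall>i<n. y i = x i) \<and> x n = f z \<and> y n = g z"
proof -
  have m: "map (\<lambda>i. if i < n then z ! i else v) [0..<n] = z" for v
    using assms(2) by (intro nth_equalityI) auto
  show ?thesis
    by (rule exI[of _ "\<lambda>i. if i < n then z ! i else f z"], rule exI[of _ "\<lambda>i. if i < n then z ! i else g z"]) (simp add: Kf Kg m assms(1))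
qed

lemma mon_degree_sum:
  assumes "ks \<mu> \<subseteq> W" "finite W"
  shows "(\<Sum>i\<in>W. lk \<mu> i) = mon_degree \<mu>"
  unfolding mon_degree_def by (rule sum.mono_neutral_right) (use assms in \<open>auto simp: in_keys_iff\<close>)

lemma poly_in_vars_degD:
  assumes "poly_in_vars_deg (Suc n) d q" "\<mu> \<in> ks q"
  shows "ks \<mu> \<subseteq> {..n}" "(\<Sum>i<n + 2. lk \<mu> i) \<le> d"
proof -
  have k: "ks \<mu> \<subseteq> {..<Suc n}" "mon_degree \<mu> \<le> d" using assms unfolding poly_in_vars_deg_def by blast+
  then show "ks \<mu> \<subseteq> {..n}" by (simp only: lessThan_Suc_atMost)
  have "ks \<mu> \<subseteq> {..<n + 2}" using k(1) by auto
  from mon_degree_sum[OF this] show "(\<Sum>i<n + 2. lk \<mu> i) \<le> d" using k(2) by simp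
qed

section \<open>Counting integer polynomials, and the final exponent\<close>

text \<open>Bounding each exponent by \<open>d\<close> instead of the total degree admits more
  monomials, but their number is bounded by a plain power.\<close>

definition low_monomials :: "nat \<Rightarrow> nat \<Rightarrow> (nat \<Rightarrow>\<^sub>0 nat) set" where
  "low_monomials n d = {\<mu>. ks \<mu> \<subseteq> {..n} \<and> (\<forall>i. lk \<mu> i \<le> d)}"

lemma card_low_monomials: "finite (low_monomials n d)" "card (low_monomials n d) \<le> (d + 1) ^ (n + 1)"
proof -
  let ?r = "\<lambda>\<mu> :: nat \<Rightarrow>\<^sub>0 nat. restrict (lk \<mu>) {..n}"
  have inj: "inj_on ?r (low_monomials n d)"
  proof (rule inj_onI, rule poly_mapping_eqI)
    fix \<mu> \<nu> i assume *: "\<mu> \<in> low_monomials n d" "\<nu> \<in> low_monomials n d" "?r \<mu> = ?r \<nu>"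
    show "lk \<mu> i = lk \<nu> i"
    proof (cases "i \<le> n")
      case True
      then show ?thesis using fun_cong[OF *(3), of i] by simp
    next
      case False
      then have "i \<notin> ks \<mu>" "i \<notin> ks \<nu>" using *(1,2) unfolding low_monomials_def by auto
      then show ?thesis by (simp add: in_keys_iff)
    qed
  qed
  have im: "?r ` low_monomials n d \<subseteq> {..n} \<rightarrow>\<^sub>E {..d}"
  proof (rule image_subsetI)
    fix \<mu> assume "\<mu> \<in> low_monomials n d"
    then show "?r \<mu> \<in> {..n} \<rightarrow>\<^sub>E {..d}" unfolding low_monomials_def by (intro restrict_PiE_iff[THEN iffD2] ballI) simp
  qed
  have fin: "finite ({..n} \<rightarrow>\<^sub>E {..d})" by (intro finite_PiE) auto
  show "finite (low_monomials n d)" using finite_imageD[OF finite_subset[OF im fin] inj] .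
  have "card (low_monomials n d) \<le> card ({..n} \<rightarrow>\<^sub>E {..d})" by (rule card_inj_on_le[OF inj im fin])
  also have "\<dots> = (d + 1) ^ (n + 1)" by (simp add: card_PiE)
  finally show "card (low_monomials n d) \<le> (d + 1) ^ (n + 1)" .
qed

lemma lookup_le_sum:
  fixes \<mu> :: "nat \<Rightarrow>\<^sub>0 nat"
  shows "ks \<mu> \<subseteq> {..n} \<Longrightarrow> (\<Sum>i<n + 2. lk \<mu> i) \<le> (d::nat) \<Longrightarrow> lk \<mu> i \<le> d"
proof (cases "i \<in> {..<n + 2}")
  case True
  assume "(\<Sum>i<n + 2. lk \<mu> i) \<le> d"
  moreover have "lk \<mu> i \<le> (\<Sum>i<n + 2. lk \<mu> i)" using True by (intro member_le_sum) auto
  ultimately show ?thesis by linarith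
next
  case False
  assume "ks \<mu> \<subseteq> {..n}"
  then have "i \<notin> ks \<mu>" using False by auto
  then show ?thesis by (simp add: in_keys_iff)
qed

text \<open>Makes the constant independent of the number of polynomials: with at most
  \<open>P\<close> monomials and coefficients below \<open>2 ^ \<tau>\<close> in absolute value
  there are at most \<open>2 ^ ((\<tau> + 1) * P)\<close> integer polynomials at all, each of length
  at most \<open>2 ^ (P + \<tau>)\<close>.\<close>

lemma sum_mlen_bound:
  fixes Q :: "int mpoly set" and \<tau> n d :: nat
  assumes Q: "\<And>q. q \<in> Q \<Longrightarrow> ks q \<subseteq> low_monomials n d" "\<And>q \<mu>. q \<in> Q \<Longrightarrow> \<bar>lk q \<mu>\<bar> < 2 ^ \<tau>"
    and P: "P = (d + 1) ^ (n + 1)"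
  shows "2 * (\<Sum>q\<in>Q. (mlen int_norm q)\<^sup>2) \<le> 2 ^ (1 + (\<tau> + 1) * P + 2 * (P + \<tau>))"
proof -
  let ?M = "low_monomials n d"
  let ?C = "{- (2 ^ \<tau>)<..<2 ^ \<tau>} :: int set"
  let ?r = "\<lambda>q :: int mpoly. restrict (lk q) ?M"
  have inj: "inj_on ?r Q"
  proof (rule inj_onI, rule poly_mapping_eqI)
    fix p q \<mu> assume *: "p \<in> Q" "q \<in> Q" "?r p = ?r q"
    show "lk p \<mu> = lk q \<mu>"
    proof (cases "\<mu> \<in> ?M")
      case True
      then show ?thesis using fun_cong[OF *(3), of \<mu>] by simp
    next
      case False
      then have "\<mu> \<notin> ks p" "\<mu> \<notin> ks q" using Q(1) *(1,2) by blast+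
      then show ?thesis by (simp add: in_keys_iff)
    qed
  qed
  have cf: "lk q \<mu> \<in> ?C" if "q \<in> Q" for q \<mu> using Q(2)[OF that, of \<mu>] by (simp add: abs_less_iff)
  have im: "?r ` Q \<subseteq> ?M \<rightarrow>\<^sub>E ?C"
  proof (rule image_subsetI)
    fix q assume "q \<in> Q"
    then show "?r q \<in> ?M \<rightarrow>\<^sub>E ?C" using cf by (intro restrict_PiE_iff[THEN iffD2] ballI) blast
  qed
  have fin: "finite (?M \<rightarrow>\<^sub>E ?C)" using card_low_monomials(1) by (intro finite_PiE) auto
  have "card Q \<le> card (?M \<rightarrow>\<^sub>E ?C)" by (rule card_inj_on_le[OF inj im fin])
  also have "\<dots> = card ?C ^ card ?M" using card_low_monomials(1) by (simp add: card_PiE)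
  also have "\<dots> \<le> (2 ^ (\<tau> + 1)) ^ card ?M"
  proof (rule power_mono)
    have "card ?C = nat (2 ^ \<tau> - (- (2 ^ \<tau>) + 1))" by simp
    also have "\<dots> \<le> nat (2 ^ (\<tau> + 1))" by (intro nat_mono) simp
    also have "\<dots> = 2 ^ (\<tau> + 1)" by (subst nat_power_eq) simp_all
    finally show "card ?C \<le> 2 ^ (\<tau> + 1)" .
  qed simp
  also have "\<dots> \<le> (2 ^ (\<tau> + 1)) ^ P" unfolding P by (intro power_increasing card_low_monomials(2)) simp
  finally have cQ: "card Q \<le> 2 ^ ((\<tau> + 1) * P)" by (simp only: power_mult)
  have ml: "(mlen int_norm q)\<^sup>2 \<le> 2 ^ (2 * (P + \<tau>))" if q: "q \<in> Q" for q
  proof -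
    have b: "int_norm (lk q \<mu>) \<le> 2 ^ \<tau>" for \<mu>
    proof -
      have "real_of_int \<bar>lk q \<mu>\<bar> \<le> real_of_int (2 ^ \<tau>)" using Q(2)[OF q, of \<mu>] by (simp only: of_int_le_iff less_imp_le)
      then show ?thesis unfolding int_norm_def by simp
    qed
    have "mlen int_norm q \<le> (\<Sum>\<mu>\<in>ks q. 2 ^ \<tau>)" unfolding mlen_def by (rule sum_mono) (rule b)
    also have "\<dots> = real (card (ks q)) * 2 ^ \<tau>" by simp
    also have "\<dots> \<le> 2 ^ P * 2 ^ \<tau>"
    proof (rule mult_right_mono)
      have "card (ks q) \<le> card ?M" by (rule card_mono[OF card_low_monomials(1) Q(1)[OF q]])
      also have "\<dots> \<le> P" unfolding P by (rule card_low_monomials(2))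
      also have "\<dots> \<le> 2 ^ P" by (rule less_imp_le[OF less_exp])
      finally have "real (card (ks q)) \<le> real (2 ^ P)" by (rule of_nat_mono)
      then show "real (card (ks q)) \<le> 2 ^ P" by simp
    qed simp
    finally have "mlen int_norm q \<le> 2 ^ (P + \<tau>)" by (simp only: power_add)
    then have "(mlen int_norm q)\<^sup>2 \<le> (2 ^ (P + \<tau>))\<^sup>2" using mlen_nonneg[OF ring_norm_int, of q] by (rule power_mono)
    then show ?thesis by (simp only: power_mult[symmetric] mult.commute)
  qed
  have "(\<Sum>q\<in>Q. (mlen int_norm q)\<^sup>2) \<le> real (card Q) * 2 ^ (2 * (P + \<tau>))" by (rule sum_bounded_above) (rule ml)
  also have "\<dots> \<le> 2 ^ ((\<tau> + 1) * P) * 2 ^ (2 * (P + \<tau>))"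
  proof (rule mult_right_mono)
    have "real (card Q) \<le> real (2 ^ ((\<tau> + 1) * P))" using cQ by (rule of_nat_mono)
    then show "real (card Q) \<le> 2 ^ ((\<tau> + 1) * P)" by simp
  qed simp
  finally have "2 * (\<Sum>q\<in>Q. (mlen int_norm q)\<^sup>2) \<le> 2 * (2 ^ ((\<tau> + 1) * P) * 2 ^ (2 * (P + \<tau>)))" by (rule mult_left_mono) simp
  then show ?thesis by (simp only: power_add[of 2 "1 + (\<tau> + 1) * P"] power_add[of 2 1] power_one_right mult.assoc)
qed

text \<open>As \<open>d \<ge> 2\<close> and \<open>n \<ge> 1\<close>, numerical factors and additive
  constants in exponents are absorbed into powers \<open>d ^ (k * n)\<close>. The three factors
  contribute 47, 7 and 65, which add up to 119.\<close>

lemma exponent_bound: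
  fixes d n \<tau> :: nat
  assumes d: "2 \<le> d" and n: "1 \<le> n" and \<tau>: "1 \<le> \<tau>"
    and Y: "Y = (2 * d + 2) ^ (n + 2)" and P: "P = (d + 1) ^ (n + 1)" and N: "N = (8 * d) ^ (2 * (n + 7))"
  shows "3 * Y ^ 5 * (1 + (\<tau> + 1) * P + 2 * (P + \<tau>) + 1) * (N + 11 * Y ^ 5) \<le> \<tau> * d ^ (119 * n)"
proof -
  have up: "d ^ a \<le> d ^ b" if "a \<le> b" for a b using d that by (intro power_increasing) auto
  have pw: "2 ^ k \<le> d ^ k" for k :: nat using d by (intro power_mono) auto
  have "(2 * d + 2) \<le> d ^ 3"
  proof -
    have "2 * d + 2 \<le> 4 * d" using d by simp
    also have "4 * d \<le> d ^ 2 * d" using pw[of 2] by (intro mult_right_mono) auto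
    finally show ?thesis by (simp add: eval_nat_numeral)
  qed
  then have "Y \<le> (d ^ 3) ^ (n + 2)" unfolding Y by (rule power_mono) simp
  also have "\<dots> = d ^ (3 * (n + 2))" by (simp only: power_mult)
  also have "\<dots> \<le> d ^ (9 * n)" using n by (intro up) simp
  finally have "Y ^ 5 \<le> (d ^ (9 * n)) ^ 5" by (rule power_mono) simp
  also have "\<dots> = d ^ (45 * n)" by (simp flip: power_mult add: mult.commute)
  finally have Y5: "Y ^ 5 \<le> d ^ (45 * n)" .
  have "d + 1 \<le> 2 * d" using d by simp
  also have "\<dots> \<le> d ^ 2" using mult_le_mono1[OF d, of d] by (simp only: power2_eq_square)
  finally have "P \<le> (d ^ 2) ^ (n + 1)" unfolding P by (rule power_mono) simp
  also have "\<dots> = d ^ (2 * (n + 1))" by (simp only: power_mult)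
  also have "\<dots> \<le> d ^ (4 * n)" using n by (intro up) simp
  finally have P4: "P \<le> d ^ (4 * n)" .
  have P1: "1 \<le> P" unfolding P by (rule one_le_power) simp
  have "8 * d \<le> d ^ 3 * d" using pw[of 3] by (intro mult_right_mono) auto
  then have "8 * d \<le> d ^ 4" by (simp add: eval_nat_numeral)
  then have "N \<le> (d ^ 4) ^ (2 * (n + 7))" unfolding N by (rule power_mono) simp
  also have "\<dots> = d ^ (4 * (2 * (n + 7)))" by (simp only: power_mult)
  also have "\<dots> \<le> d ^ (64 * n)" using n by (intro up) simp
  finally have N': "N \<le> d ^ (64 * n)" .
  have s: "1 + (\<tau> + 1) * P + 2 * (P + \<tau>) + 1 \<le> \<tau> * d ^ (7 * n)"
  proof -
    have "P \<le> \<tau> * P" "\<tau> \<le> \<tau> * P" "1 \<le> \<tau> * P" using P1 \<tau> by auto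
    moreover have "1 + (\<tau> + 1) * P + 2 * (P + \<tau>) + 1 = \<tau> * P + 3 * P + 2 * \<tau> + 2" by (simp add: algebra_simps)
    ultimately have "1 + (\<tau> + 1) * P + 2 * (P + \<tau>) + 1 \<le> 8 * (\<tau> * P)" by linarith
    also have "\<dots> = \<tau> * (8 * P)" by simp
    also have "\<dots> \<le> \<tau> * (d ^ 3 * d ^ (4 * n))" using pw[of 3] P4 by (intro mult_left_mono mult_mono) auto
    also have "\<dots> = \<tau> * d ^ (3 + 4 * n)" by (simp only: power_add)
    also have "\<dots> \<le> \<tau> * d ^ (7 * n)" using n by (intro mult_left_mono up) auto
    finally show ?thesis .
  qed
  have t: "N + 11 * Y ^ 5 \<le> d ^ (65 * n)"
  proof -
    have "11 * Y ^ 5 \<le> d ^ 4 * d ^ (45 * n)" using pw[of 4] Y5 by (intro mult_mono) auto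
    also have "\<dots> = d ^ (4 + 45 * n)" by (simp only: power_add)
    also have "\<dots> \<le> d ^ (64 * n)" using n by (intro up) simp
    finally have "N + 11 * Y ^ 5 \<le> 2 * d ^ (64 * n)" using N' by simp
    also have "\<dots> \<le> d ^ 1 * d ^ (64 * n)" using d by (intro mult_right_mono) auto
    also have "\<dots> = d ^ (1 + 64 * n)" by (simp only: power_add)
    also have "\<dots> \<le> d ^ (65 * n)" using n by (intro up) simp
    finally show ?thesis .
  qed
  have u: "3 * Y ^ 5 \<le> d ^ (47 * n)"
  proof -
    have "3 * Y ^ 5 \<le> d ^ 2 * d ^ (45 * n)" using pw[of 2] Y5 by (intro mult_mono) auto
    also have "\<dots> = d ^ (2 + 45 * n)" by (simp only: power_add)
    also have "\<dots> \<le> d ^ (47 * n)" using n by (intro up) simp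
    finally show ?thesis .
  qed
  have "3 * Y ^ 5 * (1 + (\<tau> + 1) * P + 2 * (P + \<tau>) + 1) * (N + 11 * Y ^ 5) \<le> d ^ (47 * n) * (\<tau> * d ^ (7 * n)) * d ^ (65 * n)"
    by (intro mult_le_mono u s t)
  also have "\<dots> = \<tau> * (d ^ (47 * n) * d ^ (7 * n) * d ^ (65 * n))" by (simp only: mult.assoc mult.left_commute)
  also have "\<dots> = \<tau> * d ^ (119 * n)" by (simp flip: power_add add: algebra_simps)
  finally show ?thesis .
qed

text \<open>The single bound \<open>2 ^ (\<tau> * d ^ (119 * n))\<close> lies below both terms of
  the minimum, because \<open>n\<close> is at most its square and
  \<open>log 2 d \<ge> 1\<close>.\<close>

lemma constant_bound:
  fixes d n \<tau> m :: nat
  assumes "2 \<le> d" "1 \<le> n" "m \<le> \<tau> * d ^ (119 * n)"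
  shows "(2::real) ^ m \<le> min (2 powr (real \<tau> * real d powr (119 * real n ^ 2)))
                      (2 powr (real \<tau> * real d powr (119 * real n * log 2 (real d))))"
proof -
  have "(2::real) ^ m \<le> 2 powr (real \<tau> * real d powr v)" if "119 * real n \<le> v" for v
  proof -
    have "real m \<le> real (\<tau> * d ^ (119 * n))" using assms(3) by (rule of_nat_mono)
    also have "\<dots> = real \<tau> * real d powr (real (119 * n))" using assms(1) by (subst powr_realpow) auto
    also have "\<dots> \<le> real \<tau> * real d powr v" using assms(1) that by (intro mult_left_mono powr_mono) auto
    finally have "2 powr real m \<le> 2 powr (real \<tau> * real d powr v)" by (intro powr_mono) auto
    then show ?thesis by (simp add: powr_realpow)
  qed
  moreover have "119 * real n \<le> 119 * real n ^ 2" using assms(2) by (simp add: power2_eq_square)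
  moreover have "119 * real n \<le> 119 * real n * log 2 (real d)"
  proof -
    have "1 \<le> log 2 (real d)" using assms(1) by (simp add: le_log_iff)
    then show ?thesis using mult_left_mono[of 1 "log 2 (real d)" "119 * real n"] by simp
  qed
  ultimately show ?thesis by (intro min.boundedI) blast+
qed

lemma abs_less_bitsize:
  assumes "bitsize a \<le> \<tau>"
  shows "\<bar>a\<bar> < 2 ^ \<tau>"
proof -
  have "nat \<bar>a\<bar> < 2 ^ nat \<bar>a\<bar>" by (rule less_exp)
  then have "int (nat \<bar>a\<bar>) < int (2 ^ nat \<bar>a\<bar>)" by (simp only: of_nat_less_iff)
  then have "\<bar>a\<bar> < 2 ^ nat \<bar>a\<bar>" by simp
  then have "\<bar>a\<bar> < 2 ^ bitsize a" unfolding bitsize_def by (rule LeastI)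
  also have "(2::int) ^ bitsize a \<le> 2 ^ \<tau>" using assms by (intro power_increasing) auto
  finally show ?thesis .
qed

lemma N_ge_degree_bound: "2 \<le> d \<Longrightarrow> (2 * d + 2) ^ (n + 1) \<le> (8 * d) ^ (2 * (n + 7))" for d n :: nat
proof -
  assume "2 \<le> d"
  then have "(2 * d + 2) ^ (n + 1) \<le> (8 * d) ^ (n + 1)" by (intro power_mono) auto
  also have "\<dots> \<le> (8 * d) ^ (2 * (n + 7))" using \<open>2 \<le> d\<close> by (intro power_increasing) auto
  finally show ?thesis .
qed

section \<open>The inequality for semi-algebraic functions\<close>

lemma lojasiewicz_rcf:
  fixes Q :: "'a::real_closed_field mpoly set"
  assumes d: "2 \<le> d" and Q: "finite Q" "\<forall>q\<in>Q. poly_in_vars_deg (Suc n) d q" and A: "semialg n P A"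
    and cl: "sa_closed n A" "sa_bounded n A" and cont: "sa_continuous_on n A f" "sa_continuous_on n A g"
    and sf: "semialg_fun n Q A f" "semialg_fun n Q A g" and zero: "\<forall>x\<in>A. f x = 0 \<longrightarrow> g x = 0"
  shows "\<exists>c. \<forall>x\<in>A. \<bar>g x\<bar> ^ ((8 * d) ^ (2 * (n + 7))) \<le> c * \<bar>f x\<bar>"
proof -
  let ?N = "(8 * d) ^ (2 * (n + 7))"
  have len: "length z = n" if "z \<in> A" for z using A that unfolding semialg_def by auto
  from semialg_fun_graph[OF sf(1) bspec[OF Q(2)] len]
  obtain \<phi> where \<phi>': "qf_atoms \<phi> \<subseteq> Q \<and>
    (\<forall>x. qf_sem (coeff_eval n ks lk x) \<phi> \<longleftrightarrow> map x [0..<n] \<in> A \<and> f (map x [0..<n]) = x n)" ..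
  note \<phi> = \<phi>'[THEN conjunct1] spec[OF \<phi>'[THEN conjunct2]]
  from semialg_fun_graph[OF sf(2) bspec[OF Q(2)] len]
  obtain \<gamma> where \<gamma>': "qf_atoms \<gamma> \<subseteq> Q \<and>
    (\<forall>x. qf_sem (coeff_eval n ks lk x) \<gamma> \<longleftrightarrow> map x [0..<n] \<in> A \<and> g (map x [0..<n]) = x n)" ..
  note \<gamma> = \<gamma>'[THEN conjunct1] spec[OF \<gamma>'[THEN conjunct2]]
  have H: "graph_hyps n (\<lambda>x. qf_sem (coeff_eval n ks lk x) \<phi>) (\<lambda>x. qf_sem (coeff_eval n ks lk x) \<gamma>)"
    by (rule graph_hypsI[where A = A and f = f and g = g]) (fact \<phi>(2) \<gamma>(2) cl cont zero)+
  have "graph_concl n ?N (\<lambda>x. qf_sem (coeff_eval n ks lk x) \<phi>) (\<lambda>x. qf_sem (coeff_eval n ks lk x) \<gamma>)"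
  proof (rule graph_lojasiewicz[where Q = Q and d = d])
    show "ks \<mu> \<subseteq> {..n}" "(\<Sum>i<n + 2. lk \<mu> i) \<le> d" if "q \<in> Q" "\<mu> \<in> ks q" for q \<mu>
      using poly_in_vars_degD[OF bspec[OF Q(2) that(1)] that(2)] .
  qed (fact Q(1) \<phi>(1) \<gamma>(1) H N_ge_degree_bound[OF d])+
  then obtain c :: "nat \<Rightarrow> 'a" where c: "\<forall>x. qf_sem (coeff_eval n ks lk x) \<phi> \<longrightarrow>
      (\<forall>y. qf_sem (coeff_eval n ks lk y) \<gamma> \<longrightarrow> (\<forall>i<n. y i = x i) \<longrightarrow> \<bar>y n\<bar> ^ ?N \<le> c 0 * \<bar>x n\<bar>)"
    unfolding graph_concl_def ..
  show ?thesis
  proof (intro exI[of _ "c 0"] ballI)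
    fix z assume z: "z \<in> A"
    obtain x y where xy: "qf_sem (coeff_eval n ks lk x) \<phi>" "qf_sem (coeff_eval n ks lk y) \<gamma>" "\<forall>i<n. y i = x i" "x n = f z" "y n = g z"
      using graph_function_points[OF z len[OF z], of "\<lambda>x. qf_sem (coeff_eval n ks lk x) \<phi>" f "\<lambda>x. qf_sem (coeff_eval n ks lk x) \<gamma>" g, OF \<phi>(2) \<gamma>(2)] by blast
    from mp[OF mp[OF spec[OF mp[OF spec[OF c] xy(1)]] xy(2)] xy(3)] show "\<bar>g z\<bar> ^ ?N \<le> c 0 * \<bar>f z\<bar>" unfolding xy(4,5) .
  qed
qed

lemma int_coeffs_bitsize_0:
  assumes "int_coeffs_bitsize 0 p"
  shows "p = 0"
proof (rule poly_mapping_eqI)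
  fix \<mu>
  obtain a :: int where a: "lk p \<mu> = of_int a" "bitsize a \<le> 0" using assms unfolding int_coeffs_bitsize_def by blast
  then have "a = 0" using abs_less_bitsize[OF a(2)] by simp
  then show "lk p \<mu> = lk 0 \<mu>" using a(1) by simp
qed

text \<open>With only the zero polynomial as atom a formula cannot tell points of equal length
  apart, so over a point \<open>z\<close> of \<open>A\<close> the graph would contain
  \<open>f z + 1\<close> together with \<open>f z\<close>. This settles bit-size 0, which forces all
  coefficients to vanish.\<close>

lemma semialg_fun_zero_polys:
  fixes f :: "'a::linordered_idom list \<Rightarrow> 'a"
  assumes "semialg_fun n Q A f" "Q \<subseteq> {0}"
  shows "A = {}"
proof (rule ccontr)
  assume "A \<noteq> {}"
  then obtain z where z: "z \<in> A" by blast
  obtain \<phi> where \<phi>: "qf_atoms \<phi> \<subseteq> Q" "(\<lambda>x. x @ [f x]) ` A = {x. length x = Suc n \<and> qf_sat \<phi> x}"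
    using assms(1) unfolding semialg_fun_def semialg_def by auto
  have "z @ [f z] \<in> {x. length x = Suc n \<and> qf_sat \<phi> x}" unfolding \<phi>(2)[symmetric] using z by blast
  moreover have "qf_sat \<phi> (z @ [f z + 1]) = qf_sat \<phi> (z @ [f z])" unfolding qf_sat_qf_sem
  proof (rule qf_sem_cong_sgn)
    fix p assume "p \<in> qf_atoms \<phi>"
    then have "p = 0" using \<phi>(1) assms(2) by blast
    then show "sgn (mpoly_eval p (z @ [f z + 1])) = sgn (mpoly_eval p (z @ [f z]))" by (simp add: mpoly_eval_def)
  qed
  ultimately have "z @ [f z + 1] \<in> (\<lambda>x. x @ [f x]) ` A" unfolding \<phi>(2) by simp
  then show False by auto
qed

lemma sign_determined_qf_sem:
  fixes Q :: "real mpoly set" and iq :: "real mpoly \<Rightarrow> 'r::comm_ring_1 mpoly"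
  assumes ev: "\<And>q x. q \<in> Q \<Longrightarrow> full_eval h {..n} (iq q) x = coeff_eval n ks lk x q" and at: "qf_atoms \<xi> \<subseteq> Q"
  shows "sign_determined h n (iq ` Q) (\<lambda>x. qf_sem (coeff_eval n ks lk x) \<xi>)"
proof -
  have eq: "qf_sem (coeff_eval n ks lk y) \<xi> = qf_sem (coeff_eval n ks lk x) \<xi>"
    if s: "\<forall>q\<in>iq ` Q. sgn (full_eval h {..n} q y) = sgn (full_eval h {..n} q x)" for x y
  proof (rule qf_sem_cong_sgn)
    fix q assume "q \<in> qf_atoms \<xi>"
    then have q: "q \<in> Q" using at by blast
    have "sgn (full_eval h {..n} (iq q) y) = sgn (full_eval h {..n} (iq q) x)" using s q by simp
    then show "sgn (coeff_eval n ks lk y q) = sgn (coeff_eval n ks lk x q)" by (simp only: ev[OF q])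
  qed
  show ?thesis unfolding sign_determined_def by (intro allI impI) (rule iffD2[OF eq])
qed

lemma lojasiewicz_int_coeffs:
  fixes Q :: "real mpoly set" and n d \<tau> :: nat
  assumes n: "1 \<le> n" and d: "2 \<le> d" and \<tau>: "1 \<le> \<tau>" and Q: "finite Q" "\<forall>q\<in>Q. poly_in_vars_deg (Suc n) d q \<and> int_coeffs_bitsize \<tau> q"
    and A: "semialg n P A"
    and cl: "sa_closed n A" "sa_bounded n A" and cont: "sa_continuous_on n A f" "sa_continuous_on n A g"
    and sf: "semialg_fun n Q A f" "semialg_fun n Q A g" and zero: "\<forall>x\<in>A. f x = 0 \<longrightarrow> g x = 0"
  shows "\<exists>m\<le>\<tau> * d ^ (119 * n). \<forall>x\<in>A. \<bar>g x\<bar> ^ ((8 * d) ^ (2 * (n + 7))) \<le> 2 ^ m * \<bar>f x\<bar>"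
proof -
  let ?N = "(8 * d) ^ (2 * (n + 7))"
  define Y where "Y = (2 * d + 2) ^ (n + 2)"
  define R where "R = (d + 1) ^ (n + 1)"
  define \<sigma> where "\<sigma> = 1 + (\<tau> + 1) * R + 2 * (R + \<tau>)"
  define m where "m = 3 * Y ^ 5 * (\<sigma> + 1) * (?N + 11 * Y ^ 5)"
  have mb: "m \<le> \<tau> * d ^ (119 * n)" unfolding m_def \<sigma>_def by (rule exponent_bound[OF d n \<tau> Y_def R_def refl])
  have len: "length z = n" if "z \<in> A" for z using A that unfolding semialg_def by auto
  have Qv: "poly_in_vars_deg (Suc n) d q" if "q \<in> Q" for q using Q(2) that by blast
  from semialg_fun_graph[OF sf(1) Qv len]
  obtain \<phi> where \<phi>': "qf_atoms \<phi> \<subseteq> Q \<and>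
    (\<forall>x. qf_sem (coeff_eval n ks lk x) \<phi> \<longleftrightarrow> map x [0..<n] \<in> A \<and> f (map x [0..<n]) = x n)" ..
  note \<phi> = \<phi>'[THEN conjunct1] spec[OF \<phi>'[THEN conjunct2]]
  from semialg_fun_graph[OF sf(2) Qv len]
  obtain \<gamma> where \<gamma>': "qf_atoms \<gamma> \<subseteq> Q \<and>
    (\<forall>x. qf_sem (coeff_eval n ks lk x) \<gamma> \<longleftrightarrow> map x [0..<n] \<in> A \<and> g (map x [0..<n]) = x n)" ..
  note \<gamma> = \<gamma>'[THEN conjunct1] spec[OF \<gamma>'[THEN conjunct2]]
  have H: "graph_hyps n (\<lambda>x. qf_sem (coeff_eval n ks lk x) \<phi>) (\<lambda>x. qf_sem (coeff_eval n ks lk x) \<gamma>)"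
    by (rule graph_hypsI[where A = A and f = f and g = g]) (fact \<phi>(2) \<gamma>(2) cl cont zero)+
  \<comment> \<open>\<open>floor\<close> recovers the integers behind the real coefficients, so
    supports and values are unchanged.\<close>
  define iq :: "real mpoly \<Rightarrow> int mpoly" where "iq q = Poly_Mapping.map floor q" for q
  have liq: "real_of_int (lk (iq q) \<mu>) = lk q \<mu>" "\<bar>lk (iq q) \<mu>\<bar> < 2 ^ \<tau>" if "q \<in> Q" for q \<mu>
  proof -
    have "int_coeffs_bitsize \<tau> q" using bspec[OF Q(2) that] by (rule conjunct2)
    from spec[OF this[unfolded int_coeffs_bitsize_def], of \<mu>]
    obtain a :: int where a': "lk q \<mu> = of_int a \<and> bitsize a \<le> \<tau>" ..
    note a = a'[THEN conjunct1] a'[THEN conjunct2]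
    have "lk (iq q) \<mu> = a" unfolding iq_def using a(1) by (simp add: Poly_Mapping.map.rep_eq when_def)
    then show "real_of_int (lk (iq q) \<mu>) = lk q \<mu>" "\<bar>lk (iq q) \<mu>\<bar> < 2 ^ \<tau>" using a(1) abs_less_bitsize[OF a(2)] by simp_all
  qed
  have kiq: "ks (iq q) = ks q" if "q \<in> Q" for q
  proof (rule Set.set_eqI)
    fix \<mu>
    have "lk (iq q) \<mu> = 0 \<longleftrightarrow> lk q \<mu> = 0" unfolding liq(1)[OF that, of \<mu>, symmetric] by simp
    then show "\<mu> \<in> ks (iq q) \<longleftrightarrow> \<mu> \<in> ks q" by (simp add: in_keys_iff)
  qed
  have ev: "full_eval real_of_int {..n} (iq q) x = coeff_eval n ks lk x q" if "q \<in> Q" for q x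
    unfolding full_eval_def coeff_eval_def kiq[OF that] by (rule sum.cong[OF refl]) (simp only: liq(1)[OF that] monval_def)
  have sd: "sign_determined real_of_int n (iq ` Q) (\<lambda>x. qf_sem (coeff_eval n ks lk x) \<xi>)" if "qf_atoms \<xi> \<subseteq> Q" for \<xi>
    by (rule sign_determined_qf_sem[OF ev that])
  have iQ: "ks \<mu> \<subseteq> {..n}" "(\<Sum>i<n + 2. lk \<mu> i) \<le> d" if p: "p \<in> iq ` Q" "\<mu> \<in> ks p" for p \<mu>
  proof -
    obtain q where q: "q \<in> Q" "p = iq q" using p(1) by blast
    then have "\<mu> \<in> ks q" using p(2) kiq by simp
    from poly_in_vars_degD[OF Qv[OF q(1)] this] show "ks \<mu> \<subseteq> {..n}" "(\<Sum>i<n + 2. lk \<mu> i) \<le> d" .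
  qed
  have S: "2 * (\<Sum>q\<in>iq ` Q. (mlen int_norm q)\<^sup>2) \<le> 2 ^ \<sigma>" unfolding \<sigma>_def
  proof (rule sum_mlen_bound[OF _ _ R_def])
    show "ks p \<subseteq> low_monomials n d" if p: "p \<in> iq ` Q" for p
    proof
      fix \<mu> assume \<mu>: "\<mu> \<in> ks p"
      show "\<mu> \<in> low_monomials n d" unfolding low_monomials_def using iQ(1)[OF p \<mu>] lookup_le_sum[OF iQ[OF p \<mu>]] by simp
    qed
    show "\<bar>lk p \<mu>\<bar> < 2 ^ \<tau>" if "p \<in> iq ` Q" for p \<mu> using that liq(2) by blast
  qed
  show ?thesis
  proof (intro exI[of _ m] conjI mb ballI)
    fix z assume z: "z \<in> A"
    obtain x y where xy: "qf_sem (coeff_eval n ks lk x) \<phi>" "qf_sem (coeff_eval n ks lk y) \<gamma>" "\<forall>i<n. y i = x i" "x n = f z" "y n = g z"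
      using graph_function_points[OF z len[OF z], of "\<lambda>x. qf_sem (coeff_eval n ks lk x) \<phi>" f "\<lambda>x. qf_sem (coeff_eval n ks lk x) \<gamma>" g, OF \<phi>(2) \<gamma>(2)] by blast
    have "\<bar>y n\<bar> ^ ?N \<le> 2 ^ m * \<bar>x n\<bar>" unfolding m_def
    proof (rule graph_lojasiewicz_int[where Q = "iq ` Q" and d = d, OF _ _ _ d sd[OF \<phi>(1)] sd[OF \<gamma>(1)] H N_ge_degree_bound[OF d] Y_def S xy(1,2)])
      show "y i = x i" if "i < n" for i using xy(3) that by blast
      show "ks \<mu> \<subseteq> {..n}" "(\<Sum>i<n + 2. lk \<mu> i) \<le> d" if "p \<in> iq ` Q" "\<mu> \<in> ks p" for p \<mu> using iQ[OF that] .
    qed (use Q(1) in simp)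
    then show "\<bar>g z\<bar> ^ ?N \<le> 2 ^ m * \<bar>f z\<bar>" unfolding xy(4,5) .
  qed
qed

theorem theorem2p2:
  shows
  "(\<forall>(n::nat) (d::nat) (P::'a::real_closed_field mpoly set) (Q::'a mpoly set)
       (A::'a list set) (f::'a list \<Rightarrow> 'a) (g::'a list \<Rightarrow> 'a).
      2 \<le> d \<and> finite P \<and> finite Q \<and>
      (\<forall>p\<in>P. poly_in_vars_deg n d p) \<and> (\<forall>q\<in>Q. poly_in_vars_deg (Suc n) d q) \<and>
      semialg n P A \<and> sa_closed n A \<and> sa_bounded n A \<and>
      sa_continuous_on n A f \<and> sa_continuous_on n A g \<and>
      semialg_fun n Q A f \<and> semialg_fun n Q A g \<and>
      (\<forall>x\<in>A. f x = 0 \<longrightarrow> g x = 0)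
      \<longrightarrow> (\<exists>(c::'a) (N::nat). N \<le> (8 * d) ^ (2 * (n + 7)) \<and>
              (\<forall>x\<in>A. \<bar>g x\<bar> ^ N \<le> c * \<bar>f x\<bar>)))
   \<and>
   (\<exists>C::real. C > 0 \<and>
      (\<forall>(n::nat) (d::nat) (\<tau>::nat) (P::real mpoly set) (Q::real mpoly set)
          (A::real list set) (f::real list \<Rightarrow> real) (g::real list \<Rightarrow> real).
        1 \<le> n \<and> 2 \<le> d \<and> finite P \<and> finite Q \<and>
        (\<forall>p\<in>P. poly_in_vars_deg n d p \<and> int_coeffs_bitsize \<tau> p) \<and>
        (\<forall>q\<in>Q. poly_in_vars_deg (Suc n) d q \<and> int_coeffs_bitsize \<tau> q) \<and>
        semialg n P A \<and> sa_closed n A \<and> sa_bounded n A \<and>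
        sa_continuous_on n A f \<and> sa_continuous_on n A g \<and>
        semialg_fun n Q A f \<and> semialg_fun n Q A g \<and>
        (\<forall>x\<in>A. f x = 0 \<longrightarrow> g x = 0)
        \<longrightarrow> (\<exists>c::real.
              c \<le> min (2 powr (real \<tau> * real d powr (C * real n ^ 2)))
                      (2 powr (real \<tau> * real d powr (C * real n * log 2 (real d)))) \<and>
              (\<forall>x\<in>A. \<bar>g x\<bar> ^ ((8 * d) ^ (2 * (n + 7))) \<le> c * \<bar>f x\<bar>))))"
proof (intro conjI allI impI)
  fix n d :: nat and P Q :: "'a mpoly set" and A :: "'a list set" and f g :: "'a list \<Rightarrow> 'a"
  assume H: "2 \<le> d \<and> finite P \<and> finite Q \<and>
      (\<forall>p\<in>P. poly_in_vars_deg n d p) \<and> (\<forall>q\<in>Q. poly_in_vars_deg (Suc n) d q) \<and>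
      semialg n P A \<and> sa_closed n A \<and> sa_bounded n A \<and>
      sa_continuous_on n A f \<and> sa_continuous_on n A g \<and>
      semialg_fun n Q A f \<and> semialg_fun n Q A g \<and>
      (\<forall>x\<in>A. f x = 0 \<longrightarrow> g x = 0)"
  then have "\<exists>c. \<forall>x\<in>A. \<bar>g x\<bar> ^ ((8 * d) ^ (2 * (n + 7))) \<le> c * \<bar>f x\<bar>"
    by (intro lojasiewicz_rcf[of d Q n P A f g]) blast+
  then show "\<exists>c N. N \<le> (8 * d) ^ (2 * (n + 7)) \<and> (\<forall>x\<in>A. \<bar>g x\<bar> ^ N \<le> c * \<bar>f x\<bar>)" by blast
next
  show "\<exists>C::real. C > 0 \<and>
      (\<forall>(n::nat) (d::nat) (\<tau>::nat) (P::real mpoly set) (Q::real mpoly set)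
          (A::real list set) (f::real list \<Rightarrow> real) (g::real list \<Rightarrow> real).
        1 \<le> n \<and> 2 \<le> d \<and> finite P \<and> finite Q \<and>
        (\<forall>p\<in>P. poly_in_vars_deg n d p \<and> int_coeffs_bitsize \<tau> p) \<and>
        (\<forall>q\<in>Q. poly_in_vars_deg (Suc n) d q \<and> int_coeffs_bitsize \<tau> q) \<and>
        semialg n P A \<and> sa_closed n A \<and> sa_bounded n A \<and>
        sa_continuous_on n A f \<and> sa_continuous_on n A g \<and>
        semialg_fun n Q A f \<and> semialg_fun n Q A g \<and>
        (\<forall>x\<in>A. f x = 0 \<longrightarrow> g x = 0)
        \<longrightarrow> (\<exists>c::real.
              c \<le> min (2 powr (real \<tau> * real d powr (C * real n ^ 2)))
                      (2 powr (real \<tau> * real d powr (C * real n * log 2 (real d)))) \<and>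
              (\<forall>x\<in>A. \<bar>g x\<bar> ^ ((8 * d) ^ (2 * (n + 7))) \<le> c * \<bar>f x\<bar>)))"
  \<comment> \<open>The constant is the total exponent computed in
    \<open>exponent_bound\<close>.\<close>
  proof (rule exI[of _ 119], intro conjI allI impI)
    fix n d \<tau> :: nat and P Q :: "real mpoly set" and A :: "real list set" and f g :: "real list \<Rightarrow> real"
    let ?b = "min (2 powr (real \<tau> * real d powr (119 * real n ^ 2)))
                      (2 powr (real \<tau> * real d powr (119 * real n * log 2 (real d))))"
    assume H: "1 \<le> n \<and> 2 \<le> d \<and> finite P \<and> finite Q \<and>
        (\<forall>p\<in>P. poly_in_vars_deg n d p \<and> int_coeffs_bitsize \<tau> p) \<and>
        (\<forall>q\<in>Q. poly_in_vars_deg (Suc n) d q \<and> int_coeffs_bitsize \<tau> q) \<and>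
        semialg n P A \<and> sa_closed n A \<and> sa_bounded n A \<and>
        sa_continuous_on n A f \<and> sa_continuous_on n A g \<and>
        semialg_fun n Q A f \<and> semialg_fun n Q A g \<and>
        (\<forall>x\<in>A. f x = 0 \<longrightarrow> g x = 0)"
    show "\<exists>c. c \<le> ?b \<and> (\<forall>x\<in>A. \<bar>g x\<bar> ^ ((8 * d) ^ (2 * (n + 7))) \<le> c * \<bar>f x\<bar>)"
    proof (cases "1 \<le> \<tau>")
      case True
      from H have "\<exists>m\<le>\<tau> * d ^ (119 * n). \<forall>x\<in>A. \<bar>g x\<bar> ^ ((8 * d) ^ (2 * (n + 7))) \<le> 2 ^ m * \<bar>f x\<bar>"
        by (intro lojasiewicz_int_coeffs[of n d \<tau> Q P A f g, OF _ _ True]) blast+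
      then obtain m where m: "m \<le> \<tau> * d ^ (119 * n)" "\<forall>x\<in>A. \<bar>g x\<bar> ^ ((8 * d) ^ (2 * (n + 7))) \<le> 2 ^ m * \<bar>f x\<bar>" by blast
      have "(2::real) ^ m \<le> ?b" by (rule constant_bound[OF _ _ m(1)]) (use H in blast)+
      with m(2) show ?thesis by blast
    next
      \<comment> \<open>For \<open>\<tau> = 0\<close> the bound on \<open>c\<close> degenerates to
        1, but then all members of \<open>Q\<close> are zero and \<open>A\<close> is empty.\<close>
      case False
      then have \<tau>: "\<tau> = 0" by simp
      have "\<forall>q\<in>Q. int_coeffs_bitsize 0 q" "semialg_fun n Q A f" using H unfolding \<tau> by blast+
      then have "A = {}" using int_coeffs_bitsize_0 by (intro semialg_fun_zero_polys[of n Q A f]) auto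
      then show ?thesis by (intro exI[of _ 0]) simp
    qed
  qed simp
qed

end
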